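(* Consider the random dynamical system, random transfer operators and observable $f$ described in the context, and suppose that the random spectral assumption stated there holds. Let $S_n^\omega=\sum_{j=0}^{n-1}f_{\theta^j\omega}\circ T_{\theta^{j-1}\omega}\circ\cdots\circ T_\omega$, considered as a random variable on $(\mathcal E_\omega,\mu_\omega)$. (i) There is a nonnegative number $\sigma$ such that $\mathbb P$-a.s. $$\sigma^2=\lim_{n\to\infty}\frac1n\mathrm{Var}_{\mu_\omega}(S_n^\omega).$$ Moreover, $\sigma^2=0$ if and only if $f(\omega,x)-\int f(\omega,y)\,d\mu_\omega(y)=r(\omega,x)-r(\theta\omega,T_\omega x)$ for some function $r$ with $\int\int|r(\omega,y)|^2\,d\mu_\omega(y)\,d\mathbb P(\omega)<\infty$. (ii) Suppose that $\sigma^2>0$. Then for $\mathbb P$-a.e. $\omega$ the sequence $S_n=S_n^\omega-\mu_\omega(S_n^\omega)$ satisfies the growth condition of order $m$ (see context) for every integer $m\ge2$. Thus, for $\mathbb P$-a.e. $\omega$, with $\sigma_n=\|S_n\|_{L^2(\mu_\omega)}$, $(A_n)$ a bounded real sequence, $B_n=\sigma_n+O(1)$ and $W_n=(S_n-A_n)/B_n$, the following hold for every integer $m\ge2$: (a) there is a constant $C$ such that for all $x\in\mathbb R$, $|\mu_\omega(W_n\le x)-\Phi(x)|\le C\sigma_n^{-1}(1+|x|)^{-m}$; in particular, $\|\mu_\omega(W_n\le\cdot)-\Phi\|_{L^p(dx)}=O(\sigma_n^{-1})$ for every $p>1/m$; (b) there is a constant $R>0$ such that for every a.e. differentiable function $h:\mathbb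 R\to\mathbb R$ with $H_m(h)=\int_{\mathbb R}\frac{|h'(x)|}{(1+|x|)^m}dx<\infty$, $$\left|\int h(W_n)\,d\mu_\omega-\int_{\mathbb R} h(x)\varphi(x)\,dx\right|\le R\,H_m(h)\,\sigma_n^{-1};$$ in particular, for every $q<m$ this bound holds for $h(x)=x^q$ and for $h(x)=|x|^q$.
   Context: $\Phi,\varphi$: standard normal distribution function and density. Setting: $(\Omega,\mathcal F,\mathbb P)$ is a probability space and $\theta:\Omega\to\Omega$ an ergodic (measure preserving) invertible map. $(\mathcal X,d)$ is a metric space, $\mathcal E_\omega$, $\omega\in\Omega$, is a measurable family of compact subsets, $\mathcal E=\{(\omega,x):\omega\in\Omega,\ x\in\mathcal E_\omega\}$, and $T:\mathcal E\to\mathcal E$ is a measurable map of the form $T(\omega,x)=(\theta\omega,T_\omega x)$ with $T_\omega:\mathcal E_\omega\to\mathcal E_{\theta\omega}$. $\mu=\int\mu_\omega\,d\mathbb P(\omega)$ is a $T$-invariant probability measure on $\mathcal E$, where for $\mathbb P$-a.e. $\omega$ the probability measure $\mu_\omega$ on $\mathcal E_\omega$ satisfies $(T_\omega)_*\mu_\omega=\mu_{\theta\omega}$. $\mathcal L_\omega$ is the unique operator such that $\int g\cdot(u\circ T_\omega)\,d\mu_\omega=\int u\cdot(\mathcal L_\omega g)\,d\mu_{\theta\omega}$ for all bounded functions $g,u$ on the appropriate domains. $(B_\omega,\|\cdot\|_\omega)$ is a normed space of functions on $\mathcal E_\omega$ (with dual $B_\omega^*$), and $f:\mathcal E\to\mathbb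 R$ is measurable with $\mathrm{ess\,sup}_\omega\|f(\omega,\cdot)\|_\omega<\infty$; $f_\omega=f(\omega,\cdot)$. It is assumed that $\mathcal L_\omega$ is a continuous operator from $B_\omega$ to $B_{\theta\omega}$ and that $z\mapsto e^{zf_\omega}\in B_\omega$ is analytic in $z$, uniformly in $\omega$. For complex $z$, $\mathcal L_\omega^z(g)=\mathcal L_\omega(ge^{zf_\omega})$. Random spectral assumption: there is a constant $r_0>0$ such that ($\mathbb P$-a.s.) for every complex $z$ with $|z|<r_0$ there is a triplet $\lambda_\omega(z)\in\mathbb C\setminus\{0\}$, $h_\omega^{(z)}\in B_\omega$, $\nu_\omega^{(z)}\in B_\omega^*$, measurable in $\omega$ and analytic in $z$, such that: (1) $\lambda_\omega(0)=1$, $h_\omega^{(0)}=\mathbf 1$, $\nu_\omega^{(0)}=\mu_\omega$, $\nu_\omega^{(z)}(h_\omega^{(z)})=1$; (2) with $\mathcal L_\omega^{z,n}=\mathcal L^z_{\theta^{n-1}\omega}\circ\cdots\circ\mathcal L^z_\omega$ and $\lambda_{\omega,n}(z)=\lambda_{\theta^{n-1}\omega}(z)\cdots\lambda_\omega(z)$, there are $C>0$ and $\delta\in(0,1)$ such that $$\left\|(\lambda_{\omega,n}(z))^{-1}\mathcal L_\omega^{z,n}-\nu_\omega^{(z)}\otimes h_{\theta^n\omega}^{(z)}\right\|_{\theta^n\omega}\le C\delta^n,$$ where the operator $\nu\otimes h$ is given by $g\mapsto\nu(g)\cdot h$ (the norm being the operator norm from $B_\omega$ to $B_{\theta^n\omega}$).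 Growth condition of order $m$ for centered $S_n$ with $\sigma_n=\|S_n\|_{L^2}$: with $\Lambda_n(t)=\ln\mathbb E[e^{itS_n/\sigma_n}]+t^2/2$, for all $3\le j\le m+1$ there exist constants $C_j,\varepsilon_j>0$ (independent of $n$) such that $\sup_{t\in[-\varepsilon_j\sigma_n,\varepsilon_j\sigma_n]}|\Lambda_n^{(j)}(t)|\le C_j\sigma_n^{-(j-2)}$.
   Formalization: The norms of h and ν are also assumed bounded uniformly in ω for z near 0 (otherwise false: Var(S_n)/n can diverge); in (b) "a.e. differentiable h" means h is also a primitive of h', i.e. locally absolutely continuous (otherwise false: a step function has H_m(h)=0). *)

theory Defs
  imports "HOL-Probability.Probability" "HOL-Library.Landau_Symbols"
begin

section \<open>Random dynamical systems\<close>

locale ergodic_invertible = prob_space P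
  for P :: "'w measure" and \<theta> :: "'w \<Rightarrow> 'w" +
  assumes bij_base: "bij_betw \<theta> (space P) (space P)"
    and measurable_base: "\<theta> \<in> P \<rightarrow>\<^sub>M P"
    and measurable_base_inv: "the_inv_into (space P) \<theta> \<in> P \<rightarrow>\<^sub>M P"
    and preserving_base: "distr P P \<theta> = P"
    and ergodic_base: "\<And>A. A \<in> sets P \<Longrightarrow> \<theta> -` A \<inter> space P = A \<Longrightarrow> prob A = 0 \<or> prob A = 1"

definition total_space :: "'w measure \<Rightarrow> ('w \<Rightarrow> 'x::metric_space set) \<Rightarrow> ('w \<times> 'x) measure" where
  "total_space P E = restrict_space (P \<Otimes>\<^sub>M borel) (Sigma (space P) E)"

definition skew_product :: "('w \<Rightarrow> 'w) \<Rightarrow> ('w \<Rightarrow> 'x \<Rightarrow> 'x) \<Rightarrow> 'w \<times> 'x \<Rightarrow> 'w \<times> 'x" where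
  "skew_product \<theta> T = (\<lambda>(\<omega>, x). (\<theta> \<omega>, T \<omega> x))"

text \<open>Used both for the maps \<open>T\<close> and for the operators \<open>L\<close>: the \<open>n\<close>-th iterate over \<open>\<omega>\<close> is
  \<open>A (\<theta>\<^sup>n\<^sup>-\<^sup>1 \<omega>) \<circ> \<dots> \<circ> A \<omega>\<close>.\<close>

primrec fibre_iterate :: "('w \<Rightarrow> 'w) \<Rightarrow> ('w \<Rightarrow> 'y \<Rightarrow> 'y) \<Rightarrow> 'w \<Rightarrow> nat \<Rightarrow> 'y \<Rightarrow> 'y" where
  "fibre_iterate \<theta> A \<omega> 0 = id"
| "fibre_iterate \<theta> A \<omega> (Suc n) = A ((\<theta> ^^ n) \<omega>) \<circ> fibre_iterate \<theta> A \<omega> n"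

definition birkhoff_sum ::
  "('w \<Rightarrow> 'w) \<Rightarrow> ('w \<Rightarrow> 'x \<Rightarrow> 'x) \<Rightarrow> ('w \<Rightarrow> 'x \<Rightarrow> real) \<Rightarrow> 'w \<Rightarrow> nat \<Rightarrow> 'x \<Rightarrow> real" where
  "birkhoff_sum \<theta> T f \<omega> n x = (\<Sum>j<n. f ((\<theta> ^^ j) \<omega>) (fibre_iterate \<theta> T \<omega> j x))"

text \<open>A measurable family of compact sets is one whose graph lies in the product
  \<open>\<sigma>\<close>-algebra. The members of \<open>mu\<close> are measures on the fibres \<open>E \<omega>\<close>, not on the whole metric
  space, and \<open>M\<close> is the measure with disintegration \<open>mu\<close>.\<close>

locale random_dynamical_system = ergodic_invertible P \<theta>
  for P :: "'w measure" and \<theta> :: "'w \<Rightarrow> 'w" +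
  fixes E :: "'w \<Rightarrow> 'x::metric_space set"
    and T :: "'w \<Rightarrow> 'x \<Rightarrow> 'x"
    and mu :: "'w \<Rightarrow> 'x measure"
    and M :: "('w \<times> 'x) measure"
  assumes compact_fibre: "\<And>\<omega>. \<omega> \<in> space P \<Longrightarrow> compact (E \<omega>)"
    and measurable_family: "Sigma (space P) E \<in> sets (P \<Otimes>\<^sub>M borel)"
    and measurable_skew: "skew_product \<theta> T \<in> total_space P E \<rightarrow>\<^sub>M total_space P E"
    and fibre_measures: "AE \<omega> in P. sets (mu \<omega>) = sets (restrict_space borel (E \<omega>)) \<and>
          prob_space (mu \<omega>) \<and> distr (mu \<omega>) (mu (\<theta> \<omega>)) (T \<omega>) = mu (\<theta> \<omega>)"
    and prob_total: "prob_space M"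
    and sets_total: "sets M = sets (total_space P E)"
    and measurable_fibre_measures: "\<And>A. A \<in> sets (total_space P E) \<Longrightarrow>
          (\<lambda>\<omega>. emeasure (mu \<omega>) (Pair \<omega> -` A)) \<in> borel_measurable P"
    and disintegration: "\<And>A. A \<in> sets (total_space P E) \<Longrightarrow>
          emeasure M A = (\<integral>\<^sup>+\<omega>. emeasure (mu \<omega>) (Pair \<omega> -` A) \<partial>P)"
    and invariant_total: "distr M M (skew_product \<theta> T) = M"

section \<open>Normed spaces of functions on a fibre\<close>

text \<open>A space of functions on \<open>E\<close> is given by a set \<open>V\<close> of total functions that is closed under
  changing values outside \<open>E\<close>; then \<open>N\<close> is automatically insensitive to such changes.\<close>

definition function_normed_space ::
  "'x set \<Rightarrow> ('x \<Rightarrow> complex) set \<Rightarrow> (('x \<Rightarrow> complex) \<Rightarrow> real) \<Rightarrow> bool" where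
  "function_normed_space E V N \<longleftrightarrow>
     (\<lambda>x. 0) \<in> V \<and>
     (\<forall>g\<in>V. \<forall>h\<in>V. (\<lambda>x. g x + h x) \<in> V \<and> N (\<lambda>x. g x + h x) \<le> N g + N h) \<and>
     (\<forall>g\<in>V. \<forall>c. (\<lambda>x. c * g x) \<in> V \<and> N (\<lambda>x. c * g x) = cmod c * N g) \<and>
     (\<forall>g\<in>V. N g \<ge> 0 \<and> (N g = 0 \<longleftrightarrow> (\<forall>x\<in>E. g x = 0))) \<and>
     (\<forall>g\<in>V. \<forall>h. (\<forall>x\<in>E. h x = g x) \<longrightarrow> h \<in> V)"

definition continuous_operator ::
  "'x set \<Rightarrow> ('x \<Rightarrow> complex) set \<Rightarrow> (('x \<Rightarrow> complex) \<Rightarrow> real) \<Rightarrow>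
   ('x \<Rightarrow> complex) set \<Rightarrow> (('x \<Rightarrow> complex) \<Rightarrow> real) \<Rightarrow>
   (('x \<Rightarrow> complex) \<Rightarrow> 'x \<Rightarrow> complex) \<Rightarrow> bool" where
  "continuous_operator E' V N V' N' A \<longleftrightarrow>
     (\<forall>g\<in>V. A g \<in> V') \<and>
     (\<forall>g\<in>V. \<forall>h\<in>V. \<forall>a b. \<forall>y\<in>E'. A (\<lambda>x. a * g x + b * h x) y = a * A g y + b * A h y) \<and>
     (\<exists>K. \<forall>g\<in>V. N' (A g) \<le> K * N g)"

definition dual_space ::
  "('x \<Rightarrow> complex) set \<Rightarrow> (('x \<Rightarrow> complex) \<Rightarrow> real) \<Rightarrow> (('x \<Rightarrow> complex) \<Rightarrow> complex) set" where
  "dual_space V N = {\<phi>.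
     (\<forall>g\<in>V. \<forall>h\<in>V. \<forall>a b. \<phi> (\<lambda>x. a * g x + b * h x) = a * \<phi> g + b * \<phi> h) \<and>
     (\<exists>K. \<forall>g\<in>V. cmod (\<phi> g) \<le> K * N g)}"

definition dual_norm ::
  "('x \<Rightarrow> complex) set \<Rightarrow> (('x \<Rightarrow> complex) \<Rightarrow> real) \<Rightarrow> (('x \<Rightarrow> complex) \<Rightarrow> complex) \<Rightarrow> real" where
  "dual_norm V N \<phi> = (SUP g\<in>{g\<in>V. N g \<le> 1}. cmod (\<phi> g))"

text \<open>Local norm-convergent power series expansions with coefficients in \<open>V\<close>. The type of points
  is arbitrary, so that the definition applies to \<open>V\<close> and to its dual.\<close>

definition analytic_into ::
  "('y \<Rightarrow> complex) set \<Rightarrow> (('y \<Rightarrow> complex) \<Rightarrow> real) \<Rightarrow> complex set \<Rightarrow>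
   (complex \<Rightarrow> 'y \<Rightarrow> complex) \<Rightarrow> bool" where
  "analytic_into V N D F \<longleftrightarrow> (\<forall>z0\<in>D. \<exists>\<rho>>0. \<exists>a. (\<forall>k. a k \<in> V) \<and>
     (\<forall>z\<in>ball z0 \<rho>. F z \<in> V \<and>
        (\<lambda>n. N (\<lambda>y. F z y - (\<Sum>k<n. (z - z0) ^ k * a k y))) \<longlonglongrightarrow> 0))"

text \<open>Uniformity in \<open>\<omega>\<close> is expressed by local boundedness with constants not depending on \<open>\<omega>\<close>;
  by Cauchy's estimates this bounds all Taylor coefficients uniformly in \<open>\<omega>\<close>.\<close>

definition analytic_into_uniformly ::
  "'w measure \<Rightarrow> ('w \<Rightarrow> ('y \<Rightarrow> complex) set) \<Rightarrow> ('w \<Rightarrow> ('y \<Rightarrow> complex) \<Rightarrow> real) \<Rightarrow> complex set \<Rightarrow>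
   ('w \<Rightarrow> complex \<Rightarrow> 'y \<Rightarrow> complex) \<Rightarrow> bool" where
  "analytic_into_uniformly P V N D F \<longleftrightarrow>
     (AE \<omega> in P. analytic_into (V \<omega>) (N \<omega>) D (F \<omega>)) \<and>
     (\<forall>z0\<in>D. \<exists>\<rho>>0. \<exists>K. AE \<omega> in P. \<forall>z\<in>ball z0 \<rho>. N \<omega> (F \<omega> z) \<le> K)"

section \<open>Transfer operators\<close>

text \<open>\<open>L\<close> is only required to act on bounded functions and on the spaces \<open>B \<omega>\<close>, whose members
  need not be bounded. Assumption \<open>bounded_observable\<close> is the finiteness of the essential supremum
  of the norms of \<open>f \<omega>\<close>, stated without assuming that they are measurable in \<open>\<omega>\<close>.\<close>

locale random_transfer_operators = random_dynamical_system P \<theta> E T mu M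
  for P :: "'w measure" and \<theta> :: "'w \<Rightarrow> 'w" and E :: "'w \<Rightarrow> 'x::metric_space set"
    and T :: "'w \<Rightarrow> 'x \<Rightarrow> 'x" and mu :: "'w \<Rightarrow> 'x measure" and M :: "('w \<times> 'x) measure" +
  fixes L :: "'w \<Rightarrow> ('x \<Rightarrow> complex) \<Rightarrow> 'x \<Rightarrow> complex"
    and B :: "'w \<Rightarrow> ('x \<Rightarrow> complex) set"
    and N :: "'w \<Rightarrow> ('x \<Rightarrow> complex) \<Rightarrow> real"
    and f :: "'w \<Rightarrow> 'x \<Rightarrow> real"
  assumes normed_spaces: "\<And>\<omega>. \<omega> \<in> space P \<Longrightarrow> function_normed_space (E \<omega>) (B \<omega>) (N \<omega>)"
    and duality: "AE \<omega> in P. \<forall>g. integrable (mu \<omega>) g \<and> (bounded (g ` E \<omega>) \<or> g \<in> B \<omega>) \<longrightarrow>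
          integrable (mu (\<theta> \<omega>)) (L \<omega> g) \<and>
          (\<forall>u. u \<in> borel_measurable (mu (\<theta> \<omega>)) \<and> bounded (u ` E (\<theta> \<omega>)) \<longrightarrow>
             (\<integral>x. g x * u (T \<omega> x) \<partial>mu \<omega>) = (\<integral>y. u y * L \<omega> g y \<partial>mu (\<theta> \<omega>)))"
    and continuous_transfer: "AE \<omega> in P.
          continuous_operator (E (\<theta> \<omega>)) (B \<omega>) (N \<omega>) (B (\<theta> \<omega>)) (N (\<theta> \<omega>)) (L \<omega>)"
    and measurable_observable: "(\<lambda>(\<omega>, x). f \<omega> x) \<in> borel_measurable (total_space P E)"
    and bounded_observable: "\<exists>K. AE \<omega> in P.
          (\<lambda>x. complex_of_real (f \<omega> x)) \<in> B \<omega> \<and> N \<omega> (\<lambda>x. complex_of_real (f \<omega> x)) \<le> K"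
    and analytic_observable: "analytic_into_uniformly P B N UNIV
          (\<lambda>\<omega> z x. exp (z * complex_of_real (f \<omega> x)))"

definition twisted_transfer ::
  "('w \<Rightarrow> ('x \<Rightarrow> complex) \<Rightarrow> 'x \<Rightarrow> complex) \<Rightarrow> ('w \<Rightarrow> 'x \<Rightarrow> real) \<Rightarrow> complex \<Rightarrow>
   'w \<Rightarrow> ('x \<Rightarrow> complex) \<Rightarrow> 'x \<Rightarrow> complex" where
  "twisted_transfer L f z \<omega> g = L \<omega> (\<lambda>x. g x * exp (z * complex_of_real (f \<omega> x)))"

text \<open>The second conjunct makes \<open>twisted_transfer L f z \<omega>\<close> an operator on \<open>B \<omega>\<close>. The bounds on
  \<open>h\<close> and \<open>\<nu>\<close> near \<open>z = 0\<close> are the uniformity in \<open>\<omega>\<close> of the analyticity of the triplet. The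
  last conjunct bounds an operator norm; it is written as an inequality because a real-valued
  supremum would be meaningless for an unbounded operator.\<close>

definition random_spectral_assumption ::
  "'w measure \<Rightarrow> ('w \<Rightarrow> 'w) \<Rightarrow> ('w \<Rightarrow> 'x::metric_space set) \<Rightarrow> ('w \<Rightarrow> 'x measure) \<Rightarrow>
   ('w \<Rightarrow> ('x \<Rightarrow> complex) \<Rightarrow> 'x \<Rightarrow> complex) \<Rightarrow> ('w \<Rightarrow> ('x \<Rightarrow> complex) set) \<Rightarrow>
   ('w \<Rightarrow> ('x \<Rightarrow> complex) \<Rightarrow> real) \<Rightarrow> ('w \<Rightarrow> 'x \<Rightarrow> real) \<Rightarrow> bool" where
  "random_spectral_assumption P \<theta> E mu L B N f \<longleftrightarrow>
   (\<exists>r0>0. \<exists>(lam :: 'w \<Rightarrow> complex \<Rightarrow> complex) (h :: 'w \<Rightarrow> complex \<Rightarrow> 'x \<Rightarrow> complex)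
       (\<nu> :: 'w \<Rightarrow> complex \<Rightarrow> ('x \<Rightarrow> complex) \<Rightarrow> complex).
     (AE \<omega> in P. \<forall>z\<in>ball 0 r0.
        lam \<omega> z \<noteq> 0 \<and> h \<omega> z \<in> B \<omega> \<and> \<nu> \<omega> z \<in> dual_space (B \<omega>) (N \<omega>)) \<and>
     (AE \<omega> in P. \<forall>z\<in>ball 0 r0. \<forall>g\<in>B \<omega>. (\<lambda>x. g x * exp (z * complex_of_real (f \<omega> x))) \<in> B \<omega>) \<and>
     (\<forall>z\<in>ball 0 r0.
        (\<lambda>\<omega>. lam \<omega> z) \<in> borel_measurable P \<and>
        (\<lambda>(\<omega>, x). h \<omega> z x) \<in> borel_measurable (total_space P E) \<and>
        (\<forall>g. (\<lambda>(\<omega>, x). g \<omega> x) \<in> borel_measurable (total_space P E) \<and> (\<forall>\<omega>\<in>space P. g \<omega> \<in> B \<omega>) \<longrightarrow>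
           (\<lambda>\<omega>. \<nu> \<omega> z (g \<omega>)) \<in> borel_measurable P)) \<and>
     (AE \<omega> in P. lam \<omega> analytic_on ball 0 r0 \<and>
        analytic_into (B \<omega>) (N \<omega>) (ball 0 r0) (h \<omega>) \<and>
        analytic_into (dual_space (B \<omega>) (N \<omega>)) (dual_norm (B \<omega>) (N \<omega>)) (ball 0 r0) (\<nu> \<omega>)) \<and>
     (\<exists>\<rho>>0. \<exists>K. AE \<omega> in P. \<forall>z\<in>ball 0 \<rho>.
        N \<omega> (h \<omega> z) \<le> K \<and> dual_norm (B \<omega>) (N \<omega>) (\<nu> \<omega> z) \<le> K) \<and>
     (AE \<omega> in P. lam \<omega> 0 = 1 \<and> (\<forall>x\<in>E \<omega>. h \<omega> 0 x = 1) \<and>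
        (\<forall>g\<in>B \<omega>. integrable (mu \<omega>) g \<and> \<nu> \<omega> 0 g = (\<integral>x. g x \<partial>mu \<omega>)) \<and>
        (\<forall>z\<in>ball 0 r0. \<nu> \<omega> z (h \<omega> z) = 1)) \<and>
     (\<exists>C>0. \<exists>\<delta>. 0 < \<delta> \<and> \<delta> < 1 \<and>
        (AE \<omega> in P. \<forall>z\<in>ball 0 r0. \<forall>n\<ge>1. \<forall>g\<in>B \<omega>.
           N ((\<theta> ^^ n) \<omega>)
             (\<lambda>y. inverse (\<Prod>j<n. lam ((\<theta> ^^ j) \<omega>) z) *
                     fibre_iterate \<theta> (twisted_transfer L f z) \<omega> n g y
                   - \<nu> \<omega> z g * h ((\<theta> ^^ n) \<omega>) z y)
           \<le> C * \<delta> ^ n * N \<omega> g)))"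

section \<open>Growth condition and rates of convergence\<close>

definition l2_norm :: "'x measure \<Rightarrow> ('x \<Rightarrow> real) \<Rightarrow> real" where
  "l2_norm M X = sqrt (\<integral>x. (X x)\<^sup>2 \<partial>M)"

text \<open>\<open>\<Lambda> 0\<close> is the continuous branch, vanishing at \<open>0\<close>, of
  \<open>t \<mapsto> ln \<bbbE>[exp (\<i> t S\<^sub>n / \<sigma>\<^sub>n)] + t\<^sup>2 / 2\<close>, and \<open>\<Lambda> i\<close> is its \<open>i\<close>-th derivative. The principal
  logarithm would not do, since the argument of the characteristic function is unbounded on
  the intervals considered as \<open>n\<close> grows.\<close>

definition growth_condition :: "'x measure \<Rightarrow> (nat \<Rightarrow> 'x \<Rightarrow> real) \<Rightarrow> nat \<Rightarrow> bool" where
  "growth_condition M S m \<longleftrightarrow>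
     (\<forall>j\<in>{3..m + 1}. \<exists>C>0. \<exists>\<epsilon>>0. \<forall>n. l2_norm M (S n) > 0 \<longrightarrow>
        (let s = l2_norm M (S n); I = {- \<epsilon> * s..\<epsilon> * s} in
         \<exists>\<Lambda> :: nat \<Rightarrow> real \<Rightarrow> complex.
           continuous_on I (\<Lambda> 0) \<and> \<Lambda> 0 0 = 0 \<and>
           (\<forall>t\<in>I. exp (\<Lambda> 0 t - complex_of_real (t\<^sup>2 / 2)) = char (distr M borel (S n)) (t / s)) \<and>
           (\<forall>i<j. \<forall>t\<in>I. (\<Lambda> i has_vector_derivative \<Lambda> (Suc i) t) (at t within I)) \<and>
           (\<forall>t\<in>I. cmod (\<Lambda> j t) \<le> C / s ^ (j - 2))))"

definition normalized_sum ::
  "(nat \<Rightarrow> 'x \<Rightarrow> real) \<Rightarrow> (nat \<Rightarrow> real) \<Rightarrow> (nat \<Rightarrow> real) \<Rightarrow> nat \<Rightarrow> 'x \<Rightarrow> real" where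
  "normalized_sum S a b n x = (S n x - a n) / b n"

text \<open>The distance of the distribution functions of \<open>W\<^sub>n\<close> and of the standard normal law.\<close>

definition cdf_error :: "'x measure \<Rightarrow> ('x \<Rightarrow> real) \<Rightarrow> real \<Rightarrow> real" where
  "cdf_error M W x = \<bar>measure M {y \<in> space M. W y \<le> x} - cdf std_normal_distribution x\<bar>"

definition weighted_variation :: "nat \<Rightarrow> (real \<Rightarrow> real) \<Rightarrow> real" where
  "weighted_variation m h = (\<integral>x. \<bar>deriv h x\<bar> / (1 + \<bar>x\<bar>) ^ m \<partial>lebesgue)"

text \<open>Almost everywhere differentiable functions are understood to be primitives of their
  derivatives: for jump functions or the Cantor function, whose derivative vanishes almost
  everywhere, no bound in terms of \<open>weighted_variation m h\<close> is possible.\<close>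

definition ae_differentiable :: "(real \<Rightarrow> real) \<Rightarrow> bool" where
  "ae_differentiable h \<longleftrightarrow>
     (AE x in lebesgue. h differentiable (at x)) \<and>
     (\<forall>a b. a \<le> b \<longrightarrow> deriv h absolutely_integrable_on {a..b} \<and>
        (deriv h has_integral (h b - h a)) {a..b})"

definition finite_weighted_variation :: "nat \<Rightarrow> (real \<Rightarrow> real) \<Rightarrow> bool" where
  "finite_weighted_variation m h \<longleftrightarrow> integrable lebesgue (\<lambda>x. \<bar>deriv h x\<bar> / (1 + \<bar>x\<bar>) ^ m)"

text \<open>Indices for which \<open>1 / \<sigma>\<^sub>n\<close> or \<open>W\<^sub>n\<close> is undefined are excluded.\<close>

definition admissible_index ::
  "'x measure \<Rightarrow> (nat \<Rightarrow> 'x \<Rightarrow> real) \<Rightarrow> (nat \<Rightarrow> real) \<Rightarrow> nat \<Rightarrow> bool" where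
  "admissible_index M S b n \<longleftrightarrow> l2_norm M (S n) > 0 \<and> b n \<noteq> 0"

definition expectation_bound ::
  "'x measure \<Rightarrow> (nat \<Rightarrow> 'x \<Rightarrow> real) \<Rightarrow> (nat \<Rightarrow> real) \<Rightarrow> (nat \<Rightarrow> real) \<Rightarrow> nat \<Rightarrow> real \<Rightarrow>
   (real \<Rightarrow> real) \<Rightarrow> bool" where
  "expectation_bound M S a b m R h \<longleftrightarrow>
     integrable lborel (\<lambda>x. h x * std_normal_density x) \<and>
     (\<forall>n. admissible_index M S b n \<longrightarrow>
        integrable M (\<lambda>y. h (normalized_sum S a b n y)) \<and>
        \<bar>(\<integral>y. h (normalized_sum S a b n y) \<partial>M) - (\<integral>x. h x * std_normal_density x \<partial>lborel)\<bar>
          \<le> R * weighted_variation m h / l2_norm M (S n))"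

end

theory Submission
  imports Defs "HOL-Complex_Analysis.Complex_Analysis" "HOL-Real_Asymp.Real_Asymp"
begin

text \<open>Let \<open>Z\<^sub>n\<close> be the moment generating function of \<open>S\<^sub>n\<close> over \<open>\<omega>\<close>. By duality it is the integral
  of the iterated twisted transfer operator applied to \<open>1\<close>, so the spectral assumption writes it as
  \<open>lam \<omega> z \<cdots> lam (\<theta>\<^sup>n\<^sup>-\<^sup>1 \<omega>) z\<close> times a factor that is close to \<open>1\<close> near \<open>z = 0\<close> uniformly in \<open>\<omega>\<close>
  and \<open>n\<close>. Hence \<open>ln Z\<^sub>n\<close> is analytic in a disc independent of \<open>\<omega>\<close> and \<open>n\<close> and of size \<open>O(n)\<close> there,
  and Cauchy's estimates bound all cumulants by multiples of \<open>n\<close>.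

  Since the eigenvalues cancel, \<open>Var S\<^sub>n\<^sub>+\<^sub>1\<close> over \<open>\<omega>\<close> minus \<open>Var S\<^sub>n\<close> over \<open>\<theta> \<omega>\<close> converges
  exponentially fast to a bounded function of \<open>\<omega>\<close>, and \<open>\<sigma>\<^sup>2\<close> is its mean by the ergodic theorem. If
  \<open>\<sigma>\<^sup>2 = 0\<close>, the mean variances converge with a summable rate, and Cesaro means of the centred
  sums converge to the function \<open>r\<close>.

  If \<open>\<sigma>\<^sup>2 > 0\<close>, the variances grow linearly and the cumulant bounds give the growth condition.
  The law of \<open>S\<^sub>n / \<sigma>\<^sub>n\<close> tilted by \<open>exp (\<plusminus> y)\<close> and recentred is close to the normal law by a
  smoothing inequality for characteristic functions; undoing the tilt gives the error of the
  distribution functions an exponentially decaying weight, which dominates all polynomial ones.\<close>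

section \<open>Birkhoff's ergodic theorem\<close>

text \<open>The obstacle is that no bound on \<open>lam\<close> uniform in \<open>\<omega>\<close>
  is assumed, so \<open>ln Z\<^sub>n\<close> cannot be built eigenvalue by eigenvalue. The quotient
  of the generating functions for \<open>n + 1\<close> steps over \<open>\<omega>\<close> and
  \<open>n\<close> steps over \<open>\<theta> \<omega>\<close> changes with \<open>n\<close> only by
  a cross ratio, in which the eigenvalues and the limiting factors cancel; this ratio tends to
  \<open>1\<close> geometrically. The finitely many early \<open>n\<close> are controlled by
  convexity of \<open>exp\<close> and invariance of the fibre measures. Telescoping along the orbit
  then gives \<open>ln Z\<^sub>n\<close> as a sum of \<open>n\<close> uniformly bounded terms. The
  tilt replaces derivatives of characteristic functions, a usual source of weights: the normal law
  is unchanged by tilting and recentring, so an unweighted smoothing inequality suffices, and the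
  price is to evaluate transforms at \<open>\<i> t - 1\<close> instead of \<open>\<i> t\<close>.
  Hypotheses on fibres hold only almost everywhere, and fibre measures live on different spaces.
  Hence the estimates are made on a forward invariant set of full measure, and variances get
  measurable versions before the ergodic theorem is applied.\<close>

context ergodic_invertible
begin

lemma funpow_base_space: "\<omega> \<in> space P \<Longrightarrow> (\<theta> ^^ n) \<omega> \<in> space P"
  by (induction n) (use measurable_base in \<open>auto simp: measurable_def\<close>)

lemma measurable_funpow_base [measurable]: "\<theta> ^^ n \<in> P \<rightarrow>\<^sub>M P"
  by (induction n) (use measurable_base in \<open>auto intro: measurable_comp\<close>)

lemma distr_funpow_base: "distr P P (\<theta> ^^ n) = P"
proof (induction n)
  case 0
  then show ?case by (simp add: distr_id2 id_def)
next
  case (Suc n)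
  have "distr (distr P P (\<theta> ^^ n)) P \<theta> = distr P P (\<theta> \<circ> \<theta> ^^ n)"
    by (rule distr_distr[OF measurable_base measurable_funpow_base])
  then show ?case using Suc preserving_base by (simp only: funpow.simps)
qed

lemma AE_funpow_base:
  assumes "AE \<omega> in P. Q \<omega>"
  shows "AE \<omega> in P. \<forall>n. Q ((\<theta> ^^ n) \<omega>)"
proof -
  have "AE \<omega> in P. Q ((\<theta> ^^ n) \<omega>)" for n
    by (rule AE_distrD[of "\<theta> ^^ n" P P]) (simp_all only: distr_funpow_base measurable_funpow_base assms)
  then show ?thesis by (simp add: AE_all_countable)
qed

text \<open>The running maximum \<open>max\<^sub>k\<^sub>\<le>\<^sub>n\<close> of the Birkhoff sums of \<open>g\<close>.\<close>

primrec birkhoff_max :: "('w \<Rightarrow> real) \<Rightarrow> nat \<Rightarrow> 'w \<Rightarrow> real" where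
  "birkhoff_max g 0 \<omega> = 0"
| "birkhoff_max g (Suc n) \<omega> = max 0 (g \<omega> + birkhoff_max g n (\<theta> \<omega>))"

lemma birkhoff_max_nonneg: "0 \<le> birkhoff_max g n \<omega>"
  by (cases n) auto

lemma birkhoff_max_mono: "m \<le> n \<Longrightarrow> birkhoff_max g m \<omega> \<le> birkhoff_max g n \<omega>"
proof -
  have "birkhoff_max g n \<omega> \<le> birkhoff_max g (Suc n) \<omega>" for n \<omega>
  proof (induction n arbitrary: \<omega>)
    case (Suc n)
    show ?case using Suc[of "\<theta> \<omega>"]
      by (simp only: birkhoff_max.simps(2))
  qed simp
  then show "m \<le> n \<Longrightarrow> birkhoff_max g m \<omega> \<le> birkhoff_max g n \<omega>"
    by (rule lift_Suc_mono_le)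
qed

lemma sum_le_birkhoff_max: "(\<Sum>j<n. g ((\<theta> ^^ j) \<omega>)) \<le> birkhoff_max g n \<omega>"
proof (induction n arbitrary: \<omega>)
  case (Suc n)
  have "(\<Sum>j<Suc n. g ((\<theta> ^^ j) \<omega>)) = g \<omega> + (\<Sum>j<n. g ((\<theta> ^^ j) (\<theta> \<omega>)))"
    by (simp only: sum.lessThan_Suc_shift funpow_Suc_right o_def funpow_0 id_apply)
  then show ?case using Suc[of "\<theta> \<omega>"] by simp
qed simp

lemma birkhoff_max_measurable [measurable]:
  fixes g :: "'w \<Rightarrow> real"
  assumes [measurable]: "g \<in> borel_measurable P"
  shows "birkhoff_max g n \<in> borel_measurable P"
proof (induction n)
  case (Suc n)
  note [measurable] = measurable_base
  have "(\<lambda>\<omega>. birkhoff_max g n (\<theta> \<omega>)) \<in> borel_measurable P"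
    using Suc by (rule measurable_compose[OF measurable_base])
  then have "(\<lambda>\<omega>. max 0 (g \<omega> + birkhoff_max g n (\<theta> \<omega>))) \<in> borel_measurable P"
    by measurable
  then show ?case by (simp cong: measurable_cong)
qed simp

lemma birkhoff_max_le:
  assumes "\<And>\<omega>. \<bar>g \<omega>\<bar> \<le> K"
  shows "birkhoff_max g n \<omega> \<le> real n * K"
proof (induction n arbitrary: \<omega>)
  case (Suc n)
  have "0 \<le> K" using assms[of \<omega>] by linarith
  then have "0 \<le> real n * K" by simp
  then show ?case
    using Suc[of "\<theta> \<omega>"] assms[of \<omega>] \<open>0 \<le> K\<close> by (auto simp: algebra_simps)
qed simp

text \<open>Maximal ergodic argument. The set where the running maxima are unbounded is invariant,
  hence null or of full measure. Full measure is impossible: the maximum of order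
  \<open>n + 1\<close> at \<open>\<omega>\<close> minus that of order \<open>n\<close> at
  \<open>\<theta> \<omega>\<close> has nonnegative mean by invariance and monotonicity, yet these
  differences converge to \<open>g\<close>, whose mean is negative.\<close>

lemma AE_birkhoff_sums_bdd_above:
  fixes g :: "'w \<Rightarrow> real"
  assumes [measurable]: "g \<in> borel_measurable P" and bounded: "\<And>\<omega>. \<bar>g \<omega>\<bar> \<le> K"
    and negative: "expectation g < 0"
  shows "AE \<omega> in P. \<exists>C. \<forall>n. (\<Sum>j<n. g ((\<theta> ^^ j) \<omega>)) \<le> C"
proof -
  note [measurable] = measurable_base
  let ?M = "birkhoff_max g"
  define A where "A = {\<omega> \<in> space P. \<forall>k::nat. \<exists>n. real k < ?M n \<omega>}"
  have A[measurable]: "A \<in> sets P" unfolding A_def by measurable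
  have step: "\<omega> \<in> A \<longleftrightarrow> \<theta> \<omega> \<in> A" if "\<omega> \<in> space P" for \<omega>
  proof
    assume a: "\<omega> \<in> A"
    have "\<exists>n. real k < ?M n (\<theta> \<omega>)" for k
    proof -
      obtain n where n: "real (k + nat \<lceil>\<bar>g \<omega>\<bar>\<rceil>) < ?M n \<omega>" using a unfolding A_def by blast
      have "n \<noteq> 0"
      proof
        assume "n = 0"
        with n have "real (k + nat \<lceil>\<bar>g \<omega>\<bar>\<rceil>) < 0" by simp
        then show False using of_nat_0_le_iff not_less by blast
      qed
      then obtain l where "n = Suc l" by (cases n) auto
      with n have "real k < ?M l (\<theta> \<omega>)" by (simp add: max_def split: if_splits) linarith+
      then show ?thesis by blast
    qed
    then show "\<theta> \<omega> \<in> A" using that funpow_base_space[of \<omega> 1] unfolding A_def by simp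
  next
    assume a: "\<theta> \<omega> \<in> A"
    have "\<exists>n. real k < ?M n \<omega>" for k
    proof -
      obtain n where "real (k + nat \<lceil>\<bar>g \<omega>\<bar>\<rceil>) < ?M n (\<theta> \<omega>)" using a unfolding A_def by blast
      then have "real k < ?M (Suc n) \<omega>" by (simp add: max_def) linarith
      then show ?thesis by blast
    qed
    then show "\<omega> \<in> A" using that unfolding A_def by simp
  qed
  have "\<theta> -` A \<inter> space P = A" using step A_def by blast
  then have "prob A = 0 \<or> prob A = 1" by (intro ergodic_base A)
  moreover have "prob A \<noteq> 1"
  proof
    assume "prob A = 1"
    then have AE_A: "AE \<omega> in P. \<omega> \<in> A" by (simp add: prob_eq_1)
    have int: "integrable P (\<lambda>\<omega>. indicator A \<omega> * ?M n \<omega>)" for n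
      by (rule integrable_const_bound[of _ "real n * K"])
         (use birkhoff_max_le[of g K] bounded birkhoff_max_nonneg[of g] in
          \<open>auto simp: indicator_def abs_of_nonneg intro!: AE_I2 order_trans[OF _ birkhoff_max_le[of g K]]\<close>)
    have int': "integrable P (\<lambda>\<omega>. indicator A (\<theta> \<omega>) * ?M n (\<theta> \<omega>))" for n
      by (rule integrable_distr[OF measurable_base])
         (use int[of n] in \<open>simp add: preserving_base\<close>)
    have eq: "(\<integral>\<omega>. indicator A (\<theta> \<omega>) * ?M n (\<theta> \<omega>) \<partial>P) = (\<integral>\<omega>. indicator A \<omega> * ?M n \<omega> \<partial>P)" for n
      using integral_distr[OF measurable_base, of "\<lambda>\<omega>. indicator A \<omega> * ?M n \<omega>"]
      by (simp add: preserving_base)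
    \<comment> \<open>Subtracting \<open>?M n (\<theta> \<omega>)\<close> inside the maximum of the
      recursion leaves this expression. It equals \<open>g \<omega>\<close> as soon as the running
      maximum at \<open>\<theta> \<omega>\<close> exceeds \<open>\<bar>g \<omega>\<bar>\<close>,
      which happens on \<open>A\<close>.\<close>
    let ?D = "\<lambda>n \<omega>. indicator A \<omega> * max (- ?M n (\<theta> \<omega>)) (g \<omega>)"
    have D: "AE \<omega> in P. indicator A \<omega> * ?M (Suc n) \<omega> - indicator A (\<theta> \<omega>) * ?M n (\<theta> \<omega>) = ?D n \<omega>" for n
      using step by (intro AE_I2) (auto simp: indicator_def max_def)
    have nonneg: "0 \<le> (\<integral>\<omega>. ?D n \<omega> \<partial>P)" for n
    proof -
      have "(\<integral>\<omega>. ?D n \<omega> \<partial>P) =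
        (\<integral>\<omega>. indicator A \<omega> * ?M (Suc n) \<omega> - indicator A (\<theta> \<omega>) * ?M n (\<theta> \<omega>) \<partial>P)"
        by (rule integral_cong_AE[OF _ _ AE_symmetric[OF D]]) measurable
      also have "\<dots> = (\<integral>\<omega>. indicator A \<omega> * ?M (Suc n) \<omega> \<partial>P) - (\<integral>\<omega>. indicator A \<omega> * ?M n \<omega> \<partial>P)"
        by (subst Bochner_Integration.integral_diff[OF int int']) (simp only: eq)
      also have "\<dots> \<ge> 0"
        using integral_mono[OF int[of n] int[of "Suc n"]]
          birkhoff_max_mono[of n "Suc n" g] by (simp add: mult_left_mono del: birkhoff_max.simps)
      finally show ?thesis .
    qed
    have "(\<lambda>n. \<integral>\<omega>. ?D n \<omega> \<partial>P) \<longlonglongrightarrow> (\<integral>\<omega>. indicator A \<omega> * g \<omega> \<partial>P)"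
    proof (rule integral_dominated_convergence[where w = "\<lambda>_. K"])
      show "AE \<omega> in P. (\<lambda>n. ?D n \<omega>) \<longlonglongrightarrow> indicator A \<omega> * g \<omega>"
      proof (rule AE_I2)
        fix \<omega> assume w: "\<omega> \<in> space P"
        show "(\<lambda>n. ?D n \<omega>) \<longlonglongrightarrow> indicator A \<omega> * g \<omega>"
        proof (cases "\<omega> \<in> A")
          case True
          then have "\<theta> \<omega> \<in> A" using step w by simp
          then obtain n where n: "real (nat \<lceil>\<bar>g \<omega>\<bar>\<rceil>) < ?M n (\<theta> \<omega>)" unfolding A_def by blast
          have "?D k \<omega> = indicator A \<omega> * g \<omega>" if "k \<ge> n" for k
          proof -
            have "\<bar>g \<omega>\<bar> < ?M k (\<theta> \<omega>)"
              using n birkhoff_max_mono[OF that, of g "\<theta> \<omega>"] by linarith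
            then show ?thesis by (auto simp: max_def)
          qed
          then show ?thesis
            by (intro tendsto_eventually) (auto simp: eventually_sequentially)
        qed simp
      qed
      show "AE \<omega> in P. norm (?D n \<omega>) \<le> K" for n
      proof (rule AE_I2)
        fix \<omega>
        show "norm (?D n \<omega>) \<le> K"
          using bounded[of \<omega>] birkhoff_max_nonneg[of g n "\<theta> \<omega>"] by (auto simp: indicator_def max_def)
      qed
    qed auto
    then have "0 \<le> (\<integral>\<omega>. indicator A \<omega> * g \<omega> \<partial>P)"
      by (rule LIMSEQ_le_const) (use nonneg in auto)
    also have "\<dots> = expectation g"
      by (rule integral_cong_AE) (use AE_A in auto)
    finally show False using negative by simp
  qed
  ultimately have "AE \<omega> in P. \<omega> \<notin> A" by (simp add: prob_eq_0)
  then show ?thesis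
  proof (rule AE_mp, intro AE_I2 impI)
    fix \<omega> assume "\<omega> \<in> space P" "\<omega> \<notin> A"
    then obtain k :: nat where "\<forall>n. ?M n \<omega> \<le> real k" unfolding A_def by (auto simp: not_less)
    then show "\<exists>C. \<forall>n. (\<Sum>j<n. g ((\<theta> ^^ j) \<omega>)) \<le> C"
      using sum_le_birkhoff_max[of g] order_trans by blast
  qed
qed

text \<open>The preceding bound applies to \<open>g\<close> lowered by its mean and by
  \<open>1 / Suc k\<close>, whose mean is negative, and a constant disappears after division by
  \<open>n\<close>. Countably many \<open>k\<close> keep the exceptional set null.\<close>

lemma AE_birkhoff_averages_less:
  fixes g :: "'w \<Rightarrow> real"
  assumes [measurable]: "g \<in> borel_measurable P" and bounded: "\<And>\<omega>. \<bar>g \<omega>\<bar> \<le> K"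
  shows "AE \<omega> in P. \<forall>e>0. \<forall>\<^sub>F n in sequentially. (\<Sum>j<n. g ((\<theta> ^^ j) \<omega>)) / real n < expectation g + e"
proof -
  have int: "integrable P g" by (rule integrable_const_bound[of _ K]) (use bounded in auto)
  have "AE \<omega> in P. \<exists>C. \<forall>n. (\<Sum>j<n. g ((\<theta> ^^ j) \<omega>) - expectation g - 1 / Suc k) \<le> C" for k
    by (rule AE_birkhoff_sums_bdd_above[where K = "K + \<bar>expectation g\<bar> + 1"])
       (use int prob_space bounded in \<open>auto intro!: order_trans[OF abs_triangle_ineq4] add_mono\<close>)
  then have "AE \<omega> in P. \<forall>k. \<exists>C. \<forall>n. (\<Sum>j<n. g ((\<theta> ^^ j) \<omega>) - expectation g - 1 / Suc k) \<le> C"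
    by (simp add: AE_all_countable)
  then show ?thesis
  proof (rule AE_mp, intro AE_I2 impI allI)
    fix \<omega> and e :: real
    assume b: "\<forall>k. \<exists>C. \<forall>n. (\<Sum>j<n. g ((\<theta> ^^ j) \<omega>) - expectation g - 1 / Suc k) \<le> C" and "0 < e"
    obtain k where k: "1 / Suc k < e / 2" using \<open>0 < e\<close> nat_approx_posE[of "e/2"] by auto
    obtain C where C: "\<And>n. (\<Sum>j<n. g ((\<theta> ^^ j) \<omega>) - expectation g - 1 / Suc k) \<le> C" using b by blast
    have "(\<lambda>n. C / real n) \<longlonglongrightarrow> 0" by (rule lim_const_over_n)
    then have "\<forall>\<^sub>F n in sequentially. C / real n < e / 2"
      using \<open>0 < e\<close> by (intro order_tendstoD(2)[where y = 0]) auto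
    moreover have "\<forall>\<^sub>F n :: nat in sequentially. n > 0" by (rule eventually_gt_at_top)
    ultimately show "\<forall>\<^sub>F n in sequentially. (\<Sum>j<n. g ((\<theta> ^^ j) \<omega>)) / real n < expectation g + e"
    proof eventually_elim
      case (elim n)
      have "(\<Sum>j<n. g ((\<theta> ^^ j) \<omega>)) - real n * (expectation g + 1 / Suc k) \<le> C"
        using C[of n] by (simp add: sum_subtractf algebra_simps)
      then have "(\<Sum>j<n. g ((\<theta> ^^ j) \<omega>)) / real n \<le> (C + real n * (expectation g + 1 / Suc k)) / real n"
        by (intro divide_right_mono) auto
      also have "\<dots> = C / real n + expectation g + 1 / Suc k" using elim by (simp add: add_divide_distrib)
      finally show ?case using elim k by linarith
    qed
  qed
qed

text \<open>The one-sided bounds for \<open>g\<close> and for \<open>- g\<close> enclose the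
  averages.\<close>

lemma birkhoff_averages_tendsto:
  fixes g :: "'w \<Rightarrow> real"
  assumes [measurable]: "g \<in> borel_measurable P" and bounded: "\<And>\<omega>. \<bar>g \<omega>\<bar> \<le> K"
  shows "AE \<omega> in P. (\<lambda>n. (\<Sum>j<n. g ((\<theta> ^^ j) \<omega>)) / real n) \<longlonglongrightarrow> expectation g"
proof -
  have "AE \<omega> in P. \<forall>e>0. \<forall>\<^sub>F n in sequentially.
      (\<Sum>j<n. - g ((\<theta> ^^ j) \<omega>)) / real n < expectation (\<lambda>\<omega>. - g \<omega>) + e"
    by (rule AE_birkhoff_averages_less[of _ K]) (use bounded in auto)
  with AE_birkhoff_averages_less[OF assms] show ?thesis
  proof eventually_elim
    case (elim \<omega>)
    show ?case
    proof (rule order_tendstoI)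
      fix a assume "a < expectation g"
      then have "\<forall>\<^sub>F n in sequentially. (\<Sum>j<n. - g ((\<theta> ^^ j) \<omega>)) / real n
          < expectation (\<lambda>\<omega>. - g \<omega>) + (expectation g - a)"
        using elim(2)[rule_format, of "expectation g - a"] by simp
      then show "\<forall>\<^sub>F n in sequentially. a < (\<Sum>j<n. g ((\<theta> ^^ j) \<omega>)) / real n"
        by eventually_elim (simp add: sum_negf)
    next
      fix a assume "expectation g < a"
      then show "\<forall>\<^sub>F n in sequentially. (\<Sum>j<n. g ((\<theta> ^^ j) \<omega>)) / real n < a"
        using elim(1)[rule_format, of "a - expectation g"] by simp
    qed
  qed
qed

end

section \<open>Smoothing inequality\<close>

text \<open>A multiple of the Fejer kernel: its Fourier transform is supported in
  \<open>[-1, 1]\<close>, so smoothing by it involves characteristic functions only at frequencies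
  up to \<open>1\<close>. The value at \<open>0\<close> is the continuous extension.\<close>

definition fejer_kernel :: "real \<Rightarrow> real" where
  "fejer_kernel u = (if u = 0 then 1 / 2 else (1 - cos u) / u\<^sup>2)"

lemma fejer_kernel_measurable [measurable]: "fejer_kernel \<in> borel_measurable borel"
  unfolding fejer_kernel_def by measurable

lemma fejer_kernel_nonneg: "0 \<le> fejer_kernel u"
  by (simp add: fejer_kernel_def)

lemma fejer_kernel_minus [simp]: "fejer_kernel (- u) = fejer_kernel u"
  by (simp add: fejer_kernel_def)

lemma fejer_kernel_eq_integral:
  "fejer_kernel u = (\<integral>t. indicator {0..1} t *\<^sub>R ((1 - t) * cos (t * u)) \<partial>lborel)"
proof (cases "u = 0")
  case True
  have "(\<integral>t. indicator {0..1} t *\<^sub>R (1 - t) \<partial>lborel) = (1 - 1\<^sup>2 / 2) - (0 - (0::real)\<^sup>2 / 2)"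
    by (rule integral_FTC_Icc[where F = "\<lambda>t. t - t\<^sup>2 / 2"])
       (auto intro!: derivative_eq_intros continuous_intros simp: has_real_derivative_iff_has_vector_derivative[symmetric])
  with True show ?thesis by (simp add: fejer_kernel_def)
next
  case False
  let ?F = "\<lambda>t. (1 - t) * sin (t * u) / u - cos (t * u) / u\<^sup>2"
  have "(\<integral>t. indicator {0..1} t *\<^sub>R ((1 - t) * cos (t * u)) \<partial>lborel) = ?F 1 - ?F 0"
    by (rule integral_FTC_Icc[where F = ?F])
       (use False in \<open>auto intro!: derivative_eq_intros continuous_intros
          simp: has_real_derivative_iff_has_vector_derivative[symmetric] field_simps power2_eq_square\<close>)
  with False show ?thesis by (simp add: fejer_kernel_def field_simps)
qed

lemma fejer_kernel_le_inverse_square: "fejer_kernel u \<le> 2 / u\<^sup>2" if "u \<noteq> 0"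
  using that cos_ge_minus_one[of u] by (auto simp: fejer_kernel_def intro!: divide_right_mono)

lemma fejer_kernel_le_half: "fejer_kernel u \<le> 1 / 2"
proof (cases "u = 0")
  case False
  have "1 - cos u = 2 * (sin (u / 2))\<^sup>2" using cos_double_sin[of "u / 2"] by simp
  also have "\<dots> \<le> 2 * (u / 2)\<^sup>2"
    using abs_sin_x_le_abs_x[of "u / 2"] by (intro mult_left_mono) (auto simp: abs_le_square_iff[symmetric])
  finally have "1 - cos u \<le> 1 / 2 * u\<^sup>2" by (simp add: power_divide)
  then show ?thesis using False by (simp add: fejer_kernel_def divide_le_eq)
qed (simp add: fejer_kernel_def)

lemma integrable_inverse_one_plus_square: "integrable lborel (\<lambda>x::real. inverse (1 + x\<^sup>2))"
  using integrable_inverse_1_plus_square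
  by (simp add: set_integrable_def einterval_eq)

lemma fejer_kernel_integrable [simp, intro]: "integrable lborel fejer_kernel"
proof (rule Bochner_Integration.integrable_bound[OF integrable_mult_right[OF integrable_inverse_one_plus_square, of 3]])
  show "AE u in lborel. norm (fejer_kernel u) \<le> norm (3 * inverse (1 + u\<^sup>2))"
  proof (rule AE_I2)
    fix u :: real
    have "fejer_kernel u * u\<^sup>2 \<le> 2"
      using cos_ge_minus_one[of u] by (auto simp: fejer_kernel_def)
    then have "fejer_kernel u * (1 + u\<^sup>2) \<le> 3"
      using fejer_kernel_le_half[of u] by (simp add: algebra_simps)
    moreover have "0 < 1 + u\<^sup>2" by (simp add: add_pos_nonneg)
    ultimately show "norm (fejer_kernel u) \<le> norm (3 * inverse (1 + u\<^sup>2))"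
      using fejer_kernel_nonneg[of u] by (simp add: field_simps)
  qed
qed simp

definition fejer_mass :: real where "fejer_mass = (\<integral>u. fejer_kernel u \<partial>lborel)"

lemma fejer_mass_pos: "0 < fejer_mass"
proof -
  have "fejer_mass \<noteq> 0"
  proof
    assume "fejer_mass = 0"
    then have "AE u in lborel. fejer_kernel u = 0"
      unfolding fejer_mass_def
      by (subst (asm) integral_nonneg_eq_0_iff_AE) (auto simp: fejer_kernel_nonneg)
    then have "AE u in lborel. u \<notin> {0<..<1::real}"
    proof (rule AE_mp, intro AE_I2 impI)
      fix u :: real assume "fejer_kernel u = 0"
      moreover have "cos u < 1" if "0 < u" "u < 1"
        using cos_monotone_0_pi[of 0 u] that pi_gt3 by simp
      ultimately show "u \<notin> {0<..<1}" by (auto simp: fejer_kernel_def)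
    qed
    then have "emeasure lborel {0<..<1::real} = 0"
      by (subst (asm) AE_iff_measurable[OF _ refl]) (auto simp: Collect_conj_eq lessThan_def greaterThan_def greaterThanLessThan_def)
    then show False by simp
  qed
  moreover have "0 \<le> fejer_mass"
    unfolding fejer_mass_def by (intro integral_nonneg_AE) (auto simp: fejer_kernel_nonneg)
  ultimately show ?thesis by linarith
qed

text \<open>Each half line contributes at most \<open>2 / d\<close>, the integral of
  \<open>2 / u\<^sup>2\<close> from \<open>d\<close> on.\<close>

lemma fejer_kernel_tail:
  assumes "0 < d"
  shows "(\<integral>u. indicator {u. d \<le> \<bar>u\<bar>} u * fejer_kernel u \<partial>lborel) \<le> 4 / d"
proof -
  have right: "(\<integral>\<^sup>+u. ennreal (fejer_kernel u) * indicator {d..} u \<partial>lborel) \<le> ennreal (2 / d)"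
  proof -
    have "(\<integral>\<^sup>+u. ennreal (fejer_kernel u) * indicator {d..} u \<partial>lborel)
        \<le> (\<integral>\<^sup>+u. ennreal (2 / u\<^sup>2) * indicator {d..} u \<partial>lborel)"
      using assms by (intro nn_integral_mono)
        (auto simp: indicator_def intro!: ennreal_leI fejer_kernel_le_inverse_square)
    also have "\<dots> = ennreal (0 - (- 2 / d))"
    proof (rule nn_integral_FTC_atLeast)
      show "((\<lambda>u::real. - 2 / u) \<longlongrightarrow> 0) at_top" by real_asymp
    qed (use assms in \<open>auto intro!: derivative_eq_intros simp: power2_eq_square\<close>)
    finally show ?thesis by simp
  qed
  have left: "(\<integral>\<^sup>+u. ennreal (fejer_kernel u) * indicator {..- d} u \<partial>lborel)
      = (\<integral>\<^sup>+u. ennreal (fejer_kernel u) * indicator {d..} u \<partial>lborel)"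
    by (subst nn_integral_real_affine[where c = "- 1" and t = 0])
       (auto intro!: nn_integral_cong simp: indicator_def)
  have "ennreal (\<integral>u. indicator {u. d \<le> \<bar>u\<bar>} u * fejer_kernel u \<partial>lborel)
      = (\<integral>\<^sup>+u. ennreal (indicator {u. d \<le> \<bar>u\<bar>} u * fejer_kernel u) \<partial>lborel)"
    by (intro nn_integral_eq_integral[symmetric] AE_I2 integrable_real_mult_indicator
          integrable_mult_indicator[where 'b = real, unfolded real_scaleR_def])
       (auto simp: fejer_kernel_nonneg)
  also have "\<dots> = (\<integral>\<^sup>+u. ennreal (fejer_kernel u) * indicator {d..} u
      + ennreal (fejer_kernel u) * indicator {..- d} u \<partial>lborel)"
    using assms by (intro nn_integral_cong) (auto simp: indicator_def fejer_kernel_nonneg abs_if)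
  also have "\<dots> \<le> ennreal (2 / d) + ennreal (2 / d)"
    by (subst nn_integral_add) (auto intro!: add_mono right simp: left)
  also have "\<dots> = ennreal (4 / d)" using assms by (subst ennreal_plus[symmetric]) auto
  finally show ?thesis using assms by (subst (asm) ennreal_le_iff) auto
qed

section \<open>Smoothed distribution functions in terms of characteristic functions\<close>

abbreviation "unit_interval_measure \<equiv> restrict_space lborel {0..1::real}"

lemma finite_measure_restrict_lborel: "finite_measure (restrict_space lborel {a..b::real})"
  by (intro finite_measure_restrict_space finite_measureI) (auto simp: emeasure_restrict_space space_restrict_space emeasure_lborel_Icc_eq)

text \<open>Yields the bound \<open>2 / t\<close> for the transform of an interval of any length.
  The independence of the length is what allows the left end to go to minus infinity.\<close>

lemma integral_iexp_Ioc:
  fixes a b t :: real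
  assumes "a \<le> b" "t \<noteq> 0"
  shows "(\<integral>x. indicator {a<..b} x *\<^sub>R iexp (- (t * x)) \<partial>lborel) = (iexp (- (t * a)) - iexp (- (t * b))) / (\<i> * t)"
proof -
  have "(LBINT x=a..b. iexp (- (t * x))) = - iexp (- (t * b)) / (\<i> * t) - - iexp (- (t * a)) / (\<i> * t)"
  proof (rule interval_integral_FTC_finite)
    show "((\<lambda>x. - iexp (- (t * x)) / (\<i> * t)) has_vector_derivative iexp (- (t * x)))
        (at x within {min a b..max a b})" for x
    proof -
      have "((\<lambda>z. - exp (- (\<i> * t * z)) / (\<i> * t)) has_field_derivative exp (- (\<i> * t * of_real x))) (at (of_real x))"
        using assms by (auto intro!: derivative_eq_intros)
      then show ?thesis
        by (auto dest!: has_vector_derivative_real_field simp: mult.assoc)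
    qed
  qed (auto intro!: continuous_intros)
  then show ?thesis
    using assms by (simp add: interval_integral_Ioc set_lebesgue_integral_def diff_divide_distrib)
qed

text \<open>Fubini, after the kernel has been written as an integral of cosines: smoothing
  multiplies the transform by \<open>1 - t\<close> and cuts it off at \<open>1\<close>. Bounded
  intervals are used because the indicator of a half line is not integrable.\<close>

lemma integral_mult_iexp_Ioc:
  fixes M :: "real measure" and a b :: real
  assumes "real_distribution M" "a \<le> b"
  defines "J \<equiv> \<lambda>t. \<integral>x. indicator {a<..b} x *\<^sub>R iexp (- (t * x)) \<partial>lborel"
  shows "(\<integral>u. fejer_kernel u * measure M {a - u<..b - u} \<partial>lborel)
     = (\<integral>t. (1 - t) * Re (char M t * J t) \<partial>unit_interval_measure)"
proof -
  interpret M: real_distribution M by fact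
  interpret U: finite_measure unit_interval_measure by (rule finite_measure_restrict_lborel)
  interpret I: finite_measure "restrict_space lborel {a<..b}"
    by (intro finite_measure_restrict_space finite_measureI)
       (use assms in \<open>auto simp: emeasure_restrict_space space_restrict_space\<close>)
  interpret LM: pair_sigma_finite lborel M ..
  interpret UM: pair_sigma_finite unit_interval_measure M ..
  interpret IU: pair_sigma_finite "restrict_space lborel {a<..b}" unit_interval_measure ..
  interpret IM: pair_sigma_finite "restrict_space lborel {a<..b}" M ..
  interpret UMf: finite_measure "unit_interval_measure \<Otimes>\<^sub>M M"
    by (rule finite_measure_pair_measure) unfold_locales
  interpret IUf: finite_measure "restrict_space lborel {a<..b} \<Otimes>\<^sub>M unit_interval_measure"
    by (rule finite_measure_pair_measure) unfold_locales
  have id_U[measurable]: "(\<lambda>x. x) \<in> borel_measurable unit_interval_measure"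
    and id_I[measurable]: "(\<lambda>x. x) \<in> borel_measurable (restrict_space lborel {a<..b})"
    by (auto intro!: measurable_restrict_space1)
  define K where "K t y = (\<integral>x. cos (t * (x - y)) \<partial>restrict_space lborel {a<..b})" for t y
  have J_eq: "J t = (\<integral>x. iexp (- (t * x)) \<partial>restrict_space lborel {a<..b})" for t
    unfolding J_def by (subst integral_restrict_space) auto
  have K_eq: "K t y = Re (iexp (t * y) * J t)" for t y
  proof -
    have "iexp (t * y) * J t = (\<integral>x. iexp (t * y) * iexp (- (t * x)) \<partial>restrict_space lborel {a<..b})"
      unfolding J_eq by (rule integral_mult_right_zero[symmetric])
    also have "Re \<dots> = (\<integral>x. Re (iexp (t * y) * iexp (- (t * x))) \<partial>restrict_space lborel {a<..b})"
      by (rule integral_Re[symmetric]) (auto intro!: I.integrable_const_bound[of _ 1] simp: norm_mult)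
    also have "\<dots> = K t y"
      unfolding K_def
      by (intro Bochner_Integration.integral_cong refl) (simp add: Re_exp Im_exp right_diff_distrib cos_diff)
    finally show ?thesis by simp
  qed
  have J_meas[measurable]: "J \<in> borel_measurable borel"
    unfolding J_eq[abs_def] by (rule I.borel_measurable_lebesgue_integral) measurable
  have K_meas[measurable]: "(\<lambda>(t, y). K t y) \<in> borel_measurable (unit_interval_measure \<Otimes>\<^sub>M M)"
    unfolding K_eq by measurable
  have J_le: "cmod (J t) \<le> b - a" for t
  proof -
    have "cmod (J t) \<le> (\<integral>x. cmod (iexp (- (t * x))) \<partial>restrict_space lborel {a<..b})"
      unfolding J_eq by (rule integral_norm_bound)
    also have "\<dots> = b - a"
      using assms(2) by (simp add: measure_restrict_space space_restrict_space)
    finally show ?thesis .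
  qed
  have K_le: "\<bar>K t y\<bar> \<le> b - a" for t y
    using abs_Re_le_cmod[of "iexp (t * y) * J t"] J_le[of t] by (simp add: K_eq norm_mult)
  have int_v: "(\<integral>x. fejer_kernel (x - y) \<partial>restrict_space lborel {a<..b}) = (\<integral>t. (1 - t) * K t y \<partial>unit_interval_measure)" for y
  proof -
    have "(\<integral>x. fejer_kernel (x - y) \<partial>restrict_space lborel {a<..b}) =
        (\<integral>x. (\<integral>t. (1 - t) * cos (t * (x - y)) \<partial>unit_interval_measure) \<partial>restrict_space lborel {a<..b})"
      by (simp add: fejer_kernel_eq_integral integral_restrict_space)
    also have "\<dots> = (\<integral>t. (\<integral>x. (1 - t) * cos (t * (x - y)) \<partial>restrict_space lborel {a<..b}) \<partial>unit_interval_measure)"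
      by (rule IU.Fubini_integral[symmetric], rule IUf.integrable_const_bound[of _ 1])
         (auto intro!: AE_I2 mult_le_one simp: abs_mult space_restrict_space space_pair_measure)
    finally show ?thesis unfolding K_def by simp
  qed
  have ind: "measure M {a - u<..b - u} = (\<integral>y. indicator {a<..b} (y + u) \<partial>M)" for u
  proof -
    have "(\<lambda>y. indicator {a<..b} (y + u) :: real) = indicator {a - u<..b - u}"
      by (auto simp: indicator_def fun_eq_iff)
    then show ?thesis by simp
  qed
  have "(\<integral>u. fejer_kernel u * measure M {a - u<..b - u} \<partial>lborel)
      = (\<integral>u. (\<integral>y. fejer_kernel u * indicator {a<..b} (y + u) \<partial>M) \<partial>lborel)"
    by (simp add: ind)
  also have "\<dots> = (\<integral>y. (\<integral>u. fejer_kernel u * indicator {a<..b} (y + u) \<partial>lborel) \<partial>M)"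
  proof (rule LM.Fubini_integral[symmetric])
    have "integrable (lborel \<Otimes>\<^sub>M M) (\<lambda>z. fejer_kernel (fst z))"
      by (rule LM.Fubini_integrable) (auto simp: M.prob_space)
    then show "integrable (lborel \<Otimes>\<^sub>M M) (\<lambda>(u, y). fejer_kernel u * indicator {a<..b} (y + u))"
      by (rule Bochner_Integration.integrable_bound) (auto simp: indicator_def)
  qed
  also have "\<dots> = (\<integral>y. (\<integral>x. fejer_kernel (x - y) \<partial>restrict_space lborel {a<..b}) \<partial>M)"
  proof (rule Bochner_Integration.integral_cong[OF refl])
    fix y
    show "(\<integral>u. fejer_kernel u * indicator {a<..b} (y + u) \<partial>lborel)
      = (\<integral>x. fejer_kernel (x - y) \<partial>restrict_space lborel {a<..b})"
      by (subst lborel_integral_real_affine[where c = 1 and t = "- y"])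
         (auto simp: integral_restrict_space mult.commute)
  qed
  also have "\<dots> = (\<integral>y. (\<integral>t. (1 - t) * K t y \<partial>unit_interval_measure) \<partial>M)"
    by (simp only: int_v)
  also have "\<dots> = (\<integral>t. (\<integral>y. (1 - t) * K t y \<partial>M) \<partial>unit_interval_measure)"
  proof (rule UM.Fubini_integral, rule UMf.integrable_const_bound[of _ "b - a"])
    show "AE z in unit_interval_measure \<Otimes>\<^sub>M M. norm (case z of (t, y) \<Rightarrow> (1 - t) * K t y) \<le> b - a"
    proof (rule AE_I2)
      fix z assume "z \<in> space (unit_interval_measure \<Otimes>\<^sub>M M)"
      then obtain t y where z: "z = (t, y)" "0 \<le> t" "t \<le> 1"
        by (auto simp: space_pair_measure space_restrict_space)
      then show "norm (case z of (t, y) \<Rightarrow> (1 - t) * K t y) \<le> b - a"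
        using mult_mono[of "1 - t" 1 "\<bar>K t y\<bar>" "b - a"] K_le[of t y] by (simp add: abs_mult)
    qed
  qed measurable
  also have "\<dots> = (\<integral>t. (1 - t) * Re (char M t * J t) \<partial>unit_interval_measure)"
  proof (intro Bochner_Integration.integral_cong refl)
    fix t
    have "(\<integral>y. K t y \<partial>M) = Re (\<integral>y. iexp (t * y) * J t \<partial>M)"
      unfolding K_eq using J_le[of t]
      by (intro integral_Re) (auto intro!: M.integrable_const_bound[of _ "b - a"] simp: norm_mult)
    then show "(\<integral>y. (1 - t) * K t y \<partial>M) = (1 - t) * Re (char M t * J t)"
      by (simp add: char_def)
  qed
  finally show ?thesis .
qed

section \<open>Exponential tilting\<close>

text \<open>Esseen's method. The kernel average of the difference \<open>H\<close> is small by the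
  Fourier bound. Conversely, near a point where \<open>\<bar>H\<bar>\<close> is almost extremal,
  monotonicity of one distribution function and the Lipschitz bound of the other keep
  \<open>H\<close> large on a whole interval, so the average there controls the supremum.\<close>

lemma smoothing_inequality:
  fixes M1 M2 :: "real measure" and w :: "real \<Rightarrow> real"
  assumes "real_distribution M1" "real_distribution M2"
    and "0 < A" and lipschitz: "\<And>x y. x \<le> y \<Longrightarrow> cdf M2 y - cdf M2 x \<le> A * (y - x)"
    and w: "integrable unit_interval_measure w" "(\<integral>t. w t \<partial>unit_interval_measure) \<le> W"
    and char: "\<And>t. 0 < t \<Longrightarrow> t \<le> 1 \<Longrightarrow> cmod (char M1 t - char M2 t) \<le> t * w t"
  shows "\<bar>cdf M1 x - cdf M2 x\<bar> \<le> 4 / fejer_mass * (2 * W + 96 * A)"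
proof -
  interpret M1: real_distribution M1 by fact
  interpret M2: real_distribution M2 by fact
  interpret U: finite_measure unit_interval_measure by (rule finite_measure_restrict_lborel)
  define H where "H x = cdf M1 x - cdf M2 x" for x
  have H_le_1: "\<bar>H x\<bar> \<le> 1" for x
    using M1.cdf_bounded_prob[of x] M2.cdf_bounded_prob[of x] M1.cdf_nonneg[of x] M2.cdf_nonneg[of x]
    unfolding H_def by linarith
  have [measurable]: "cdf M1 \<in> borel_measurable borel" "cdf M2 \<in> borel_measurable borel"
    by (intro borel_measurable_mono monoI M1.cdf_nondecreasing M2.cdf_nondecreasing; assumption)+
  have H_meas[measurable]: "H \<in> borel_measurable borel"
    unfolding H_def by measurable
  have int_vH: "integrable lborel (\<lambda>u. fejer_kernel u * H (b - u))" for b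
    by (rule Bochner_Integration.integrable_bound[OF fejer_kernel_integrable])
       (use H_le_1 in \<open>auto simp: abs_mult fejer_kernel_nonneg intro!: mult_left_le\<close>)
  define S where "S b = (\<integral>u. fejer_kernel u * H (b - u) \<partial>lborel)" for b
  have int_M: "integrable lborel (\<lambda>u. fejer_kernel u * measure M {a - u<..b - u})"
    if "real_distribution M" "a \<le> b" for M a b
  proof -
    interpret M: real_distribution M by fact
    have [measurable]: "cdf M \<in> borel_measurable borel"
      by (intro borel_measurable_mono monoI M.cdf_nondecreasing)
    have "measure M {a - u<..b - u} = cdf M (b - u) - cdf M (a - u)" for u
      using that by (cases "a = b") (auto simp: M.cdf_diff_eq)
    then have m: "(\<lambda>u. measure M {a - u<..b - u}) \<in> borel_measurable borel" by simp
    show ?thesis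
      by (rule Bochner_Integration.integrable_bound[OF fejer_kernel_integrable])
         (use m in \<open>auto simp: abs_mult fejer_kernel_nonneg intro!: mult_left_le\<close>)
  qed
  \<comment> \<open>The length \<open>b - a\<close> must not enter: the \<open>1 / t\<close> from
    the transform of the interval is absorbed by the factor \<open>t\<close> in the hypothesis on
    the characteristic functions.\<close>
  have diff_le: "\<bar>S b - S a\<bar> \<le> 2 * W" if "a \<le> b" for a b
  proof -
    let ?J = "\<lambda>t. \<integral>x. indicator {a<..b} x *\<^sub>R iexp (- (t * x)) \<partial>lborel"
    have "S b - S a = (\<integral>u. fejer_kernel u * H (b - u) - fejer_kernel u * H (a - u) \<partial>lborel)"
      unfolding S_def by (rule Bochner_Integration.integral_diff[symmetric]) (rule int_vH)+
    also have "\<dots> = (\<integral>u. fejer_kernel u * measure M1 {a - u<..b - u} - fejer_kernel u * measure M2 {a - u<..b - u} \<partial>lborel)"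
    proof (intro Bochner_Integration.integral_cong refl)
      fix u
      have "measure M1 {a - u<..b - u} = cdf M1 (b - u) - cdf M1 (a - u)"
           "measure M2 {a - u<..b - u} = cdf M2 (b - u) - cdf M2 (a - u)"
        using that by (cases "a = b"; auto simp: M1.cdf_diff_eq M2.cdf_diff_eq)+
      then have "H (b - u) - H (a - u) = measure M1 {a - u<..b - u} - measure M2 {a - u<..b - u}"
        unfolding H_def by simp
      then show "fejer_kernel u * H (b - u) - fejer_kernel u * H (a - u)
         = fejer_kernel u * measure M1 {a - u<..b - u} - fejer_kernel u * measure M2 {a - u<..b - u}"
        by (simp only: right_diff_distrib[symmetric])
    qed
    also have "\<dots> = (\<integral>u. fejer_kernel u * measure M1 {a - u<..b - u} \<partial>lborel)
        - (\<integral>u. fejer_kernel u * measure M2 {a - u<..b - u} \<partial>lborel)"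
      by (intro Bochner_Integration.integral_diff int_M assms that)
    also have "\<dots> = (\<integral>t. (1 - t) * Re (char M1 t * ?J t) \<partial>unit_interval_measure)
        - (\<integral>t. (1 - t) * Re (char M2 t * ?J t) \<partial>unit_interval_measure)"
      by (simp only: integral_mult_iexp_Ioc[OF assms(1) that] integral_mult_iexp_Ioc[OF assms(2) that])
    also have "\<dots> = (\<integral>t. (1 - t) * Re (char M1 t * ?J t) - (1 - t) * Re (char M2 t * ?J t) \<partial>unit_interval_measure)"
    proof (rule Bochner_Integration.integral_diff[symmetric])
      have J_le: "cmod (?J t) \<le> b - a" for t
      proof -
        have "cmod (?J t) \<le> (\<integral>x. cmod (indicator {a<..b} x *\<^sub>R iexp (- (t * x))) \<partial>lborel)"
          by (rule integral_norm_bound)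
        also have "\<dots> = (\<integral>x. indicator {a<..b} x \<partial>lborel)"
          by (intro Bochner_Integration.integral_cong) (auto simp: indicator_def)
        also have "\<dots> = b - a" using that by simp
        finally show ?thesis .
      qed
      have id_meas[measurable]: "(\<lambda>x. x) \<in> borel_measurable unit_interval_measure"
        by (auto intro!: measurable_restrict_space1)
      have J_meas: "?J \<in> borel_measurable unit_interval_measure"
        by (rule lborel.borel_measurable_lebesgue_integral) measurable
      have "integrable unit_interval_measure (\<lambda>t. (1 - t) * Re (char M t * ?J t))" if "real_distribution M" for M
      proof -
        interpret M: real_distribution M by fact
        have char_M: "char M \<in> borel_measurable unit_interval_measure"
          using M.char_measurable by (intro measurable_restrict_space1) simp
        have "\<bar>Re (char M t * ?J t)\<bar> \<le> b - a" for t
        proof -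
          have "\<bar>Re (char M t * ?J t)\<bar> \<le> cmod (char M t) * cmod (?J t)"
            using abs_Re_le_cmod[of "char M t * ?J t"] by (simp only: norm_mult)
          also have "\<dots> \<le> 1 * (b - a)" by (intro mult_mono J_le M.cmod_char_le_1) auto
          finally show ?thesis by simp
        qed
        then have "norm ((1 - t) * Re (char M t * ?J t)) \<le> b - a" if "t \<in> space unit_interval_measure" for t
          using that mult_mono[of "1 - t" 1 "\<bar>Re (char M t * ?J t)\<bar>" "b - a"]
          by (simp add: space_restrict_space abs_mult)
        then show ?thesis
          by (intro U.integrable_const_bound[of _ "b - a"] AE_I2 borel_measurable_times borel_measurable_diff
                borel_measurable_const borel_measurable_Re char_M J_meas id_meas) simp_all
      qed
      then show "integrable unit_interval_measure (\<lambda>t. (1 - t) * Re (char M1 t * ?J t))"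
        "integrable unit_interval_measure (\<lambda>t. (1 - t) * Re (char M2 t * ?J t))" using assms by auto
    qed
    finally have S_diff: "S b - S a = (\<integral>t. (1 - t) * Re (char M1 t * ?J t) - (1 - t) * Re (char M2 t * ?J t) \<partial>unit_interval_measure)" .
    have "AE t in lborel. t \<noteq> (0::real)" by (rule AE_lborel_singleton)
    then have nonzero: "AE t in unit_interval_measure. t \<noteq> 0"
      by (subst AE_restrict_space_iff) auto
    have bound: "norm ((1 - t) * Re (char M1 t * ?J t) - (1 - t) * Re (char M2 t * ?J t)) \<le> 2 * w t"
      if t: "0 < t" "t \<le> 1" for t
    proof -
      have J: "cmod (?J t) \<le> 2 / t"
        using t norm_triangle_ineq4[of "iexp (- (t * a))" "iexp (- (t * b))"]
        by (subst integral_iexp_Ioc[OF \<open>a \<le> b\<close>])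
           (auto simp: norm_divide norm_mult intro!: divide_right_mono simp del: of_real_minus of_real_mult)
      have "(1 - t) * Re (p * j) - (1 - t) * Re (q * j) = (1 - t) * Re ((p - q) * j)" for p q j
        by (simp add: algebra_simps)
      then have "norm ((1 - t) * Re (char M1 t * ?J t) - (1 - t) * Re (char M2 t * ?J t))
          = (1 - t) * \<bar>Re ((char M1 t - char M2 t) * ?J t)\<bar>"
        using t by (simp only: real_norm_def abs_mult)
      also have "\<dots> \<le> 1 * (cmod (char M1 t - char M2 t) * cmod (?J t))"
        using t abs_Re_le_cmod[of "(char M1 t - char M2 t) * ?J t"]
        by (intro mult_mono) (auto simp only: norm_mult)
      also have "\<dots> \<le> 1 * ((t * w t) * (2 / t))"
        using char[OF t] J order_trans[OF norm_ge_zero char[OF t]] by (intro mult_left_mono mult_mono) auto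
      finally show ?thesis using t by simp
    qed
    have w_nonneg: "0 \<le> 2 * w t" if t: "0 < t" "t \<le> 1" for t
      using order_trans[OF norm_ge_zero char[OF t]] t by (simp add: zero_le_mult_iff)
    have pos: "AE t in unit_interval_measure. 0 < t \<and> t \<le> 1"
      using nonzero by (rule AE_mp) (auto simp: space_restrict_space)
    have "\<bar>S b - S a\<bar> \<le> (\<integral>t. norm ((1 - t) * Re (char M1 t * ?J t) - (1 - t) * Re (char M2 t * ?J t)) \<partial>unit_interval_measure)"
      unfolding S_diff real_norm_def[symmetric] by (rule integral_norm_bound)
    also have "\<dots> \<le> (\<integral>t. 2 * w t \<partial>unit_interval_measure)"
    proof (rule integral_mono_AE')
      show "integrable unit_interval_measure (\<lambda>t. 2 * w t)" using w by simp
    qed (rule eventually_mono[OF pos], elim conjE, rule bound w_nonneg; assumption)+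
    also have "\<dots> \<le> 2 * W" using w by simp
    finally show ?thesis .
  qed
  \<comment> \<open>The left end tends to minus infinity, where both distribution functions
    vanish.\<close>
  have S_le: "\<bar>S b\<bar> \<le> 2 * W" for b
  proof -
    have "(\<lambda>n. S (- real n)) \<longlonglongrightarrow> (\<integral>u. 0 \<partial>(lborel :: real measure))"
      unfolding S_def
    proof (rule integral_dominated_convergence[where w = fejer_kernel])
      show "AE u in lborel. (\<lambda>n. fejer_kernel u * H (- real n - u)) \<longlonglongrightarrow> 0"
      proof (rule AE_I2)
        fix u :: real
        have *: "filterlim (\<lambda>n. - real n - u) at_bot sequentially"
          by real_asymp
        have "(\<lambda>n. H (- real n - u)) \<longlonglongrightarrow> 0 - 0" unfolding H_def
          by (intro tendsto_diff filterlim_compose[OF M1.cdf_lim_at_bot *] filterlim_compose[OF M2.cdf_lim_at_bot *])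
        then show "(\<lambda>n. fejer_kernel u * H (- real n - u)) \<longlonglongrightarrow> 0"
          by (auto intro: tendsto_mult_right_zero)
      qed
      show "AE u in lborel. norm (fejer_kernel u * H (- real n - u)) \<le> fejer_kernel u" for n
        using H_le_1 by (auto simp: abs_mult fejer_kernel_nonneg intro!: mult_left_le)
    qed auto
    then have lim: "(\<lambda>n. \<bar>S b - S (- real n)\<bar>) \<longlonglongrightarrow> \<bar>S b - 0\<bar>"
      by (intro tendsto_intros) simp
    have "\<forall>n\<ge>nat \<lceil>- b\<rceil>. \<bar>S b - S (- real n)\<bar> \<le> 2 * W"
      by (intro allI impI diff_le) linarith
    then have "\<bar>S b - 0\<bar> \<le> 2 * W" by (intro LIMSEQ_le_const2[OF lim]) blast
    then show ?thesis by simp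
  qed
  define \<eta> where "\<eta> = (SUP x. \<bar>H x\<bar>)"
  have bdd: "bdd_above (range (\<lambda>x. \<bar>H x\<bar>))" using H_le_1 by (intro bdd_aboveI[of _ 1]) auto
  have H_le: "\<bar>H x\<bar> \<le> \<eta>" for x unfolding \<eta>_def by (intro cSUP_upper bdd) auto
  have W: "0 \<le> 2 * W" using S_le[of 0] by linarith
  \<comment> \<open>The supremum need not be attained. A point with more than half of it is enough,
    because \<open>\<bar>H\<bar>\<close> then stays below twice its value there.\<close>
  have key: "\<bar>H x\<bar> \<le> 2 / fejer_mass * (2 * W + 96 * A)" if x: "\<bar>H x\<bar> > \<eta> / 2" for x
  proof -
    define h where "h = \<bar>H x\<bar>"
    have h: "0 < h" using x H_le[of x] by (simp add: h_def)
    \<comment> \<open>Over a stretch of length \<open>2 * \<delta>\<close> the Lipschitz bound costs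
      at most \<open>h / 2\<close>.\<close>
    define \<delta> where "\<delta> = h / (4 * A)"
    have \<delta>: "0 < \<delta>" using h \<open>0 < A\<close> by (simp add: \<delta>_def)
    have A\<delta>: "A * (2 * \<delta>) = h / 2" using \<open>0 < A\<close> by (simp add: \<delta>_def)
    \<comment> \<open>The sign tells on which side of \<open>x\<close> the monotonicity of
      \<open>cdf M1\<close> preserves the deviation.\<close>
    define s where "s = sgn (H x)"
    have s: "s = 1 \<or> s = - 1" "s * H x = h" using h by (auto simp: s_def h_def sgn_if)
    have local: "s * H (x + s * \<delta> - u) \<ge> h / 2" if "\<bar>u\<bar> < \<delta>" for u
      using s(1)
    proof
      assume [simp]: "s = 1"
      have "cdf M2 (x + \<delta> - u) - cdf M2 x \<le> A * (\<delta> - u)" using lipschitz[of x "x + \<delta> - u"] that by simp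
      also have "\<dots> \<le> A * (2 * \<delta>)" using that \<open>0 < A\<close> by (intro mult_left_mono) auto
      finally have "cdf M2 (x + \<delta> - u) - cdf M2 x \<le> h / 2" using A\<delta> by simp
      moreover have "cdf M1 x \<le> cdf M1 (x + \<delta> - u)" using that by (intro M1.cdf_nondecreasing) auto
      ultimately show ?thesis using s(2) unfolding H_def \<open>s = 1\<close> mult_1 by linarith
    next
      assume [simp]: "s = - 1"
      have "cdf M2 x - cdf M2 (x - \<delta> - u) \<le> A * (\<delta> + u)" using lipschitz[of "x - \<delta> - u" x] that by simp
      also have "\<dots> \<le> A * (2 * \<delta>)" using that \<open>0 < A\<close> by (intro mult_left_mono) auto
      finally have "cdf M2 x - cdf M2 (x - \<delta> - u) \<le> h / 2" using A\<delta> by simp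
      moreover have "cdf M1 (x - \<delta> - u) \<le> cdf M1 x" using that by (intro M1.cdf_nondecreasing) auto
      ultimately show ?thesis using s(2) unfolding H_def \<open>s = - 1\<close> by simp
    qed
    let ?tail = "\<lambda>u. indicator {u. \<delta> \<le> \<bar>u\<bar>} u * fejer_kernel u"
    have int_tail: "integrable lborel ?tail"
      by (rule Bochner_Integration.integrable_bound[OF fejer_kernel_integrable]) (auto simp: indicator_def)
    \<comment> \<open>\<open>16 * A / h\<close> is the tail bound \<open>4 / \<delta>\<close>. Away
      from the stretch the smoothed function is at least \<open>- 2 * h\<close>, and
      \<open>h / 2 - 3 * h\<close> lies below that.\<close>
    have "h / 2 * fejer_mass - 3 * h * (16 * A / h)
        \<le> h / 2 * fejer_mass - 3 * h * (\<integral>u. ?tail u \<partial>lborel)"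
      using fejer_kernel_tail[OF \<delta>] h by (intro diff_left_mono mult_left_mono) (auto simp: \<delta>_def)
    also have "\<dots> = (\<integral>u. h / 2 * fejer_kernel u - 3 * h * ?tail u \<partial>lborel)"
      using int_tail by (simp add: fejer_mass_def)
    also have "\<dots> \<le> (\<integral>u. s * (fejer_kernel u * H (x + s * \<delta> - u)) \<partial>lborel)"
    proof (rule integral_mono)
      show "integrable lborel (\<lambda>u. h / 2 * fejer_kernel u - 3 * h * ?tail u)" using int_tail by simp
      show "integrable lborel (\<lambda>u. s * (fejer_kernel u * H (x + s * \<delta> - u)))"
        using int_vH by simp
      fix u :: real
      have "h / 2 - 3 * h * indicator {u. \<delta> \<le> \<bar>u\<bar>} u \<le> s * H (x + s * \<delta> - u)"
      proof (cases "\<delta> \<le> \<bar>u\<bar>")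
        case True
        have "\<bar>s * H (x + s * \<delta> - u)\<bar> \<le> \<eta>" using s H_le[of "x + s * \<delta> - u"] by (auto simp: abs_mult)
        then show ?thesis using True x unfolding h_def[symmetric] by simp
      qed (use local in simp)
      then have "(h / 2 - 3 * h * indicator {u. \<delta> \<le> \<bar>u\<bar>} u) * fejer_kernel u \<le> s * H (x + s * \<delta> - u) * fejer_kernel u"
        by (intro mult_right_mono fejer_kernel_nonneg)
      then show "h / 2 * fejer_kernel u - 3 * h * ?tail u \<le> s * (fejer_kernel u * H (x + s * \<delta> - u))"
        by (simp add: algebra_simps)
    qed
    also have "\<dots> = s * S (x + s * \<delta>)" by (simp add: S_def)
    also have "\<dots> \<le> 2 * W" using S_le[of "x + s * \<delta>"] s(1) by auto
    finally have "h / 2 * fejer_mass \<le> 2 * W + 48 * A" using h by simp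
    also have "\<dots> \<le> 2 * W + 96 * A" using \<open>0 < A\<close> by simp
    finally show ?thesis using fejer_mass_pos by (simp add: h_def[symmetric] field_simps)
  qed
  have bound_pos: "0 \<le> 4 / fejer_mass * (2 * W + 96 * A)"
    using W fejer_mass_pos \<open>0 < A\<close> by simp
  show ?thesis
  proof (cases "\<eta> \<le> 0")
    case True
    then have "\<bar>H x\<bar> \<le> 0" using H_le[of x] by linarith
    then show ?thesis using bound_pos unfolding H_def by linarith
  next
    case False
    then obtain y where y: "\<eta> / 2 < \<bar>H y\<bar>"
      using less_cSUP_iff[OF _ bdd, of "\<eta> / 2"] unfolding \<eta>_def[symmetric] by auto
    then have "\<eta> \<le> 2 * (2 / fejer_mass * (2 * W + 96 * A))" using key[OF y] by linarith
    then show ?thesis using H_le[of x] unfolding H_def by simp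
  qed
qed

section \<open>Exponential moments on half lines and the effect of a tilt\<close>

abbreviation "std_normal_cdf \<equiv> cdf std_normal_distribution"

lemma integrable_exp_atMost: "integrable lborel (\<lambda>y::real. indicator {..a} y * exp y)"
  and integral_exp_atMost: "(\<integral>y. indicator {..a} y * exp y \<partial>lborel) = exp (a::real)"
proof -
  have "(\<integral>\<^sup>+y. ennreal (indicator {..a} y * exp y) \<partial>lborel)
      = (\<integral>\<^sup>+y. ennreal (exp (- y)) * indicator {- a..} y \<partial>lborel)"
    by (subst nn_integral_real_affine[where c = "- 1" and t = 0])
       (auto intro!: nn_integral_cong simp: indicator_def)
  also have "\<dots> = ennreal (0 - - exp (- (- a)))"
  proof (rule nn_integral_FTC_atLeast)
    show "((\<lambda>y::real. - exp (- y)) \<longlongrightarrow> 0) at_top" by real_asymp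
  qed (auto intro!: derivative_eq_intros)
  finally have *: "(\<integral>\<^sup>+y. ennreal (indicator {..a} y * exp y) \<partial>lborel) = ennreal (exp a)" by simp
  show "integrable lborel (\<lambda>y::real. indicator {..a} y * exp y)"
    by (rule integrableI_nn_integral_finite[OF _ _ *]) auto
  show "(\<integral>y. indicator {..a} y * exp y \<partial>lborel) = exp (a::real)"
    by (rule integral_eq_nn_integral[OF _ _ , THEN trans]) (auto simp: *)
qed

text \<open>Integration by parts, carried out by Fubini. It expresses the truncated exponential
  moment through the distribution function alone, so uniform closeness of distribution functions can
  be inserted.\<close>

lemma (in real_distribution) integral_exp_atMost_eq:
  "(\<integral>v. indicator {..a} v * exp v \<partial>M)
     = exp a * cdf M a - (\<integral>y. indicator {..a} y * exp y * cdf M y \<partial>lborel)"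
proof -
  interpret L: pair_sigma_finite lborel M ..
  have int_y: "(\<integral>y. indicator {..a} y * exp y * indicator {..y} v \<partial>lborel) = indicator {..a} v * (exp a - exp v)" for v
  proof (cases "v \<le> a")
    case True
    have "(\<integral>y. indicator {..a} y * exp y * indicator {..y} v \<partial>lborel) = (\<integral>y. indicator {v..a} y *\<^sub>R exp y \<partial>lborel)"
      by (intro Bochner_Integration.integral_cong) (auto simp: indicator_def)
    also have "\<dots> = exp a - exp v"
      using True by (intro integral_FTC_Icc)
        (auto intro!: derivative_eq_intros continuous_intros simp: has_real_derivative_iff_has_vector_derivative[symmetric])
    finally show ?thesis using True by simp
  next
    case False
    have "(\<lambda>y. indicator {..a} y * exp y * indicator {..y} v) = (\<lambda>y. 0 :: real)"
      using False by (auto simp: indicator_def)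
    with False show ?thesis by simp
  qed
  have "(\<integral>y. indicator {..a} y * exp y * cdf M y \<partial>lborel)
      = (\<integral>y. (\<integral>v. indicator {..a} y * exp y * indicator {..y} v \<partial>M) \<partial>lborel)"
    by (simp add: cdf_def)
  also have "\<dots> = (\<integral>v. (\<integral>y. indicator {..a} y * exp y * indicator {..y} v \<partial>lborel) \<partial>M)"
  proof (rule L.Fubini_integral[symmetric])
    have "integrable (lborel \<Otimes>\<^sub>M M) (\<lambda>z. indicator {..a} (fst z) * exp (fst z))"
      using prob_space unfolding space_eq_univ
      by (intro L.Fubini_integrable) (auto simp: integrable_exp_atMost abs_mult)
    moreover have "(\<lambda>(y, v). indicator {..a} y * exp y * indicator {..y} v) \<in> borel_measurable (lborel \<Otimes>\<^sub>M M)"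
    proof -
      have "(\<lambda>(y, v). indicator {..a} y * exp y * (if v \<le> y then 1 else 0)) \<in> borel_measurable (lborel \<Otimes>\<^sub>M M)"
        by measurable
      then show ?thesis by (simp add: indicator_def cong: if_cong)
    qed
    ultimately show "integrable (lborel \<Otimes>\<^sub>M M) (\<lambda>(y, v). indicator {..a} y * exp y * indicator {..y} v)"
      by (rule Bochner_Integration.integrable_bound) (auto simp: indicator_def)
  qed
  also have "\<dots> = (\<integral>v. exp a * indicator {..a} v - indicator {..a} v * exp v \<partial>M)"
    by (intro Bochner_Integration.integral_cong refl) (simp only: int_y, simp add: algebra_simps)
  also have "\<dots> = (\<integral>v. exp a * indicator {..a} v \<partial>M) - (\<integral>v. indicator {..a} v * exp v \<partial>M)"
    by (intro Bochner_Integration.integral_diff integrable_const_bound[of _ "exp a"])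
       (auto simp: indicator_def)
  finally show ?thesis by (simp add: cdf_def)
qed

text \<open>Both terms of the integration by parts are linear in the distribution function, and each
  changes by at most \<open>exp a * D\<close>.\<close>

lemma integral_exp_atMost_diff_le:
  assumes "real_distribution M1" "real_distribution M2"
    and "\<And>y. \<bar>cdf M1 y - cdf M2 y\<bar> \<le> D"
  shows "\<bar>(\<integral>v. indicator {..a} v * exp v \<partial>M1) - (\<integral>v. indicator {..a} v * exp v \<partial>M2)\<bar> \<le> 2 * exp a * D"
proof -
  have int: "integrable lborel (\<lambda>y. indicator {..a} y * exp y * cdf M y)" if "real_distribution M" for M
  proof -
    interpret M: real_distribution M by fact
    have [measurable]: "cdf M \<in> borel_measurable borel"
      by (intro borel_measurable_mono monoI M.cdf_nondecreasing)
    show ?thesis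
      by (rule Bochner_Integration.integrable_bound[OF integrable_exp_atMost[of a]])
         (auto simp: indicator_def abs_mult M.cdf_nonneg M.cdf_bounded_prob)
  qed
  let ?f = "\<lambda>M y. indicator {..a} y * exp y * cdf M y"
  have "\<bar>(\<integral>y. ?f M1 y \<partial>lborel) - (\<integral>y. ?f M2 y \<partial>lborel)\<bar> = \<bar>\<integral>y. ?f M1 y - ?f M2 y \<partial>lborel\<bar>"
    using int assms by simp
  also have "\<dots> \<le> (\<integral>y. D * (indicator {..a} y * exp y) \<partial>lborel)"
    unfolding real_norm_def[symmetric]
  proof (rule order_trans[OF integral_norm_bound integral_mono_AE'])
    show "integrable lborel (\<lambda>y. D * (indicator {..a} y * exp y))"
      by (intro integrable_mult_right integrable_exp_atMost)
    have *: "norm (?f M1 y - ?f M2 y) \<le> D * (indicator {..a} y * exp y)" for y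
      using mult_left_mono[OF assms(3)[of y], of "exp y"]
      by (auto simp: indicator_def right_diff_distrib[symmetric] abs_mult mult.commute)
    then show "AE y in lborel. norm (?f M1 y - ?f M2 y) \<le> D * (indicator {..a} y * exp y)" by simp
    show "AE y in lborel. 0 \<le> D * (indicator {..a} y * exp y)"
      using order_trans[OF norm_ge_zero *] by simp
  qed
  also have "\<dots> = exp a * D" by (simp add: integral_exp_atMost)
  finally have "\<bar>(\<integral>y. ?f M1 y \<partial>lborel) - (\<integral>y. ?f M2 y \<partial>lborel)\<bar> \<le> exp a * D" .
  moreover have "\<bar>exp a * cdf M1 a - exp a * cdf M2 a\<bar> \<le> exp a * D"
    using assms(3)[of a] by (simp add: right_diff_distrib[symmetric] abs_mult)
  ultimately show ?thesis
    using real_distribution.integral_exp_atMost_eq[OF assms(1), of a]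
      real_distribution.integral_exp_atMost_eq[OF assms(2), of a] by linarith
qed

lemma std_normal_cdf_eq: "std_normal_cdf x = (\<integral>y. indicator {..x} y * std_normal_density y \<partial>lborel)"
proof -
  interpret real_distribution std_normal_distribution by (rule real_dist_normal_dist)
  have "std_normal_cdf x = (\<integral>y. indicator {..x} y \<partial>std_normal_distribution)"
    by (simp add: cdf_def)
  also have "\<dots> = (\<integral>y. std_normal_density y *\<^sub>R indicator {..x} y \<partial>lborel)"
    by (rule integral_density) auto
  finally show ?thesis by (simp add: mult.commute)
qed

text \<open>Completing the square: the factor \<open>exp v\<close> shifts the normal density by
  \<open>1\<close> and multiplies it by \<open>exp (1 / 2)\<close>.\<close>

lemma std_normal_tilt:
  "(\<integral>v. indicator {..a} v * exp v \<partial>std_normal_distribution) = exp (1 / 2) * std_normal_cdf (a - 1)"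
proof -
  have "(\<integral>v. indicator {..a} v * exp v \<partial>std_normal_distribution)
      = (\<integral>v. std_normal_density v *\<^sub>R (indicator {..a} v * exp v) \<partial>lborel)"
    by (rule integral_density) auto
  also have "\<dots> = (\<integral>y. std_normal_density (y + 1) * (indicator {..a} (y + 1) * exp (y + 1)) \<partial>lborel)"
    by (subst lborel_integral_real_affine[where c = 1 and t = 1]) (auto simp: add.commute)
  also have "\<dots> = (\<integral>y. exp (1 / 2) * (indicator {..a - 1} y * std_normal_density y) \<partial>lborel)"
  proof (rule Bochner_Integration.integral_cong[OF refl])
    fix y :: real
    have "exp (- (y + 1)\<^sup>2 / 2) * exp (y + 1) = exp (1 / 2) * exp (- y\<^sup>2 / 2)"
      unfolding exp_add[symmetric] by (simp add: power2_eq_square field_simps)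
    then have "std_normal_density (y + 1) * exp (y + 1) = exp (1 / 2) * std_normal_density y"
      by (simp add: std_normal_density_def field_simps)
    then show "std_normal_density (y + 1) * (indicator {..a} (y + 1) * exp (y + 1))
        = exp (1 / 2) * (indicator {..a - 1} y * std_normal_density y)"
      by (auto simp: indicator_def)
  qed
  also have "\<dots> = exp (1 / 2) * std_normal_cdf (a - 1)" by (simp add: std_normal_cdf_eq)
  finally show ?thesis .
qed

lemma std_normal_density_le_1: "std_normal_density x \<le> 1"
proof -
  have "1 \<le> sqrt (2 * pi)" using pi_gt3 by simp
  then have "1 / sqrt (2 * pi) * exp (- x\<^sup>2 / 2) \<le> 1 * 1"
    by (intro mult_mono) auto
  then show ?thesis by (simp add: std_normal_density_def)
qed

lemma std_normal_cdf_lipschitz: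
  assumes "x \<le> y"
  shows "std_normal_cdf y - std_normal_cdf x \<le> 1 * (y - x)"
proof (cases "x = y")
  case False
  interpret real_distribution std_normal_distribution by (rule real_dist_normal_dist)
  have "std_normal_cdf y - std_normal_cdf x = measure std_normal_distribution {x<..y}"
    using assms False by (intro cdf_diff_eq) auto
  also have "\<dots> = (\<integral>z. indicator {x<..y} z \<partial>std_normal_distribution)" by simp
  also have "\<dots> = (\<integral>z. std_normal_density z *\<^sub>R indicator {x<..y} z \<partial>lborel)"
    by (rule integral_density) auto
  also have "\<dots> \<le> (\<integral>z. indicator {x<..y} z \<partial>lborel)"
    using assms by (intro integral_mono') (auto simp: std_normal_density_le_1 split: split_indicator)
  also have "\<dots> = y - x" using assms by simp
  finally show ?thesis by simp
qed simp

text \<open>Exponential tilting by \<open>- 1\<close>, recentred: for the standard normal law the result is the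
  standard normal law again.\<close>

definition tilted :: "real measure \<Rightarrow> real measure" where
  "tilted Q = distr (density Q (\<lambda>y. ennreal (exp (- y) / (\<integral>v. exp (- v) \<partial>Q)))) borel (\<lambda>y. y + 1)"

context real_distribution
begin

text \<open>The second conclusion undoes the tilt, since \<open>exp (- y)\<close> and
  \<open>exp (y + 1)\<close> cancel to a constant. By the third, the characteristic function of the
  tilted law is the transform of \<open>M\<close> along the vertical line through
  \<open>- 1\<close>, normalised there and with a phase from the recentring.\<close>

lemma tilted:
  assumes int: "integrable M (\<lambda>y. exp (- y))"
  shows real_distribution_tilted: "real_distribution (tilted M)"
    and integral_exp_tilted: "(\<integral>v. indicator {..x + 1} v * exp v \<partial>tilted M) = exp 1 / (\<integral>v. exp (- v) \<partial>M) * cdf M x"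
    and char_tilted: "char (tilted M) t = iexp t * (\<integral>y. exp ((\<i> * t - 1) * y) \<partial>M) / (\<integral>v. exp (- v) \<partial>M)"
proof -
  define m where "m = (\<integral>v. exp (- v) \<partial>M)"
  have m: "0 < m"
  proof -
    have "m \<noteq> 0"
      unfolding m_def using int by (subst integral_nonneg_eq_0_iff_AE) (auto simp: AE_const)
    moreover have "0 \<le> m" unfolding m_def by (intro integral_nonneg_AE) auto
    ultimately show ?thesis by linarith
  qed
  have tilted_eq: "tilted M = distr (density M (\<lambda>y. ennreal (exp (- y) / m))) borel (\<lambda>y. y + 1)"
    by (simp add: tilted_def m_def)
  have "prob_space (density M (\<lambda>y. ennreal (exp (- y) / m)))"
  proof (rule prob_spaceI)
    have "(\<integral>\<^sup>+y. ennreal (exp (- y) / m) \<partial>M) = ennreal (\<integral>y. exp (- y) / m \<partial>M)"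
      using int m by (intro nn_integral_eq_integral) auto
    also have "(\<integral>y. exp (- y) / m \<partial>M) = 1" using m by (simp add: m_def)
    finally show "emeasure (density M (\<lambda>y. ennreal (exp (- y) / m))) (space (density M (\<lambda>y. ennreal (exp (- y) / m)))) = 1"
      by (simp add: emeasure_density cong: nn_integral_cong_simp)
  qed
  then have "prob_space (tilted M)" unfolding tilted_eq by (rule prob_space.prob_space_distr) simp
  then show "real_distribution (tilted M)"
    by (simp add: real_distribution_def real_distribution_axioms_def tilted_eq)
  show "(\<integral>v. indicator {..x + 1} v * exp v \<partial>tilted M) = exp 1 / (\<integral>v. exp (- v) \<partial>M) * cdf M x"
  proof -
    have "(\<integral>v. indicator {..x + 1} v * exp v \<partial>tilted M) = (\<integral>y. indicator {..x + 1} (y + 1) * exp (y + 1) \<partial>density M (\<lambda>y. ennreal (exp (- y) / m)))"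
      unfolding tilted_eq by (rule integral_distr) auto
    also have "\<dots> = (\<integral>y. (exp (- y) / m) *\<^sub>R (indicator {..x + 1} (y + 1) * exp (y + 1)) \<partial>M)"
      using m by (intro integral_density) auto
    also have "\<dots> = (\<integral>y. exp 1 / m * indicator {..x} y \<partial>M)"
      by (intro Bochner_Integration.integral_cong refl) (auto simp: indicator_def exp_add exp_minus)
    also have "\<dots> = exp 1 / m * cdf M x" by (simp add: cdf_def)
    finally show ?thesis by (simp add: m_def)
  qed
  show "char (tilted M) t = iexp t * (\<integral>y. exp ((\<i> * t - 1) * y) \<partial>M) / (\<integral>v. exp (- v) \<partial>M)"
  proof -
    have "char (tilted M) t = (\<integral>y. iexp (t * (y + 1)) \<partial>density M (\<lambda>y. ennreal (exp (- y) / m)))"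
      unfolding tilted_eq char_def by (rule integral_distr) auto
    also have "\<dots> = (\<integral>y. (exp (- y) / m) *\<^sub>R iexp (t * (y + 1)) \<partial>M)"
      using m by (intro integral_density) auto
    also have "\<dots> = (\<integral>y. iexp t / of_real m * exp ((\<i> * t - 1) * y) \<partial>M)"
    proof (intro Bochner_Integration.integral_cong refl)
      fix y
      have "exp ((\<i> * t - 1) * y) * iexp t = complex_of_real (exp (- y)) * iexp (t * (y + 1))"
        unfolding exp_of_real[symmetric] exp_add[symmetric] by (simp add: algebra_simps)
      then show "(exp (- y) / m) *\<^sub>R iexp (t * (y + 1)) = iexp t / of_real m * exp ((\<i> * t - 1) * y)"
        using m by (simp add: scaleR_conv_of_real field_simps)
    qed
    also have "\<dots> = iexp t * (\<integral>y. exp ((\<i> * t - 1) * y) \<partial>M) / (\<integral>v. exp (- v) \<partial>M)"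
      by (simp add: m_def)
    finally show ?thesis .
  qed
qed

end

section \<open>Weighted normal approximation\<close>

lemma norm_exp_minus_one_le: "norm (exp u - 1) \<le> norm u * exp (norm u)" for u :: complex
proof -
  have "norm (exp u - exp 0) \<le> exp (norm u) * norm (u - 0)"
  proof (rule field_differentiable_bound[where S = "cball 0 (norm u)"])
    fix z :: complex assume "z \<in> cball 0 (norm u)"
    then show "norm (exp z) \<le> exp (norm u)"
      using complex_Re_le_cmod[of z] by simp
  qed (auto intro!: derivative_eq_intros)
  then show ?thesis by (simp add: mult.commute)
qed

text \<open>With \<open>a = t\<^sup>2 / 4\<close> this compares \<open>(1 + 4 * a)\<^sup>2\<close>
  with \<open>64\<close> times the quadratic Taylor polynomial of \<open>exp a\<close>. The form of
  the right-hand side is chosen because its rescaled integral over the unit interval is an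
  arctangent, bounded independently of the scale.\<close>

lemma one_plus_square_exp_le: "(1 + t\<^sup>2) * exp (- (t\<^sup>2 / 4)) \<le> 64 * inverse (1 + t\<^sup>2)" for t :: real
proof -
  define a where "a = t\<^sup>2 / 4"
  have a: "0 \<le> a" "t\<^sup>2 = 4 * a" by (auto simp: a_def)
  have "(1 + 4 * a)\<^sup>2 \<le> 64 * (1 + a + a\<^sup>2 / 2)" using a(1) by (simp add: power2_eq_square algebra_simps)
  also have "\<dots> \<le> 64 * exp a" using exp_lower_Taylor_quadratic[OF a(1)] by simp
  finally have "(1 + 4 * a) * (1 + 4 * a) \<le> 64 * exp a" by (simp add: power2_eq_square)
  moreover have "0 < 1 + 4 * a" using a by simp
  ultimately show ?thesis by (simp add: a(2) exp_minus field_simps)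
qed

lemma integral_unit_arctan_le:
  assumes "0 < T"
  shows "integrable unit_interval_measure (\<lambda>\<tau>. T * inverse (1 + (T * \<tau>)\<^sup>2))"
    and "(\<integral>\<tau>. T * inverse (1 + (T * \<tau>)\<^sup>2) \<partial>unit_interval_measure) \<le> 2"
proof -
  have *: "1 + (T * x)\<^sup>2 \<noteq> 0" for x
    by (metis add_nonneg_eq_0_iff zero_le_one zero_le_power2 zero_neq_one)
  have cont: "continuous_on {0..1} (\<lambda>\<tau>. T * inverse (1 + (T * \<tau>)\<^sup>2))"
    using * by (auto intro!: continuous_intros)
  have "integrable lborel (\<lambda>\<tau>. indicator {0..1} \<tau> *\<^sub>R (T * inverse (1 + (T * \<tau>)\<^sup>2)))"
    using borel_integrable_atLeastAtMost'[OF cont] by (simp add: set_integrable_def)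
  then show "integrable unit_interval_measure (\<lambda>\<tau>. T * inverse (1 + (T * \<tau>)\<^sup>2))"
    by (subst integrable_restrict_space) auto
  have "(\<integral>\<tau>. indicator {0..1} \<tau> *\<^sub>R (T * inverse (1 + (T * \<tau>)\<^sup>2)) \<partial>lborel) = arctan (T * 1) - arctan (T * 0)"
    by (rule integral_FTC_Icc[OF _ _ cont])
       (auto intro!: derivative_eq_intros simp: has_real_derivative_iff_has_vector_derivative[symmetric])
  also have "\<dots> \<le> 2" using arctan_ubound[of T] pi_less_4 by simp
  finally show "(\<integral>\<tau>. T * inverse (1 + (T * \<tau>)\<^sup>2) \<partial>unit_interval_measure) \<le> 2"
    by (subst integral_restrict_space) auto
qed

text \<open>Dilating both laws by \<open>T\<close> moves the frequencies up to \<open>T\<close> into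
  the unit interval and turns the Lipschitz constant \<open>1\<close> of the normal distribution
  function into \<open>1 / T\<close>. The weight integrates to at most \<open>2 * c\<close> for
  every \<open>T\<close>.\<close>

lemma smoothing_inequality_scaled:
  assumes M1: "real_distribution M1" and "0 < T" "0 \<le> c"
    and char: "\<And>t. 0 < t \<Longrightarrow> t \<le> T \<Longrightarrow> cmod (char M1 t - char std_normal_distribution t) \<le> c * t * inverse (1 + t\<^sup>2)"
  shows "\<bar>cdf M1 x - std_normal_cdf x\<bar> \<le> 4 / fejer_mass * (4 * c + 96 / T)"
proof -
  interpret M1: real_distribution M1 by fact
  interpret N: real_distribution std_normal_distribution by (rule real_dist_normal_dist)
  let ?S = "\<lambda>M. distr M borel ((*) T)"
  have rd: "real_distribution (?S M)" if "real_distribution M" for M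
  proof -
    interpret M: real_distribution M by fact
    show ?thesis
      by (simp add: real_distribution_def real_distribution_axioms_def M.prob_space_distr)
  qed
  have cdf: "cdf (?S M) x = cdf M (x / T)" if "real_distribution M" for M x
  proof -
    interpret M: real_distribution M by fact
    have "(*) T -` {..x} = {..x / T}" using \<open>0 < T\<close> by (auto simp: field_simps)
    then show ?thesis by (simp add: cdf_def measure_distr)
  qed
  have chars: "char (?S M) t = char M (t * T)" if "real_distribution M" for M t
  proof -
    interpret M: real_distribution M by fact
    show ?thesis by (simp add: char_def integral_distr mult_ac)
  qed
  have "\<bar>cdf (?S M1) (T * x) - cdf (?S std_normal_distribution) (T * x)\<bar> \<le> 4 / fejer_mass * (2 * (2 * c) + 96 * (1 / T))"
  proof (rule smoothing_inequality[where w = "\<lambda>\<tau>. c * (T * inverse (1 + (T * \<tau>)\<^sup>2))"])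
    show "real_distribution (?S M1)" "real_distribution (?S std_normal_distribution)"
      by (intro rd M1 real_dist_normal_dist)+
    show "0 < 1 / T" using \<open>0 < T\<close> by simp
    show "cdf (?S std_normal_distribution) y - cdf (?S std_normal_distribution) x \<le> 1 / T * (y - x)" if "x \<le> y" for x y
      using std_normal_cdf_lipschitz[of "x / T" "y / T"] that \<open>0 < T\<close>
      by (simp add: cdf real_dist_normal_dist divide_right_mono diff_divide_distrib)
    show "integrable unit_interval_measure (\<lambda>\<tau>. c * (T * inverse (1 + (T * \<tau>)\<^sup>2)))"
      by (intro integrable_mult_right integral_unit_arctan_le \<open>0 < T\<close>)
    have "(\<integral>\<tau>. c * (T * inverse (1 + (T * \<tau>)\<^sup>2)) \<partial>unit_interval_measure)
      = c * (\<integral>\<tau>. T * inverse (1 + (T * \<tau>)\<^sup>2) \<partial>unit_interval_measure)"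
      by (rule integral_mult_right_zero)
    also have "\<dots> \<le> c * 2"
      by (intro mult_left_mono integral_unit_arctan_le \<open>0 < T\<close> \<open>0 \<le> c\<close>)
    finally show "(\<integral>\<tau>. c * (T * inverse (1 + (T * \<tau>)\<^sup>2)) \<partial>unit_interval_measure) \<le> 2 * c" by simp
    fix t :: real assume t: "0 < t" "t \<le> 1"
    then have "cmod (char M1 (t * T) - char std_normal_distribution (t * T)) \<le> c * (t * T) * inverse (1 + (t * T)\<^sup>2)"
      using \<open>0 < T\<close> by (intro char) (auto intro: mult_le_cancel_right1[THEN iffD2])
    then show "cmod (char (?S M1) t - char (?S std_normal_distribution) t) \<le> t * (c * (T * inverse (1 + (T * t)\<^sup>2)))"
      by (simp add: chars M1 real_dist_normal_dist mult_ac)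
  qed
  then show ?thesis using \<open>0 < T\<close> by (simp add: cdf M1 real_dist_normal_dist)
qed

text \<open>\<open>\<kappa>\<close> is the logarithm of the transform without its Gaussian part, and
  \<open>s\<close> stands for the standard deviation before normalisation. The bound is put on
  \<open>deriv \<kappa>\<close> because increments of \<open>\<kappa>\<close> along vertical
  segments are needed with a factor equal to their length, as the smoothing inequality asks for a
  factor \<open>t\<close>.\<close>

definition near_gaussian :: "real \<Rightarrow> real \<Rightarrow> real \<Rightarrow> real measure \<Rightarrow> bool" where
  "near_gaussian \<rho> C s Q \<longleftrightarrow> real_distribution Q \<and> 0 < s \<and>
     (\<exists>\<kappa>. \<kappa> holomorphic_on ball 0 (\<rho> * s) \<and> \<kappa> 0 = 0 \<and>
        (\<forall>w\<in>ball 0 (\<rho> * s). cmod (deriv \<kappa> w) \<le> C * (cmod w)\<^sup>2 / s \<and>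
           integrable Q (\<lambda>y. exp (w * y)) \<and> (\<integral>y. exp (w * y) \<partial>Q) = exp (w\<^sup>2 / 2 + \<kappa> w)))"

lemma near_gaussian_uminus:
  assumes "near_gaussian \<rho> C s Q"
  shows "near_gaussian \<rho> C s (distr Q borel uminus)"
proof -
  from assms obtain \<kappa> where Q: "real_distribution Q" "0 < s" and \<kappa>: "\<kappa> holomorphic_on ball 0 (\<rho> * s)" "\<kappa> 0 = 0"
    "\<And>w. w \<in> ball 0 (\<rho> * s) \<Longrightarrow> cmod (deriv \<kappa> w) \<le> C * (cmod w)\<^sup>2 / s \<and>
           integrable Q (\<lambda>y. exp (w * y)) \<and> (\<integral>y. exp (w * y) \<partial>Q) = exp (w\<^sup>2 / 2 + \<kappa> w)"
    unfolding near_gaussian_def by blast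
  interpret Q: real_distribution Q by fact
  have minus: "- w \<in> ball 0 (\<rho> * s)" if "w \<in> ball 0 (\<rho> * s)" for w :: complex using that by simp
  have deriv_minus: "deriv (\<lambda>w. \<kappa> (- w)) w = - deriv \<kappa> (- w)" if "w \<in> ball 0 (\<rho> * s)" for w
  proof (rule DERIV_imp_deriv)
    have "(\<kappa> has_field_derivative deriv \<kappa> (- w)) (at (- w))"
      using \<kappa>(1) minus[OF that] by (intro holomorphic_derivI[of _ "ball 0 (\<rho> * s)"]) auto
    then show "((\<lambda>w. \<kappa> (- w)) has_field_derivative - deriv \<kappa> (- w)) (at w)"
      using DERIV_chain2[of \<kappa> "deriv \<kappa> (- w)" "\<lambda>w. - w" w "- 1" UNIV] by (simp add: DERIV_minus[OF DERIV_ident])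
  qed
  have "(\<lambda>w. \<kappa> (- w)) holomorphic_on ball 0 (\<rho> * s)"
    using holomorphic_on_compose_gen[OF holomorphic_on_minus[OF holomorphic_on_ident] \<kappa>(1), of "ball 0 (\<rho> * s)"]
    by (force simp: o_def)
  moreover have "real_distribution (distr Q borel uminus)"
    by (simp add: real_distribution_def real_distribution_axioms_def Q.prob_space_distr)
  moreover have "cmod (deriv (\<lambda>w. \<kappa> (- w)) w) \<le> C * (cmod w)\<^sup>2 / s \<and>
           integrable (distr Q borel uminus) (\<lambda>y. exp (w * y)) \<and>
           (\<integral>y. exp (w * y) \<partial>distr Q borel uminus) = exp (w\<^sup>2 / 2 + \<kappa> (- w))"
    if w: "w \<in> ball 0 (\<rho> * s)" for w
    using \<kappa>(3)[OF minus[OF w]] by (simp add: deriv_minus[OF w] integrable_distr_eq integral_distr)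
  ultimately show ?thesis unfolding near_gaussian_def using Q \<kappa>(2) by (auto intro!: exI[of _ "\<lambda>w. \<kappa> (- w)"])
qed

context
  fixes \<rho> C :: real
  assumes \<rho>: "0 < \<rho>" and C: "0 \<le> C"
begin

text \<open>The tilted law has the normal characteristic function times \<open>exp\<close> of an
  increment of \<open>\<kappa>\<close> of size \<open>O(t * (1 + t\<^sup>2) / s)\<close>, so
  smoothing gives it an error \<open>O(1 / s)\<close>. Undoing the tilt multiplies the error by
  \<open>exp x\<close>, which is a gain on the left half line.\<close>

lemma near_gaussian_cdf_nonpos:
  obtains D s0 where "0 \<le> D" "0 < s0"
    "\<And>Q s x. near_gaussian \<rho> C s Q \<Longrightarrow> s0 \<le> s \<Longrightarrow> \<bar>cdf Q x - std_normal_cdf x\<bar> \<le> D / s * exp x"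
proof
  \<comment> \<open>Frequencies up to \<open>\<epsilon> * s\<close> are used. The first bound keeps
    \<open>\<i> t - 1\<close> inside the disc; the second makes the perturbation of the exponent at
    most \<open>(1 + t\<^sup>2) / 4\<close>, so half of the Gaussian decay survives.\<close>
  define \<epsilon> where "\<epsilon> = min (\<rho> / 2) (1 / (4 * C + 4))"
  have \<epsilon>: "0 < \<epsilon>" "\<epsilon> \<le> \<rho> / 2" "C * \<epsilon> \<le> 1 / 4"
  proof -
    show "0 < \<epsilon>" "\<epsilon> \<le> \<rho> / 2" using \<rho> C by (auto simp: \<epsilon>_def)
    have "C * \<epsilon> \<le> C * (1 / (4 * C + 4))" using C by (intro mult_left_mono) (auto simp: \<epsilon>_def)
    also have "\<dots> \<le> 1 / 4" using C by (simp add: field_simps)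
    finally show "C * \<epsilon> \<le> 1 / 4" .
  qed
  \<comment> \<open>From \<open>s0\<close> on, \<open>\<rho> * s \<ge> 3\<close> puts the closed
    unit disc and the points \<open>\<i> t - 1\<close> into the domain, and \<open>C \<le> s\<close>
    bounds \<open>\<kappa> (- 1)\<close> by \<open>1\<close>.\<close>
  define s0 where "s0 = max (max 1 (3 / \<rho>)) C"
  \<comment> \<open>\<open>128\<close> is the \<open>64\<close> from the comparison with
    \<open>inverse (1 + t\<^sup>2)\<close> times the bound \<open>2\<close> for
    \<open>exp (1 / 4)\<close>.\<close>
  define D1 where "D1 = 4 / fejer_mass * (4 * (128 * C) + 96 / \<epsilon>)"
  define D where "D = exp 1 * exp 1 * C + 2 * exp 1 * exp 1 * D1"
  have D1: "0 \<le> D1" using C \<epsilon> fejer_mass_pos by (auto simp: D1_def intro!: mult_nonneg_nonneg)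
  show "0 \<le> D" "0 < s0" using C D1 by (auto simp: D_def s0_def)
  fix Q and s x :: real assume ng: "near_gaussian \<rho> C s Q" and s: "s0 \<le> s"
  then obtain \<kappa> :: "complex \<Rightarrow> complex" where Q: "real_distribution Q" and \<kappa>: "\<kappa> holomorphic_on ball 0 (\<rho> * s)" "\<kappa> 0 = 0"
    "\<And>w. w \<in> ball 0 (\<rho> * s) \<Longrightarrow> cmod (deriv \<kappa> w) \<le> C * (cmod w)\<^sup>2 / s"
    "\<And>w :: complex. w \<in> ball 0 (\<rho> * s) \<Longrightarrow> integrable Q (\<lambda>y. exp (w * y))"
    "\<And>w :: complex. w \<in> ball 0 (\<rho> * s) \<Longrightarrow> (\<integral>y. exp (w * y) \<partial>Q) = exp (w\<^sup>2 / 2 + \<kappa> w)"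
    unfolding near_gaussian_def by blast
  interpret Q: real_distribution Q by fact
  interpret N: real_distribution std_normal_distribution by (rule real_dist_normal_dist)
  have s1: "1 \<le> s" "3 / \<rho> \<le> s" "C \<le> s" using s by (auto simp: s0_def)
  have \<rho>s: "3 \<le> \<rho> * s" using s1(2) \<rho> by (simp add: field_simps)
  have in_ball: "\<i> * of_real t - 1 \<in> ball 0 (\<rho> * s)" if "\<bar>t\<bar> \<le> \<epsilon> * s" for t :: real
  proof -
    have "cmod (\<i> * of_real t - 1) \<le> \<bar>t\<bar> + 1" using norm_triangle_ineq4[of "\<i> * of_real t" 1] by (simp add: norm_mult)
    also have "\<dots> \<le> \<rho> / 2 * s + 1"
      using that mult_right_mono[OF \<epsilon>(2), of s] s1 by linarith
    also have "\<dots> < \<rho> * s" using \<rho>s by simp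
    finally show ?thesis by simp
  qed
  have m1_ball: "(- 1 :: complex) \<in> ball 0 (\<rho> * s)" using \<rho>s by simp
  define m where "m = (\<integral>y. exp (- y) \<partial>Q)"
  have int_exp: "integrable Q (\<lambda>y. exp (- y))"
  proof -
    have "integrable Q (\<lambda>y. Re (exp (- 1 * complex_of_real y)))" by (rule integrable_Re) (rule \<kappa>(4)[OF m1_ball])
    then show ?thesis by (simp add: Re_exp)
  qed
  have m_eq: "complex_of_real m = exp (1 / 2 + \<kappa> (- 1))"
  proof -
    have "complex_of_real m = (\<integral>y. exp (- 1 * complex_of_real y) \<partial>Q)"
      unfolding m_def by (subst integral_complex_of_real[symmetric]) (simp add: exp_of_real[symmetric])
    then show ?thesis using \<kappa>(5)[OF m1_ball] by simp
  qed
  have \<kappa>_m1: "cmod (\<kappa> (- 1)) \<le> C / s"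
  proof -
    have "cmod (\<kappa> (- 1) - \<kappa> 0) \<le> C / s * cmod (- 1 - 0)"
    proof (rule field_differentiable_bound[where S = "cball 0 1"])
      fix z :: complex assume z: "z \<in> cball 0 1"
      then have zb: "z \<in> ball 0 (\<rho> * s)" using \<rho>s by simp
      show "(\<kappa> has_field_derivative deriv \<kappa> z) (at z within cball 0 1)"
        using \<kappa>(1) zb by (auto intro: holomorphic_derivI has_field_derivative_at_within)
      have "C * (cmod z)\<^sup>2 \<le> C * 1" using z C by (intro mult_left_mono) (auto simp: power_le_one)
      then have "C * (cmod z)\<^sup>2 / s \<le> C / s" using s1 by (intro divide_right_mono) auto
      then show "cmod (deriv \<kappa> z) \<le> C / s" using \<kappa>(3)[OF zb] by linarith
    qed auto
    then show ?thesis using \<kappa>(2) by simp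
  qed
  have Cs: "0 \<le> C / s" "C / s \<le> 1" using s1 C by auto
  have m_diff: "\<bar>m - exp (1 / 2)\<bar> \<le> exp 1 * exp 1 * (C / s)"
  proof -
    have "\<bar>m - exp (1 / 2)\<bar> = cmod (complex_of_real m - of_real (exp (1 / 2)))"
      by (simp only: of_real_diff[symmetric] norm_of_real)
    also have "complex_of_real m - of_real (exp (1 / 2)) = of_real (exp (1 / 2)) * (exp (\<kappa> (- 1)) - 1)"
      unfolding m_eq exp_add by (simp add: exp_of_real[symmetric] algebra_simps)
    also have "cmod \<dots> \<le> exp (1 / 2) * (cmod (\<kappa> (- 1)) * exp (cmod (\<kappa> (- 1))))"
      unfolding norm_mult by (simp add: norm_exp_minus_one_le)
    also have "\<dots> \<le> exp 1 * (C / s * exp 1)"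
      using \<kappa>_m1 Cs by (intro mult_mono) auto
    finally show ?thesis by (simp add: mult_ac)
  qed
  have m_le: "m \<le> exp 1 * exp 1"
  proof -
    have "m = cmod (exp (1 / 2 + \<kappa> (- 1)))"
      using m_eq norm_of_real[of m, where 'a = complex] by (simp add: m_def)
    also have "\<dots> \<le> exp (1 + 1)"
      using \<kappa>_m1 Cs abs_Re_le_cmod[of "\<kappa> (- 1)"] by simp
    finally show ?thesis by (simp only: exp_add)
  qed
  have m_pos: "0 < m"
  proof -
    have "m \<noteq> 0" using m_eq by (metis exp_not_eq_zero of_real_0)
    moreover have "0 \<le> m" unfolding m_def by (intro integral_nonneg_AE) auto
    ultimately show ?thesis by simp
  qed
  interpret R: real_distribution "tilted Q" by (rule Q.real_distribution_tilted[OF int_exp])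
  have char_R: "char (tilted Q) t = exp (- (t\<^sup>2 / 2)) * exp (\<kappa> (\<i> * t - 1) - \<kappa> (- 1))" if "\<bar>t\<bar> \<le> \<epsilon> * s" for t
  proof -
    have "char (tilted Q) t = iexp t * exp ((\<i> * t - 1)\<^sup>2 / 2 + \<kappa> (\<i> * t - 1)) / exp (1 / 2 + \<kappa> (- 1))"
      using Q.char_tilted[OF int_exp, of t] \<kappa>(5)[OF in_ball[OF that]] m_eq by (simp add: m_def)
    also have "\<dots> = exp (\<i> * t + ((\<i> * t - 1)\<^sup>2 / 2 + \<kappa> (\<i> * t - 1)) - (1 / 2 + \<kappa> (- 1)))"
      by (simp add: exp_diff exp_add)
    also have "\<i> * t + ((\<i> * t - 1)\<^sup>2 / 2 + \<kappa> (\<i> * t - 1)) - (1 / 2 + \<kappa> (- 1))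
        = - (t\<^sup>2 / 2) + (\<kappa> (\<i> * t - 1) - \<kappa> (- 1))"
      by (simp add: power2_eq_square field_simps)
    finally show ?thesis by (simp add: exp_add[symmetric] exp_of_real[symmetric])
  qed
  have R_diff: "\<bar>cdf (tilted Q) y - std_normal_cdf y\<bar> \<le> D1 / s" for y
  proof -
    have "\<bar>cdf (tilted Q) y - std_normal_cdf y\<bar> \<le> 4 / fejer_mass * (4 * (128 * C / s) + 96 / (\<epsilon> * s))"
    proof (rule smoothing_inequality_scaled)
      show "real_distribution (tilted Q)" by unfold_locales
      show "0 < \<epsilon> * s" "0 \<le> 128 * C / s" using \<epsilon> s1 C by auto
      fix t assume t: "0 < t" "t \<le> \<epsilon> * s"
      then have t': "\<bar>t\<bar> \<le> \<epsilon> * s" by simp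
      define u where "u = \<kappa> (\<i> * t - 1) - \<kappa> (- 1)"
      have seg: "\<i> * of_real \<tau> - 1 \<in> ball 0 (\<rho> * s)" if "0 \<le> \<tau>" "\<tau> \<le> t" for \<tau>
        using that t by (intro in_ball) auto
      have u_le: "cmod u \<le> C * (1 + t\<^sup>2) / s * t"
      proof -
        have "cmod (\<kappa> (\<i> * t - 1) - \<kappa> (- 1)) \<le> C * (1 + t\<^sup>2) / s * cmod ((\<i> * t - 1) - (- 1))"
        proof (rule field_differentiable_bound[where S = "closed_segment (- 1) (\<i> * t - 1)"])
          fix z assume "z \<in> closed_segment (- 1) (\<i> * of_real t - 1)"
          then obtain v where v: "0 \<le> v" "v \<le> 1" "z = \<i> * of_real (v * t) - 1"
            by (auto simp: closed_segment_def scaleR_conv_of_real algebra_simps)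
          have vt: "0 \<le> v * t" "v * t \<le> t" using v t by (auto simp: mult_le_cancel_right1)
          have zb: "z \<in> ball 0 (\<rho> * s)" unfolding v(3) by (rule seg) (use vt in auto)
          show "(\<kappa> has_field_derivative deriv \<kappa> z) (at z within closed_segment (- 1) (\<i> * of_real t - 1))"
            using \<kappa>(1) zb by (auto intro: holomorphic_derivI has_field_derivative_at_within)
          have "(cmod z)\<^sup>2 = 1 + (v * t)\<^sup>2" unfolding v(3) by (simp add: cmod_power2)
          also have "\<dots> \<le> 1 + t\<^sup>2" using vt by (simp add: power_mono)
          finally have "C * (cmod z)\<^sup>2 / s \<le> C * (1 + t\<^sup>2) / s"
            using C s1 by (intro divide_right_mono mult_left_mono) auto
          then show "cmod (deriv \<kappa> z) \<le> C * (1 + t\<^sup>2) / s" using \<kappa>(3)[OF zb] by linarith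
        qed auto
        then show ?thesis using t by (simp add: u_def norm_mult)
      qed
      have u_le2: "cmod u \<le> 1 / 4 + t\<^sup>2 / 4"
      proof -
        have "C * (1 + t\<^sup>2) / s * t \<le> C * (1 + t\<^sup>2) / s * (\<epsilon> * s)"
          using t C s1 by (intro mult_left_mono) auto
        also have "\<dots> = (C * \<epsilon>) * (1 + t\<^sup>2)" using s1 by simp
        also have "\<dots> \<le> 1 / 4 * (1 + t\<^sup>2)" using \<epsilon>(3) by (intro mult_right_mono) auto
        finally show ?thesis using u_le by (simp add: algebra_simps)
      qed
      have "cmod (char (tilted Q) t - char std_normal_distribution t) = cmod (of_real (exp (- (t\<^sup>2 / 2))) * (exp u - 1))"
        by (simp only: char_R[OF t'] char_std_normal_distribution u_def[symmetric])
           (simp add: right_diff_distrib exp_of_real[symmetric])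
      also have "\<dots> = exp (- (t\<^sup>2 / 2)) * cmod (exp u - 1)" by (simp add: norm_mult)
      also have "\<dots> \<le> exp (- (t\<^sup>2 / 2)) * (cmod u * exp (cmod u))"
        by (intro mult_left_mono norm_exp_minus_one_le) auto
      also have "\<dots> \<le> exp (- (t\<^sup>2 / 2)) * ((C * (1 + t\<^sup>2) / s * t) * exp (1 / 4 + t\<^sup>2 / 4))"
        using u_le u_le2 C s1 t by (intro mult_left_mono mult_mono) auto
      also have "\<dots> = exp (1 / 4) * (C * t / s) * ((1 + t\<^sup>2) * (exp (- (t\<^sup>2 / 2)) * exp (t\<^sup>2 / 4)))"
        by (simp add: exp_add mult_ac)
      also have "exp (- (t\<^sup>2 / 2)) * exp (t\<^sup>2 / 4) = exp (- (t\<^sup>2 / 4))"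
        by (simp add: exp_add[symmetric] field_simps)
      also have "exp (1 / 4) * (C * t / s) * ((1 + t\<^sup>2) * exp (- (t\<^sup>2 / 4))) \<le> 2 * (C * t / s) * (64 * inverse (1 + t\<^sup>2))"
      proof (rule mult_mono[OF _ one_plus_square_exp_le])
        have "exp (1 / 4 :: real) \<le> 2" using exp_bound[of "1 / 4 :: real"] by (simp add: power2_eq_square)
        then show "exp (1 / 4) * (C * t / s) \<le> 2 * (C * t / s)" using C s1 t by (intro mult_right_mono) auto
      qed (use C s1 t in auto)
      also have "\<dots> = 128 * C / s * t * inverse (1 + t\<^sup>2)" by simp
      finally show "cmod (char (tilted Q) t - char std_normal_distribution t) \<le> 128 * C / s * t * inverse (1 + t\<^sup>2)" .
    qed
    also have "\<dots> = D1 / s" using \<epsilon> s1 by (simp add: D1_def field_simps)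
    finally show ?thesis .
  qed
  let ?I = "\<lambda>R. \<integral>v. indicator {..x + 1} v * exp v \<partial>R"
  have "exp 1 * cdf Q x = m * ?I (tilted Q)"
    using Q.integral_exp_tilted[OF int_exp, of x] m_pos by (simp add: m_def[symmetric] field_simps)
  moreover have I_N: "?I std_normal_distribution = exp (1 / 2) * std_normal_cdf x"
    using std_normal_tilt[of "x + 1"] by simp
  then have "exp 1 * std_normal_cdf x = exp (1 / 2) * ?I std_normal_distribution"
    by (simp add: exp_add[symmetric] mult.assoc[symmetric])
  \<comment> \<open>Two sources of error: the tilted law, and the normalising constant
    \<open>m\<close>, whose value for the normal law is \<open>exp (1 / 2)\<close>.\<close>
  ultimately have "exp 1 * (cdf Q x - std_normal_cdf x)
      = m * (?I (tilted Q) - ?I std_normal_distribution) + (m - exp (1 / 2)) * ?I std_normal_distribution"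
    by (simp add: algebra_simps)
  then have "\<bar>exp 1 * (cdf Q x - std_normal_cdf x)\<bar>
      = \<bar>m * (?I (tilted Q) - ?I std_normal_distribution) + (m - exp (1 / 2)) * ?I std_normal_distribution\<bar>"
    by (rule arg_cong)
  also have "\<dots> \<le> m * \<bar>?I (tilted Q) - ?I std_normal_distribution\<bar> + \<bar>m - exp (1 / 2)\<bar> * \<bar>?I std_normal_distribution\<bar>"
  proof -
    have "\<bar>m * p + q * r\<bar> \<le> m * \<bar>p\<bar> + \<bar>q\<bar> * \<bar>r\<bar>" for p q r :: real
      using abs_triangle_ineq[of "m * p" "q * r"] m_pos by (simp add: abs_mult)
    then show ?thesis .
  qed
  also have "\<dots> \<le> (exp 1 * exp 1) * (2 * exp (x + 1) * (D1 / s)) + (exp 1 * exp 1 * (C / s)) * exp (x + 1)"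
  proof (intro add_mono mult_mono m_le m_diff)
    show "\<bar>?I (tilted Q) - ?I std_normal_distribution\<bar> \<le> 2 * exp (x + 1) * (D1 / s)"
      by (rule integral_exp_atMost_diff_le) (use R_diff in \<open>unfold_locales, auto\<close>)
    have "\<bar>?I std_normal_distribution\<bar> = ?I std_normal_distribution"
      by (intro abs_of_nonneg integral_nonneg_AE) auto
    also have "\<dots> \<le> (\<integral>v. exp (x + 1) \<partial>std_normal_distribution)"
      by (rule integral_mono') (auto simp: indicator_def)
    finally show "\<bar>?I std_normal_distribution\<bar> \<le> exp (x + 1)" using N.prob_space by simp
  qed (use m_pos D1 s1 Cs C in \<open>auto intro!: divide_nonneg_nonneg\<close>)
  also have "\<dots> = exp 1 * (D / s * exp x)"
    by (simp add: D_def exp_add add_divide_distrib algebra_simps)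
  finally show "\<bar>cdf Q x - std_normal_cdf x\<bar> \<le> D / s * exp x"
    by (simp only: abs_mult abs_exp_cancel mult_le_cancel_left_pos[OF exp_gt_zero])
qed

end

lemma std_normal_cdf_uminus: "std_normal_cdf (- x) = 1 - std_normal_cdf x"
proof -
  interpret N: real_distribution std_normal_distribution by (rule real_dist_normal_dist)
  have int: "integrable lborel (\<lambda>y. indicator A y * std_normal_density y)" if "A \<in> sets borel" for A
    using that integrable_normal_density[of 1 0]
    by (intro integrable_real_mult_indicator[where 'a = real, simplified mult.commute[of _ "indicator _ _"]]) auto
  have "std_normal_cdf (- x) = (\<integral>y. indicator {x..} y * std_normal_density y \<partial>lborel)"
    unfolding std_normal_cdf_eq
    by (subst lborel_integral_real_affine[where c = "- 1" and t = 0])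
       (auto intro!: Bochner_Integration.integral_cong simp: indicator_def normal_density_def)
  also have "\<dots> = (\<integral>y. std_normal_density y - indicator {..x} y * std_normal_density y \<partial>lborel)"
  proof (rule integral_cong_AE)
    show "AE y in lborel. indicator {x..} y * std_normal_density y
        = std_normal_density y - indicator {..x} y * std_normal_density y"
      using AE_lborel_singleton[of x] by eventually_elim (auto simp: indicator_def)
  qed auto
  also have "\<dots> = 1 - std_normal_cdf x"
    using int[of "{..x}"] by (simp add: std_normal_cdf_eq)
  finally show ?thesis .
qed

text \<open>On the right half line the bound is applied to the reflected law. Reflection yields the
  mass of an open half line, so the closed one is reached by letting points decrease to
  \<open>x\<close>.\<close>

lemma near_gaussian_cdf:
  assumes "0 < \<rho>" "0 \<le> C"
  obtains D s0 where "0 \<le> D" "0 < s0"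
    "\<And>Q s x. near_gaussian \<rho> C s Q \<Longrightarrow> s0 \<le> s \<Longrightarrow> \<bar>cdf Q x - std_normal_cdf x\<bar> \<le> D / s * exp (- \<bar>x\<bar>)"
proof -
  obtain D s0 where D: "0 \<le> D" "0 < s0" and le:
    "\<And>Q s x. near_gaussian \<rho> C s Q \<Longrightarrow> s0 \<le> s \<Longrightarrow> \<bar>cdf Q x - std_normal_cdf x\<bar> \<le> D / s * exp x"
    using near_gaussian_cdf_nonpos[OF assms] by blast
  have "\<bar>cdf Q x - std_normal_cdf x\<bar> \<le> D / s * exp (- \<bar>x\<bar>)" if Q: "near_gaussian \<rho> C s Q" "s0 \<le> s" for Q s x
  proof (cases "x \<le> 0")
    case True
    then show ?thesis using le[OF Q, of x] by simp
  next
    case False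
    interpret Q: real_distribution Q using Q by (simp add: near_gaussian_def)
    interpret Q': real_distribution "distr Q borel uminus"
      by (simp add: real_distribution_def real_distribution_axioms_def Q.prob_space_distr)
    let ?Q' = "cdf (distr Q borel uminus)"
    have cont: "continuous_on UNIV std_normal_cdf"
    proof (rule lipschitz_on_continuous_on[where L = 1], rule lipschitz_onI)
      interpret N: real_distribution std_normal_distribution by (rule real_dist_normal_dist)
      fix x y :: real
      show "dist (std_normal_cdf x) (std_normal_cdf y) \<le> 1 * dist x y"
        using std_normal_cdf_lipschitz[of x y] std_normal_cdf_lipschitz[of y x]
          N.cdf_nondecreasing[of x y] N.cdf_nondecreasing[of y x]
        by (cases "x \<le> y") (auto simp: dist_real_def abs_if)
    qed simp
    have lim: "(\<lambda>n. x + 1 / real (Suc n)) \<longlonglongrightarrow> x"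
      using tendsto_add[OF tendsto_const LIMSEQ_inverse_real_of_nat, of x] by (simp add: inverse_eq_divide)
    have Q'_eq: "?Q' (- y) = 1 - measure Q {..<y}" for y
    proof -
      have "?Q' (- y) = measure Q {y..}"
        by (auto simp: cdf_def measure_distr intro!: arg_cong[where f = "measure Q"])
      also have "\<dots> = measure Q (space Q - {..<y})"
        by (rule arg_cong[where f = "measure Q"]) auto
      also have "\<dots> = 1 - measure Q {..<y}" by (rule Q.prob_compl) simp
      finally show ?thesis .
    qed
    have "(\<lambda>n. measure Q {..<x + 1 / real (Suc n)}) \<longlonglongrightarrow> measure Q (\<Inter>n. {..<x + 1 / real (Suc n)})"
    proof (rule Q.finite_Lim_measure_decseq)
      show "decseq (\<lambda>n. {..<x + 1 / real (Suc n)})"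
        by (auto simp: decseq_def intro!: frac_le intro: less_le_trans)
    qed auto
    also have "(\<Inter>n. {..<x + 1 / real (Suc n)}) = {..x}"
    proof (intro set_eqI iffI)
      fix y assume "y \<in> (\<Inter>n. {..<x + 1 / real (Suc n)})"
      then have "y \<le> x + 1 / real (Suc n)" for n by (auto intro: less_imp_le)
      then have "y \<le> x" by (intro LIMSEQ_le_const[OF lim]) auto
      then show "y \<in> {..x}" by simp
    qed (auto intro: le_less_trans)
    finally have limQ: "(\<lambda>n. 1 - ?Q' (- (x + 1 / real (Suc n)))) \<longlonglongrightarrow> cdf Q x"
      unfolding Q'_eq cdf_def[of Q] by simp
    have limN: "(\<lambda>n. std_normal_cdf (x + 1 / real (Suc n))) \<longlonglongrightarrow> std_normal_cdf x"
      by (rule continuous_on_tendsto_compose[OF cont lim]) auto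
    have "(\<lambda>n. \<bar>(1 - ?Q' (- (x + 1 / real (Suc n)))) - std_normal_cdf (x + 1 / real (Suc n))\<bar>) \<longlonglongrightarrow> \<bar>cdf Q x - std_normal_cdf x\<bar>"
      by (intro tendsto_intros limQ limN)
    moreover have "(\<lambda>n. D / s * exp (- (x + 1 / real (Suc n)))) \<longlonglongrightarrow> D / s * exp (- x)"
      by (intro tendsto_intros lim)
    moreover have "\<bar>(1 - ?Q' (- y)) - std_normal_cdf y\<bar> \<le> D / s * exp (- y)" for y
      using le[OF near_gaussian_uminus[OF Q(1)] Q(2), of "- y"] by (simp add: std_normal_cdf_uminus abs_minus_commute)
    ultimately have "\<bar>cdf Q x - std_normal_cdf x\<bar> \<le> D / s * exp (- x)"
      by (intro LIMSEQ_le) blast+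
    then show ?thesis using False by simp
  qed
  then show ?thesis using that D by blast
qed

section \<open>Expectations of test functions\<close>

lemma ae_differentiable_continuous:
  assumes "ae_differentiable h"
  shows "continuous_on UNIV h"
proof -
  have "isCont h x" for x
  proof -
    have int: "(deriv h has_integral h b - h a) {a..b}" if "a \<le> b" for a b
      using assms that unfolding ae_differentiable_def by blast
    have "continuous_on {x - 1..x + 1} (\<lambda>y. integral {x - 1..y} (deriv h))"
      using int[of "x - 1" "x + 1"] by (intro indefinite_integral_continuous_1) auto
    then have "continuous_on {x - 1..x + 1} (\<lambda>y. integral {x - 1..y} (deriv h) + h (x - 1))"
      by (intro continuous_intros)
    also have "?this \<longleftrightarrow> continuous_on {x - 1..x + 1} h"
    proof (rule continuous_on_cong[OF refl])
      fix y assume "y \<in> {x - 1..x + 1}"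
      then show "integral {x - 1..y} (deriv h) + h (x - 1) = h y"
        using int[of "x - 1" y] by (simp add: integral_unique)
    qed
    finally show ?thesis
      by (rule continuous_on_interior) simp
  qed
  then show ?thesis by (simp add: continuous_at_imp_continuous_on)
qed

text \<open>\<open>deriv h\<close> itself is only Lebesgue measurable.\<close>

lemma ae_differentiable_borel_deriv:
  assumes "ae_differentiable h" "finite_weighted_variation m h"
  obtains g where "g \<in> borel_measurable borel"
    "\<And>a b. a \<le> b \<Longrightarrow> integrable lborel (\<lambda>t. indicator {a..b} t * g t)"
    "\<And>a b. a \<le> b \<Longrightarrow> h b - h a = (\<integral>t. indicator {a..b} t * g t \<partial>lborel)"
    "integrable lborel (\<lambda>t. \<bar>g t\<bar> / (1 + \<bar>t\<bar>) ^ m)"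
    "weighted_variation m h = (\<integral>t. \<bar>g t\<bar> / (1 + \<bar>t\<bar>) ^ m \<partial>lborel)"
proof -
  have meas: "deriv h \<in> borel_measurable lebesgue"
  proof (rule borel_measurable_LIMSEQ_real)
    show "(\<lambda>n. indicator {- real n..real n} x * deriv h x) \<longlonglongrightarrow> deriv h x" for x
    proof (rule tendsto_eventually)
      show "\<forall>\<^sub>F n in sequentially. indicator {- real n..real n} x * deriv h x = deriv h x"
        using eventually_ge_at_top[of "nat \<lceil>\<bar>x\<bar>\<rceil>"] by eventually_elim (auto simp: indicator_def)
    qed
    have "set_integrable lebesgue {- real n..real n} (deriv h)" for n
      using assms(1) unfolding ae_differentiable_def by auto
    then show "(\<lambda>x. indicator {- real n..real n} x * deriv h x) \<in> borel_measurable lebesgue" for n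
      unfolding set_integrable_def by (auto dest: borel_measurable_integrable)
  qed
  then obtain g where g: "g \<in> borel_measurable lborel" "AE t in lborel. deriv h t = g t"
    using completion_ex_borel_measurable_real by blast
  have AE: "AE t in lebesgue. deriv h t = g t" using g(2) by (rule AE_completion)
  have gm[measurable]: "g \<in> borel_measurable borel" using g(1) by simp
  have g_leb: "g \<in> borel_measurable lebesgue" using g(1) by (rule measurable_completion)
  show ?thesis
  proof
    show "g \<in> borel_measurable borel" by fact
    fix a b :: real assume ab: "a \<le> b"
    have "integrable lebesgue (\<lambda>t. indicator {a..b} t *\<^sub>R deriv h t)"
      using assms(1) ab unfolding ae_differentiable_def set_integrable_def by blast
    then have "integrable lebesgue (\<lambda>t. indicator {a..b} t * g t)"
    proof (rule integrable_cong_AE_imp)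
      show "(\<lambda>t. indicator {a..b} t * g t) \<in> borel_measurable lebesgue"
        by (rule measurable_completion) measurable
    qed (use AE in \<open>auto elim: eventually_mono\<close>)
    then show int: "integrable lborel (\<lambda>t. indicator {a..b} t * g t)"
      by (subst (asm) integrable_completion) auto
    have "(deriv h has_integral (LINT t:{a..b}|lebesgue. deriv h t)) {a..b}"
      using assms(1) ab unfolding ae_differentiable_def by (intro has_integral_set_lebesgue) auto
    moreover have "(deriv h has_integral h b - h a) {a..b}"
      using assms(1) ab unfolding ae_differentiable_def by blast
    ultimately have "h b - h a = (LINT t:{a..b}|lebesgue. deriv h t)" by (rule has_integral_unique[symmetric])
    also have "\<dots> = (\<integral>t. indicator {a..b} t * g t \<partial>lebesgue)"
      unfolding set_lebesgue_integral_def
    proof (rule integral_cong_AE)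
      show "(\<lambda>t. indicator {a..b} t *\<^sub>R deriv h t) \<in> borel_measurable lebesgue"
        by (intro borel_measurable_scaleR borel_measurable_indicator meas) simp
      show "(\<lambda>t. indicator {a..b} t * g t) \<in> borel_measurable lebesgue"
        by (rule measurable_completion) measurable
    qed (use AE in \<open>auto elim: eventually_mono\<close>)
    also have "\<dots> = (\<integral>t. indicator {a..b} t * g t \<partial>lborel)" by (rule integral_completion) auto
    finally show "h b - h a = (\<integral>t. indicator {a..b} t * g t \<partial>lborel)" .
  next
    have "integrable lebesgue (\<lambda>t. \<bar>g t\<bar> / (1 + \<bar>t\<bar>) ^ m)"
      using assms(2) unfolding finite_weighted_variation_def
    proof (rule integrable_cong_AE_imp)
      show "(\<lambda>t. \<bar>g t\<bar> / (1 + \<bar>t\<bar>) ^ m) \<in> borel_measurable lebesgue"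
        by (rule measurable_completion) measurable
    qed (use AE in \<open>auto elim: eventually_mono\<close>)
    then show "integrable lborel (\<lambda>t. \<bar>g t\<bar> / (1 + \<bar>t\<bar>) ^ m)"
      by (subst (asm) integrable_completion) auto
    have "weighted_variation m h = (\<integral>t. \<bar>g t\<bar> / (1 + \<bar>t\<bar>) ^ m \<partial>lebesgue)"
      unfolding weighted_variation_def
    proof (rule integral_cong_AE)
      show "(\<lambda>t. \<bar>g t\<bar> / (1 + \<bar>t\<bar>) ^ m) \<in> borel_measurable lebesgue"
        by (rule measurable_completion) measurable
      show "(\<lambda>t. \<bar>deriv h t\<bar> / (1 + \<bar>t\<bar>) ^ m) \<in> borel_measurable lebesgue"
        using assms(2) unfolding finite_weighted_variation_def by (rule borel_measurable_integrable)
    qed (use AE in \<open>auto elim: eventually_mono\<close>)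
    also have "\<dots> = (\<integral>t. \<bar>g t\<bar> / (1 + \<bar>t\<bar>) ^ m \<partial>lborel)" by (rule integral_completion) measurable
    finally show "weighted_variation m h = (\<integral>t. \<bar>g t\<bar> / (1 + \<bar>t\<bar>) ^ m \<partial>lborel)" .
  qed
qed

text \<open>Markov's inequality for \<open>m\<close>-th powers. The factor \<open>2 ^ m\<close>
  replaces \<open>\<bar>t\<bar>\<close> by \<open>1 + \<bar>t\<bar>\<close>: directly when
  \<open>\<bar>t\<bar> \<le> 1\<close>, and through
  \<open>1 + \<bar>t\<bar> \<le> 2 * \<bar>y\<bar>\<close> otherwise.\<close>

lemma (in real_distribution) tail_moment_le:
  assumes int: "integrable M (\<lambda>y. \<bar>y\<bar> ^ m)"
  defines "c \<equiv> 2 ^ m * (1 + (\<integral>y. \<bar>y\<bar> ^ m \<partial>M))"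
  shows "0 \<le> c" "t \<ge> 0 \<Longrightarrow> 1 - cdf M t \<le> c / (1 + \<bar>t\<bar>) ^ m" "t \<le> 0 \<Longrightarrow> cdf M t \<le> c / (1 + \<bar>t\<bar>) ^ m"
proof -
  have E: "0 \<le> (\<integral>y. \<bar>y\<bar> ^ m \<partial>M)" by (intro integral_nonneg_AE) auto
  then show "0 \<le> c" by (simp add: c_def)
  have key: "measure M A \<le> c / (1 + \<bar>t\<bar>) ^ m" if A: "A \<in> sets borel" "\<And>y. y \<in> A \<Longrightarrow> \<bar>t\<bar> \<le> \<bar>y\<bar>" for A t
  proof -
    have "measure M A = (\<integral>y. indicator A y \<partial>M)" using A by simp
    also have "\<dots> \<le> (\<integral>y. 2 ^ m * (1 + \<bar>y\<bar> ^ m) / (1 + \<bar>t\<bar>) ^ m \<partial>M)"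
    proof (rule integral_mono')
      fix y
      have "(1 + \<bar>t\<bar>) ^ m \<le> 2 ^ m * (1 + \<bar>y\<bar> ^ m)" if "y \<in> A"
      proof (cases "\<bar>t\<bar> \<le> 1")
        case True
        then have "(1 + \<bar>t\<bar>) ^ m \<le> 2 ^ m * 1" by (auto intro!: power_mono)
        also have "\<dots> \<le> 2 ^ m * (1 + \<bar>y\<bar> ^ m)" by (intro mult_left_mono) auto
        finally show ?thesis .
      next
        case False
        then have "(1 + \<bar>t\<bar>) ^ m \<le> (2 * \<bar>y\<bar>) ^ m" using A(2)[OF that] by (intro power_mono) auto
        also have "\<dots> = 2 ^ m * \<bar>y\<bar> ^ m" by (simp add: power_mult_distrib)
        also have "\<dots> \<le> 2 ^ m * (1 + \<bar>y\<bar> ^ m)" by (intro mult_left_mono) auto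
        finally show ?thesis .
      qed
      then show "indicator A y \<le> 2 ^ m * (1 + \<bar>y\<bar> ^ m) / (1 + \<bar>t\<bar>) ^ m"
        by (auto simp: indicator_def le_divide_eq)
    qed (use int in auto)
    also have "\<dots> = c / (1 + \<bar>t\<bar>) ^ m" using int prob_space by (simp add: c_def)
    finally show ?thesis .
  qed
  show "1 - cdf M t \<le> c / (1 + \<bar>t\<bar>) ^ m" if "t \<ge> 0"
  proof -
    have "1 - cdf M t = measure M (space M - {..t})" unfolding cdf_def by (rule prob_compl[symmetric]) simp
    also have "\<dots> \<le> c / (1 + \<bar>t\<bar>) ^ m" using that by (intro key) (auto simp: Compl_eq_Diff_UNIV[symmetric])
    finally show ?thesis .
  qed
  show "cdf M t \<le> c / (1 + \<bar>t\<bar>) ^ m" if "t \<le> 0"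
    unfolding cdf_def using that by (intro key) auto
qed

text \<open>\<open>h y\<close> is \<open>h 0\<close> plus an integral of \<open>g\<close> against a
  kernel with values \<open>- 1\<close>, \<open>0\<close> and \<open>1\<close>, and Fubini exchanges
  it with the expectation. The base point \<open>0\<close> leaves right tails at positive and left
  tails at other points; the moment bound for these tails matches the weight under which
  \<open>g\<close> is integrable.\<close>

lemma (in real_distribution) expectation_ae_differentiable:
  fixes g :: "real \<Rightarrow> real"
  assumes mom: "integrable M (\<lambda>y. \<bar>y\<bar> ^ m)"
    and [measurable]: "g \<in> borel_measurable borel"
    and int: "\<And>a b. a \<le> b \<Longrightarrow> integrable lborel (\<lambda>t. indicator {a..b} t * g t)"
    and h: "\<And>a b. a \<le> b \<Longrightarrow> h b - h a = (\<integral>t. indicator {a..b} t * g t \<partial>lborel)"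
    and finite: "integrable lborel (\<lambda>t. \<bar>g t\<bar> / (1 + \<bar>t\<bar>) ^ m)"
  defines "K \<equiv> \<lambda>t. if 0 < t then 1 - cdf M t else - cdf M t"
  shows "integrable M h" "integrable lborel (\<lambda>t. g t * K t)"
    "(\<integral>y. h y \<partial>M) = h 0 + (\<integral>t. g t * K t \<partial>lborel)"
proof -
  interpret L: pair_sigma_finite lborel M ..
  define k where "k t y = (if 0 < t then if t < y then 1 else 0 else if y \<le> t then - 1 else 0 :: real)" for t y :: real
  have [measurable]: "cdf M \<in> borel_measurable borel"
    by (intro borel_measurable_mono monoI cdf_nondecreasing)
  have [measurable]: "K \<in> borel_measurable borel" unfolding K_def by measurable
  have k_meas[measurable]: "(\<lambda>(t, y). k t y) \<in> borel_measurable (lborel \<Otimes>\<^sub>M M)"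
    unfolding k_def by measurable
  have [measurable]: "(\<lambda>t. k t y) \<in> borel_measurable borel" for y
    unfolding k_def by measurable
  have int_k: "(\<integral>y. k t y \<partial>M) = K t" and int_abs_k: "(\<integral>y. \<bar>k t y\<bar> \<partial>M) = \<bar>K t\<bar>" and integrable_k: "integrable M (k t)" for t
  proof -
    have compl: "measure M {t<..} = 1 - cdf M t"
    proof -
      have "measure M {t<..} = measure M (space M - {..t})" by (rule arg_cong[where f = "measure M"]) auto
      also have "\<dots> = 1 - cdf M t" unfolding cdf_def by (rule prob_compl) simp
      finally show ?thesis .
    qed
    have k_eq: "k t = (if 0 < t then indicator {t<..} else (\<lambda>y. - indicator {..t} y))"
      by (auto simp: k_def fun_eq_iff indicator_def)
    show "(\<integral>y. k t y \<partial>M) = K t" unfolding k_eq K_def using compl by (simp add: cdf_def)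
    show "(\<integral>y. \<bar>k t y\<bar> \<partial>M) = \<bar>K t\<bar>" unfolding k_eq K_def using compl by (simp add: cdf_def abs_indicator cdf_bounded_prob)
    show "integrable M (k t)" unfolding k_eq by (auto intro!: integrable_const_bound[of _ 1])
  qed
  obtain c where c: "0 \<le> c" "\<And>t. \<bar>K t\<bar> \<le> c / (1 + \<bar>t\<bar>) ^ m"
  proof -
    have "\<bar>K t\<bar> \<le> (2 ^ m * (1 + (\<integral>y. \<bar>y\<bar> ^ m \<partial>M))) / (1 + \<bar>t\<bar>) ^ m" for t
      using tail_moment_le(2,3)[OF mom, of t] cdf_bounded_prob[of t] cdf_nonneg[of t] by (auto simp: K_def)
    then show ?thesis using that tail_moment_le(1)[OF mom] by blast
  qed
  have gK_le: "\<bar>g t\<bar> * \<bar>K t\<bar> \<le> c * (\<bar>g t\<bar> / (1 + \<bar>t\<bar>) ^ m)" for t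
    using mult_left_mono[OF c(2)[of t], of "\<bar>g t\<bar>"] by (simp add: mult.commute)
  have int_gK: "integrable lborel (\<lambda>t. \<bar>g t\<bar> * \<bar>K t\<bar>)"
  proof (rule Bochner_Integration.integrable_bound[OF integrable_mult_right[OF finite, of c]])
    have "norm (\<bar>g t\<bar> * \<bar>K t\<bar>) = \<bar>g t\<bar> * \<bar>K t\<bar>" for t by (simp add: abs_mult)
    then show "AE t in lborel. norm (\<bar>g t\<bar> * \<bar>K t\<bar>) \<le> norm (c * (\<bar>g t\<bar> / (1 + \<bar>t\<bar>) ^ m))"
      using order_trans[OF gK_le abs_ge_self] by (simp only: real_norm_def) simp
  qed measurable
  show "integrable lborel (\<lambda>t. g t * K t)"
    by (rule Bochner_Integration.integrable_bound[OF int_gK]) (auto simp: abs_mult)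
  have prod: "integrable (lborel \<Otimes>\<^sub>M M) (\<lambda>(t, y). g t * k t y)"
  proof (rule L.Fubini_integrable)
    show "integrable lborel (\<lambda>t. \<integral>y. norm (case (t, y) of (t, y) \<Rightarrow> g t * k t y) \<partial>M)"
      using int_gK by (simp add: abs_mult int_abs_k)
    show "AE t in lborel. integrable M (\<lambda>y. case (t, y) of (t, y) \<Rightarrow> g t * k t y)"
      using integrable_k by simp
  qed measurable
  define h0 where "h0 = h 0"
  have h_eq: "h y = h0 + (\<integral>t. g t * k t y \<partial>lborel)" for y
  proof (cases "0 \<le> y")
    case True
    have "(\<integral>t. g t * k t y \<partial>lborel) = (\<integral>t. indicator {0..y} t * g t \<partial>lborel)"
    proof (rule integral_cong_AE)
      show "AE t in lborel. g t * k t y = indicator {0..y} t * g t"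
        using AE_lborel_singleton[of 0] AE_lborel_singleton[of y]
        by eventually_elim (use True in \<open>auto simp: k_def indicator_def\<close>)
    qed measurable
    then show ?thesis using h[OF True] by (simp add: h0_def)
  next
    case False
    have "(\<integral>t. g t * k t y \<partial>lborel) = (\<integral>t. - (indicator {y..0} t * g t) \<partial>lborel)"
    proof (rule integral_cong_AE)
      show "AE t in lborel. g t * k t y = - (indicator {y..0} t * g t)"
        using AE_lborel_singleton[of 0] AE_lborel_singleton[of y]
        by eventually_elim (use False in \<open>auto simp: k_def indicator_def\<close>)
    qed measurable
    then show ?thesis using h[of y 0] False by (simp add: h0_def)
  qed
  have int_h: "integrable M (\<lambda>y. \<integral>t. g t * k t y \<partial>lborel)"
    by (rule L.integrable_snd[OF prod])
  then have "integrable M (\<lambda>y. h0 + (\<integral>t. g t * k t y \<partial>lborel))" by simp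
  then show "integrable M h" by (simp only: h_eq[symmetric])
  have "(\<integral>y. h y \<partial>M) = (\<integral>y. h0 + (\<integral>t. g t * k t y \<partial>lborel) \<partial>M)"
    by (rule Bochner_Integration.integral_cong[OF refl h_eq])
  also have "\<dots> = h0 + (\<integral>y. (\<integral>t. g t * k t y \<partial>lborel) \<partial>M)"
    using int_h prob_space by simp
  also have "(\<integral>y. (\<integral>t. g t * k t y \<partial>lborel) \<partial>M) = (\<integral>t. (\<integral>y. g t * k t y \<partial>M) \<partial>lborel)"
    by (rule L.Fubini_integral[OF prod])
  also have "\<dots> = (\<integral>t. g t * K t \<partial>lborel)"
    by (rule Bochner_Integration.integral_cong[OF refl]) (simp only: integral_mult_right_zero int_k)
  finally show "(\<integral>y. h y \<partial>M) = h 0 + (\<integral>t. g t * K t \<partial>lborel)" by (simp only: h0_def)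
qed

text \<open>The terms \<open>h 0\<close> cancel, and the two tail functions differ by a difference
  of distribution functions on either side of \<open>0\<close>. The weight of the error then meets
  the weight of the variation.\<close>

lemma expectation_diff_weighted_variation:
  assumes Q: "real_distribution Q" "real_distribution N"
    and mom: "integrable Q (\<lambda>y. \<bar>y\<bar> ^ m)" "integrable N (\<lambda>y. \<bar>y\<bar> ^ m)"
    and h: "ae_differentiable h" "finite_weighted_variation m h"
    and c: "\<And>x. \<bar>cdf Q x - cdf N x\<bar> \<le> c / (1 + \<bar>x\<bar>) ^ m"
  shows "integrable Q h" "integrable N h"
    "\<bar>(\<integral>y. h y \<partial>Q) - (\<integral>y. h y \<partial>N)\<bar> \<le> c * weighted_variation m h"
proof -
  interpret Q: real_distribution Q by fact
  interpret N: real_distribution N by fact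
  obtain g where g: "g \<in> borel_measurable borel"
    "\<And>a b. a \<le> b \<Longrightarrow> integrable lborel (\<lambda>t. indicator {a..b} t * g t)"
    "\<And>a b. a \<le> b \<Longrightarrow> h b - h a = (\<integral>t. indicator {a..b} t * g t \<partial>lborel)"
    "integrable lborel (\<lambda>t. \<bar>g t\<bar> / (1 + \<bar>t\<bar>) ^ m)"
    "weighted_variation m h = (\<integral>t. \<bar>g t\<bar> / (1 + \<bar>t\<bar>) ^ m \<partial>lborel)"
    using ae_differentiable_borel_deriv[OF h] by blast
  note EQ = Q.expectation_ae_differentiable[OF mom(1) g(1-4)]
  note EN = N.expectation_ae_differentiable[OF mom(2) g(1-4)]
  show "integrable Q h" "integrable N h" using EQ(1) EN(1) by auto
  let ?K = "\<lambda>M t. g t * (if 0 < t then 1 - cdf M t else - cdf M t)"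
  have "(\<integral>y. h y \<partial>Q) - (\<integral>y. h y \<partial>N) = (\<integral>t. ?K Q t - ?K N t \<partial>lborel)"
    using EQ(2,3) EN(2,3) by simp
  then have "\<bar>(\<integral>y. h y \<partial>Q) - (\<integral>y. h y \<partial>N)\<bar> = \<bar>\<integral>t. ?K Q t - ?K N t \<partial>lborel\<bar>"
    by (rule arg_cong)
  also have "\<dots> \<le> (\<integral>t. c * (\<bar>g t\<bar> / (1 + \<bar>t\<bar>) ^ m) \<partial>lborel)"
    unfolding real_norm_def[symmetric]
  proof (rule order_trans[OF integral_norm_bound integral_mono_AE'])
    show "integrable lborel (\<lambda>t. c * (norm (g t) / (1 + norm t) ^ m))"
      using integrable_mult_right[OF g(4), of c] by (simp only: real_norm_def)
    have *: "norm (?K Q t - ?K N t) \<le> c * (norm (g t) / (1 + norm t) ^ m)" for t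
    proof -
      have "norm (?K Q t - ?K N t) = \<bar>g t\<bar> * \<bar>cdf Q t - cdf N t\<bar>"
        by (auto simp: right_diff_distrib[symmetric] abs_mult abs_minus_commute)
      also have "\<dots> \<le> \<bar>g t\<bar> * (c / (1 + \<bar>t\<bar>) ^ m)" by (intro mult_left_mono c) auto
      finally show ?thesis by (simp add: mult.commute)
    qed
    show "AE t in lborel. norm (?K Q t - ?K N t) \<le> c * (norm (g t) / (1 + norm t) ^ m)"
      by (rule AE_I2) (rule *)
    show "AE t in lborel. 0 \<le> c * (norm (g t) / (1 + norm t) ^ m)"
      by (rule AE_I2) (rule order_trans[OF norm_ge_zero *])
  qed
  also have "\<dots> = c * weighted_variation m h" by (simp only: integral_mult_right_zero g(5))
  finally show "\<bar>(\<integral>y. h y \<partial>Q) - (\<integral>y. h y \<partial>N)\<bar> \<le> c * weighted_variation m h" .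
qed

section \<open>Comparison of weights and the error of a shifted, rescaled sum\<close>

lemma power_le_fact_exp: "y ^ k \<le> fact k * exp y" if "0 \<le> y" for y :: real
proof -
  have "(\<Sum>n\<in>{k}. y ^ n /\<^sub>R fact n) \<le> (\<Sum>n. y ^ n /\<^sub>R fact n)"
    using exp_converges[of y] that by (intro sum_le_suminf) (auto simp: sums_iff)
  also have "\<dots> = exp y" using exp_converges[of y] by (simp add: sums_iff)
  finally show ?thesis by (simp add: field_simps)
qed

text \<open>A single term of the exponential series at \<open>(1 + x) / 2\<close> bounds the power,
  and the exponential cancels up to a constant.\<close>

lemma one_plus_power_exp_le: "(1 + x) ^ k * exp (- x / 2) \<le> 2 ^ k * fact k * exp 1" if "0 \<le> x" for x :: real
proof -
  have "(1 + x) ^ k = 2 ^ k * ((1 + x) / 2) ^ k" by (simp add: power_divide)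
  also have "\<dots> \<le> 2 ^ k * (fact k * exp ((1 + x) / 2))"
    using that by (intro mult_left_mono power_le_fact_exp) auto
  finally have "(1 + x) ^ k * exp (- x / 2) \<le> 2 ^ k * (fact k * exp ((1 + x) / 2)) * exp (- x / 2)"
    by (rule mult_right_mono) simp
  also have "\<dots> = 2 ^ k * fact k * exp (1 / 2)"
    by (simp add: mult.assoc exp_add[symmetric] add_divide_distrib)
  also have "\<dots> \<le> 2 ^ k * fact k * exp 1" by (intro mult_left_mono) auto
  finally show ?thesis .
qed

lemma std_normal_abs_moment: "integrable std_normal_distribution (\<lambda>y. \<bar>y\<bar> ^ m)"
  using integrable_abs[OF integrable_std_normal_distribution_moment[of m]] by (simp add: power_abs)

text \<open>Comes from \<open>(\<bar>y\<bar> - 1)\<^sup>2 \<ge> 0\<close>. It gives displacements of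
  the normal distribution function the same kind of weight as the approximation error.\<close>

lemma std_normal_density_le_exp: "std_normal_density y \<le> exp (1 / 2 - \<bar>y\<bar>)"
proof -
  have "0 \<le> (\<bar>y\<bar> - 1)\<^sup>2" by simp
  then have "- y\<^sup>2 / 2 \<le> 1 / 2 - \<bar>y\<bar>" by (simp add: power2_diff)
  moreover have "1 \<le> sqrt (2 * pi)" using pi_gt3 by simp
  then have "1 / sqrt (2 * pi) * exp (- y\<^sup>2 / 2) \<le> 1 * exp (- y\<^sup>2 / 2)"
    by (intro mult_right_mono) auto
  ultimately show ?thesis by (simp add: std_normal_density_def order_trans[OF _ exp_le_cancel_iff[THEN iffD2]])
qed

lemma std_normal_cdf_diff_le:
  assumes "x \<le> y" "\<And>z. x \<le> z \<Longrightarrow> z \<le> y \<Longrightarrow> r \<le> \<bar>z\<bar>"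
  shows "std_normal_cdf y - std_normal_cdf x \<le> exp (1 / 2 - r) * (y - x)"
proof (cases "x = y")
  case False
  interpret real_distribution std_normal_distribution by (rule real_dist_normal_dist)
  have "std_normal_cdf y - std_normal_cdf x = measure std_normal_distribution {x<..y}"
    using assms False by (intro cdf_diff_eq) auto
  also have "\<dots> = (\<integral>z. indicator {x<..y} z \<partial>std_normal_distribution)" by simp
  also have "\<dots> = (\<integral>z. std_normal_density z *\<^sub>R indicator {x<..y} z \<partial>lborel)"
    by (rule integral_density) auto
  also have "\<dots> \<le> (\<integral>z. exp (1 / 2 - r) * indicator {x<..y} z \<partial>lborel)"
  proof (rule integral_mono')
    fix z show "std_normal_density z *\<^sub>R indicator {x<..y} z \<le> exp (1 / 2 - r) * indicator {x<..y} z"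
      using assms(2)[of z] std_normal_density_le_exp[of z] by (auto simp: indicator_def intro: order_trans)
  qed (use assms(1) in auto)
  also have "\<dots> = exp (1 / 2 - r) * (y - x)" using assms(1) by simp
  finally show ?thesis .
qed simp

context prob_space
begin

lemma cdf_error_eq:
  assumes "W \<in> borel_measurable M"
  shows "cdf_error M W x = \<bar>cdf (distr M borel W) x - std_normal_cdf x\<bar>"
  unfolding cdf_error_def cdf_def[of "distr M borel W"] using assms
  by (subst measure_distr) (auto simp: vimage_def Collect_conj_eq Int_commute space_borel)

lemma cdf_error_measurable:
  assumes "W \<in> borel_measurable M"
  shows "cdf_error M W \<in> borel_measurable borel"
proof -
  interpret W: real_distribution "distr M borel W" by (rule real_distribution_distr) fact
  interpret N: real_distribution std_normal_distribution by (rule real_dist_normal_dist)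
  have [measurable]: "cdf (distr M borel W) \<in> borel_measurable borel" "std_normal_cdf \<in> borel_measurable borel"
    by (intro borel_measurable_mono monoI W.cdf_nondecreasing N.cdf_nondecreasing; assumption)+
  show ?thesis unfolding cdf_error_eq[OF assms, abs_def] by measurable
qed

text \<open>Serves the finitely many indices to which the Gaussian approximation does not apply:
  moments alone give the weight, with a constant that depends on \<open>W\<close>.\<close>

lemma cdf_error_moment_le:
  assumes W[measurable]: "W \<in> borel_measurable M" and mom: "integrable M (\<lambda>x. \<bar>W x\<bar> ^ m)"
  shows "\<exists>c. \<forall>x. cdf_error M W x \<le> c / (1 + \<bar>x\<bar>) ^ m"
proof -
  interpret W: real_distribution "distr M borel W" by (rule real_distribution_distr) fact
  interpret N: real_distribution std_normal_distribution by (rule real_dist_normal_dist)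
  have mom_W: "integrable (distr M borel W) (\<lambda>y. \<bar>y\<bar> ^ m)"
    using mom by (simp add: integrable_distr_eq)
  define c1 where "c1 = 2 ^ m * (1 + (\<integral>y. \<bar>y\<bar> ^ m \<partial>distr M borel W))"
  define c2 where "c2 = 2 ^ m * (1 + (\<integral>y. \<bar>y\<bar> ^ m \<partial>std_normal_distribution))"
  note Wt = W.tail_moment_le[OF mom_W, folded c1_def]
  note Nt = N.tail_moment_le[OF std_normal_abs_moment[of m], folded c2_def]
  have "cdf_error M W x \<le> (c1 + c2) / (1 + \<bar>x\<bar>) ^ m" for x
  proof -
    have pos: "0 \<le> c1 / (1 + \<bar>x\<bar>) ^ m" "0 \<le> c2 / (1 + \<bar>x\<bar>) ^ m" using Wt(1) Nt(1) by auto
    have "\<bar>cdf (distr M borel W) x - std_normal_cdf x\<bar> \<le> c1 / (1 + \<bar>x\<bar>) ^ m + c2 / (1 + \<bar>x\<bar>) ^ m"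
      using Wt(2,3)[of x] Nt(2,3)[of x] pos W.cdf_nonneg[of x] N.cdf_nonneg[of x]
        W.cdf_bounded_prob[of x] N.cdf_bounded_prob[of x] by (cases "0 \<le> x") auto
    then show ?thesis by (simp add: cdf_error_eq[OF W] add_divide_distrib)
  qed
  then show ?thesis by blast
qed

text \<open>The event for the shifted and rescaled sum is the event for \<open>S / s\<close> at
  \<open>x' = (b * x + a) / s\<close>. Since \<open>x'\<close> is within
  \<open>\<bar>x\<bar> / 2 + 1\<close> of \<open>x\<close>, the approximation error at
  \<open>x'\<close> and the displacement of the normal distribution function both decay like
  \<open>exp (- \<bar>x\<bar> / 2)\<close>, the latter with a linear factor.\<close>

lemma cdf_error_affine_le:
  assumes S[measurable]: "S \<in> borel_measurable M"
    and D: "\<And>y. \<bar>cdf (distr M borel (\<lambda>x. S x / s)) y - std_normal_cdf y\<bar> \<le> D / s * exp (- \<bar>y\<bar>)"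
    and ab: "\<bar>a\<bar> \<le> A" "\<bar>b - s\<bar> \<le> K" and s: "2 * K + 1 \<le> s" "A \<le> s" and "0 \<le> D"
  shows "cdf_error M (\<lambda>x. (S x - a) / b) x \<le> (D + A + K) * exp 2 / s * ((1 + \<bar>x\<bar>) * exp (- \<bar>x\<bar> / 2))"
proof -
  have K: "0 \<le> K" "0 \<le> A" using ab by auto
  have s0: "0 < s" and b: "0 < b" using s ab K by auto
  interpret N: real_distribution std_normal_distribution by (rule real_dist_normal_dist)
  define x' where "x' = (b * x + a) / s"
  define e where "e = exp (- \<bar>x\<bar> / 2)"
  have W: "cdf_error M (\<lambda>x. (S x - a) / b) x = \<bar>cdf (distr M borel (\<lambda>x. S x / s)) x' - std_normal_cdf x\<bar>"
  proof -
    have "(S y - a) / b \<le> x \<longleftrightarrow> S y / s \<le> x'" for y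
      using s0 b by (simp add: x'_def field_simps)
    then have "cdf (distr M borel (\<lambda>x. S x / s)) x' = measure M {y \<in> space M. (S y - a) / b \<le> x}"
      by (simp add: cdf_def measure_distr vimage_def Collect_conj_eq Int_commute)
    then show ?thesis unfolding cdf_error_def by simp
  qed
  have "x' - x = ((b - s) * x + a) / s" using s0 by (simp add: x'_def field_simps)
  moreover have "\<bar>(b - s) * x + a\<bar> \<le> K * \<bar>x\<bar> + A"
    using abs_triangle_ineq[of "(b - s) * x" a] mult_right_mono[OF ab(2), of "\<bar>x\<bar>"] ab(1) by (simp add: abs_mult)
  ultimately have diff: "\<bar>x' - x\<bar> \<le> (K * \<bar>x\<bar> + A) / s" using s0 by (simp add: divide_right_mono)
  also have "\<dots> \<le> (s / 2 * \<bar>x\<bar> + s) / s" using s s0 K by (intro divide_right_mono add_mono mult_right_mono) auto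
  also have "\<dots> = \<bar>x\<bar> / 2 + 1" using s0 by (simp add: field_simps)
  finally have diff': "\<bar>x' - x\<bar> \<le> \<bar>x\<bar> / 2 + 1" .
  \<comment> \<open>Points between \<open>x\<close> and \<open>x'\<close> have modulus at least
    \<open>\<bar>x\<bar> / 2 - 1\<close>; the lost constants fit into \<open>exp 2\<close>.\<close>
  have exp_le: "exp (1 / 2 - (\<bar>x\<bar> / 2 - 1)) \<le> exp 2 * e" "exp (- \<bar>x'\<bar>) \<le> exp 2 * e"
  proof -
    show "exp (1 / 2 - (\<bar>x\<bar> / 2 - 1)) \<le> exp 2 * e" unfolding e_def exp_add[symmetric] by simp
    have "- \<bar>x'\<bar> \<le> 2 + - \<bar>x\<bar> / 2" using diff' by linarith
    then show "exp (- \<bar>x'\<bar>) \<le> exp 2 * e" unfolding e_def exp_add[symmetric] by simp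
  qed
  have "\<bar>std_normal_cdf x' - std_normal_cdf x\<bar> \<le> exp (1 / 2 - (\<bar>x\<bar> / 2 - 1)) * \<bar>x' - x\<bar>"
  proof (cases "x \<le> x'")
    case True
    have "std_normal_cdf x' - std_normal_cdf x \<le> exp (1 / 2 - (\<bar>x\<bar> / 2 - 1)) * (x' - x)"
      using True diff' by (intro std_normal_cdf_diff_le) (auto simp: abs_if split: if_splits)
    then show ?thesis using True N.cdf_nondecreasing[of x x'] by simp
  next
    case False
    have "std_normal_cdf x - std_normal_cdf x' \<le> exp (1 / 2 - (\<bar>x\<bar> / 2 - 1)) * (x - x')"
      using False diff' by (intro std_normal_cdf_diff_le) (auto simp: abs_if split: if_splits)
    then show ?thesis using False N.cdf_nondecreasing[of x' x] by simp
  qed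
  also have "\<dots> \<le> exp 2 * e * ((K * \<bar>x\<bar> + A) / s)"
    using exp_le(1) diff by (intro mult_mono) (auto simp: e_def)
  also have "\<dots> \<le> exp 2 * e * ((A + K) * (1 + \<bar>x\<bar>) / s)"
    using K s0 by (intro mult_left_mono divide_right_mono) (auto simp: e_def algebra_simps)
  finally have 1: "\<bar>std_normal_cdf x' - std_normal_cdf x\<bar> \<le> exp 2 * e * ((A + K) * (1 + \<bar>x\<bar>) / s)" .
  have "\<bar>cdf (distr M borel (\<lambda>x. S x / s)) x' - std_normal_cdf x'\<bar> \<le> D / s * exp (- \<bar>x'\<bar>)" by (rule D)
  also have "\<dots> \<le> D / s * (exp 2 * e)" using \<open>0 \<le> D\<close> s0 exp_le(2) by (intro mult_left_mono) auto
  also have "\<dots> \<le> D / s * (exp 2 * e) * (1 + \<bar>x\<bar>)"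
    using \<open>0 \<le> D\<close> s0 mult_left_mono[of 1 "1 + \<bar>x\<bar>" "D / s * (exp 2 * e)"] by (simp add: e_def)
  finally have 2: "\<bar>cdf (distr M borel (\<lambda>x. S x / s)) x' - std_normal_cdf x'\<bar> \<le> D / s * (exp 2 * e) * (1 + \<bar>x\<bar>)" .
  have "cdf_error M (\<lambda>x. (S x - a) / b) x \<le> D / s * (exp 2 * e) * (1 + \<bar>x\<bar>) + exp 2 * e * ((A + K) * (1 + \<bar>x\<bar>) / s)"
    unfolding W using 1 2 by linarith
  also have "\<dots> = (D + A + K) * exp 2 / s * ((1 + \<bar>x\<bar>) * e)"
    by (simp add: add_divide_distrib algebra_simps)
  finally show ?thesis by (simp add: e_def)
qed

lemma integrable_affine_power:
  fixes S :: "'a \<Rightarrow> real"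
  assumes S[measurable]: "S \<in> borel_measurable M" and mom: "\<And>k. integrable M (\<lambda>x. \<bar>S x\<bar> ^ k)"
  shows "integrable M (\<lambda>x. \<bar>(S x - a) / b\<bar> ^ k)"
proof -
  have "integrable M (\<lambda>x. 2 ^ k * (\<bar>S x\<bar> ^ k + \<bar>a\<bar> ^ k) / \<bar>b\<bar> ^ k)" using mom by simp
  then show ?thesis
  proof (rule Bochner_Integration.integrable_bound)
    have "\<bar>S x - a\<bar> ^ k \<le> 2 ^ k * (\<bar>S x\<bar> ^ k + \<bar>a\<bar> ^ k)" for x
    proof -
      have "\<bar>S x - a\<bar> ^ k \<le> (2 * max \<bar>S x\<bar> \<bar>a\<bar>) ^ k" by (intro power_mono) auto
      also have "\<dots> = 2 ^ k * max \<bar>S x\<bar> \<bar>a\<bar> ^ k" by (simp add: power_mult_distrib)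
      also have "\<dots> \<le> 2 ^ k * (\<bar>S x\<bar> ^ k + \<bar>a\<bar> ^ k)" by (intro mult_left_mono) (auto simp: max_def)
      finally show ?thesis .
    qed
    then show "AE x in M. norm (\<bar>(S x - a) / b\<bar> ^ k) \<le> norm (2 ^ k * (\<bar>S x\<bar> ^ k + \<bar>a\<bar> ^ k) / \<bar>b\<bar> ^ k)"
      by (intro AE_I2) (auto simp: power_divide abs_mult intro!: divide_right_mono)
  qed measurable
qed

end

section \<open>Integrable weights and powers as test functions\<close>

lemma integrable_one_plus_powr:
  fixes q :: real
  assumes "1 < q"
  shows "integrable lborel (\<lambda>x::real. (1 + \<bar>x\<bar>) powr - q)"
proof -
  have "(\<integral>\<^sup>+x. ennreal ((1 + \<bar>x\<bar>) powr - q) * indicator {0..} x \<partial>lborel) = ennreal (0 - (- ((1 + 0) powr (1 - q) / (q - 1))))"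
  proof (rule nn_integral_FTC_atLeast)
    fix x :: real assume "0 \<le> x"
    then show "((\<lambda>x. - ((1 + x) powr (1 - q) / (q - 1))) has_real_derivative (1 + \<bar>x\<bar>) powr - q) (at x)"
    proof -
      have "((\<lambda>x. (1 + x) powr (1 - q)) has_real_derivative (1 - q) * (1 + x) powr (1 - q - 1)) (at x)"
        using \<open>0 \<le> x\<close> by (auto intro!: derivative_eq_intros)
      then have "((\<lambda>x. - ((1 + x) powr (1 - q) / (q - 1))) has_real_derivative
          - ((1 - q) * (1 + x) powr (1 - q - 1) / (q - 1))) (at x)"
        by (intro DERIV_minus DERIV_cdivide)
      moreover have "- ((1 - q) * (1 + x) powr (1 - q - 1) / (q - 1)) = (1 + \<bar>x\<bar>) powr - q"
        using assms \<open>0 \<le> x\<close> by (simp add: minus_divide_left[symmetric] left_diff_distrib[symmetric] del: minus_divide_left) (simp add: field_simps)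
      ultimately show ?thesis by simp
    qed
  next
    have "filterlim (\<lambda>x::real. 1 + x) at_top at_top" by real_asymp
    then have "((\<lambda>x::real. (1 + x) powr (1 - q)) \<longlongrightarrow> 0) at_top"
      using assms by (intro tendsto_neg_powr) auto
    from tendsto_minus[OF tendsto_divide[OF this tendsto_const[of "q - 1"]]]
    show "((\<lambda>x::real. - ((1 + x) powr (1 - q) / (q - 1))) \<longlongrightarrow> 0) at_top" using assms by simp
  qed auto
  then have fin: "(\<integral>\<^sup>+x. ennreal (indicator {0..} x * (1 + \<bar>x\<bar>) powr - q) \<partial>lborel) = ennreal (1 / (q - 1))"
    by (simp add: ennreal_mult' ennreal_indicator mult.commute)
  have "integrable lborel (\<lambda>x::real. indicator {0..} x *\<^sub>R (1 + \<bar>x\<bar>) powr - q)"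
    by (rule integrableI_nn_integral_finite[OF _ _ fin[unfolded real_scaleR_def[symmetric]]]) auto
  then have "has_bochner_integral lborel (\<lambda>x::real. indicator {0..} x *\<^sub>R (1 + \<bar>x\<bar>) powr - q)
      (\<integral>x. indicator {0..} x *\<^sub>R (1 + \<bar>x\<bar>) powr - q \<partial>lborel)"
    by (rule has_bochner_integral_integrable)
  from has_bochner_integral_even_function[OF this] show ?thesis
    by (auto dest: integrable.intros)
qed

lemma ae_differentiable_power: "ae_differentiable (\<lambda>x. x ^ q)"
proof -
  have D: "((\<lambda>x. x ^ q) has_real_derivative real q * x ^ (q - 1)) (at x)" for x
    by (auto intro!: derivative_eq_intros)
  have deriv: "deriv (\<lambda>x. x ^ q) = (\<lambda>x::real. real q * x ^ (q - 1))"
    using D by (intro ext DERIV_imp_deriv)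
  show ?thesis unfolding ae_differentiable_def
  proof (intro conjI allI impI AE_I2)
    show "(\<lambda>x. x ^ q) differentiable at x" for x :: real
      unfolding real_differentiable_def using D by blast
    fix a b :: real assume "a \<le> b"
    show "deriv (\<lambda>x. x ^ q) absolutely_integrable_on {a..b}"
      unfolding deriv by (intro absolutely_integrable_continuous_real continuous_intros)
    show "(deriv (\<lambda>x. x ^ q) has_integral b ^ q - a ^ q) {a..b}"
      unfolding deriv using D \<open>a \<le> b\<close>
      by (intro fundamental_theorem_of_calculus)
         (auto simp: has_real_derivative_iff_has_vector_derivative[symmetric] intro: DERIV_subset)
  qed
qed

lemma finite_weighted_variation_power:
  assumes "q < m" "2 \<le> m"
  shows "finite_weighted_variation m (\<lambda>x. x ^ q)"
proof -
  have deriv: "deriv (\<lambda>x. x ^ q) = (\<lambda>x::real. real q * x ^ (q - 1))"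
    by (intro ext DERIV_imp_deriv) (auto intro!: derivative_eq_intros)
  have "integrable lborel (\<lambda>x. \<bar>real q * x ^ (q - 1)\<bar> / (1 + \<bar>x\<bar>) ^ m)"
  proof (rule Bochner_Integration.integrable_bound)
    show "integrable lborel (\<lambda>x::real. real q * (1 + \<bar>x\<bar>) powr - 2)"
      by (intro integrable_mult_right integrable_one_plus_powr) simp
    show "AE x in lborel. norm (\<bar>real q * x ^ (q - 1)\<bar> / (1 + \<bar>x\<bar>) ^ m) \<le> norm (real q * (1 + \<bar>x\<bar>) powr - 2)"
    proof (rule AE_I2)
      fix x :: real
      have "\<bar>x\<bar> ^ (q - 1) * (1 + \<bar>x\<bar>)\<^sup>2 \<le> (1 + \<bar>x\<bar>) ^ (q - 1) * (1 + \<bar>x\<bar>)\<^sup>2"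
        by (intro mult_right_mono power_mono) auto
      also have "\<dots> = (1 + \<bar>x\<bar>) ^ (q - 1 + 2)" by (simp only: power_add)
      \<comment> \<open>Natural subtraction: for \<open>q = 0\<close> the exponent is
        \<open>2\<close> and not \<open>1\<close>, which is where \<open>2 \<le> m\<close>
        enters.\<close>
      also have "\<dots> \<le> (1 + \<bar>x\<bar>) ^ m" using assms by (intro power_increasing) auto
      finally have "\<bar>x\<bar> ^ (q - 1) / (1 + \<bar>x\<bar>) ^ m \<le> (1 + \<bar>x\<bar>) powr - 2"
        by (simp add: powr_minus powr_realpow[of "1 + \<bar>x\<bar>" 2, simplified] field_simps)
      from mult_left_mono[OF this, of "real q"]
      show "norm (\<bar>real q * x ^ (q - 1)\<bar> / (1 + \<bar>x\<bar>) ^ m) \<le> norm (real q * (1 + \<bar>x\<bar>) powr - 2)"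
        by (simp add: abs_mult power_abs)
    qed
  qed measurable
  then show ?thesis unfolding finite_weighted_variation_def deriv by (subst integrable_completion) auto
qed

text \<open>For \<open>q < 1\<close> the derivative is unbounded near \<open>0\<close>.
  Integrability follows from the fundamental theorem with exceptional point \<open>0\<close>,
  because the absolute value of the derivative has the odd continuous primitive
  \<open>?k\<close>.\<close>

lemma
  fixes q :: real
  assumes "0 < q"
  shows ae_differentiable_abs_powr: "ae_differentiable (\<lambda>x. \<bar>x\<bar> powr q)"
    and finite_weighted_variation_abs_powr: "q < real m \<Longrightarrow> finite_weighted_variation m (\<lambda>x. \<bar>x\<bar> powr q)"
proof -
  let ?h = "\<lambda>x::real. \<bar>x\<bar> powr q" and ?k = "\<lambda>x::real. sgn x * \<bar>x\<bar> powr q"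
  have Dh: "(?h has_real_derivative sgn x * (q * \<bar>x\<bar> powr (q - 1))) (at x)" if "x \<noteq> 0" for x
  proof (cases "0 < x")
    case True
    have "((\<lambda>x. x powr q) has_real_derivative q * x powr (q - 1)) (at x)"
      using True by (auto intro!: derivative_eq_intros)
    then have "(?h has_real_derivative q * x powr (q - 1)) (at x)"
      by (rule has_field_derivative_transform_within_open[where S = "{0<..}"]) (use True in auto)
    then show ?thesis using True by simp
  next
    case False
    have "((\<lambda>x. (- x) powr q) has_real_derivative - (q * (- x) powr (q - 1))) (at x)"
      using False that by (auto intro!: derivative_eq_intros)
    then have "(?h has_real_derivative - (q * (- x) powr (q - 1))) (at x)"
      by (rule has_field_derivative_transform_within_open[where S = "{..<0}"]) (use False that in auto)
    then show ?thesis using False that by simp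
  qed
  have Dk: "(?k has_real_derivative q * \<bar>x\<bar> powr (q - 1)) (at x)" if "x \<noteq> 0" for x
  proof -
    have "((\<lambda>y. sgn x * ?h y) has_real_derivative sgn x * (sgn x * (q * \<bar>x\<bar> powr (q - 1)))) (at x)"
      by (rule DERIV_cmult[OF Dh[OF that]])
    then have "(?k has_real_derivative sgn x * (sgn x * (q * \<bar>x\<bar> powr (q - 1)))) (at x)"
      by (rule has_field_derivative_transform_within_open[where S = "if 0 < x then {0<..} else {..<0}"])
         (use that in \<open>auto split: if_splits\<close>)
    then show ?thesis using that by (simp add: sgn_if split: if_splits)
  qed
  have deriv: "deriv ?h x = sgn x * (q * \<bar>x\<bar> powr (q - 1))" if "x \<noteq> 0" for x
    using Dh[OF that] by (rule DERIV_imp_deriv)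
  have abs_deriv: "\<bar>deriv ?h x\<bar> = q * \<bar>x\<bar> powr (q - 1)" if "x \<noteq> 0" for x
    using that assms by (simp add: deriv abs_mult)
  have cont_h: "continuous_on UNIV ?h" using assms by (intro continuous_on_powr' continuous_intros) auto
  have cont_k: "continuous_on UNIV ?k"
  proof -
    have "isCont ?k x" for x
    proof (cases "x = 0")
      case True
      have "isCont ?h 0" using cont_h continuous_on_eq_continuous_at[OF open_UNIV] by blast
      then have "(?h \<longlongrightarrow> 0) (at 0)" using assms by (simp add: isCont_def)
      then have "((\<lambda>x. \<bar>?k x\<bar>) \<longlongrightarrow> 0) (at 0)"
        by (rule Lim_transform_eventually) (auto simp: eventually_at abs_mult sgn_if intro!: exI[of _ 1])
      then have "(?k \<longlongrightarrow> 0) (at 0)" by (simp add: tendsto_rabs_zero_iff)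
      then show ?thesis using True by (simp add: isCont_def)
    qed (use Dk in \<open>auto intro: DERIV_isCont\<close>)
    then show ?thesis by (simp add: continuous_at_imp_continuous_on)
  qed
  have int: "(deriv ?h has_integral ?h b - ?h a) {a..b}" if "a \<le> b" for a b
  proof (rule fundamental_theorem_of_calculus_interior_strong[of "{0}"])
    show "(?h has_vector_derivative deriv ?h x) (at x)" if "x \<in> {a<..<b} - {0}" for x
      using Dh[of x] deriv[of x] that by (simp add: has_real_derivative_iff_has_vector_derivative)
  qed (use that in \<open>auto intro: continuous_on_subset[OF cont_h]\<close>)
  have int_abs: "((\<lambda>x. \<bar>deriv ?h x\<bar>) has_integral ?k b - ?k a) {a..b}" if "a \<le> b" for a b
  proof (rule fundamental_theorem_of_calculus_interior_strong[of "{0}"])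
    show "(?k has_vector_derivative \<bar>deriv ?h x\<bar>) (at x)" if "x \<in> {a<..<b} - {0}" for x
      using Dk[of x] abs_deriv[of x] that by (simp add: has_real_derivative_iff_has_vector_derivative)
  qed (use that in \<open>auto intro: continuous_on_subset[OF cont_k]\<close>)
  have abs_int: "deriv ?h absolutely_integrable_on {a..b}" if "a \<le> b" for a b
    using int[OF that] int_abs[OF that] by (auto simp: absolutely_integrable_on_def)
  show aed: "ae_differentiable ?h" unfolding ae_differentiable_def
  proof (intro conjI allI impI int abs_int)
    have "AE x in lebesgue. x \<noteq> (0::real)" by (intro AE_completion AE_lborel_singleton)
    then show "AE x in lebesgue. ?h differentiable at x"
      by eventually_elim (use Dh in \<open>auto simp: real_differentiable_def\<close>)
  qed
  show "finite_weighted_variation m ?h" if "q < real m"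
  proof -
    \<comment> \<open>\<open>deriv\<close> has no known value at \<open>0\<close> when the function
      is not differentiable there, hence the separate case; \<open>g\<close> is Borel whatever that
      value is.\<close>
    define g where "g x = (if x = 0 then \<bar>deriv ?h 0\<bar> else q * \<bar>x\<bar> powr (q - 1))" for x
    have g: "\<bar>deriv ?h x\<bar> = g x" for x by (simp add: g_def abs_deriv)
    have [measurable]: "g \<in> borel_measurable borel" unfolding g_def by measurable
    have "integrable lebesgue (\<lambda>x. indicator {- 1..1} x *\<^sub>R deriv ?h x)"
      using abs_int[of "- 1" 1] by (simp add: set_integrable_def)
    then have "integrable lebesgue (\<lambda>x. \<bar>indicator {- 1..1} x *\<^sub>R deriv ?h x\<bar>)" by (rule integrable_abs)
    then have "integrable lebesgue (\<lambda>x. indicator {- 1..1} x * g x)" by (simp add: abs_mult g)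
    then have int1: "integrable lborel (\<lambda>x. indicator {- 1..1} x * g x)" by (subst (asm) integrable_completion) auto
    have int2: "integrable lborel (\<lambda>x::real. 2 * q * (1 + \<bar>x\<bar>) powr - (real m + 1 - q))"
      using that by (intro integrable_mult_right integrable_one_plus_powr) simp
    have "integrable lborel (\<lambda>x. g x / (1 + \<bar>x\<bar>) ^ m)"
    proof (rule Bochner_Integration.integrable_bound[OF Bochner_Integration.integrable_add[OF int1 int2]])
      show "AE x in lborel. norm (g x / (1 + \<bar>x\<bar>) ^ m)
          \<le> norm (indicator {- 1..1} x * g x + 2 * q * (1 + \<bar>x\<bar>) powr - (real m + 1 - q))"
      proof (rule AE_I2)
        fix x :: real
        have g0: "0 \<le> g x" by (simp add: g[symmetric])
        have r0: "0 \<le> 2 * q * (1 + \<bar>x\<bar>) powr - (real m + 1 - q)" using assms by simp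
        have "g x / (1 + \<bar>x\<bar>) ^ m \<le> indicator {- 1..1} x * g x + 2 * q * (1 + \<bar>x\<bar>) powr - (real m + 1 - q)"
        proof (cases "\<bar>x\<bar> \<le> 1")
          case True
          have "g x / (1 + \<bar>x\<bar>) ^ m \<le> g x" using g0 by (simp add: divide_le_eq mult_le_cancel_left1 one_le_power)
          then show ?thesis using True r0 by (simp add: indicator_def abs_le_iff)
        next
          case False
          \<comment> \<open>The factor \<open>2\<close> pays for negative exponents, where
            \<open>\<bar>x\<bar> \<ge> (1 + \<bar>x\<bar>) / 2\<close> is used and
            \<open>2 powr (1 - q)\<close> is at most \<open>2\<close>.\<close>
          have "\<bar>x\<bar> powr (q - 1) \<le> 2 * (1 + \<bar>x\<bar>) powr (q - 1)"
          proof (cases "1 \<le> q")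
            case True
            then have "\<bar>x\<bar> powr (q - 1) \<le> (1 + \<bar>x\<bar>) powr (q - 1)" by (intro powr_mono2) auto
            also have "\<dots> \<le> 2 * (1 + \<bar>x\<bar>) powr (q - 1)" by simp
            finally show ?thesis .
          next
            case q: False
            have "\<bar>x\<bar> powr (q - 1) \<le> ((1 + \<bar>x\<bar>) / 2) powr (q - 1)"
              using False q by (intro powr_mono2') auto
            also have "\<dots> = 2 powr (1 - q) * (1 + \<bar>x\<bar>) powr (q - 1)"
              by (simp add: powr_divide powr_minus_divide[of 2 "q - 1", simplified] powr_diff)
            also have "\<dots> \<le> 2 powr 1 * (1 + \<bar>x\<bar>) powr (q - 1)"
              using assms by (intro mult_right_mono powr_mono) auto
            finally show ?thesis by simp
          qed
          then have "g x \<le> 2 * q * (1 + \<bar>x\<bar>) powr (q - 1)"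
            using False assms by (auto simp: g_def mult.commute mult.left_commute)
          then have "g x / (1 + \<bar>x\<bar>) ^ m \<le> 2 * q * (1 + \<bar>x\<bar>) powr (q - 1) / (1 + \<bar>x\<bar>) ^ m"
            by (intro divide_right_mono) auto
          also have "\<dots> = 2 * q * (1 + \<bar>x\<bar>) powr (q - 1 - real m)"
            by (simp add: powr_diff powr_realpow)
          finally show ?thesis using False by (auto simp: indicator_def algebra_simps)
        qed
        then show "norm (g x / (1 + \<bar>x\<bar>) ^ m)
          \<le> norm (indicator {- 1..1} x * g x + 2 * q * (1 + \<bar>x\<bar>) powr - (real m + 1 - q))"
          using g0 r0 by (simp add: indicator_def)
      qed
    qed measurable
    then show ?thesis unfolding finite_weighted_variation_def g by (subst integrable_completion) auto
  qed
qed

text \<open>Everything that part (ii) needs to know about the centred sums of a single \<open>\<omega>\<close>.\<close>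

locale near_gaussian_sequence = prob_space M for M :: "'a measure" +
  fixes S :: "nat \<Rightarrow> 'a \<Rightarrow> real" and D :: real and n0 :: nat
  assumes S_meas [measurable]: "\<And>n. S n \<in> borel_measurable M"
    and moments: "\<And>n k. integrable M (\<lambda>x. \<bar>S n x\<bar> ^ k)"
    and D_nonneg: "0 \<le> D"
    and cdf_near: "\<And>n y. n0 \<le> n \<Longrightarrow>
      \<bar>cdf (distr M borel (\<lambda>x. S n x / l2_norm M (S n))) y - std_normal_cdf y\<bar>
        \<le> D / l2_norm M (S n) * exp (- \<bar>y\<bar>)"
    and norm_at_top: "filterlim (\<lambda>n. l2_norm M (S n)) at_top sequentially"
begin

context
  fixes a b :: "nat \<Rightarrow> real"
  assumes a: "bounded (range a)" and b: "(\<lambda>n. b n - l2_norm M (S n)) \<in> O(\<lambda>n. 1)"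
begin

abbreviation "\<sigma> n \<equiv> l2_norm M (S n)"
abbreviation "W \<equiv> normalized_sum S a b"

lemma W_meas [measurable]: "W n \<in> borel_measurable M"
  unfolding normalized_sum_def[abs_def] by measurable

lemma W_moments: "integrable M (\<lambda>x. \<bar>W n x\<bar> ^ k)"
  unfolding normalized_sum_def by (intro integrable_affine_power moments) measurable

text \<open>For large \<open>n\<close> the exponential weight dominates the polynomial one, and one
  more power absorbs the linear factor of the affine correction. The remaining indices are finite in
  number and use the moment bounds, with constants multiplied by \<open>\<sigma> n\<close>.\<close>

lemma nonuniform_bound:
  "\<exists>C\<ge>0. \<forall>n x. admissible_index M S b n \<longrightarrow>
     cdf_error M (W n) x \<le> C * inverse (\<sigma> n) * inverse ((1 + \<bar>x\<bar>) ^ m)"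
proof -
  obtain A where A: "\<And>n. \<bar>a n\<bar> \<le> A" using a unfolding bounded_iff by auto
  have A0: "0 \<le> A" using A[of 0] by linarith
  obtain K where "\<forall>\<^sub>F n in sequentially. \<bar>b n - \<sigma> n\<bar> \<le> K"
    using b by (auto elim!: landau_o.bigE simp: eventually_mono)
  then have "\<forall>\<^sub>F n in sequentially. \<bar>b n - \<sigma> n\<bar> \<le> max 0 K" by (auto elim: eventually_mono)
  moreover have "\<forall>\<^sub>F n in sequentially. 2 * max 0 K + 1 + A \<le> \<sigma> n"
    using norm_at_top by (simp add: filterlim_at_top)
  moreover have "\<forall>\<^sub>F n in sequentially. n0 \<le> n" by (rule eventually_ge_at_top)
  ultimately have "\<forall>\<^sub>F n in sequentially. \<bar>b n - \<sigma> n\<bar> \<le> max 0 K \<and> 2 * max 0 K + 1 + A \<le> \<sigma> n \<and> n0 \<le> n"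
    by eventually_elim auto
  then obtain n1 where n1: "\<And>n. n1 \<le> n \<Longrightarrow> \<bar>b n - \<sigma> n\<bar> \<le> max 0 K"
      "\<And>n. n1 \<le> n \<Longrightarrow> 2 * max 0 K + 1 + A \<le> \<sigma> n" "\<And>n. n1 \<le> n \<Longrightarrow> n0 \<le> n"
    unfolding eventually_sequentially by blast
  define C1 where "C1 = (D + A + max 0 K) * exp 2 * (2 ^ Suc m * fact (Suc m) * exp 1)"
  have C1: "0 \<le> C1" using D_nonneg A0 by (simp add: C1_def)
  have large: "cdf_error M (W n) x \<le> C1 * inverse (\<sigma> n) * inverse ((1 + \<bar>x\<bar>) ^ m)" if "n1 \<le> n" for n x
  proof -
    have \<sigma>: "0 < \<sigma> n" using n1(2)[OF that] A0 by linarith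
    have "cdf_error M (\<lambda>x. (S n x - a n) / b n) x
        \<le> (D + A + max 0 K) * exp 2 / \<sigma> n * ((1 + \<bar>x\<bar>) * exp (- \<bar>x\<bar> / 2))"
      using n1(2)[OF that] A0
      by (intro cdf_error_affine_le S_meas cdf_near n1 that A D_nonneg) auto
    also have "\<dots> \<le> (D + A + max 0 K) * exp 2 / \<sigma> n * (2 ^ Suc m * fact (Suc m) * exp 1 * inverse ((1 + \<bar>x\<bar>) ^ m))"
    proof (rule mult_left_mono)
      show "(1 + \<bar>x\<bar>) * exp (- \<bar>x\<bar> / 2) \<le> 2 ^ Suc m * fact (Suc m) * exp 1 * inverse ((1 + \<bar>x\<bar>) ^ m)"
        using one_plus_power_exp_le[of "\<bar>x\<bar>" "Suc m"] by (simp add: field_simps)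
    qed (use \<sigma> D_nonneg A0 in auto)
    finally show ?thesis by (simp add: C1_def normalized_sum_def[abs_def] divide_inverse mult_ac)
  qed
  have "\<exists>c. \<forall>x. cdf_error M (W n) x \<le> c / (1 + \<bar>x\<bar>) ^ m" for n
    by (intro cdf_error_moment_le W_moments W_meas)
  then obtain c where c: "\<And>n x. cdf_error M (W n) x \<le> c n / (1 + \<bar>x\<bar>) ^ m" by metis
  define C where "C = C1 + (\<Sum>n<n1. \<bar>c n * \<sigma> n\<bar>)"
  have C: "0 \<le> C" "C1 \<le> C" using C1 by (auto simp: C_def sum_nonneg)
  have "cdf_error M (W n) x \<le> C * inverse (\<sigma> n) * inverse ((1 + \<bar>x\<bar>) ^ m)" if "admissible_index M S b n" for n x
  proof (cases "n1 \<le> n")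
    case True
    have "0 < \<sigma> n" using that by (simp add: admissible_index_def)
    then have "C1 * inverse (\<sigma> n) * inverse ((1 + \<bar>x\<bar>) ^ m) \<le> C * inverse (\<sigma> n) * inverse ((1 + \<bar>x\<bar>) ^ m)"
      using C by (intro mult_right_mono) auto
    then show ?thesis using large[OF True, of x] by linarith
  next
    case False
    have \<sigma>: "0 < \<sigma> n" using that by (simp add: admissible_index_def)
    have "\<bar>c n * \<sigma> n\<bar> \<le> (\<Sum>n<n1. \<bar>c n * \<sigma> n\<bar>)" using False by (intro member_le_sum) auto
    then have "c n * \<sigma> n \<le> C" using C1 by (simp add: C_def)
    then have "c n \<le> C * inverse (\<sigma> n)" using \<sigma> by (simp add: field_simps)
    then have "c n / (1 + \<bar>x\<bar>) ^ m \<le> C * inverse (\<sigma> n) / (1 + \<bar>x\<bar>) ^ m" by (intro divide_right_mono) auto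
    from order_trans[OF c this] show ?thesis unfolding divide_inverse .
  qed
  then show ?thesis using C(1) by blast
qed

lemma eventually_admissible: "\<forall>\<^sub>F n in sequentially. admissible_index M S b n"
proof -
  obtain K where "\<forall>\<^sub>F n in sequentially. \<bar>b n - \<sigma> n\<bar> \<le> K"
    using b by (auto elim!: landau_o.bigE simp: eventually_mono)
  moreover have "\<forall>\<^sub>F n in sequentially. K + 1 + \<bar>K\<bar> \<le> \<sigma> n"
    using norm_at_top by (simp add: filterlim_at_top)
  ultimately show ?thesis
    by eventually_elim (auto simp: admissible_index_def)
qed

lemma expectation_bound_ae_differentiable:
  "\<exists>R>0. \<forall>h. ae_differentiable h \<and> finite_weighted_variation m h \<longrightarrow> expectation_bound M S a b m R h"
proof -
  obtain C where C: "0 \<le> C" "\<And>n x. admissible_index M S b n \<Longrightarrow>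
     cdf_error M (W n) x \<le> C * inverse (\<sigma> n) * inverse ((1 + \<bar>x\<bar>) ^ m)"
    using nonuniform_bound[of m] by blast
  \<comment> \<open>\<open>C\<close> may be \<open>0\<close>, whereas a positive constant is asked
    for.\<close>
  have "expectation_bound M S a b m (C + 1) h" if h: "ae_differentiable h" "finite_weighted_variation m h" for h
  proof -
    note rn = real_dist_normal_dist
    have [measurable]: "h \<in> borel_measurable borel"
      using ae_differentiable_continuous[OF h(1)] by (rule borel_measurable_continuous_onI)
    have V: "0 \<le> weighted_variation m h" unfolding weighted_variation_def by (intro integral_nonneg_AE) auto
    \<comment> \<open>Both laws are taken to be normal, and only the integrability is
      extracted.\<close>
    have int_h: "integrable std_normal_distribution h"
      by (rule expectation_diff_weighted_variation(1)[OF rn rn _ _ h, of 0]) (auto simp: std_normal_abs_moment)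
    have E_h: "(\<integral>x. h x \<partial>std_normal_distribution) = (\<integral>x. h x * std_normal_density x \<partial>lborel)"
      by (subst integral_density) (auto simp: mult.commute)
    have "integrable M (\<lambda>y. h (W n y)) \<and> \<bar>(\<integral>y. h (W n y) \<partial>M) - (\<integral>x. h x * std_normal_density x \<partial>lborel)\<bar>
        \<le> (C + 1) * weighted_variation m h / \<sigma> n" if n: "admissible_index M S b n" for n
    proof -
      have \<sigma>: "0 < \<sigma> n" using n by (simp add: admissible_index_def)
      have Q: "real_distribution (distr M borel (W n))" by (rule real_distribution_distr) measurable
      have mom: "integrable (distr M borel (W n)) (\<lambda>y. \<bar>y\<bar> ^ m)"
        using W_moments by (simp add: integrable_distr_eq)
      have close: "\<bar>cdf (distr M borel (W n)) x - std_normal_cdf x\<bar> \<le> C / \<sigma> n / (1 + \<bar>x\<bar>) ^ m" for x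
        using C(2)[OF n, of x] by (simp add: cdf_error_eq divide_inverse)
      note E = expectation_diff_weighted_variation[OF Q rn mom std_normal_abs_moment h close]
      have "C / \<sigma> n * weighted_variation m h \<le> (C + 1) * weighted_variation m h / \<sigma> n"
        using \<sigma> V by (simp add: divide_right_mono mult_right_mono)
      then show ?thesis
        using E(1,3) by (simp add: integrable_distr_eq integral_distr E_h)
    qed
    moreover have "integrable lborel (\<lambda>x. h x * std_normal_density x)"
      using int_h by (simp add: integrable_density mult.commute)
    ultimately show ?thesis unfolding expectation_bound_def by blast
  qed
  then show ?thesis using C(1) by (intro exI[of _ "C + 1"]) auto
qed

text \<open>\<open>m * p > 1\<close> is exactly what makes the \<open>p\<close>-th power of the
  weight integrable.\<close>

lemma Lp_bound:
  fixes p :: real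
  assumes m: "0 < m" and p: "1 / real m < p"
  shows "admissible_index M S b n \<Longrightarrow> integrable lborel (\<lambda>x. cdf_error M (W n) x powr p)"
    and "(\<lambda>n. (\<integral>x. cdf_error M (W n) x powr p \<partial>lborel) powr (1 / p)) \<in> O(\<lambda>n. inverse (\<sigma> n))"
proof -
  have p0: "0 < p" using m p by (metis divide_pos_pos less_trans of_nat_0_less_iff zero_less_one)
  have mp: "1 < real m * p" using m p by (simp add: field_simps)
  obtain C where C: "0 \<le> C" "\<And>n x. admissible_index M S b n \<Longrightarrow>
     cdf_error M (W n) x \<le> C * inverse (\<sigma> n) * inverse ((1 + \<bar>x\<bar>) ^ m)"
    using nonuniform_bound[of m] by blast
  define I where "I = (\<integral>x. (1 + \<bar>x\<bar>) powr - (real m * p) \<partial>(lborel :: real measure))"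
  note intI = integrable_one_plus_powr[OF mp]
  have I: "0 \<le> I" unfolding I_def by (intro integral_nonneg_AE) auto
  have le: "cdf_error M (W n) x powr p \<le> (C * inverse (\<sigma> n)) powr p * (1 + \<bar>x\<bar>) powr - (real m * p)"
    if n: "admissible_index M S b n" for n x
  proof -
    have \<sigma>: "0 < \<sigma> n" using n by (simp add: admissible_index_def)
    have "cdf_error M (W n) x powr p \<le> (C * inverse (\<sigma> n) * inverse ((1 + \<bar>x\<bar>) ^ m)) powr p"
      using C(2)[OF n, of x] p0 by (intro powr_mono2) (auto simp: cdf_error_def)
    also have "\<dots> = (C * inverse (\<sigma> n)) powr p * (inverse ((1 + \<bar>x\<bar>) ^ m)) powr p"
      using C(1) \<sigma> by (intro powr_mult)
    also have "inverse ((1 + \<bar>x\<bar>) ^ m) = (1 + \<bar>x\<bar>) powr - real m"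
      by (simp add: powr_minus powr_realpow)
    finally show ?thesis by (simp add: powr_powr)
  qed
  have [measurable]: "cdf_error M (W n) \<in> borel_measurable borel" for n
    by (rule cdf_error_measurable) measurable
  show int: "integrable lborel (\<lambda>x. cdf_error M (W n) x powr p)" if n: "admissible_index M S b n" for n
  proof (rule Bochner_Integration.integrable_bound)
    show "integrable lborel (\<lambda>x. (C * inverse (\<sigma> n)) powr p * (1 + \<bar>x\<bar>) powr - (real m * p))"
      using intI by simp
    show "AE x in lborel. norm (cdf_error M (W n) x powr p) \<le> norm ((C * inverse (\<sigma> n)) powr p * (1 + \<bar>x\<bar>) powr - (real m * p))"
      using le[OF n] by simp
  qed measurable
  have "\<forall>\<^sub>F n in sequentially. norm ((\<integral>x. cdf_error M (W n) x powr p \<partial>lborel) powr (1 / p))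
      \<le> (C * I powr (1 / p)) * norm (inverse (\<sigma> n))"
    using eventually_admissible
  proof eventually_elim
    case (elim n)
    have \<sigma>: "0 < \<sigma> n" using elim by (simp add: admissible_index_def)
    have "(\<integral>x. cdf_error M (W n) x powr p \<partial>lborel) \<le> (\<integral>x. (C * inverse (\<sigma> n)) powr p * (1 + \<bar>x\<bar>) powr - (real m * p) \<partial>lborel)"
      using intI le[OF elim] by (intro integral_mono int elim) auto
    also have "\<dots> = (C * inverse (\<sigma> n)) powr p * I" by (simp add: I_def)
    finally have "(\<integral>x. cdf_error M (W n) x powr p \<partial>lborel) powr (1 / p) \<le> ((C * inverse (\<sigma> n)) powr p * I) powr (1 / p)"
      using p0 by (intro powr_mono2 integral_nonneg_AE) auto
    also have "\<dots> = C * inverse (\<sigma> n) * I powr (1 / p)"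
      using p0 C(1) \<sigma> I by (simp add: powr_mult powr_powr)
    finally show ?case using \<sigma> by (simp add: mult_ac)
  qed
  then show "(\<lambda>n. (\<integral>x. cdf_error M (W n) x powr p \<partial>lborel) powr (1 / p)) \<in> O(\<lambda>n. inverse (\<sigma> n))"
    by (rule bigoI)
qed

lemma normal_approximation:
  assumes m: "2 \<le> m"
  shows "(\<exists>C. \<forall>n x. admissible_index M S b n \<longrightarrow>
            cdf_error M (normalized_sum S a b n) x
              \<le> C * inverse (l2_norm M (S n)) * inverse ((1 + \<bar>x\<bar>) ^ m)) \<and>
         (\<forall>p::real>1 / real m.
            (\<forall>n. admissible_index M S b n \<longrightarrow>
               integrable lborel (\<lambda>x. cdf_error M (normalized_sum S a b n) x powr p)) \<and>
            (\<lambda>n. (\<integral>x. cdf_error M (normalized_sum S a b n) x powr p \<partial>lborel) powr (1 / p))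
              \<in> O(\<lambda>n. inverse (l2_norm M (S n)))) \<and>
         (\<exists>R>0.
            (\<forall>h. ae_differentiable h \<and> finite_weighted_variation m h \<longrightarrow> expectation_bound M S a b m R h) \<and>
            (\<forall>q::nat<m. expectation_bound M S a b m R (\<lambda>x. x ^ q)) \<and>
            (\<forall>q::real. 0 < q \<and> q < real m \<longrightarrow> expectation_bound M S a b m R (\<lambda>x. \<bar>x\<bar> powr q)))"
proof -
  have "\<exists>R>0. (\<forall>h. ae_differentiable h \<and> finite_weighted_variation m h \<longrightarrow> expectation_bound M S a b m R h) \<and>
            (\<forall>q::nat<m. expectation_bound M S a b m R (\<lambda>x. x ^ q)) \<and>
            (\<forall>q::real. 0 < q \<and> q < real m \<longrightarrow> expectation_bound M S a b m R (\<lambda>x. \<bar>x\<bar> powr q))"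
    using expectation_bound_ae_differentiable[of m] ae_differentiable_power ae_differentiable_abs_powr
      finite_weighted_variation_power[OF _ m] finite_weighted_variation_abs_powr by blast
  moreover have "\<forall>p::real>1 / real m.
            (\<forall>n. admissible_index M S b n \<longrightarrow>
               integrable lborel (\<lambda>x. cdf_error M (normalized_sum S a b n) x powr p)) \<and>
            (\<lambda>n. (\<integral>x. cdf_error M (normalized_sum S a b n) x powr p \<partial>lborel) powr (1 / p))
              \<in> O(\<lambda>n. inverse (l2_norm M (S n)))"
    by (intro allI impI conjI Lp_bound) (use m in auto)
  ultimately show ?thesis using nonuniform_bound[of m] by blast
qed

end
end

section \<open>Cumulants and the growth condition\<close>

text \<open>Cauchy's inequality on circles of radius \<open>\<rho> / 4\<close>, which stay in the
  domain when the centre has modulus at most \<open>\<rho> / 2\<close>. The same half disc serves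
  all orders \<open>n\<close>.\<close>

lemma Cauchy_bound_half:
  assumes "f holomorphic_on ball 0 \<rho>" "\<And>z. z \<in> ball 0 \<rho> \<Longrightarrow> cmod (f z) \<le> B" "0 < \<rho>" "cmod z \<le> \<rho> / 2"
  shows "cmod ((deriv ^^ n) f z) \<le> fact n * B / (\<rho> / 4) ^ n"
proof (rule Cauchy_inequality)
  have "cball z (\<rho> / 4) \<subseteq> ball 0 \<rho>"
  proof
    fix x assume "x \<in> cball z (\<rho> / 4)"
    then have "cmod (z - x) \<le> \<rho> / 4" by (simp add: dist_norm)
    then show "x \<in> ball 0 \<rho>" using assms(3,4) norm_triangle_ineq4[of z "z - x"] by simp
  qed
  then show "f holomorphic_on ball z (\<rho> / 4)" "continuous_on (cball z (\<rho> / 4)) f"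
    using holomorphic_on_subset[OF assms(1)] ball_subset_cball[of z "\<rho> / 4"]
    by (blast intro: holomorphic_on_imp_continuous_on)+
  fix x assume "cmod (z - x) = \<rho> / 4"
  then show "cmod (f x) \<le> B"
    using \<open>cball z (\<rho> / 4) \<subseteq> ball 0 \<rho>\<close> assms(2)[of x] by (auto simp: dist_norm)
qed (use assms in auto)

text \<open>The mean value inequality, used twice. It is meant for \<open>F\<close> the derivative
  of a cumulant function, where the subtracted coefficients are mean and variance.\<close>

lemma first_order_remainder:
  fixes F :: "complex \<Rightarrow> complex"
  assumes "F holomorphic_on ball 0 \<rho>" "0 < r" "r < \<rho>"
    and bound: "\<And>z. cmod z \<le> r \<Longrightarrow> cmod ((deriv ^^ 2) F z) \<le> B" and v: "cmod v \<le> r"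
  shows "cmod (F v - F 0 - deriv F 0 * v) \<le> B * (cmod v)\<^sup>2"
proof -
  have D: "((deriv ^^ n) F has_field_derivative (deriv ^^ Suc n) F z) (at z)" if "cmod z \<le> r" for n z
    using assms that by (intro has_field_derivative_higher_deriv[of F "ball 0 \<rho>"]) auto
  have B: "0 \<le> B" using order_trans[OF norm_ge_zero bound[of 0]] \<open>0 < r\<close> by simp
  have D1: "cmod (deriv F z - deriv F 0) \<le> B * cmod v" if "cmod z \<le> cmod v" for z
  proof -
    have "cmod (deriv F z - deriv F 0) \<le> B * cmod (z - 0)"
    proof (rule field_differentiable_bound[where S = "cball 0 (cmod z)"])
      fix w :: complex assume "w \<in> cball 0 (cmod z)"
      then have w: "cmod w \<le> r" using that v by simp
      show "(deriv F has_field_derivative (deriv ^^ 2) F w) (at w within cball 0 (cmod z))"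
        using D[OF w, of 1] by (simp add: numeral_2_eq_2 has_field_derivative_at_within)
      show "cmod ((deriv ^^ 2) F w) \<le> B" by (rule bound[OF w])
    qed auto
    also have "\<dots> \<le> B * cmod v" using that B by (simp add: mult_left_mono)
    finally show ?thesis .
  qed
  have "cmod ((F v - deriv F 0 * v) - (F 0 - deriv F 0 * 0)) \<le> (B * cmod v) * cmod (v - 0)"
  proof (rule field_differentiable_bound[where S = "cball 0 (cmod v)"])
    fix w :: complex assume "w \<in> cball 0 (cmod v)"
    then have w: "cmod w \<le> cmod v" by simp
    have "(F has_field_derivative deriv F w) (at w)" using D[of w 0] w v by simp
    then have "((\<lambda>w. F w - deriv F 0 * w) has_field_derivative deriv F w - deriv F 0) (at w)"
      by (auto intro!: derivative_eq_intros)
    then show "((\<lambda>w. F w - deriv F 0 * w) has_field_derivative deriv F w - deriv F 0) (at w within cball 0 (cmod v))"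
      by (rule has_field_derivative_at_within)
    show "cmod (deriv F w - deriv F 0) \<le> B * cmod v" by (rule D1[OF w])
  qed auto
  then show ?thesis by (simp add: power2_eq_square algebra_simps)
qed

section \<open>Moment generating functions and their logarithms\<close>

lemma exp_abs_le: "exp \<bar>y\<bar> \<le> exp y + exp (- y)" for y :: real
  by (cases "0 \<le> y") auto

context prob_space
begin

lemma integrable_exp_abs:
  fixes X :: "'a \<Rightarrow> real"
  assumes [measurable]: "X \<in> borel_measurable M"
    and "integrable M (\<lambda>x. exp (r * X x))" "integrable M (\<lambda>x. exp (- r * X x))"
  shows "integrable M (\<lambda>x. exp (\<bar>r\<bar> * \<bar>X x\<bar>))"
proof (rule Bochner_Integration.integrable_bound[OF Bochner_Integration.integrable_add[OF assms(2,3)]])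
  show "AE x in M. norm (exp (\<bar>r\<bar> * \<bar>X x\<bar>)) \<le> norm (exp (r * X x) + exp (- r * X x))"
    using exp_abs_le[of "r * X x" for x] by (auto simp: abs_mult)
qed measurable

lemma integrable_power_of_exp_abs:
  fixes X :: "'a \<Rightarrow> real"
  assumes [measurable]: "X \<in> borel_measurable M"
    and "0 < r" "integrable M (\<lambda>x. exp (r * \<bar>X x\<bar>))"
  shows "integrable M (\<lambda>x. \<bar>X x\<bar> ^ k)"
proof (rule Bochner_Integration.integrable_bound[OF integrable_mult_right[OF assms(3), of "fact k / r ^ k"]])
  have "\<bar>X x\<bar> ^ k \<le> fact k / r ^ k * exp (r * \<bar>X x\<bar>)" for x
    using power_le_fact_exp[of "r * \<bar>X x\<bar>" k] \<open>0 < r\<close> by (simp add: power_mult_distrib field_simps)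
  then show "AE x in M. norm (\<bar>X x\<bar> ^ k) \<le> norm (fact k / r ^ k * exp (r * \<bar>X x\<bar>))"
    using \<open>0 < r\<close> by (simp add: abs_mult power_abs)
qed measurable

text \<open>The partial sums of the exponential series are dominated by
  \<open>exp (r * \<bar>X x\<bar>)\<close>, so the series may be integrated term by term.\<close>

lemma mgf_sums:
  fixes X :: "'a \<Rightarrow> real"
  assumes X[measurable]: "X \<in> borel_measurable M"
    and int: "integrable M (\<lambda>x. exp (r * \<bar>X x\<bar>))" and z: "cmod z < r"
  shows "(\<lambda>k. complex_of_real (\<integral>x. X x ^ k \<partial>M) / fact k * z ^ k) sums (\<integral>x. exp (z * X x) \<partial>M)"
proof -
  have r: "0 < r" using z norm_ge_zero[of z] by linarith
  have Xk: "integrable M (\<lambda>x. X x ^ k)" for k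
    using integrable_power_of_exp_abs[OF X r int, of k]
    by (rule Bochner_Integration.integrable_bound) (auto simp: power_abs)
  have partial: "(\<Sum>k<n. complex_of_real (\<integral>x. X x ^ k \<partial>M) / fact k * z ^ k)
      = (\<integral>x. (\<Sum>k<n. (z * X x) ^ k /\<^sub>R fact k) \<partial>M)" for n
  proof -
    have "(\<integral>x. (\<Sum>k<n. (z * X x) ^ k /\<^sub>R fact k) \<partial>M) = (\<integral>x. (\<Sum>k<n. (z ^ k / fact k) * complex_of_real (X x ^ k)) \<partial>M)"
      by (intro Bochner_Integration.integral_cong refl sum.cong)
         (simp add: power_mult_distrib scaleR_conv_of_real field_simps)
    also have "\<dots> = (\<Sum>k<n. (\<integral>x. (z ^ k / fact k) * complex_of_real (X x ^ k) \<partial>M))"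
      using Xk by (intro Bochner_Integration.integral_sum integrable_mult_right integrable_of_real)
    also have "\<dots> = (\<Sum>k<n. (z ^ k / fact k) * complex_of_real (\<integral>x. X x ^ k \<partial>M))"
      by (simp only: integral_mult_right_zero integral_complex_of_real)
    finally show ?thesis by (simp add: mult_ac)
  qed
  have "(\<lambda>n. \<integral>x. (\<Sum>k<n. (z * X x) ^ k /\<^sub>R fact k) \<partial>M) \<longlonglongrightarrow> (\<integral>x. exp (z * X x) \<partial>M)"
  proof (rule integral_dominated_convergence[where w = "\<lambda>x. exp (r * \<bar>X x\<bar>)"])
    show "AE x in M. (\<lambda>n. \<Sum>k<n. (z * X x) ^ k /\<^sub>R fact k) \<longlonglongrightarrow> exp (z * X x)"
      using exp_converges[of "z * complex_of_real (X x)" for x] by (simp add: sums_def)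
    show "AE x in M. norm (\<Sum>k<n. (z * X x) ^ k /\<^sub>R fact k) \<le> exp (r * \<bar>X x\<bar>)" for n
    proof (rule AE_I2)
      fix x
      have "norm (\<Sum>k<n. (z * X x) ^ k /\<^sub>R fact k) \<le> (\<Sum>k<n. (cmod z * \<bar>X x\<bar>) ^ k /\<^sub>R fact k)"
        by (rule order_trans[OF norm_sum]) (simp add: norm_power norm_mult)
      also have "\<dots> \<le> (\<Sum>k. (cmod z * \<bar>X x\<bar>) ^ k /\<^sub>R fact k)"
        using exp_converges[of "cmod z * \<bar>X x\<bar>"] by (intro sum_le_suminf) (auto simp: sums_iff)
      also have "\<dots> = exp (cmod z * \<bar>X x\<bar>)" using exp_converges[of "cmod z * \<bar>X x\<bar>"] by (simp add: sums_iff)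
      also have "\<dots> \<le> exp (r * \<bar>X x\<bar>)" using z by (simp add: mult_right_mono)
      finally show "norm (\<Sum>k<n. (z * X x) ^ k /\<^sub>R fact k) \<le> exp (r * \<bar>X x\<bar>)" .
    qed
  qed (use int in auto)
  then show ?thesis by (simp only: sums_def partial)
qed

lemma
  fixes X :: "'a \<Rightarrow> real"
  assumes X[measurable]: "X \<in> borel_measurable M"
    and int: "integrable M (\<lambda>x. exp (r * \<bar>X x\<bar>))" and r: "0 < r"
  shows mgf_holomorphic: "(\<lambda>z. \<integral>x. exp (z * X x) \<partial>M) holomorphic_on ball 0 r"
    and higher_deriv_mgf: "(deriv ^^ k) (\<lambda>z::complex. \<integral>x. exp (z * X x) \<partial>M) 0 = complex_of_real (\<integral>x. X x ^ k \<partial>M)"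
proof -
  let ?F = "\<lambda>z::complex. \<integral>x. exp (z * X x) \<partial>M"
  show "?F holomorphic_on ball 0 r"
    by (rule power_series_holomorphic[where a = "\<lambda>k. complex_of_real (\<integral>x. X x ^ k \<partial>M) / fact k"])
       (use mgf_sums[OF X int] in simp)
  define A where "A = Abs_fps (\<lambda>k. complex_of_real (\<integral>x. X x ^ k \<partial>M) / fact k)"
  have "?F has_fps_expansion A"
  proof (rule has_fps_expansionI)
    have "\<forall>\<^sub>F z in nhds 0. z \<in> ball (0 :: complex) r" using r by (intro eventually_nhds_in_open) auto
    then show "\<forall>\<^sub>F z in nhds 0. (\<lambda>n. fps_nth A n * z ^ n) sums ?F z"
      by eventually_elim (use mgf_sums[OF X int] in \<open>simp add: A_def\<close>)
  qed
  then have "fps_nth A k = (deriv ^^ k) ?F 0 / fact k" by (rule fps_nth_fps_expansion)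
  then show "(deriv ^^ k) ?F 0 = complex_of_real (\<integral>x. X x ^ k \<partial>M)" by (simp add: A_def)
qed

end

text \<open>\<open>K\<close> is a holomorphic logarithm normalised at \<open>0\<close>. It is asked
  for as a function of its own, since on a fixed disc the generating function of a long sum may wind
  around \<open>0\<close>, out of reach of \<open>Ln\<close>.\<close>

definition log_mgf_bound :: "'a measure \<Rightarrow> ('a \<Rightarrow> real) \<Rightarrow> real \<Rightarrow> real \<Rightarrow> bool" where
  "log_mgf_bound M X \<rho> B \<longleftrightarrow> X \<in> borel_measurable M \<and>
     (\<exists>K. K holomorphic_on ball 0 \<rho> \<and> K 0 = 0 \<and>
       (\<forall>z\<in>ball 0 \<rho>. cmod (K z) \<le> B \<and> integrable M (\<lambda>x. exp (z * complex_of_real (X x))) \<and>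
          (\<integral>x. exp (z * complex_of_real (X x)) \<partial>M) = exp (K z)))"

text \<open>Differentiating \<open>exp (K z)\<close> twice where \<open>K\<close> vanishes: the
  relation between the first two moments and the first two cumulants.\<close>

lemma deriv_log:
  assumes K: "K holomorphic_on ball 0 \<rho>" "K 0 = 0" "0 < \<rho>"
    and F: "\<And>z. z \<in> ball 0 \<rho> \<Longrightarrow> F z = exp (K z)"
  shows "deriv F 0 = deriv K 0" "(deriv ^^ 2) F 0 = (deriv ^^ 2) K 0 + (deriv K 0)\<^sup>2"
proof -
  have D: "((deriv ^^ n) K has_field_derivative (deriv ^^ Suc n) K z) (at z)" if "z \<in> ball 0 \<rho>" for n z
    using K that by (intro has_field_derivative_higher_deriv[of K "ball 0 \<rho>"]) auto
  have DK: "(K has_field_derivative deriv K z) (at z)" if "z \<in> ball 0 \<rho>" for z using D[OF that, of 0] by simp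
  have DK': "(deriv K has_field_derivative (deriv ^^ 2) K z) (at z)" if "z \<in> ball 0 \<rho>" for z
    using D[OF that, of 1] by (simp add: numeral_2_eq_2)
  have dF: "deriv F z = exp (K z) * deriv K z" if z: "z \<in> ball 0 \<rho>" for z
  proof (rule DERIV_imp_deriv)
    have "((\<lambda>z. exp (K z)) has_field_derivative exp (K z) * deriv K z) (at z)"
      using DK[OF z] by (auto intro!: derivative_eq_intros)
    then show "(F has_field_derivative exp (K z) * deriv K z) (at z)"
      by (rule has_field_derivative_transform_within_open[where S = "ball 0 \<rho>"]) (use F z in auto)
  qed
  have z0: "0 \<in> ball 0 \<rho>" using \<open>0 < \<rho>\<close> by simp
  show "deriv F 0 = deriv K 0" using dF[OF z0] K(2) by simp
  have "((\<lambda>z. exp (K z) * deriv K z) has_field_derivative (deriv ^^ 2) K 0 + (deriv K 0)\<^sup>2) (at 0)"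
    using DK[OF z0] DK'[OF z0] K(2) by (auto intro!: derivative_eq_intros simp: power2_eq_square)
  then have "(deriv F has_field_derivative (deriv ^^ 2) K 0 + (deriv K 0)\<^sup>2) (at 0)"
    by (rule has_field_derivative_transform_within_open[where S = "ball 0 \<rho>"]) (use dF z0 in auto)
  then show "(deriv ^^ 2) F 0 = (deriv ^^ 2) K 0 + (deriv K 0)\<^sup>2"
    by (simp add: numeral_2_eq_2 DERIV_imp_deriv)
qed

text \<open>Mean value inequality with Cauchy's bound for the derivative. It keeps uniformly
  bounded, normalised functions near \<open>1\<close> on a disc of controlled size.\<close>

lemma norm_diff_one_le:
  assumes F: "F holomorphic_on ball 0 r" "\<And>z. z \<in> ball 0 r \<Longrightarrow> cmod (F z) \<le> B" "0 < r" "F 0 = 1"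
    and z: "cmod z \<le> r / 2"
  shows "cmod (F z - 1) \<le> 4 * B / r * cmod z"
proof -
  have "cmod (F z - F 0) \<le> 4 * B / r * cmod (z - 0)"
  proof (rule field_differentiable_bound[where S = "cball 0 (r / 2)"])
    fix w :: complex assume "w \<in> cball 0 (r / 2)"
    then have w: "cmod w \<le> r / 2" by simp
    then have "w \<in> ball 0 r" using F(3) by simp
    then have "(F has_field_derivative deriv F w) (at w)" using F(1) by (intro holomorphic_derivI) auto
    then show "(F has_field_derivative deriv F w) (at w within cball 0 (r / 2))" by (rule has_field_derivative_at_within)
    show "cmod (deriv F w) \<le> 4 * B / r"
      using Cauchy_bound_half[OF F(1,2,3) w, of 1] by (simp add: mult.commute)
  qed (use z F(3) in auto)
  then show ?thesis using F(4) by simp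
qed

context prob_space
begin

lemma log_mgf_derivs:
  fixes K :: "complex \<Rightarrow> complex"
  assumes K: "X \<in> borel_measurable M" "K holomorphic_on ball 0 \<rho>" "K 0 = 0" "0 < \<rho>"
    "\<And>z. z \<in> ball 0 \<rho> \<Longrightarrow> integrable M (\<lambda>x. exp (z * complex_of_real (X x)))"
    "\<And>z. z \<in> ball 0 \<rho> \<Longrightarrow> (\<integral>x. exp (z * complex_of_real (X x)) \<partial>M) = exp (K z)"
  shows "deriv K 0 = complex_of_real (expectation X)"
    and "(deriv ^^ 2) K 0 = complex_of_real (variance X)"
    and "integrable M (\<lambda>x. \<bar>X x\<bar> ^ k)"
proof -
  note [measurable] = K(1)
  have exp_int: "integrable M (\<lambda>x. exp (t * X x))" if "\<bar>t\<bar> < \<rho>" for t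
  proof -
    have "integrable M (\<lambda>x. Re (exp (complex_of_real t * complex_of_real (X x))))"
      using that by (intro integrable_Re K(5)) simp
    then show ?thesis by (simp add: Re_exp)
  qed
  have int: "integrable M (\<lambda>x. exp (\<rho> / 2 * \<bar>X x\<bar>))"
    using integrable_exp_abs[OF K(1), of "\<rho> / 2"] exp_int[of "\<rho> / 2"] exp_int[of "- \<rho> / 2"] K(4) by simp
  have r: "0 < \<rho> / 2" using K(4) by simp
  let ?F = "\<lambda>z. \<integral>x. exp (z * complex_of_real (X x)) \<partial>M"
  show dK: "deriv K 0 = complex_of_real (expectation X)"
    using deriv_log(1)[OF K(2,3,4,6)] higher_deriv_mgf[OF K(1) int r, of 1] by simp
  show pow: "integrable M (\<lambda>x. \<bar>X x\<bar> ^ k)" for k by (rule integrable_power_of_exp_abs[OF K(1) r int])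
  have i1: "integrable M X" using pow[of 1] by (simp add: integrable_abs_iff)
  have i2: "integrable M (\<lambda>x. (X x)\<^sup>2)" using pow[of 2] by simp
  have "complex_of_real (\<integral>x. X x ^ 2 \<partial>M) = (deriv ^^ 2) K 0 + (deriv K 0)\<^sup>2"
    using deriv_log(2)[OF K(2,3,4,6)] higher_deriv_mgf[OF K(1) int r, of 2] by simp
  then have "(deriv ^^ 2) K 0 = complex_of_real ((\<integral>x. X x ^ 2 \<partial>M) - (expectation X)\<^sup>2)"
    by (simp add: dK)
  then show "(deriv ^^ 2) K 0 = complex_of_real (variance X)"
    by (simp only: variance_eq[OF i1 i2])
qed

lemma log_mgf_boundE:
  assumes "log_mgf_bound M X \<rho> B" "0 < \<rho>"
  obtains K where "X \<in> borel_measurable M" "K holomorphic_on ball 0 \<rho>" "K 0 = 0"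
    "\<And>z. z \<in> ball 0 \<rho> \<Longrightarrow> cmod (K z) \<le> B"
    "\<And>z. z \<in> ball 0 \<rho> \<Longrightarrow> integrable M (\<lambda>x. exp (z * complex_of_real (X x)))"
    "\<And>z. z \<in> ball 0 \<rho> \<Longrightarrow> (\<integral>x. exp (z * complex_of_real (X x)) \<partial>M) = exp (K z)"
    "deriv K 0 = complex_of_real (expectation X)"
    "(deriv ^^ 2) K 0 = complex_of_real (variance X)"
    "\<And>k. integrable M (\<lambda>x. \<bar>X x\<bar> ^ k)"
proof -
  obtain K where K: "X \<in> borel_measurable M" "K holomorphic_on ball 0 \<rho>" "K 0 = 0"
    "\<And>z. z \<in> ball 0 \<rho> \<Longrightarrow> cmod (K z) \<le> B"
    "\<And>z. z \<in> ball 0 \<rho> \<Longrightarrow> integrable M (\<lambda>x. exp (z * complex_of_real (X x)))"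
    "\<And>z. z \<in> ball 0 \<rho> \<Longrightarrow> (\<integral>x. exp (z * complex_of_real (X x)) \<partial>M) = exp (K z)"
    using assms(1) unfolding log_mgf_bound_def by blast
  note derivs = log_mgf_derivs[OF K(1-3) assms(2) K(5,6)]
  have d1: "deriv K 0 = complex_of_real (expectation X)" by (rule derivs(1)) assumption+
  have d2: "(deriv ^^ 2) K 0 = complex_of_real (variance X)" by (rule derivs(2)) assumption+
  have pow: "integrable M (\<lambda>x. \<bar>X x\<bar> ^ k)" for k by (rule derivs(3)) assumption+
  show ?thesis
    by (rule that[of K]) (fact K d1 d2 pow)+
qed

text \<open>Centring subtracts a linear term from the logarithm. Cauchy's bound
  \<open>4 * B / \<rho>\<close> for the mean, times \<open>\<rho>\<close>, accounts for the
  additional \<open>4 * B\<close>.\<close>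

lemma log_mgf_bound_centre:
  assumes "log_mgf_bound M X \<rho> B" "0 < \<rho>"
  shows "log_mgf_bound M (\<lambda>x. X x - expectation X) \<rho> (5 * B)"
proof -
  obtain K where K: "X \<in> borel_measurable M" "K holomorphic_on ball 0 \<rho>" "K 0 = 0"
    "\<And>z. z \<in> ball 0 \<rho> \<Longrightarrow> cmod (K z) \<le> B"
    "\<And>z. z \<in> ball 0 \<rho> \<Longrightarrow> integrable M (\<lambda>x. exp (z * complex_of_real (X x)))"
    "\<And>z. z \<in> ball 0 \<rho> \<Longrightarrow> (\<integral>x. exp (z * complex_of_real (X x)) \<partial>M) = exp (K z)"
    "deriv K 0 = complex_of_real (expectation X)"
    by (rule log_mgf_boundE[OF assms]) (rule that; assumption)
  define e where "e = expectation X"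
  note [measurable] = K(1)
  have e_le: "\<bar>e\<bar> \<le> 4 * B / \<rho>"
    using Cauchy_bound_half[OF K(2,4) assms(2), of 0 1] assms(2) by (simp add: K(7) e_def mult.commute)
  let ?K = "\<lambda>z. K z - z * complex_of_real e"
  have eq: "exp (z * complex_of_real (X x - e)) = exp (- z * complex_of_real e) * exp (z * complex_of_real (X x))" for x z
    by (simp add: exp_add[symmetric] algebra_simps)
  have "?K holomorphic_on ball 0 \<rho>" by (intro holomorphic_intros K(2))
  moreover have "cmod (?K z) \<le> 5 * B" if "z \<in> ball 0 \<rho>" for z
  proof -
    have "cmod (z * complex_of_real e) \<le> \<rho> * (4 * B / \<rho>)"
      unfolding norm_mult using e_le that assms(2) by (intro mult_mono) auto
    then show ?thesis using K(4)[OF that] norm_triangle_ineq4[of "K z" "z * complex_of_real e"] assms(2) by simp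
  qed
  moreover have "integrable M (\<lambda>x. exp (z * complex_of_real (X x - e)))"
     "(\<integral>x. exp (z * complex_of_real (X x - e)) \<partial>M) = exp (?K z)" if "z \<in> ball 0 \<rho>" for z
    unfolding eq using K(5)[OF that] K(6)[OF that] by (auto simp: exp_diff exp_minus field_simps)
  ultimately show ?thesis
    unfolding log_mgf_bound_def e_def[symmetric] using K(3) by (intro conjI exI[of _ ?K] ballI) auto
qed

text \<open>The required branch is \<open>K (\<i> t / s) + t\<^sup>2 / 2\<close>. Each derivative
  brings a factor \<open>1 / s\<close>, the bound of \<open>K\<close> is proportional to
  \<open>s\<^sup>2\<close>, and from the third derivative on the quadratic term is gone; this
  produces the exponent \<open>j - 2\<close>.\<close>

lemma growth_conditionI:
  fixes S :: "nat \<Rightarrow> 'a \<Rightarrow> real"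
  assumes "0 < \<rho>"
    and bound: "\<And>n. l2_norm M (S n) > 0 \<Longrightarrow> log_mgf_bound M (S n) \<rho> (c * (l2_norm M (S n))\<^sup>2)"
  shows "growth_condition M S m"
  unfolding growth_condition_def
proof (rule ballI)
  fix j assume j: "j \<in> {3..m + 1}"
  define C where "C = \<bar>fact j * c / (\<rho> / 4) ^ j\<bar> + 1"
  show "\<exists>C>0. \<exists>\<epsilon>>0. \<forall>n. l2_norm M (S n) > 0 \<longrightarrow>
        (let s = l2_norm M (S n); I = {- \<epsilon> * s..\<epsilon> * s} in
         \<exists>\<Lambda> :: nat \<Rightarrow> real \<Rightarrow> complex.
           continuous_on I (\<Lambda> 0) \<and> \<Lambda> 0 0 = 0 \<and>
           (\<forall>t\<in>I. exp (\<Lambda> 0 t - complex_of_real (t\<^sup>2 / 2)) = char (distr M borel (S n)) (t / s)) \<and>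
           (\<forall>i<j. \<forall>t\<in>I. (\<Lambda> i has_vector_derivative \<Lambda> (Suc i) t) (at t within I)) \<and>
           (\<forall>t\<in>I. cmod (\<Lambda> j t) \<le> C / s ^ (j - 2)))"
  proof (intro exI conjI allI impI)
    show "0 < C" unfolding C_def by (rule add_nonneg_pos) auto
    show "0 < \<rho> / 2" using assms by simp
    fix n assume sn: "l2_norm M (S n) > 0"
    define s where "s = l2_norm M (S n)"
    define I where "I = {- (\<rho> / 2) * s..\<rho> / 2 * s}"
    have s: "0 < s" using sn by (simp add: s_def)
    obtain K where K: "S n \<in> borel_measurable M" "K holomorphic_on ball 0 \<rho>" "K 0 = 0"
      "\<And>z. z \<in> ball 0 \<rho> \<Longrightarrow> cmod (K z) \<le> c * s\<^sup>2"
      "\<And>z. z \<in> ball 0 \<rho> \<Longrightarrow> (\<integral>x. exp (z * complex_of_real (S n x)) \<partial>M) = exp (K z)"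
      using bound[OF sn] unfolding log_mgf_bound_def s_def[symmetric] by blast
    define w where "w t = \<i> * complex_of_real t / complex_of_real s" for t
    have w_le: "cmod (w t) \<le> \<rho> / 2" if "t \<in> I" for t
    proof -
      have "\<bar>t\<bar> \<le> \<rho> / 2 * s" using that by (auto simp: I_def)
      then show ?thesis using s by (simp add: w_def norm_divide norm_mult field_simps)
    qed
    have w_ball: "w t \<in> ball 0 \<rho>" if "t \<in> I" for t using w_le[OF that] assms(1) by simp
    \<comment> \<open>The successive derivatives of \<open>t\<^sup>2 / 2\<close>.\<close>
    define q :: "nat \<Rightarrow> real \<Rightarrow> complex" where
      "q i t = (if i = 0 then t\<^sup>2 / 2 else if i = 1 then t else if i = 2 then 1 else 0)" for i t
    define \<Lambda> where "\<Lambda> i t = (\<i> / complex_of_real s) ^ i * (deriv ^^ i) K (w t) + q i t" for i t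
    have q: "(q i has_vector_derivative q (Suc i) t) (at t within I)" for i t
    proof -
      consider "i = 0" | "i = 1" | "i = 2" | "3 \<le> i" by linarith
      then show ?thesis
      proof cases
        case 1
        have "((\<lambda>t. complex_of_real (t\<^sup>2 / 2)) has_vector_derivative complex_of_real t) (at t within I)"
          by (intro has_vector_derivative_of_real) (auto intro!: derivative_eq_intros)
        then show ?thesis using 1 by (simp add: q_def[abs_def])
      next
        case 2
        have "((\<lambda>t. complex_of_real t) has_vector_derivative complex_of_real 1) (at t within I)"
          by (intro has_vector_derivative_of_real) (auto intro!: derivative_eq_intros)
        then show ?thesis using 2 by (simp add: q_def[abs_def])
      qed (auto simp: q_def[abs_def])
    qed
    have deriv: "(\<Lambda> i has_vector_derivative \<Lambda> (Suc i) t) (at t within I)" if "t \<in> I" for i t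
    proof -
      have "((deriv ^^ i) K has_field_derivative (deriv ^^ Suc i) K (w t)) (at (w t))"
        using K(2) w_ball[OF that] by (intro has_field_derivative_higher_deriv[of K "ball 0 \<rho>"]) auto
      moreover have "(w has_vector_derivative \<i> / complex_of_real s) (at t within I)"
      proof -
        have "((\<lambda>t. complex_of_real t) has_vector_derivative complex_of_real 1) (at t within I)"
          by (intro has_vector_derivative_of_real) (auto intro!: derivative_eq_intros)
        from has_vector_derivative_mult_right[OF this, of "\<i> / complex_of_real s"]
        show ?thesis by (simp add: w_def[abs_def])
      qed
      ultimately have "((deriv ^^ i) K \<circ> w has_vector_derivative (\<i> / complex_of_real s) * (deriv ^^ Suc i) K (w t)) (at t within I)"
        by (rule field_vector_diff_chain_within[OF _ has_field_derivative_at_within, rotated])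
      from has_vector_derivative_add[OF has_vector_derivative_mult_right[OF this, of "(\<i> / complex_of_real s) ^ i"] q]
      show ?thesis unfolding \<Lambda>_def[abs_def] by (simp add: o_def mult_ac)
    qed
    have "continuous_on I (\<Lambda> 0)"
      using deriv[of _ 0] by (auto simp: continuous_on_eq_continuous_within intro: has_vector_derivative_continuous)
    moreover have "\<Lambda> 0 0 = 0" by (simp add: \<Lambda>_def w_def q_def K(3))
    moreover have "exp (\<Lambda> 0 t - complex_of_real (t\<^sup>2 / 2)) = char (distr M borel (S n)) (t / s)" if "t \<in> I" for t
    proof -
      have "char (distr M borel (S n)) (t / s) = (\<integral>x. exp (w t * complex_of_real (S n x)) \<partial>M)"
        using K(1) by (simp add: char_def integral_distr w_def mult_ac)
      then show ?thesis using K(5)[OF w_ball[OF that]] by (simp add: \<Lambda>_def q_def)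
    qed
    moreover have "cmod (\<Lambda> j t) \<le> C / s ^ (j - 2)" if "t \<in> I" for t
    proof -
      have "cmod (\<Lambda> j t) = cmod ((deriv ^^ j) K (w t)) / s ^ j"
        using j s by (simp add: \<Lambda>_def q_def norm_mult norm_power norm_divide power_divide)
      also have "\<dots> \<le> (fact j * (c * s\<^sup>2) / (\<rho> / 4) ^ j) / s ^ j"
        using Cauchy_bound_half[OF K(2,4) assms(1) w_le[OF that], of j] s by (intro divide_right_mono) auto
      also have "\<dots> = (fact j * c / (\<rho> / 4) ^ j) * (s\<^sup>2 / s ^ j)" by simp
      also have "s\<^sup>2 / s ^ j = 1 / s ^ (j - 2)"
      proof -
        have "3 \<le> j" using j by simp
        then have "j = 2 + (j - 2)" by arith
        then have "s ^ j = s\<^sup>2 * s ^ (j - 2)" by (metis power_add)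
        then show ?thesis using s by simp
      qed
      also have "(fact j * c / (\<rho> / 4) ^ j) * (1 / s ^ (j - 2)) \<le> C * (1 / s ^ (j - 2))"
      proof (rule mult_right_mono)
        show "fact j * c / (\<rho> / 4) ^ j \<le> C" unfolding C_def by linarith
      qed (use s in simp)
      finally show ?thesis by simp
    qed
    ultimately show "let s = l2_norm M (S n); I = {- (\<rho> / 2) * s..\<rho> / 2 * s} in
         \<exists>\<Lambda> :: nat \<Rightarrow> real \<Rightarrow> complex.
           continuous_on I (\<Lambda> 0) \<and> \<Lambda> 0 0 = 0 \<and>
           (\<forall>t\<in>I. exp (\<Lambda> 0 t - complex_of_real (t\<^sup>2 / 2)) = char (distr M borel (S n)) (t / s)) \<and>
           (\<forall>i<j. \<forall>t\<in>I. (\<Lambda> i has_vector_derivative \<Lambda> (Suc i) t) (at t within I)) \<and>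
           (\<forall>t\<in>I. cmod (\<Lambda> j t) \<le> C / s ^ (j - 2))"
      unfolding Let_def s_def[symmetric] I_def[symmetric] using deriv by blast
  qed
qed

text \<open>With mean \<open>0\<close> and variance \<open>s\<^sup>2\<close>, the first-order Taylor
  polynomial of \<open>deriv K\<close> at \<open>0\<close> is \<open>s\<^sup>2 * v\<close>, and
  after scaling it cancels against the derivative of \<open>w\<^sup>2 / 2\<close>. The rest is
  controlled by the third derivative of \<open>K\<close>, hence \<open>6 = fact 3\<close> and the
  cube of the radius.\<close>

lemma near_gaussian_normalized:
  fixes X :: "'a \<Rightarrow> real"
  assumes "0 < \<rho>" "0 \<le> c" and X: "log_mgf_bound M X \<rho> (c * s\<^sup>2)"
    and mean: "expectation X = 0" and s: "variance X = s\<^sup>2" "0 < s"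
  shows "near_gaussian (\<rho> / 2) (6 * c / (\<rho> / 4) ^ 3) s (distr M borel (\<lambda>x. X x / s))"
proof -
  obtain K where K: "X \<in> borel_measurable M" "K holomorphic_on ball 0 \<rho>" "K 0 = 0"
    "\<And>z. z \<in> ball 0 \<rho> \<Longrightarrow> cmod (K z) \<le> c * s\<^sup>2"
    "\<And>z. z \<in> ball 0 \<rho> \<Longrightarrow> integrable M (\<lambda>x. exp (z * complex_of_real (X x)))"
    "\<And>z. z \<in> ball 0 \<rho> \<Longrightarrow> (\<integral>x. exp (z * complex_of_real (X x)) \<partial>M) = exp (K z)"
    "deriv K 0 = complex_of_real (expectation X)"
    "(deriv ^^ 2) K 0 = complex_of_real (variance X)"
    by (rule log_mgf_boundE[OF X assms(1)]) (rule that; assumption)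
  note [measurable] = K(1)
  define \<kappa> where "\<kappa> w = K (w / of_real s) - w\<^sup>2 / 2" for w
  have s': "complex_of_real s \<noteq> 0" using s by simp
  have ball: "w / of_real s \<in> ball 0 \<rho>" "cmod (w / of_real s) < \<rho> / 2" if "w \<in> ball 0 (\<rho> / 2 * s)" for w :: complex
  proof -
    have "cmod w < \<rho> / 2 * s" using that by simp
    then have "cmod w / s < \<rho> / 2" using s(2) by (simp only: pos_divide_less_eq)
    then show "cmod (w / of_real s) < \<rho> / 2" using s(2) by (simp add: norm_divide)
    then show "w / of_real s \<in> ball 0 \<rho>" using assms(1) by simp
  qed
  have DK: "(K has_field_derivative deriv K v) (at v)" if "v \<in> ball 0 \<rho>" for v
    using K(2) that by (intro holomorphic_derivI) auto
  have D\<kappa>: "(\<kappa> has_field_derivative deriv K (w / of_real s) / of_real s - w) (at w)" if "w \<in> ball 0 (\<rho> / 2 * s)" for w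
  proof -
    have "((\<lambda>w. w / of_real s) has_field_derivative 1 / of_real s) (at w)"
      using s' by (auto intro!: derivative_eq_intros)
    from DERIV_chain2[OF DK[OF ball(1)[OF that]] this]
    show ?thesis unfolding \<kappa>_def[abs_def] by (auto intro!: derivative_eq_intros)
  qed
  have "\<kappa> holomorphic_on ball 0 (\<rho> / 2 * s)"
    unfolding holomorphic_on_open[OF open_ball] using D\<kappa> by blast
  moreover have "\<kappa> 0 = 0" by (simp add: \<kappa>_def K(3))
  moreover have "cmod (deriv \<kappa> w) \<le> 6 * c / (\<rho> / 4) ^ 3 * (cmod w)\<^sup>2 / s" if w: "w \<in> ball 0 (\<rho> / 2 * s)" for w
  proof -
    define v where "v = w / of_real s"
    have "cmod (deriv K v - deriv K 0 - deriv (deriv K) 0 * v) \<le> fact 3 * (c * s\<^sup>2) / (\<rho> / 4) ^ 3 * (cmod v)\<^sup>2"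
    proof (rule first_order_remainder[where \<rho> = \<rho> and r = "\<rho> / 2"])
      show "deriv K holomorphic_on ball 0 \<rho>" using K(2) by (intro holomorphic_deriv) auto
      show "cmod v \<le> \<rho> / 2" using ball(2)[OF w] by (simp add: v_def)
      fix z :: complex assume "cmod z \<le> \<rho> / 2"
      from Cauchy_bound_half[OF K(2,4) assms(1) this, of 3]
      show "cmod ((deriv ^^ 2) (deriv K) z) \<le> fact 3 * (c * s\<^sup>2) / (\<rho> / 4) ^ 3"
        by (simp add: numeral_3_eq_3 numeral_2_eq_2)
    qed (use assms in auto)
    also have "deriv K v - deriv K 0 - deriv (deriv K) 0 * v = of_real s * deriv \<kappa> w"
      using s' DERIV_imp_deriv[OF D\<kappa>[OF w]] K(7,8) mean s(1)
      by (simp add: v_def numeral_2_eq_2 power2_eq_square field_simps)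
    finally have "s * cmod (deriv \<kappa> w) \<le> 6 * (c * s\<^sup>2) / (\<rho> / 4) ^ 3 * (cmod w / s)\<^sup>2"
      using s by (simp add: norm_mult v_def norm_divide fact_numeral)
    also have "\<dots> = s * (6 * c / (\<rho> / 4) ^ 3 * (cmod w)\<^sup>2 / s)"
      using s by (simp add: power_divide)
    finally show ?thesis by (simp only: mult_le_cancel_left_pos[OF s(2)])
  qed
  moreover have "integrable (distr M borel (\<lambda>x. X x / s)) (\<lambda>y. exp (w * complex_of_real y))"
    "(\<integral>y. exp (w * complex_of_real y) \<partial>distr M borel (\<lambda>x. X x / s)) = exp (w\<^sup>2 / 2 + \<kappa> w)"
    if "w \<in> ball 0 (\<rho> / 2 * s)" for w
    using K(5,6)[OF ball(1)[OF that]] by (auto simp: integrable_distr_eq integral_distr \<kappa>_def)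
  moreover have "real_distribution (distr M borel (\<lambda>x. X x / s))" by (rule real_distribution_distr) measurable
  ultimately show ?thesis unfolding near_gaussian_def using s(2) by blast
qed

text \<open>Linear growth of the variance turns the bound \<open>c * n\<close> on the cumulant
  function into a multiple of the variance itself, the form that the growth condition and the
  Gaussian approximation take as input.\<close>

lemma limit_laws_of_log_mgf_bound:
  fixes S :: "nat \<Rightarrow> 'a \<Rightarrow> real"
  assumes "0 < \<rho>" "0 \<le> c" and S: "\<And>n. log_mgf_bound M (S n) \<rho> (c * real n)"
    and var: "(\<lambda>n. variance (S n) / real n) \<longlonglongrightarrow> v" "0 < v"
  defines "S0 \<equiv> \<lambda>n x. S n x - expectation (S n)"
  shows "growth_condition M S0 m" "\<exists>D n0. near_gaussian_sequence M S0 D n0"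
proof -
  have S_meas[measurable]: "S n \<in> borel_measurable M" for n using S[of n] by (simp add: log_mgf_bound_def)
  have S_moments: "integrable M (\<lambda>x. \<bar>S n x\<bar> ^ k)" for n k
    by (rule log_mgf_boundE[OF S[of n] assms(1)])
  have S_int: "integrable M (S n)" for n
    using S_moments[of n 1] by (simp add: integrable_abs_iff)
  have S0_bound: "log_mgf_bound M (S0 n) \<rho> (5 * (c * real n))" for n
    unfolding S0_def by (rule log_mgf_bound_centre[OF S assms(1)])
  have S0_moments: "integrable M (\<lambda>x. \<bar>S0 n x\<bar> ^ k)" for n k
    by (rule log_mgf_boundE[OF S0_bound[of n] assms(1)])
  have S0_meas[measurable]: "S0 n \<in> borel_measurable M" for n unfolding S0_def by measurable
  have S0_mean: "expectation (S0 n) = 0" for n unfolding S0_def using S_int[of n] by (simp add: prob_space)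
  let ?s = "\<lambda>n. l2_norm M (S0 n)"
  have s2: "(?s n)\<^sup>2 = variance (S n)" for n
    unfolding l2_norm_def S0_def by (intro real_sqrt_pow2 integral_nonneg_AE) auto
  have varS0: "variance (S0 n) = (?s n)\<^sup>2" for n
    unfolding s2 S0_mean by (simp add: S0_def)
  have s_nonneg: "0 \<le> ?s n" for n by (simp add: l2_norm_def)
  have "\<forall>\<^sub>F n in sequentially. v / 2 < variance (S n) / real n"
    using var by (intro order_tendstoD) auto
  moreover have "\<forall>\<^sub>F n::nat in sequentially. 0 < n" by (rule eventually_gt_at_top)
  ultimately have ev: "\<forall>\<^sub>F n in sequentially. v / 2 * real n \<le> (?s n)\<^sup>2"
    by eventually_elim (simp add: s2 field_simps)
  then obtain n1 where n1: "\<And>n. n1 \<le> n \<Longrightarrow> v / 2 * real n \<le> (?s n)\<^sup>2"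
    unfolding eventually_sequentially by blast
  \<comment> \<open>The sum covers the finitely many \<open>n\<close> before the linear growth sets
    in; terms with variance \<open>0\<close> are \<open>0\<close> by the convention on
    division.\<close>
  define c' where "c' = 5 * c * (2 / v) + (\<Sum>n<n1. 5 * c * real n / (?s n)\<^sup>2)"
  have c': "0 \<le> c'" unfolding c'_def using assms by (intro add_nonneg_nonneg sum_nonneg) auto
  have le: "5 * (c * real n) \<le> c' * (?s n)\<^sup>2" if "0 < ?s n" for n
  proof (cases "n1 \<le> n")
    case True
    have "5 * (c * real n) = 5 * c * (2 / v) * (v / 2 * real n)" using var by simp
    also have "\<dots> \<le> 5 * c * (2 / v) * (?s n)\<^sup>2" using n1[OF True] assms var by (intro mult_left_mono) auto
    also have "\<dots> \<le> c' * (?s n)\<^sup>2" unfolding c'_def using assms by (intro mult_right_mono) (auto intro!: sum_nonneg)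
    finally show ?thesis .
  next
    case False
    have "5 * c * real n / (?s n)\<^sup>2 \<le> (\<Sum>n<n1. 5 * c * real n / (?s n)\<^sup>2)"
      using False assms by (intro member_le_sum) auto
    also have "\<dots> \<le> c'" unfolding c'_def using assms var by simp
    finally show ?thesis using that by (simp add: field_simps)
  qed
  have S0_bound': "log_mgf_bound M (S0 n) \<rho> (c' * (?s n)\<^sup>2)" if "0 < ?s n" for n
    using S0_bound[of n] le[OF that] unfolding log_mgf_bound_def by (meson order_trans)
  show "growth_condition M S0 m" by (rule growth_conditionI[OF assms(1) S0_bound'])
  have "filterlim (\<lambda>n. (?s n)\<^sup>2) at_top sequentially"
  proof (rule filterlim_at_top_mono[OF _ ev])
    show "filterlim (\<lambda>n. v / 2 * real n) at_top sequentially"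
      using var by (intro filterlim_tendsto_pos_mult_at_top[OF tendsto_const] filterlim_real_sequentially) auto
  qed
  then have "filterlim (\<lambda>n. sqrt ((?s n)\<^sup>2)) at_top sequentially"
    by (rule filterlim_compose[OF sqrt_at_top])
  then have lim: "filterlim ?s at_top sequentially" using s_nonneg by simp
  obtain D s0 where D: "0 \<le> D" "0 < s0"
    "\<And>Q s x. near_gaussian (\<rho> / 2) (6 * c' / (\<rho> / 4) ^ 3) s Q \<Longrightarrow> s0 \<le> s \<Longrightarrow>
       \<bar>cdf Q x - std_normal_cdf x\<bar> \<le> D / s * exp (- \<bar>x\<bar>)"
  proof (rule near_gaussian_cdf)
    show "0 < \<rho> / 2" "0 \<le> 6 * c' / (\<rho> / 4) ^ 3" using assms(1) c' by auto
  qed blast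
  obtain n0 where n0: "\<And>n. n0 \<le> n \<Longrightarrow> s0 \<le> ?s n"
    using lim unfolding filterlim_at_top eventually_sequentially by blast
  have "near_gaussian_sequence M S0 D n0"
  proof unfold_locales
    show "\<bar>cdf (distr M borel (\<lambda>x. S0 n x / ?s n)) y - std_normal_cdf y\<bar> \<le> D / ?s n * exp (- \<bar>y\<bar>)"
      if "n0 \<le> n" for n y
    proof -
      have "0 < ?s n" using n0[OF that] D(2) by linarith
      then show ?thesis
        using n0[OF that] assms(1) c' by (intro D(3) near_gaussian_normalized S0_bound' S0_mean varS0)
    qed
  qed (use S0_moments D lim in auto)
  then show "\<exists>D n0. near_gaussian_sequence M S0 D n0" by blast
qed

end

section \<open>Iterated transfer operators\<close>

text \<open>Meant for scalar functions obtained from an \<open>analytic_into\<close> family by a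
  bounded functional: convergence in norm becomes convergence of a scalar power series.\<close>

lemma holomorphic_on_of_local_expansions:
  fixes F :: "complex \<Rightarrow> complex"
  assumes "\<And>z0. z0 \<in> D \<Longrightarrow> \<exists>\<rho>>0. \<exists>c. \<forall>z\<in>ball z0 \<rho>. (\<lambda>n. F z - (\<Sum>k<n. (z - z0) ^ k * c k)) \<longlonglongrightarrow> 0"
  shows "F holomorphic_on D"
proof -
  have "F field_differentiable (at z0 within D)" if z0: "z0 \<in> D" for z0
  proof -
    obtain \<rho> c where \<rho>: "0 < \<rho>" and lim: "\<And>z. z \<in> ball z0 \<rho> \<Longrightarrow> (\<lambda>n. F z - (\<Sum>k<n. (z - z0) ^ k * c k)) \<longlonglongrightarrow> 0"
      using assms[OF z0] by blast
    have "F holomorphic_on ball z0 \<rho>"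
    proof (rule power_series_holomorphic[where a = c])
      fix w assume "w \<in> ball z0 \<rho>"
      from tendsto_diff[OF tendsto_const lim[OF this], of "F w"]
      show "(\<lambda>n. c n * (w - z0) ^ n) sums F w" by (simp add: sums_def mult.commute)
    qed
    then have "F field_differentiable (at z0)" using \<rho> by (intro holomorphic_on_imp_differentiable_at) auto
    then show ?thesis by (rule field_differentiable_at_within)
  qed
  then show ?thesis unfolding holomorphic_on_def by blast
qed

section \<open>Function spaces, their duals and iterated maps\<close>

lemma function_normed_spaceD:
  assumes "function_normed_space E V N"
  shows "g \<in> V \<Longrightarrow> h \<in> V \<Longrightarrow> (\<lambda>x. g x + h x) \<in> V" "g \<in> V \<Longrightarrow> (\<lambda>x. c * g x) \<in> V"
    "g \<in> V \<Longrightarrow> N (\<lambda>x. c * g x) = cmod c * N g" "g \<in> V \<Longrightarrow> 0 \<le> N g" "(\<lambda>x. 0) \<in> V"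
  using assms by (simp_all add: function_normed_space_def)

lemma analytic_intoE:
  assumes "analytic_into V N D F" "z0 \<in> D"
  obtains r a where "0 < r" "\<And>k. a k \<in> V" "\<And>z. z \<in> ball z0 r \<Longrightarrow> F z \<in> V"
    "\<And>z. z \<in> ball z0 r \<Longrightarrow> (\<lambda>n. N (\<lambda>y. F z y - (\<Sum>k<n. (z - z0) ^ k * a k y))) \<longlonglongrightarrow> 0"
proof -
  have "\<exists>\<rho>>0. \<exists>a. (\<forall>k. a k \<in> V) \<and> (\<forall>z\<in>ball z0 \<rho>. F z \<in> V \<and>
        (\<lambda>n. N (\<lambda>y. F z y - (\<Sum>k<n. (z - z0) ^ k * a k y))) \<longlonglongrightarrow> 0)"
    using assms(1) unfolding analytic_into_def by (rule bspec[OF _ assms(2)])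
  then obtain r a where r: "0 < r" and a: "\<forall>k. a k \<in> V" and z: "\<forall>z\<in>ball z0 r. F z \<in> V \<and>
        (\<lambda>n. N (\<lambda>y. F z y - (\<Sum>k<n. (z - z0) ^ k * a k y))) \<longlonglongrightarrow> 0" by (elim exE conjE)
  show ?thesis by (rule that[OF r spec[OF a] conjunct1[OF bspec[OF z]] conjunct2[OF bspec[OF z]]])
qed

lemma function_normed_space_lincomb:
  fixes n :: nat
  assumes V: "function_normed_space E V N" and "g \<in> V" "\<And>k. a k \<in> V"
  shows "(\<lambda>x. g x - (\<Sum>k<n. c k * a k x)) \<in> V"
proof (induction n)
  case (Suc n)
  have "(\<lambda>x. (g x - (\<Sum>k<n. c k * a k x)) + (- c n) * a n x) \<in> V"
    by (intro function_normed_spaceD[OF V] Suc assms)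
  then show ?case by (simp add: algebra_simps)
qed (use assms in simp)

text \<open>The remainders of a norm-convergent expansion have to be known to lie in the dual before
  \<open>dual_norm\<close> says anything about them.\<close>

lemma dual_space_lincomb:
  fixes n :: nat
  assumes "\<phi> \<in> dual_space V N" "\<And>k. a k \<in> dual_space V N" and N: "\<And>g. g \<in> V \<Longrightarrow> 0 \<le> N g"
  shows "(\<lambda>g. \<phi> g - (\<Sum>k<n. c k * a k g)) \<in> dual_space V N"
proof (induction n)
  case (Suc n)
  let ?\<psi> = "\<lambda>g. \<phi> g - (\<Sum>k<n. c k * a k g)"
  obtain K1 where K1: "\<And>g. g \<in> V \<Longrightarrow> cmod (?\<psi> g) \<le> K1 * N g" using Suc unfolding dual_space_def by blast
  obtain K2 where K2: "\<And>g. g \<in> V \<Longrightarrow> cmod (a n g) \<le> K2 * N g" using assms(2)[of n] unfolding dual_space_def by blast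
  have "cmod (?\<psi> g - c n * a n g) \<le> (K1 + cmod (c n) * K2) * N g" if "g \<in> V" for g
  proof -
    have "cmod (?\<psi> g - c n * a n g) \<le> cmod (?\<psi> g) + cmod (c n) * cmod (a n g)"
      by (metis norm_mult norm_triangle_ineq4)
    also have "\<dots> \<le> K1 * N g + cmod (c n) * (K2 * N g)"
      using K1 K2 that by (intro add_mono mult_left_mono) auto
    finally show ?thesis by (simp add: algebra_simps)
  qed
  moreover have "?\<psi> (\<lambda>x. s * g x + t * h x) - c n * a n (\<lambda>x. s * g x + t * h x)
      = s * (?\<psi> g - c n * a n g) + t * (?\<psi> h - c n * a n h)" if "g \<in> V" "h \<in> V" for g h s t
  proof -
    have "?\<psi> (\<lambda>x. s * g x + t * h x) = s * ?\<psi> g + t * ?\<psi> h" using Suc that unfolding dual_space_def by blast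
    moreover have "a n (\<lambda>x. s * g x + t * h x) = s * a n g + t * a n h"
      using assms(2)[of n] that unfolding dual_space_def by blast
    ultimately show ?thesis by (simp only:) (simp add: algebra_simps)
  qed
  ultimately have "(\<lambda>g. ?\<psi> g - c n * a n g) \<in> dual_space V N" unfolding dual_space_def by blast
  then show ?case by (simp add: algebra_simps)
qed (use assms in simp)

text \<open>\<open>dual_norm\<close> is a supremum of reals, so boundedness of the set comes first.
  Functions with \<open>N g = 0\<close> cannot be normalised; on them the functional vanishes by its
  own bound.\<close>

lemma cmod_le_dual_norm:
  assumes V: "function_normed_space E V N" and \<phi>: "\<phi> \<in> dual_space V N" and g: "g \<in> V"
  shows "cmod (\<phi> g) \<le> dual_norm V N \<phi> * N g" "0 \<le> dual_norm V N \<phi>"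
proof -
  obtain K where K: "\<And>g. g \<in> V \<Longrightarrow> cmod (\<phi> g) \<le> K * N g" using \<phi> unfolding dual_space_def by blast
  have lin: "\<phi> (\<lambda>x. s * g x + t * h x) = s * \<phi> g + t * \<phi> h" if "g \<in> V" "h \<in> V" for g h s t
    using \<phi> that unfolding dual_space_def by blast
  have bdd: "bdd_above ((\<lambda>g. cmod (\<phi> g)) ` {g \<in> V. N g \<le> 1})"
  proof (rule bdd_aboveI2)
    fix g assume "g \<in> {g \<in> V. N g \<le> 1}"
    then have g: "g \<in> V" "N g \<le> 1" by auto
    have "cmod (\<phi> g) \<le> K * N g" by (rule K[OF g(1)])
    also have "\<dots> \<le> \<bar>K\<bar> * 1" using g function_normed_spaceD(4)[OF V g(1)] by (intro mult_mono) auto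
    finally show "cmod (\<phi> g) \<le> \<bar>K\<bar>" by simp
  qed
  have unit: "cmod (\<phi> g) \<le> dual_norm V N \<phi>" if "g \<in> V" "N g \<le> 1" for g
    unfolding dual_norm_def using that by (intro cSUP_upper bdd) auto
  have N0: "N (\<lambda>x. 0) = 0"
    using function_normed_spaceD(3)[OF V function_normed_spaceD(5)[OF V], of 0] by simp
  show "0 \<le> dual_norm V N \<phi>"
    using unit[OF function_normed_spaceD(5)[OF V]] N0 order_trans[OF norm_ge_zero] by fastforce
  show "cmod (\<phi> g) \<le> dual_norm V N \<phi> * N g"
  proof (cases "N g = 0")
    case True
    then show ?thesis using K[OF g] by simp
  next
    case False
    then have Ng: "0 < N g" using function_normed_spaceD(4)[OF V g] by simp
    let ?c = "complex_of_real (inverse (N g))"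
    have "cmod (\<phi> (\<lambda>x. ?c * g x)) \<le> dual_norm V N \<phi>"
      using Ng g by (intro unit) (auto simp: function_normed_spaceD[OF V] simp del: of_real_inverse)
    moreover have "\<phi> (\<lambda>x. ?c * g x) = ?c * \<phi> g" using lin[OF g g, of ?c 0] by simp
    ultimately have "cmod (?c * \<phi> g) \<le> dual_norm V N \<phi>" by (simp only:)
    moreover have "cmod (?c * \<phi> g) = inverse (N g) * cmod (\<phi> g)" using Ng by (simp only: norm_mult norm_of_real) simp
    ultimately have "inverse (N g) * cmod (\<phi> g) \<le> dual_norm V N \<phi>" by (simp only:)
    then show ?thesis using Ng by (simp add: field_simps)
  qed
qed

lemma fibre_iterate_Suc_shift: "fibre_iterate \<theta> T \<omega> (Suc n) x = fibre_iterate \<theta> T (\<theta> \<omega>) n (T \<omega> x)"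
  by (induction n) (auto simp: funpow_swap1)

lemma birkhoff_sum_Suc:
  "birkhoff_sum \<theta> T f \<omega> (Suc n) x = birkhoff_sum \<theta> T f \<omega> n x + f ((\<theta> ^^ n) \<omega>) (fibre_iterate \<theta> T \<omega> n x)"
  by (simp add: birkhoff_sum_def)

text \<open>Jensen's inequality. It reduces exponential moments of a sum to those of single terms at
  \<open>n\<close> times the parameter.\<close>

lemma exp_sum_le_average:
  fixes a :: "nat \<Rightarrow> real"
  assumes "0 < n"
  shows "exp (\<Sum>j<n. a j) \<le> (\<Sum>j<n. exp (real n * a j)) / real n"
proof -
  have "exp (\<Sum>j<n. (1 / real n) *\<^sub>R (real n * a j)) \<le> (\<Sum>j<n. (1 / real n) * exp (real n * a j))"
    using assms by (intro convex_on_sum[OF _ _ exp_convex]) auto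
  then show ?thesis using assms by (simp add: sum_divide_distrib)
qed

text \<open>The almost sure hypotheses, holding everywhere on a set \<open>\<Omega>\<close> that is invariant under \<open>\<theta>\<close>.\<close>

locale uniform_transfer =
  fixes \<Omega> :: "'w set" and \<theta> :: "'w \<Rightarrow> 'w" and E :: "'w \<Rightarrow> 'x set"
    and T :: "'w \<Rightarrow> 'x \<Rightarrow> 'x" and mu :: "'w \<Rightarrow> 'x measure"
    and L :: "'w \<Rightarrow> ('x \<Rightarrow> complex) \<Rightarrow> 'x \<Rightarrow> complex"
    and B :: "'w \<Rightarrow> ('x \<Rightarrow> complex) set" and N :: "'w \<Rightarrow> ('x \<Rightarrow> complex) \<Rightarrow> real"
    and f :: "'w \<Rightarrow> 'x \<Rightarrow> real"
    and lam :: "'w \<Rightarrow> complex \<Rightarrow> complex" and h :: "'w \<Rightarrow> complex \<Rightarrow> 'x \<Rightarrow> complex"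
    and \<nu> :: "'w \<Rightarrow> complex \<Rightarrow> ('x \<Rightarrow> complex) \<Rightarrow> complex"
    and \<rho> K C \<delta> :: real
  assumes \<theta>_\<Omega>: "\<omega> \<in> \<Omega> \<Longrightarrow> \<theta> \<omega> \<in> \<Omega>"
    and prob_mu: "\<omega> \<in> \<Omega> \<Longrightarrow> prob_space (mu \<omega>)"
    and space_mu: "\<omega> \<in> \<Omega> \<Longrightarrow> space (mu \<omega>) = E \<omega>"
    and T_meas: "\<omega> \<in> \<Omega> \<Longrightarrow> T \<omega> \<in> mu \<omega> \<rightarrow>\<^sub>M mu (\<theta> \<omega>)"
    and distr_T: "\<omega> \<in> \<Omega> \<Longrightarrow> distr (mu \<omega>) (mu (\<theta> \<omega>)) (T \<omega>) = mu (\<theta> \<omega>)"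
    and f_meas: "\<omega> \<in> \<Omega> \<Longrightarrow> f \<omega> \<in> borel_measurable (mu \<omega>)"
    and normed: "\<omega> \<in> \<Omega> \<Longrightarrow> function_normed_space (E \<omega>) (B \<omega>) (N \<omega>)"
    and B_integrable: "\<omega> \<in> \<Omega> \<Longrightarrow> g \<in> B \<omega> \<Longrightarrow> integrable (mu \<omega>) g"
    and L_B: "\<omega> \<in> \<Omega> \<Longrightarrow> g \<in> B \<omega> \<Longrightarrow> L \<omega> g \<in> B (\<theta> \<omega>)"
    and duality: "\<omega> \<in> \<Omega> \<Longrightarrow> g \<in> B \<omega> \<Longrightarrow> u \<in> borel_measurable (mu (\<theta> \<omega>)) \<Longrightarrow> bounded (u ` E (\<theta> \<omega>)) \<Longrightarrow>
       (\<integral>x. g x * u (T \<omega> x) \<partial>mu \<omega>) = (\<integral>y. u y * L \<omega> g y \<partial>mu (\<theta> \<omega>))"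
    and exp_B: "\<omega> \<in> \<Omega> \<Longrightarrow> (\<lambda>x. exp (z * complex_of_real (f \<omega> x))) \<in> B \<omega>"
    and exp_N: "\<omega> \<in> \<Omega> \<Longrightarrow> cmod z < \<rho> \<Longrightarrow> N \<omega> (\<lambda>x. exp (z * complex_of_real (f \<omega> x))) \<le> K"
    and mult_B: "\<omega> \<in> \<Omega> \<Longrightarrow> cmod z < \<rho> \<Longrightarrow> g \<in> B \<omega> \<Longrightarrow> (\<lambda>x. g x * exp (z * complex_of_real (f \<omega> x))) \<in> B \<omega>"
    and lam_nz: "\<omega> \<in> \<Omega> \<Longrightarrow> cmod z < \<rho> \<Longrightarrow> lam \<omega> z \<noteq> 0"
    and h_B: "\<omega> \<in> \<Omega> \<Longrightarrow> cmod z < \<rho> \<Longrightarrow> h \<omega> z \<in> B \<omega>"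
    and \<nu>_dual: "\<omega> \<in> \<Omega> \<Longrightarrow> cmod z < \<rho> \<Longrightarrow> \<nu> \<omega> z \<in> dual_space (B \<omega>) (N \<omega>)"
    and h_analytic: "\<omega> \<in> \<Omega> \<Longrightarrow> analytic_into (B \<omega>) (N \<omega>) (ball 0 \<rho>) (h \<omega>)"
    and \<nu>_analytic: "\<omega> \<in> \<Omega> \<Longrightarrow> analytic_into (dual_space (B \<omega>) (N \<omega>)) (dual_norm (B \<omega>) (N \<omega>)) (ball 0 \<rho>) (\<nu> \<omega>)"
    and h_N: "\<omega> \<in> \<Omega> \<Longrightarrow> cmod z < \<rho> \<Longrightarrow> N \<omega> (h \<omega> z) \<le> K"
    and \<nu>_N: "\<omega> \<in> \<Omega> \<Longrightarrow> cmod z < \<rho> \<Longrightarrow> dual_norm (B \<omega>) (N \<omega>) (\<nu> \<omega> z) \<le> K"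
    and h_0: "\<omega> \<in> \<Omega> \<Longrightarrow> x \<in> E \<omega> \<Longrightarrow> h \<omega> 0 x = 1"
    and \<nu>_0: "\<omega> \<in> \<Omega> \<Longrightarrow> g \<in> B \<omega> \<Longrightarrow> \<nu> \<omega> 0 g = (\<integral>x. g x \<partial>mu \<omega>)"
    and spectral: "\<omega> \<in> \<Omega> \<Longrightarrow> cmod z < \<rho> \<Longrightarrow> 1 \<le> n \<Longrightarrow> g \<in> B \<omega> \<Longrightarrow>
           N ((\<theta> ^^ n) \<omega>) (\<lambda>y. inverse (\<Prod>j<n. lam ((\<theta> ^^ j) \<omega>) z) *
                fibre_iterate \<theta> (twisted_transfer L f z) \<omega> n g y - \<nu> \<omega> z g * h ((\<theta> ^^ n) \<omega>) z y)
           \<le> C * \<delta> ^ n * N \<omega> g"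
    and pos: "0 < \<rho>" "1 \<le> K" "0 < C" "0 < \<delta>" "\<delta> < 1"
begin

abbreviation "S \<equiv> birkhoff_sum \<theta> T f"
abbreviation "Tn \<equiv> fibre_iterate \<theta> T"

definition mgf :: "'w \<Rightarrow> nat \<Rightarrow> complex \<Rightarrow> complex" where
  "mgf \<omega> n z = (\<integral>x. exp (z * complex_of_real (S \<omega> n x)) \<partial>mu \<omega>)"

lemma funpow_\<Omega>: "\<omega> \<in> \<Omega> \<Longrightarrow> (\<theta> ^^ n) \<omega> \<in> \<Omega>"
  by (induction n) (auto simp: \<theta>_\<Omega>)

lemma Tn_meas: "\<omega> \<in> \<Omega> \<Longrightarrow> Tn \<omega> n \<in> mu \<omega> \<rightarrow>\<^sub>M mu ((\<theta> ^^ n) \<omega>)"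
  by (induction n) (auto intro: measurable_comp T_meas funpow_\<Omega>)

lemma distr_Tn: "\<omega> \<in> \<Omega> \<Longrightarrow> distr (mu \<omega>) (mu ((\<theta> ^^ n) \<omega>)) (Tn \<omega> n) = mu ((\<theta> ^^ n) \<omega>)"
proof (induction n)
  case 0
  then show ?case by (simp add: distr_id2 id_def)
next
  case (Suc n)
  let ?\<omega> = "(\<theta> ^^ n) \<omega>"
  have "distr (distr (mu \<omega>) (mu ?\<omega>) (Tn \<omega> n)) (mu (\<theta> ?\<omega>)) (T ?\<omega>) = distr (mu \<omega>) (mu (\<theta> ?\<omega>)) (T ?\<omega> \<circ> Tn \<omega> n)"
    by (rule distr_distr[OF T_meas[OF funpow_\<Omega>[OF Suc.prems]] Tn_meas[OF Suc.prems]])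
  then show ?case
    unfolding fibre_iterate.simps(2) funpow.simps(2) o_apply
    using Suc distr_T[OF funpow_\<Omega>[OF Suc.prems]] by (simp only:)
qed

lemma f_Tn_meas: "\<omega> \<in> \<Omega> \<Longrightarrow> (\<lambda>x. f ((\<theta> ^^ n) \<omega>) (Tn \<omega> n x)) \<in> borel_measurable (mu \<omega>)"
  using measurable_comp[OF Tn_meas f_meas[OF funpow_\<Omega>]] by (simp add: o_def)

lemma S_meas: "\<omega> \<in> \<Omega> \<Longrightarrow> S \<omega> n \<in> borel_measurable (mu \<omega>)"
  unfolding birkhoff_sum_def[abs_def] by (intro borel_measurable_sum f_Tn_meas)

text \<open>At \<open>z = 0\<close> the functional \<open>\<nu>\<close> is integration, so its dual
  bound controls integrals by norms uniformly in \<open>\<omega>\<close>.\<close>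

lemma integral_B_le:
  assumes "\<omega> \<in> \<Omega>" "g \<in> B \<omega>"
  shows "cmod (\<integral>x. g x \<partial>mu \<omega>) \<le> K * N \<omega> g"
proof -
  have "cmod (\<nu> \<omega> 0 g) \<le> dual_norm (B \<omega>) (N \<omega>) (\<nu> \<omega> 0) * N \<omega> g"
    using assms pos by (intro cmod_le_dual_norm(1)[OF normed] \<nu>_dual) auto
  also have "\<dots> \<le> K * N \<omega> g"
    using assms pos by (intro mult_right_mono \<nu>_N function_normed_spaceD(4)[OF normed]) auto
  finally show ?thesis using \<nu>_0[OF assms] by simp
qed

text \<open>The norm bound on \<open>exp (z f)\<close> becomes a bound \<open>K\<^sup>2\<close> on
  exponential moments; the absolute value takes both signs, hence the factor
  \<open>2\<close>.\<close>

lemma exp_f_integrable: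
  assumes "\<omega> \<in> \<Omega>"
  shows "integrable (mu \<omega>) (\<lambda>x. exp (r * \<bar>f \<omega> x\<bar>))"
    and "\<bar>r\<bar> < \<rho> \<Longrightarrow> (\<integral>x. exp (r * \<bar>f \<omega> x\<bar>) \<partial>mu \<omega>) \<le> 2 * K\<^sup>2"
proof -
  interpret prob_space "mu \<omega>" by (rule prob_mu[OF assms])
  note [measurable] = f_meas[OF assms]
  have e: "integrable (mu \<omega>) (\<lambda>x. exp (r * f \<omega> x))" "\<bar>r\<bar> < \<rho> \<Longrightarrow> (\<integral>x. exp (r * f \<omega> x) \<partial>mu \<omega>) \<le> K\<^sup>2" for r
  proof -
    have i: "integrable (mu \<omega>) (\<lambda>x. exp (complex_of_real r * complex_of_real (f \<omega> x)))"
      by (rule B_integrable[OF assms exp_B[OF assms]])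
    have eq: "exp (complex_of_real r * complex_of_real (f \<omega> x)) = complex_of_real (exp (r * f \<omega> x))" for x
      by (simp only: of_real_mult[symmetric] exp_of_real)
    show i': "integrable (mu \<omega>) (\<lambda>x. exp (r * f \<omega> x))" using integrable_Re[OF i] unfolding eq by simp
    assume r: "\<bar>r\<bar> < \<rho>"
    have "(\<integral>x. exp (r * f \<omega> x) \<partial>mu \<omega>) \<le> cmod (\<integral>x. exp (complex_of_real r * complex_of_real (f \<omega> x)) \<partial>mu \<omega>)"
      unfolding eq by simp
    also have "\<dots> \<le> K * N \<omega> (\<lambda>x. exp (complex_of_real r * complex_of_real (f \<omega> x)))"
      by (rule integral_B_le[OF assms exp_B[OF assms]])
    also have "\<dots> \<le> K * K" using exp_N[OF assms, of "complex_of_real r"] r pos by (intro mult_left_mono) auto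
    finally show "(\<integral>x. exp (r * f \<omega> x) \<partial>mu \<omega>) \<le> K\<^sup>2" by (simp add: power2_eq_square)
  qed
  have le: "exp (r * \<bar>f \<omega> x\<bar>) \<le> exp (r * f \<omega> x) + exp (- r * f \<omega> x)" for r x
    by (cases "0 \<le> f \<omega> x") auto
  have dom: "integrable (mu \<omega>) (\<lambda>x. exp (r * f \<omega> x) + exp (- r * f \<omega> x))" for r
    by (intro Bochner_Integration.integrable_add e(1))
  show i: "integrable (mu \<omega>) (\<lambda>x. exp (r * \<bar>f \<omega> x\<bar>))" for r
    by (rule Bochner_Integration.integrable_bound[OF dom[of r]]) (use le in auto)
  assume r: "\<bar>r\<bar> < \<rho>"
  have "(\<integral>x. exp (r * \<bar>f \<omega> x\<bar>) \<partial>mu \<omega>) \<le> (\<integral>x. exp (r * f \<omega> x) + exp (- r * f \<omega> x) \<partial>mu \<omega>)"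
    by (rule integral_mono[OF i dom le])
  also have "\<dots> = (\<integral>x. exp (r * f \<omega> x) \<partial>mu \<omega>) + (\<integral>x. exp (- r * f \<omega> x) \<partial>mu \<omega>)"
    by (rule Bochner_Integration.integral_add) (rule e(1))+
  also have "\<dots> \<le> K\<^sup>2 + K\<^sup>2" using r by (intro add_mono e(2)) auto
  finally show "(\<integral>x. exp (r * \<bar>f \<omega> x\<bar>) \<partial>mu \<omega>) \<le> 2 * K\<^sup>2" by simp
qed

text \<open>Convexity and invariance of the fibre measures reduce the sum to single terms. The
  uniform bound reaches only \<open>r * n < \<rho>\<close>, that is, boundedly many \<open>n\<close>
  on a fixed disc; it is meant for the early sums.\<close>

lemma exp_S_integrable:
  assumes "\<omega> \<in> \<Omega>"
  shows "integrable (mu \<omega>) (\<lambda>x. exp (r * \<bar>S \<omega> n x\<bar>))"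
    and "0 \<le> r \<Longrightarrow> r * real n < \<rho> \<Longrightarrow> (\<integral>x. exp (r * \<bar>S \<omega> n x\<bar>) \<partial>mu \<omega>) \<le> 2 * K\<^sup>2"
proof -
  interpret prob_space "mu \<omega>" by (rule prob_mu[OF assms])
  note [measurable] = S_meas[OF assms] f_Tn_meas[OF assms]
  let ?e = "\<lambda>r j x. exp (real n * (r * \<bar>f ((\<theta> ^^ j) \<omega>) (Tn \<omega> j x)\<bar>))"
  have e: "integrable (mu \<omega>) (?e r j)" "0 \<le> r \<Longrightarrow> r * real n < \<rho> \<Longrightarrow> (\<integral>x. ?e r j x \<partial>mu \<omega>) \<le> 2 * K\<^sup>2" for r j
  proof -
    let ?\<omega> = "(\<theta> ^^ j) \<omega>"
    note \<omega>j = funpow_\<Omega>[OF assms, of j]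
    note [measurable] = f_meas[OF \<omega>j]
    have m: "(\<lambda>y. exp (real n * r * \<bar>f ?\<omega> y\<bar>)) \<in> borel_measurable (mu ?\<omega>)" by measurable
    show "integrable (mu \<omega>) (?e r j)"
      using integrable_distr[OF Tn_meas[OF assms], of j "\<lambda>y. exp (real n * r * \<bar>f ?\<omega> y\<bar>)"] exp_f_integrable(1)[OF \<omega>j, of "real n * r"]
      by (simp add: distr_Tn[OF assms] mult.assoc)
    assume r: "0 \<le> r" "r * real n < \<rho>"
    have "(\<integral>x. ?e r j x \<partial>mu \<omega>) = (\<integral>y. exp (real n * r * \<bar>f ?\<omega> y\<bar>) \<partial>mu ?\<omega>)"
      using integral_distr[OF Tn_meas[OF assms, of j] m] by (simp add: distr_Tn[OF assms] mult.assoc)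
    also have "\<dots> \<le> 2 * K\<^sup>2" using r by (intro exp_f_integrable(2)[OF \<omega>j]) (simp add: abs_mult mult.commute)
    finally show "(\<integral>x. ?e r j x \<partial>mu \<omega>) \<le> 2 * K\<^sup>2" .
  qed
  have le: "exp (r * \<bar>S \<omega> n x\<bar>) \<le> (\<Sum>j<n. ?e r j x) / real n" if "0 < n" "0 \<le> r" for r x
  proof -
    have "r * \<bar>S \<omega> n x\<bar> \<le> (\<Sum>j<n. r * \<bar>f ((\<theta> ^^ j) \<omega>) (Tn \<omega> j x)\<bar>)"
      unfolding birkhoff_sum_def sum_distrib_left[symmetric] using that by (intro mult_left_mono sum_abs) auto
    then have "exp (r * \<bar>S \<omega> n x\<bar>) \<le> exp (\<Sum>j<n. r * \<bar>f ((\<theta> ^^ j) \<omega>) (Tn \<omega> j x)\<bar>)" by simp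
    also have "\<dots> \<le> (\<Sum>j<n. ?e r j x) / real n" by (rule exp_sum_le_average[OF that(1)])
    finally show ?thesis .
  qed
  have dom: "integrable (mu \<omega>) (\<lambda>x. (\<Sum>j<n. ?e r j x) / real n)" for r
    by (intro integrable_divide_zero Bochner_Integration.integrable_sum e(1))
  have S0: "S \<omega> 0 x = 0" for x by (simp add: birkhoff_sum_def)
  have i: "integrable (mu \<omega>) (\<lambda>x. exp (r * \<bar>S \<omega> n x\<bar>))" if "0 \<le> r" for r
  proof (cases "n = 0")
    case False
    have "norm (exp (r * \<bar>S \<omega> n x\<bar>)) \<le> norm ((\<Sum>j<n. ?e r j x) / real n)" for x
      using le[OF _ that, of x] False abs_ge_self[of "(\<Sum>j<n. ?e r j x) / real n"]
      unfolding real_norm_def abs_exp_cancel by linarith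
    then show ?thesis
      by (intro Bochner_Integration.integrable_bound[OF dom[of r]]) auto
  qed (simp add: S0)
  show "integrable (mu \<omega>) (\<lambda>x. exp (r * \<bar>S \<omega> n x\<bar>))"
  proof (rule Bochner_Integration.integrable_bound[OF i[of "\<bar>r\<bar>"]])
    show "AE x in mu \<omega>. norm (exp (r * \<bar>S \<omega> n x\<bar>)) \<le> norm (exp (\<bar>r\<bar> * \<bar>S \<omega> n x\<bar>))"
      by (auto intro!: AE_I2 mult_right_mono)
  qed auto
  assume r: "0 \<le> r" "r * real n < \<rho>"
  show "(\<integral>x. exp (r * \<bar>S \<omega> n x\<bar>) \<partial>mu \<omega>) \<le> 2 * K\<^sup>2"
  proof (cases "n = 0")
    case True
    have "1 \<le> K\<^sup>2" using pos by (simp add: one_le_power)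
    then show ?thesis using True prob_space by (simp add: S0)
  next
    case False
    have "(\<integral>x. exp (r * \<bar>S \<omega> n x\<bar>) \<partial>mu \<omega>) \<le> (\<integral>x. (\<Sum>j<n. ?e r j x) / real n \<partial>mu \<omega>)"
      using le r False by (intro integral_mono i dom) auto
    also have "\<dots> = (\<Sum>j<n. (\<integral>x. ?e r j x \<partial>mu \<omega>)) / real n"
      using e(1) by (simp add: Bochner_Integration.integral_sum)
    also have "\<dots> \<le> (\<Sum>j<n. 2 * K\<^sup>2) / real n" using e(2)[OF r] by (intro divide_right_mono sum_mono) auto
    also have "\<dots> = 2 * K\<^sup>2" using False by simp
    finally show ?thesis .
  qed
qed

lemma one_B: "\<omega> \<in> \<Omega> \<Longrightarrow> (\<lambda>x. 1) \<in> B \<omega>" and one_N: "\<omega> \<in> \<Omega> \<Longrightarrow> N \<omega> (\<lambda>x. 1) \<le> K"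
  using exp_B[of \<omega> 0] exp_N[of \<omega> 0] pos by auto

abbreviation "G z \<omega> n \<equiv> fibre_iterate \<theta> (twisted_transfer L f z) \<omega> n (\<lambda>x. 1)"

lemma G_B: "\<omega> \<in> \<Omega> \<Longrightarrow> cmod z < \<rho> \<Longrightarrow> G z \<omega> n \<in> B ((\<theta> ^^ n) \<omega>)"
proof (induction n)
  case (Suc n)
  have "L ((\<theta> ^^ n) \<omega>) (\<lambda>x. G z \<omega> n x * exp (z * complex_of_real (f ((\<theta> ^^ n) \<omega>) x))) \<in> B (\<theta> ((\<theta> ^^ n) \<omega>))"
    using Suc by (intro L_B mult_B funpow_\<Omega>) auto
  then show ?case
    by (simp only: fibre_iterate.simps(2) funpow.simps(2) o_apply twisted_transfer_def[of L f z "(\<theta> ^^ n) \<omega>"])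
qed (simp add: one_B)

text \<open>The duality relation is only available for bounded \<open>u\<close>, but the step needs it for
  \<open>u = exp (z f)\<close>, which is reached by truncation.\<close>

lemma iterated_duality:
  assumes \<omega>: "\<omega> \<in> \<Omega>" and z: "cmod z < \<rho>"
  shows "u \<in> borel_measurable (mu ((\<theta> ^^ n) \<omega>)) \<Longrightarrow> bounded (u ` E ((\<theta> ^^ n) \<omega>)) \<Longrightarrow>
    (\<integral>x. exp (z * complex_of_real (S \<omega> n x)) * u (Tn \<omega> n x) \<partial>mu \<omega>) = (\<integral>y. u y * G z \<omega> n y \<partial>mu ((\<theta> ^^ n) \<omega>))"
proof (induction n arbitrary: u)
  case 0
  then show ?case by (simp add: birkhoff_sum_def)
next
  case (Suc n)
  let ?\<omega> = "(\<theta> ^^ n) \<omega>"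
  interpret prob_space "mu \<omega>" by (rule prob_mu[OF \<omega>])
  note \<omega>n = funpow_\<Omega>[OF \<omega>, of n]
  have u_meas: "u \<in> borel_measurable (mu (\<theta> ?\<omega>))" and u_bdd: "bounded (u ` E (\<theta> ?\<omega>))" using Suc.prems by auto
  obtain U where U: "\<And>y. y \<in> E (\<theta> ?\<omega>) \<Longrightarrow> cmod (u y) \<le> U" using u_bdd unfolding bounded_iff by auto
  have T_E: "T ?\<omega> x \<in> E (\<theta> ?\<omega>)" if "x \<in> E ?\<omega>" for x
    using measurable_space[OF T_meas[OF \<omega>n]] that space_mu[OF \<omega>n] space_mu[OF \<theta>_\<Omega>[OF \<omega>n]] by simp
  have Tn_E: "Tn \<omega> n x \<in> E ?\<omega>" if "x \<in> space (mu \<omega>)" for x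
    using measurable_space[OF Tn_meas[OF \<omega>, of n] that] space_mu[OF \<omega>n] by simp
  have uT[measurable]: "(\<lambda>x. u (T ?\<omega> x)) \<in> borel_measurable (mu ?\<omega>)"
    using measurable_comp[OF T_meas[OF \<omega>n] u_meas] by (simp add: o_def)
  note [measurable] = f_meas[OF \<omega>n] S_meas[OF \<omega>] Tn_meas[OF \<omega>]
  let ?g = "\<lambda>x. G z \<omega> n x * exp (z * complex_of_real (f ?\<omega> x))"
  have G: "G z \<omega> n \<in> B ?\<omega>" by (rule G_B[OF \<omega> z])
  have g: "?g \<in> B ?\<omega>" by (rule mult_B[OF \<omega>n z G])
  have [measurable]: "G z \<omega> n \<in> borel_measurable (mu ?\<omega>)"
    using B_integrable[OF \<omega>n G] by (rule borel_measurable_integrable)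
  define v where "v k x = (if \<bar>f ?\<omega> x\<bar> \<le> real k then exp (z * complex_of_real (f ?\<omega> x)) * u (T ?\<omega> x) else 0)" for k x
  have v_meas[measurable]: "v k \<in> borel_measurable (mu ?\<omega>)" for k unfolding v_def by measurable
  have U0: "0 \<le> U" if "x \<in> E ?\<omega>" for x using U[OF T_E[OF that]] order_trans[OF norm_ge_zero] by blast
  have v_le: "cmod (v k x) \<le> exp (cmod z * \<bar>f ?\<omega> x\<bar>) * U" if "x \<in> E ?\<omega>" for k x
  proof -
    have "cmod (exp (z * complex_of_real (f ?\<omega> x))) \<le> exp (cmod z * \<bar>f ?\<omega> x\<bar>)"
      by (rule order_trans[OF norm_exp]) (simp add: norm_mult)
    then show ?thesis using U[OF T_E[OF that]] U0[OF that]
      by (auto simp: v_def norm_mult intro!: mult_mono)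
  qed
  have v_bdd: "bounded (v k ` E ?\<omega>)" for k
  proof -
    have "cmod (v k x) \<le> exp (cmod z * real k) * \<bar>U\<bar>" if "x \<in> E ?\<omega>" for x
    proof (cases "\<bar>f ?\<omega> x\<bar> \<le> real k")
      case True
      have "cmod (v k x) \<le> exp (cmod z * \<bar>f ?\<omega> x\<bar>) * U" by (rule v_le[OF that])
      also have "\<dots> \<le> exp (cmod z * real k) * \<bar>U\<bar>"
        using True U0[OF that] by (intro mult_mono) (auto intro: mult_left_mono)
      finally show ?thesis .
    qed (simp add: v_def)
    then show ?thesis unfolding bounded_iff by blast
  qed
  have v_lim: "(\<lambda>k. v k x) \<longlonglongrightarrow> exp (z * complex_of_real (f ?\<omega> x)) * u (T ?\<omega> x)" for x
  proof (rule tendsto_eventually)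
    show "\<forall>\<^sub>F k in sequentially. v k x = exp (z * complex_of_real (f ?\<omega> x)) * u (T ?\<omega> x)"
      using eventually_ge_at_top[of "nat \<lceil>\<bar>f ?\<omega> x\<bar>\<rceil>"] by eventually_elim (auto simp: v_def)
  qed
  have IH: "(\<integral>x. exp (z * complex_of_real (S \<omega> n x)) * v k (Tn \<omega> n x) \<partial>mu \<omega>) = (\<integral>y. v k y * G z \<omega> n y \<partial>mu ?\<omega>)" for k
    by (rule Suc.IH[OF v_meas v_bdd])
  \<comment> \<open>Dominated by \<open>cmod (?g y)\<close> times the bound of \<open>u\<close>,
    which is integrable since \<open>?g\<close> lies in the function space.\<close>
  have lim1: "(\<lambda>k. \<integral>y. v k y * G z \<omega> n y \<partial>mu ?\<omega>) \<longlonglongrightarrow> (\<integral>y. ?g y * u (T ?\<omega> y) \<partial>mu ?\<omega>)"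
  proof (rule integral_dominated_convergence[where w = "\<lambda>y. cmod (?g y) * \<bar>U\<bar>"])
    show "integrable (mu ?\<omega>) (\<lambda>y. cmod (?g y) * \<bar>U\<bar>)"
      using B_integrable[OF \<omega>n g] by (intro integrable_mult_left integrable_norm)
    show "AE y in mu ?\<omega>. (\<lambda>k. v k y * G z \<omega> n y) \<longlonglongrightarrow> ?g y * u (T ?\<omega> y)"
    proof (rule AE_I2)
      fix y
      show "(\<lambda>k. v k y * G z \<omega> n y) \<longlonglongrightarrow> ?g y * u (T ?\<omega> y)"
        using tendsto_mult[OF v_lim[of y] tendsto_const[of "G z \<omega> n y"]] by (simp add: mult_ac)
    qed
    show "AE y in mu ?\<omega>. norm (v k y * G z \<omega> n y) \<le> cmod (?g y) * \<bar>U\<bar>" for k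
    proof (rule AE_I2)
      fix y assume "y \<in> space (mu ?\<omega>)"
      then have "y \<in> E ?\<omega>" using space_mu[OF \<omega>n] by simp
      from U[OF T_E[OF this]] have "cmod (u (T ?\<omega> y)) \<le> \<bar>U\<bar>" by simp
      then have "cmod (v k y) \<le> cmod (exp (z * complex_of_real (f ?\<omega> y))) * \<bar>U\<bar>"
        by (auto simp: v_def norm_mult simp del: norm_exp_eq_Re intro!: mult_left_mono)
      from mult_right_mono[OF this norm_ge_zero[of "G z \<omega> n y"]]
      show "norm (v k y * G z \<omega> n y) \<le> cmod (?g y) * \<bar>U\<bar>"
        by (simp add: norm_mult mult_ac del: norm_exp_eq_Re)
    qed
  qed measurable
  \<comment> \<open>Here the dominating function is a product of two exponentials;
    \<open>a * b \<le> a\<^sup>2 + b\<^sup>2\<close> separates them, and each is integrable at every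
    parameter.\<close>
  have lim2: "(\<lambda>k. \<integral>x. exp (z * complex_of_real (S \<omega> n x)) * v k (Tn \<omega> n x) \<partial>mu \<omega>) \<longlonglongrightarrow>
      (\<integral>x. exp (z * complex_of_real (S \<omega> (Suc n) x)) * u (Tn \<omega> (Suc n) x) \<partial>mu \<omega>)"
  proof (rule integral_dominated_convergence[where w = "\<lambda>x. \<bar>U\<bar> * (exp (2 * cmod z * \<bar>S \<omega> n x\<bar>) + exp (2 * cmod z * \<bar>f ?\<omega> (Tn \<omega> n x)\<bar>))"])
    have "integrable (mu \<omega>) (\<lambda>x. exp (2 * cmod z * \<bar>f ?\<omega> (Tn \<omega> n x)\<bar>))"
      using integrable_distr[OF Tn_meas[OF \<omega>], of n "\<lambda>y. exp (2 * cmod z * \<bar>f ?\<omega> y\<bar>)"] exp_f_integrable(1)[OF \<omega>n]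
      by (simp add: distr_Tn[OF \<omega>])
    then show "integrable (mu \<omega>) (\<lambda>x. \<bar>U\<bar> * (exp (2 * cmod z * \<bar>S \<omega> n x\<bar>) + exp (2 * cmod z * \<bar>f ?\<omega> (Tn \<omega> n x)\<bar>)))"
      using exp_S_integrable(1)[OF \<omega>] by (intro integrable_mult_right Bochner_Integration.integrable_add)
    show "AE x in mu \<omega>. (\<lambda>k. exp (z * complex_of_real (S \<omega> n x)) * v k (Tn \<omega> n x)) \<longlonglongrightarrow>
        exp (z * complex_of_real (S \<omega> (Suc n) x)) * u (Tn \<omega> (Suc n) x)"
    proof (rule AE_I2)
      fix x
      have "exp (z * complex_of_real (S \<omega> (Suc n) x)) = exp (z * complex_of_real (S \<omega> n x)) * exp (z * complex_of_real (f ?\<omega> (Tn \<omega> n x)))"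
        by (simp add: birkhoff_sum_Suc exp_add[symmetric] distrib_left)
      then show "(\<lambda>k. exp (z * complex_of_real (S \<omega> n x)) * v k (Tn \<omega> n x)) \<longlonglongrightarrow>
        exp (z * complex_of_real (S \<omega> (Suc n) x)) * u (Tn \<omega> (Suc n) x)"
        using tendsto_mult[OF tendsto_const[of "exp (z * complex_of_real (S \<omega> n x))"] v_lim[of "Tn \<omega> n x"]]
        by (simp add: mult.assoc)
    qed
    show "AE x in mu \<omega>. norm (exp (z * complex_of_real (S \<omega> n x)) * v k (Tn \<omega> n x))
        \<le> \<bar>U\<bar> * (exp (2 * cmod z * \<bar>S \<omega> n x\<bar>) + exp (2 * cmod z * \<bar>f ?\<omega> (Tn \<omega> n x)\<bar>))" for k
    proof (rule AE_I2)
      fix x assume x: "x \<in> space (mu \<omega>)"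
      let ?a = "exp (cmod z * \<bar>S \<omega> n x\<bar>)" and ?b = "exp (cmod z * \<bar>f ?\<omega> (Tn \<omega> n x)\<bar>)"
      have a: "cmod (exp (z * complex_of_real (S \<omega> n x))) \<le> ?a"
        by (rule order_trans[OF norm_exp]) (simp add: norm_mult)
      have "cmod (v k (Tn \<omega> n x)) \<le> ?b * \<bar>U\<bar>"
        by (rule order_trans[OF v_le[OF Tn_E[OF x]] mult_left_mono[OF abs_ge_self]]) simp
      with a have "norm (exp (z * complex_of_real (S \<omega> n x)) * v k (Tn \<omega> n x)) \<le> ?a * (?b * \<bar>U\<bar>)"
        unfolding norm_mult by (intro mult_mono) auto
      also have "?a * (?b * \<bar>U\<bar>) = \<bar>U\<bar> * (?a * ?b)" by simp
      also have "\<dots> \<le> \<bar>U\<bar> * (?a\<^sup>2 + ?b\<^sup>2)"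
      proof (intro mult_left_mono)
        have "0 \<le> (?a - ?b)\<^sup>2 + ?a * ?b" by simp
        then have "0 \<le> ?a\<^sup>2 + ?b\<^sup>2 - ?a * ?b" by (simp add: power2_diff)
        then show "?a * ?b \<le> ?a\<^sup>2 + ?b\<^sup>2" by simp
      qed simp
      finally show "norm (exp (z * complex_of_real (S \<omega> n x)) * v k (Tn \<omega> n x))
        \<le> \<bar>U\<bar> * (exp (2 * cmod z * \<bar>S \<omega> n x\<bar>) + exp (2 * cmod z * \<bar>f ?\<omega> (Tn \<omega> n x)\<bar>))"
        by (simp add: exp_double[symmetric] mult.assoc)
    qed
    show "(\<lambda>x. exp (z * complex_of_real (S \<omega> (Suc n) x)) * u (Tn \<omega> (Suc n) x)) \<in> borel_measurable (mu \<omega>)"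
    proof -
      have "(\<lambda>x. u (Tn \<omega> (Suc n) x)) \<in> borel_measurable (mu \<omega>)"
        using measurable_comp[OF Tn_meas[OF \<omega>, of "Suc n"] Suc.prems(1)] by (simp add: o_def)
      then show ?thesis using S_meas[OF \<omega>, of "Suc n"] by measurable
    qed
  qed measurable
  have "(\<integral>x. exp (z * complex_of_real (S \<omega> (Suc n) x)) * u (Tn \<omega> (Suc n) x) \<partial>mu \<omega>) = (\<integral>y. ?g y * u (T ?\<omega> y) \<partial>mu ?\<omega>)"
    by (rule LIMSEQ_unique[OF lim2[unfolded IH] lim1])
  also have "\<dots> = (\<integral>y. u y * L ?\<omega> ?g y \<partial>mu (\<theta> ?\<omega>))"
    by (rule duality[OF \<omega>n g u_meas u_bdd])
  finally show ?case
    by (simp only: fibre_iterate.simps(2) funpow.simps(2) o_apply twisted_transfer_def[of L f z "(\<theta> ^^ n) \<omega>"])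
qed

lemma mgf_eq_integral_G:
  assumes "\<omega> \<in> \<Omega>" "cmod z < \<rho>"
  shows "mgf \<omega> n z = (\<integral>y. G z \<omega> n y \<partial>mu ((\<theta> ^^ n) \<omega>))"
  using iterated_duality[OF assms, of "\<lambda>y. 1" n] by (simp add: mgf_def image_constant_conv)

text \<open>The two factors of the asymptotics of the generating function after division by the
  eigenvalues: \<open>\<alpha>\<close> belongs to the start of the orbit, \<open>\<beta>\<close> to
  its end. This separation is what later makes them cancel.\<close>

definition "\<alpha> \<omega> z = \<nu> \<omega> z (\<lambda>x. 1)"
definition "\<beta> \<omega> z = (\<integral>x. h \<omega> z x \<partial>mu \<omega>)"

lemma \<alpha>_le: assumes "\<omega> \<in> \<Omega>" "cmod z < \<rho>" shows "cmod (\<alpha> \<omega> z) \<le> K\<^sup>2"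
proof -
  have "cmod (\<alpha> \<omega> z) \<le> dual_norm (B \<omega>) (N \<omega>) (\<nu> \<omega> z) * N \<omega> (\<lambda>x. 1)"
    unfolding \<alpha>_def by (intro cmod_le_dual_norm(1)[OF normed] \<nu>_dual one_B assms)
  also have "\<dots> \<le> K * K"
    using assms pos by (intro mult_mono \<nu>_N one_N function_normed_spaceD(4)[OF normed] one_B) auto
  finally show ?thesis by (simp add: power2_eq_square)
qed

lemma \<beta>_le: assumes "\<omega> \<in> \<Omega>" "cmod z < \<rho>" shows "cmod (\<beta> \<omega> z) \<le> K\<^sup>2"
proof -
  have "cmod (\<beta> \<omega> z) \<le> K * N \<omega> (h \<omega> z)"
    unfolding \<beta>_def by (intro integral_B_le h_B assms)
  also have "\<dots> \<le> K * K" using assms pos by (intro mult_left_mono h_N) auto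
  finally show ?thesis by (simp add: power2_eq_square)
qed

lemma \<alpha>_0: assumes "\<omega> \<in> \<Omega>" shows "\<alpha> \<omega> 0 = 1"
proof -
  interpret prob_space "mu \<omega>" by (rule prob_mu[OF assms])
  show ?thesis unfolding \<alpha>_def using \<nu>_0[OF assms one_B[OF assms]] prob_space by simp
qed

lemma \<beta>_0: assumes "\<omega> \<in> \<Omega>" shows "\<beta> \<omega> 0 = 1"
proof -
  interpret prob_space "mu \<omega>" by (rule prob_mu[OF assms])
  have "\<beta> \<omega> 0 = (\<integral>x. 1 \<partial>mu \<omega>)" unfolding \<beta>_def
    by (rule Bochner_Integration.integral_cong[OF refl]) (simp add: h_0[OF assms] space_mu[OF assms])
  then show ?thesis using prob_space by simp
qed

text \<open>Evaluation at the constant function is bounded in the dual norm, so the expansion of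
  \<open>\<nu>\<close> turns into a scalar one.\<close>

lemma \<alpha>_holomorphic: assumes \<omega>: "\<omega> \<in> \<Omega>" shows "\<alpha> \<omega> holomorphic_on ball 0 \<rho>"
proof (rule holomorphic_on_of_local_expansions)
  fix z0 assume z0: "z0 \<in> ball (0 :: complex) \<rho>"
  obtain r a where r: "0 < r" and a: "\<And>k::nat. a k \<in> dual_space (B \<omega>) (N \<omega>)"
    and lim: "\<And>z. z \<in> ball z0 r \<Longrightarrow> \<nu> \<omega> z \<in> dual_space (B \<omega>) (N \<omega>)"
      "\<And>z. z \<in> ball z0 r \<Longrightarrow> (\<lambda>n. dual_norm (B \<omega>) (N \<omega>) (\<lambda>y. \<nu> \<omega> z y - (\<Sum>k<n. (z - z0) ^ k * a k y))) \<longlonglongrightarrow> 0"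
    by (rule analytic_intoE[OF \<nu>_analytic[OF \<omega>] z0]) (rule that; assumption)
  have "(\<lambda>n. \<alpha> \<omega> z - (\<Sum>k<n. (z - z0) ^ k * a k (\<lambda>x. 1))) \<longlonglongrightarrow> 0" if z: "z \<in> ball z0 r" for z
  proof (rule Lim_null_comparison)
    let ?d = "\<lambda>n y. \<nu> \<omega> z y - (\<Sum>k<n. (z - z0) ^ k * a k y)"
    show "\<forall>\<^sub>F n in sequentially. norm (\<alpha> \<omega> z - (\<Sum>k<n. (z - z0) ^ k * a k (\<lambda>x. 1))) \<le> dual_norm (B \<omega>) (N \<omega>) (?d n) * N \<omega> (\<lambda>x. 1)"
      unfolding \<alpha>_def
      by (intro always_eventually allI cmod_le_dual_norm(1)[OF normed[OF \<omega>], of "?d _"] dual_space_lincomb lim(1)[OF z] a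
            one_B[OF \<omega>] function_normed_spaceD(4)[OF normed[OF \<omega>]])
    show "(\<lambda>n. dual_norm (B \<omega>) (N \<omega>) (?d n) * N \<omega> (\<lambda>x. 1)) \<longlonglongrightarrow> 0"
      using tendsto_mult[OF lim(2)[OF z] tendsto_const] by simp
  qed
  then show "\<exists>\<rho>>0. \<exists>c. \<forall>z\<in>ball z0 \<rho>. (\<lambda>n. \<alpha> \<omega> z - (\<Sum>k<n. (z - z0) ^ k * c k)) \<longlonglongrightarrow> 0"
    using r by (intro exI[of _ r] exI[of _ "\<lambda>k. a k (\<lambda>x. 1)"] conjI ballI)
qed

lemma \<beta>_holomorphic: assumes \<omega>: "\<omega> \<in> \<Omega>" shows "\<beta> \<omega> holomorphic_on ball 0 \<rho>"
proof (rule holomorphic_on_of_local_expansions)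
  fix z0 assume z0: "z0 \<in> ball (0 :: complex) \<rho>"
  obtain r a where r: "0 < r" and a: "\<And>k::nat. a k \<in> B \<omega>"
    and lim: "\<And>z. z \<in> ball z0 r \<Longrightarrow> h \<omega> z \<in> B \<omega>"
      "\<And>z. z \<in> ball z0 r \<Longrightarrow> (\<lambda>n. N \<omega> (\<lambda>y. h \<omega> z y - (\<Sum>k<n. (z - z0) ^ k * a k y))) \<longlonglongrightarrow> 0"
    by (rule analytic_intoE[OF h_analytic[OF \<omega>] z0]) (rule that; assumption)
  have "(\<lambda>n. \<beta> \<omega> z - (\<Sum>k<n. (z - z0) ^ k * (\<integral>x. a k x \<partial>mu \<omega>))) \<longlonglongrightarrow> 0" if z: "z \<in> ball z0 r" for z
  proof (rule Lim_null_comparison)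
    let ?d = "\<lambda>n y. h \<omega> z y - (\<Sum>k<n. (z - z0) ^ k * a k y)"
    have eq: "\<beta> \<omega> z - (\<Sum>k<n. (z - z0) ^ k * (\<integral>x. a k x \<partial>mu \<omega>)) = (\<integral>x. ?d n x \<partial>mu \<omega>)" for n
      unfolding \<beta>_def using B_integrable[OF \<omega> lim(1)[OF z]] B_integrable[OF \<omega> a]
      by (simp add: Bochner_Integration.integral_sum)
    show "\<forall>\<^sub>F n in sequentially. norm (\<beta> \<omega> z - (\<Sum>k<n. (z - z0) ^ k * (\<integral>x. a k x \<partial>mu \<omega>))) \<le> K * N \<omega> (?d n)"
      unfolding eq
      by (intro always_eventually allI integral_B_le[OF \<omega>] function_normed_space_lincomb[OF normed[OF \<omega>]] lim(1)[OF z] a)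
    show "(\<lambda>n. K * N \<omega> (?d n)) \<longlonglongrightarrow> 0"
      using tendsto_mult[OF tendsto_const lim(2)[OF z]] by simp
  qed
  then show "\<exists>\<rho>>0. \<exists>c. \<forall>z\<in>ball z0 \<rho>. (\<lambda>n. \<beta> \<omega> z - (\<Sum>k<n. (z - z0) ^ k * c k)) \<longlonglongrightarrow> 0"
    using r by (intro exI[of _ r] exI[of _ "\<lambda>k. \<integral>x. a k x \<partial>mu \<omega>"] conjI ballI)
qed

definition "b \<omega> n z = mgf \<omega> n z / (\<Prod>j<n. lam ((\<theta> ^^ j) \<omega>) z)"

text \<open>The spectral estimate for the constant function, integrated over the end fibre.
  Integration costs one factor \<open>K\<close>, the norm of the constant function the
  other.\<close>

lemma b_approx:
  assumes \<omega>: "\<omega> \<in> \<Omega>" and z: "cmod z < \<rho>" and n: "1 \<le> n"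
  shows "cmod (b \<omega> n z - \<alpha> \<omega> z * \<beta> ((\<theta> ^^ n) \<omega>) z) \<le> K\<^sup>2 * C * \<delta> ^ n"
proof -
  let ?\<omega> = "(\<theta> ^^ n) \<omega>" and ?\<Lambda> = "\<Prod>j<n. lam ((\<theta> ^^ j) \<omega>) z"
  note \<omega>n = funpow_\<Omega>[OF \<omega>, of n]
  let ?g = "\<lambda>y. inverse ?\<Lambda> * G z \<omega> n y - \<nu> \<omega> z (\<lambda>x. 1) * h ?\<omega> z y"
  have "(\<lambda>y. inverse ?\<Lambda> * G z \<omega> n y + (- \<nu> \<omega> z (\<lambda>x. 1)) * h ?\<omega> z y) \<in> B ?\<omega>"
    by (intro function_normed_spaceD[OF normed[OF \<omega>n]] G_B h_B \<omega> \<omega>n z)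
  then have gB: "?g \<in> B ?\<omega>" by simp
  have eq: "b \<omega> n z - \<alpha> \<omega> z * \<beta> ?\<omega> z = (\<integral>y. ?g y \<partial>mu ?\<omega>)"
    using B_integrable[OF \<omega>n G_B[OF \<omega> z, of n]] B_integrable[OF \<omega>n h_B[OF \<omega>n z]]
    by (simp add: b_def mgf_eq_integral_G[OF \<omega> z] \<alpha>_def \<beta>_def divide_inverse mult.commute)
  have "cmod (b \<omega> n z - \<alpha> \<omega> z * \<beta> ?\<omega> z) \<le> K * N ?\<omega> ?g"
    unfolding eq by (rule integral_B_le[OF \<omega>n gB])
  also have "\<dots> \<le> K * (C * \<delta> ^ n * N \<omega> (\<lambda>x. 1))"
    using spectral[OF \<omega> z n one_B[OF \<omega>]] pos by (intro mult_left_mono) auto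
  also have "\<dots> \<le> K * (C * \<delta> ^ n * K)"
    using one_N[OF \<omega>] pos by (intro mult_left_mono) auto
  finally show ?thesis by (simp add: power2_eq_square mult_ac)
qed

end

section \<open>Uniform bounds for the cumulants\<close>

lemma norm_Ln_near_one_le:
  assumes "cmod (w - 1) \<le> 1 / 4"
  shows "cmod (Ln w) \<le> 2 * cmod (w - 1)" "w \<notin> \<real>\<^sub>\<le>\<^sub>0" "w \<noteq> 0"
proof -
  show "cmod (Ln w) \<le> 2 * cmod (w - 1)" using norm_Ln_le[of "w - 1"] assms by simp
  have "0 < Re w" using assms abs_Re_le_cmod[of "w - 1"] by (simp add: abs_if split: if_splits)
  then show "w \<notin> \<real>\<^sub>\<le>\<^sub>0" "w \<noteq> 0" by (auto simp: complex_nonpos_Reals_iff)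
qed

lemma norm_mult_diff_le:
  fixes x y x0 y0 :: complex
  assumes "cmod (x - x0) \<le> e" "cmod (y - y0) \<le> e" "cmod y \<le> 2" "cmod x0 \<le> 2"
  shows "cmod (x * y - x0 * y0) \<le> 4 * e"
proof -
  have "cmod (x * y - x0 * y0) = cmod ((x - x0) * y + x0 * (y - y0))" by (simp add: algebra_simps)
  also have "\<dots> \<le> cmod (x - x0) * cmod y + cmod x0 * cmod (y - y0)"
    by (rule order_trans[OF norm_triangle_ineq]) (simp add: norm_mult)
  also have "\<dots> \<le> e * 2 + 2 * e"
    using assms order_trans[OF norm_ge_zero assms(1)] by (intro add_mono mult_mono) auto
  finally show ?thesis by simp
qed

context uniform_transfer
begin

lemma mgf_holomorphic_ball: assumes "\<omega> \<in> \<Omega>" "0 < r" shows "mgf \<omega> n holomorphic_on ball 0 r"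
proof -
  interpret prob_space "mu \<omega>" by (rule prob_mu[OF assms(1)])
  show ?thesis unfolding mgf_def[abs_def]
    by (rule mgf_holomorphic[OF S_meas[OF assms(1)] exp_S_integrable(1)[OF assms(1)] assms(2)])
qed

lemma mgf_0: assumes "\<omega> \<in> \<Omega>" shows "mgf \<omega> n 0 = 1"
proof -
  interpret prob_space "mu \<omega>" by (rule prob_mu[OF assms])
  show ?thesis by (simp add: mgf_def prob_space)
qed

lemma exp_zS_integrable: assumes "\<omega> \<in> \<Omega>" shows "integrable (mu \<omega>) (\<lambda>x. exp (z * complex_of_real (S \<omega> n x)))"
proof (rule Bochner_Integration.integrable_bound[OF exp_S_integrable(1)[OF assms, of "cmod z" n]])
  show "(\<lambda>x. exp (z * complex_of_real (S \<omega> n x))) \<in> borel_measurable (mu \<omega>)"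
    using S_meas[OF assms, of n] by measurable
  have "cmod (exp (z * complex_of_real (S \<omega> n x))) \<le> exp (cmod z * \<bar>S \<omega> n x\<bar>)" for x
    by (rule order_trans[OF norm_exp]) (simp add: norm_mult)
  then show "AE x in mu \<omega>. norm (exp (z * complex_of_real (S \<omega> n x))) \<le> norm (exp (cmod z * \<bar>S \<omega> n x\<bar>))"
    by simp
qed

lemma mgf_le: assumes "\<omega> \<in> \<Omega>" "cmod z * real n < \<rho>" shows "cmod (mgf \<omega> n z) \<le> 2 * K\<^sup>2"
proof -
  have "cmod (mgf \<omega> n z) \<le> (\<integral>x. cmod (exp (z * complex_of_real (S \<omega> n x))) \<partial>mu \<omega>)"
    unfolding mgf_def by (rule integral_norm_bound)
  also have "\<dots> \<le> (\<integral>x. exp (cmod z * \<bar>S \<omega> n x\<bar>) \<partial>mu \<omega>)"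
  proof (rule integral_mono[OF integrable_norm[OF exp_zS_integrable[OF assms(1)]] exp_S_integrable(1)[OF assms(1)]])
    fix x show "cmod (exp (z * complex_of_real (S \<omega> n x))) \<le> exp (cmod z * \<bar>S \<omega> n x\<bar>)"
      by (rule order_trans[OF norm_exp]) (simp add: norm_mult)
  qed
  also have "\<dots> \<le> 2 * K\<^sup>2" using assms by (intro exp_S_integrable(2)) auto
  finally show ?thesis .
qed

text \<open>The quotient of \<open>mgf \<omega> (n + 1)\<close> and
  \<open>mgf (\<theta> \<omega>) n\<close> divided by its predecessor in \<open>n\<close>. Every
  starting point and every end point of the four orbit segments occurs once above and once
  below.\<close>

definition "R \<omega> n z = (mgf \<omega> (n + 1) z * mgf (\<theta> \<omega>) (n - 1) z) / (mgf \<omega> n z * mgf (\<theta> \<omega>) n z)"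

text \<open>The eigenvalue products above and below run through the same points of the orbit with
  the same multiplicities; only the grouping differs.\<close>

lemma R_eq_b:
  assumes \<omega>: "\<omega> \<in> \<Omega>" and z: "cmod z < \<rho>" and n: "1 \<le> n"
  shows "R \<omega> n z = (b \<omega> (n + 1) z * b (\<theta> \<omega>) (n - 1) z) / (b \<omega> n z * b (\<theta> \<omega>) n z)"
proof -
  define \<Lambda> where "\<Lambda> \<omega> n = (\<Prod>j<n. lam ((\<theta> ^^ j) \<omega>) z)" for \<omega> n
  have nz: "\<Lambda> \<omega> n \<noteq> 0" if "\<omega> \<in> \<Omega>" for \<omega> n using lam_nz[OF funpow_\<Omega>[OF that] z] by (simp add: \<Lambda>_def)
  have shift: "\<Lambda> \<omega> (Suc n) = lam \<omega> z * \<Lambda> (\<theta> \<omega>) n" for \<omega> n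
    unfolding \<Lambda>_def by (simp only: prod.lessThan_Suc_shift funpow_Suc_right o_def) simp
  have b: "mgf \<omega> n z = b \<omega> n z * \<Lambda> \<omega> n" if "\<omega> \<in> \<Omega>" for \<omega> n
    using nz[OF that] unfolding b_def \<Lambda>_def[symmetric] by simp
  obtain k where k: "n = Suc k" using n by (cases n) auto
  note \<theta> = \<theta>_\<Omega>[OF \<omega>]
  have "\<Lambda> \<omega> (n + 1) * \<Lambda> (\<theta> \<omega>) (n - 1) = \<Lambda> \<omega> n * \<Lambda> (\<theta> \<omega>) n"
    by (simp add: k shift)
  moreover have "\<Lambda> \<omega> n * \<Lambda> (\<theta> \<omega>) n \<noteq> 0" using nz \<omega> \<theta> by simp
  moreover have "(b1 * p) * (b2 * q) / ((b3 * s) * (b4 * t)) = (b1 * b2) / (b3 * b4)"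
    if "p * q = s * t" "s * t \<noteq> 0" for b1 b2 b3 b4 p q s t :: complex
  proof -
    have "(b1 * p) * (b2 * q) = (b1 * b2) * (s * t)" unfolding that(1)[symmetric] by (simp only: mult_ac)
    moreover have "(b3 * s) * (b4 * t) = (b3 * b4) * (s * t)" by (simp only: mult_ac)
    ultimately show ?thesis using that(2) by (simp only: mult_divide_mult_cancel_right if_False) simp
  qed
  ultimately show ?thesis unfolding R_def b[OF \<omega>] b[OF \<theta>] by blast
qed

text \<open>Two regimes. For \<open>n \<ge> n0\<close> the spectral error is small, the factors
  \<open>b\<close> stay away from \<open>0\<close>, and \<open>R\<close> is geometrically close to
  \<open>1\<close> because its limiting factors cancel exactly. For \<open>n \<le> Suc n0\<close>
  the generating functions themselves are near \<open>1\<close>, on a disc so small that exponential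
  moments of the sums are available.\<close>

lemma spectral_constants:
  obtains r n0 where "0 < r" "r < \<rho>" "2 \<le> n0"
    "\<And>\<omega> z n. \<omega> \<in> \<Omega> \<Longrightarrow> cmod z < r \<Longrightarrow> n \<le> Suc n0 \<Longrightarrow> cmod (mgf \<omega> n z - 1) \<le> 1 / 4"
    "\<And>\<omega> z n. \<omega> \<in> \<Omega> \<Longrightarrow> cmod z < r \<Longrightarrow> n0 \<le> n \<Longrightarrow> mgf \<omega> n z \<noteq> 0"
    "\<And>\<omega> z n. \<omega> \<in> \<Omega> \<Longrightarrow> cmod z < r \<Longrightarrow> n0 \<le> n \<Longrightarrow> cmod (R \<omega> n z - 1) \<le> 32 * (K\<^sup>2 * C * \<delta> ^ (n - 1))"
    "\<And>n. n0 \<le> n \<Longrightarrow> 32 * (K\<^sup>2 * C * \<delta> ^ (n - 1)) \<le> 1 / 4"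
proof -
  define e where "e n = K\<^sup>2 * C * \<delta> ^ n" for n
  have e_pos: "0 \<le> e n" for n using pos by (simp add: e_def)
  have e_mono: "e n \<le> e m" if "m \<le> n" for m n
    unfolding e_def using pos that by (intro mult_left_mono power_decreasing) auto
  have "(\<lambda>n. K\<^sup>2 * C * \<delta> ^ n) \<longlonglongrightarrow> K\<^sup>2 * C * 0"
    using pos by (intro tendsto_intros LIMSEQ_power_zero) auto
  then have "\<forall>\<^sub>F n in sequentially. e n < 1 / 128"
    unfolding e_def[abs_def, symmetric] by (intro order_tendstoD) auto
  then obtain n1 where n1: "\<And>n. n1 \<le> n \<Longrightarrow> e n < 1 / 128" unfolding eventually_sequentially by blast
  \<comment> \<open>The additional \<open>2\<close> makes \<open>n - 1\<close> both at least
    \<open>1\<close> and beyond \<open>n1\<close>, since \<open>R\<close> at \<open>n\<close>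
    involves \<open>b\<close> at \<open>n - 1\<close>.\<close>
  define n0 where "n0 = n1 + 2"
  define r1 where "r1 = \<rho> / (2 * real (Suc n0))"
  have r1: "0 < r1" using pos by (simp add: r1_def)
  have r1n: "r1 * real (Suc n0) = \<rho> / 2" unfolding r1_def by (simp del: of_nat_Suc)
  \<comment> \<open>Halves of the two radii admit the mean value bounds;
    \<open>\<rho> / (64 * K\<^sup>2)\<close> brings \<open>\<alpha>\<close> and
    \<open>\<beta>\<close> within \<open>1 / 16\<close> of \<open>1\<close>, and
    \<open>r1 / (32 * K\<^sup>2)\<close> brings the early generating functions within
    \<open>1 / 4\<close>.\<close>
  define r where "r = min (min (\<rho> / 2) (\<rho> / (64 * K\<^sup>2))) (min (r1 / 2) (r1 / (32 * K\<^sup>2)))"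
  have K2: "0 < K\<^sup>2" using pos by simp
  have r: "0 < r" "r \<le> \<rho> / 2" "r \<le> \<rho> / (64 * K\<^sup>2)" "r \<le> r1 / 2" "r \<le> r1 / (32 * K\<^sup>2)"
    using pos r1 K2 unfolding r_def by auto
  have r\<rho>: "r < \<rho>" using r(2) pos by simp
  have near: "cmod (F z - 1) \<le> 1 / 16" if "F holomorphic_on ball 0 \<rho>" "\<And>z. z \<in> ball 0 \<rho> \<Longrightarrow> cmod (F z) \<le> K\<^sup>2" "F 0 = 1" "cmod z < r" for F z
  proof -
    have "cmod (F z - 1) \<le> 4 * K\<^sup>2 / \<rho> * cmod z"
      using that r pos by (intro norm_diff_one_le) auto
    also have "\<dots> \<le> 4 * K\<^sup>2 / \<rho> * (\<rho> / (64 * K\<^sup>2))"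
      using that(4) r(3) pos by (intro mult_left_mono) auto
    also have "\<dots> = 1 / 16" using pos by simp
    finally show ?thesis .
  qed
  have \<alpha>1: "cmod (\<alpha> \<omega> z - 1) \<le> 1 / 16" if "\<omega> \<in> \<Omega>" "cmod z < r" for \<omega> z
    by (rule near[OF \<alpha>_holomorphic]) (use that \<alpha>_le \<alpha>_0 in auto)
  have \<beta>1: "cmod (\<beta> \<omega> z - 1) \<le> 1 / 16" if "\<omega> \<in> \<Omega>" "cmod z < r" for \<omega> z
    by (rule near[OF \<beta>_holomorphic]) (use that \<beta>_le \<beta>_0 in auto)
  have \<alpha>\<beta>: "cmod (\<alpha> \<omega> z * \<beta> \<omega>' z - 1) \<le> 1 / 4" if "\<omega> \<in> \<Omega>" "\<omega>' \<in> \<Omega>" "cmod z < r" for \<omega> \<omega>' z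
  proof -
    have "cmod (\<beta> \<omega>' z) \<le> 2" using \<beta>1[OF that(2,3)] norm_triangle_ineq2[of "\<beta> \<omega>' z" 1] by simp
    from norm_mult_diff_le[OF \<alpha>1[OF that(1,3)] \<beta>1[OF that(2,3)] this, of] show ?thesis by simp
  qed
  have b_near: "cmod (b \<omega> n z - 1) \<le> 1 / 2" "b \<omega> n z \<noteq> 0" "1 / 2 \<le> cmod (b \<omega> n z)" "cmod (b \<omega> n z) \<le> 2"
    if "\<omega> \<in> \<Omega>" "cmod z < r" "n0 - 1 \<le> n" for \<omega> z n
  proof -
    have n: "1 \<le> n" "n1 \<le> n" using that(3) by (auto simp: n0_def)
    have "cmod (b \<omega> n z - \<alpha> \<omega> z * \<beta> ((\<theta> ^^ n) \<omega>) z) \<le> e n"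
      unfolding e_def using that r\<rho> by (intro b_approx n) auto
    then have "cmod ((b \<omega> n z - \<alpha> \<omega> z * \<beta> ((\<theta> ^^ n) \<omega>) z) + (\<alpha> \<omega> z * \<beta> ((\<theta> ^^ n) \<omega>) z - 1)) \<le> 1 / 128 + 1 / 4"
      using n1[OF n(2)] \<alpha>\<beta>[OF that(1) funpow_\<Omega>[OF that(1)] that(2)] by (intro norm_triangle_mono) auto
    then show near: "cmod (b \<omega> n z - 1) \<le> 1 / 2" by simp
    show lb: "1 / 2 \<le> cmod (b \<omega> n z)" using near norm_triangle_ineq2[of 1 "b \<omega> n z"] by (simp add: norm_minus_commute)
    show "cmod (b \<omega> n z) \<le> 2" using near norm_triangle_ineq2[of "b \<omega> n z" 1] by simp
    show "b \<omega> n z \<noteq> 0" using lb by auto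
  qed
  show ?thesis
  proof (rule that[of r n0])
    show "0 < r" "r < \<rho>" "2 \<le> n0" using r r\<rho> by (auto simp: n0_def)
    fix \<omega> z n assume \<omega>: "\<omega> \<in> \<Omega>" and z: "cmod z < r"
    show "cmod (mgf \<omega> n z - 1) \<le> 1 / 4" if n: "n \<le> Suc n0"
    proof -
      have "cmod (mgf \<omega> n z - 1) \<le> 4 * (2 * K\<^sup>2) / r1 * cmod z"
      proof (rule norm_diff_one_le[OF mgf_holomorphic_ball[OF \<omega> r1] _ r1 mgf_0[OF \<omega>]])
        fix w :: complex assume "w \<in> ball 0 r1"
        then have "cmod w * real n \<le> r1 * real (Suc n0)" using n r1 by (intro mult_mono) auto
        also have "\<dots> < \<rho>" using pos by (simp add: r1n del: of_nat_Suc)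
        finally show "cmod (mgf \<omega> n w) \<le> 2 * K\<^sup>2" by (rule mgf_le[OF \<omega>])
      qed (use z r in auto)
      also have "\<dots> \<le> 4 * (2 * K\<^sup>2) / r1 * (r1 / (32 * K\<^sup>2))"
        using z r(5) r1 by (intro mult_left_mono) auto
      also have "\<dots> = 1 / 4" using r1 pos by simp
      finally show ?thesis .
    qed
    assume n: "n0 \<le> n"
    have z\<rho>: "cmod z < \<rho>" using z r\<rho> by simp
    have "mgf \<omega> n z = b \<omega> n z * (\<Prod>j<n. lam ((\<theta> ^^ j) \<omega>) z)"
      using lam_nz[OF funpow_\<Omega>[OF \<omega>] z\<rho>] by (simp add: b_def)
    then show "mgf \<omega> n z \<noteq> 0" using b_near(2)[OF \<omega> z, of n] n lam_nz[OF funpow_\<Omega>[OF \<omega>] z\<rho>] by simp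
    note \<theta>\<omega> = \<theta>_\<Omega>[OF \<omega>]
    have ns: "1 \<le> n" "1 \<le> n - 1" "n0 - 1 \<le> n" "n0 - 1 \<le> n - 1" "n0 - 1 \<le> n + 1" using n by (auto simp: n0_def)
    define x1 x2 x3 x4 where "x1 = b \<omega> (n + 1) z" and "x2 = b (\<theta> \<omega>) (n - 1) z" and "x3 = b \<omega> n z" and "x4 = b (\<theta> \<omega>) n z"
    define y1 y2 y3 y4 where "y1 = \<alpha> \<omega> z * \<beta> ((\<theta> ^^ (n + 1)) \<omega>) z" and "y2 = \<alpha> (\<theta> \<omega>) z * \<beta> ((\<theta> ^^ (n - 1)) (\<theta> \<omega>)) z"
      and "y3 = \<alpha> \<omega> z * \<beta> ((\<theta> ^^ n) \<omega>) z" and "y4 = \<alpha> (\<theta> \<omega>) z * \<beta> ((\<theta> ^^ n) (\<theta> \<omega>)) z"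
    have iter: "(\<theta> ^^ (n - 1)) (\<theta> \<omega>) = (\<theta> ^^ n) \<omega>" "(\<theta> ^^ n) (\<theta> \<omega>) = (\<theta> ^^ (n + 1)) \<omega>"
      using ns(1) by (cases n; simp add: funpow_swap1)+
    \<comment> \<open>The exact cancellation of the limiting factors: the starting points agree and
      the end points are exchanged.\<close>
    have y: "y1 * y2 = y3 * y4" unfolding y1_def y2_def y3_def y4_def iter by simp
    have em: "e (n + 1) \<le> e (n - 1)" "e n \<le> e (n - 1)" by (rule e_mono, simp)+
    have d: "cmod (x1 - y1) \<le> e (n - 1)" "cmod (x2 - y2) \<le> e (n - 1)" "cmod (x3 - y3) \<le> e (n - 1)" "cmod (x4 - y4) \<le> e (n - 1)"
      unfolding x1_def x2_def x3_def x4_def y1_def y2_def y3_def y4_def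
      using order_trans[OF b_approx[OF \<omega> z\<rho>, folded e_def] em(1)] b_approx[OF \<theta>\<omega> z\<rho> ns(2), folded e_def]
        order_trans[OF b_approx[OF \<omega> z\<rho> ns(1), folded e_def] em(2)] order_trans[OF b_approx[OF \<theta>\<omega> z\<rho> ns(1), folded e_def] em(2)]
      by (simp_all only: le_add2)
    have x: "cmod x2 \<le> 2" "cmod x4 \<le> 2" "1 / 2 \<le> cmod x3" "1 / 2 \<le> cmod x4"
      unfolding x2_def x3_def x4_def using b_near \<omega> \<theta>\<omega> z ns by auto
    have "cmod (\<alpha> \<omega> z * \<beta> \<omega>' z) \<le> 2" if "\<omega>' \<in> \<Omega>" for \<omega>'
      using \<alpha>\<beta>[OF \<omega> that z] norm_triangle_ineq2[of "\<alpha> \<omega> z * \<beta> \<omega>' z" 1] by simp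
    from this[OF funpow_\<Omega>[OF \<omega>]] have y2: "cmod y1 \<le> 2" "cmod y3 \<le> 2" unfolding y1_def y3_def by blast+
    have "cmod (x1 * x2 - x3 * x4) = cmod ((x1 * x2 - y1 * y2) - (x3 * x4 - y3 * y4))" by (simp add: y)
    also have "\<dots> \<le> 4 * e (n - 1) + 4 * e (n - 1)"
      by (rule order_trans[OF norm_triangle_ineq4]) (intro add_mono norm_mult_diff_le d x y2)
    finally have num: "cmod (x1 * x2 - x3 * x4) \<le> 8 * e (n - 1)" by simp
    have den: "1 / 4 \<le> cmod (x3 * x4)" unfolding norm_mult using mult_mono[OF x(3,4)] by simp
    have nz: "x3 * x4 \<noteq> 0" using den by auto
    have "R \<omega> n z - 1 = (x1 * x2 - x3 * x4) / (x3 * x4)"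
      unfolding R_eq_b[OF \<omega> z\<rho> ns(1)] x1_def[symmetric] x2_def[symmetric] x3_def[symmetric] x4_def[symmetric]
      using nz by (simp add: diff_divide_distrib)
    then have "cmod (R \<omega> n z - 1) = cmod (x1 * x2 - x3 * x4) / cmod (x3 * x4)" by (simp only: norm_divide)
    also have "\<dots> \<le> 8 * e (n - 1) / (1 / 4)"
      using num den e_pos by (intro frac_le) auto
    finally show "cmod (R \<omega> n z - 1) \<le> 32 * (K\<^sup>2 * C * \<delta> ^ (n - 1))" by (simp add: e_def)
  next
    fix n assume "n0 \<le> n"
    then have "n1 \<le> n - 1" by (simp add: n0_def)
    from n1[OF this] show "32 * (K\<^sup>2 * C * \<delta> ^ (n - 1)) \<le> 1 / 4" unfolding e_def by simp
  qed
qed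

text \<open>\<open>q n\<close> is a logarithm of the ratio of the moment generating functions of \<open>S\<^sub>n\<^sub>+\<^sub>1\<close> over \<open>\<omega>\<close>
  and of \<open>S\<^sub>n\<close> over \<open>\<theta> \<omega>\<close>. The eigenvalues cancel in \<open>R\<close>, so the increments of \<open>q\<close> decay
  exponentially, and no bounds on \<open>lam\<close> are needed.\<close>

lemma log_ratio_exists:
  obtains r c where "0 < r" "r < \<rho>" "0 \<le> c" "\<And>\<omega>. \<omega> \<in> \<Omega> \<Longrightarrow> \<exists>q.
     (\<forall>n. q n holomorphic_on ball 0 r \<and> q n 0 = 0 \<and>
        (\<forall>z\<in>ball 0 r. cmod (q n z) \<le> c \<and> mgf \<omega> (Suc n) z = exp (q n z) * mgf (\<theta> \<omega>) n z \<and>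
           cmod (q (Suc n) z - q n z) \<le> c * \<delta> ^ n))"
proof -
  obtain r n0 where r: "0 < r" "r < \<rho>" "2 \<le> n0"
    and small: "\<And>\<omega> z n. \<omega> \<in> \<Omega> \<Longrightarrow> cmod z < r \<Longrightarrow> n \<le> Suc n0 \<Longrightarrow> cmod (mgf \<omega> n z - 1) \<le> 1 / 4"
    and nz: "\<And>\<omega> z n. \<omega> \<in> \<Omega> \<Longrightarrow> cmod z < r \<Longrightarrow> n0 \<le> n \<Longrightarrow> mgf \<omega> n z \<noteq> 0"
    and R: "\<And>\<omega> z n. \<omega> \<in> \<Omega> \<Longrightarrow> cmod z < r \<Longrightarrow> n0 \<le> n \<Longrightarrow> cmod (R \<omega> n z - 1) \<le> 32 * (K\<^sup>2 * C * \<delta> ^ (n - 1))"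
    and R_small: "\<And>n. n0 \<le> n \<Longrightarrow> 32 * (K\<^sup>2 * C * \<delta> ^ (n - 1)) \<le> 1 / 4"
    by (rule spectral_constants) (rule that; assumption)
  have mgf_nz: "mgf \<omega> n z \<noteq> 0" if "\<omega> \<in> \<Omega>" "cmod z < r" for \<omega> z n
    using nz[OF that, of n] norm_Ln_near_one_le(3)[OF small[OF that, of n]] by (cases "n0 \<le> n") auto
  define a where "a = 64 * (K\<^sup>2 * C)"
  have a: "0 \<le> a" using pos by (simp add: a_def)
  \<comment> \<open>\<open>2\<close> bounds the principal logarithms and
    \<open>a / (1 - \<delta>)\<close> the later geometric sum. Increments need \<open>a\<close> in
    the late regime; before it, \<open>4 / \<delta> ^ n0\<close> lets
    \<open>c * \<delta> ^ n\<close> dominate the trivial bound \<open>4\<close>.\<close>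
  define c where "c = 2 + a / (1 - \<delta>) + a + 4 / \<delta> ^ n0"
  have c_ge: "2 + a / (1 - \<delta>) \<le> c" "a \<le> c" "4 / \<delta> ^ n0 \<le> c" "0 \<le> c" using a pos by (auto simp: c_def)
  show ?thesis
  proof (rule that[of r c])
    show "0 < r" "r < \<rho>" "0 \<le> c" using r c_ge by auto
    fix \<omega> assume \<omega>: "\<omega> \<in> \<Omega>"
    note \<theta>\<omega> = \<theta>_\<Omega>[OF \<omega>]
    \<comment> \<open>Principal logarithms while the generating functions are near \<open>1\<close>,
      then the accumulated logarithms of \<open>R\<close>. The last early index \<open>n0\<close>
      uses \<open>mgf\<close> at \<open>Suc n0\<close>, which is why closeness to \<open>1\<close>
      was secured up to there.\<close>
    define q where "q = rec_nat (\<lambda>z. Ln (mgf \<omega> 1 z) - Ln (mgf (\<theta> \<omega>) 0 z))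
      (\<lambda>n qn z. if Suc n \<le> n0 then Ln (mgf \<omega> (Suc (Suc n)) z) - Ln (mgf (\<theta> \<omega>) (Suc n) z)
               else qn z + Ln (R \<omega> (Suc n) z))"
    have q_small: "q n = (\<lambda>z. Ln (mgf \<omega> (Suc n) z) - Ln (mgf (\<theta> \<omega>) n z))" if "n \<le> n0" for n
      using that by (cases n) (auto simp: q_def fun_eq_iff)
    have q_Suc: "q (Suc n) = (\<lambda>z. q n z + Ln (R \<omega> (Suc n) z))" if "n0 \<le> n" for n
      using that by (auto simp: q_def fun_eq_iff)
    have R1: "cmod (R \<omega> n z - 1) \<le> 1 / 4" if "cmod z < r" "n0 \<le> n" for z n
      using R[OF \<omega> that] R_small[OF that(2)] by linarith
    have R_hol: "R \<omega> n holomorphic_on ball 0 r" if "n0 \<le> n" for n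
      unfolding R_def[abs_def] using mgf_nz[OF \<omega>] mgf_nz[OF \<theta>\<omega>]
      by (intro holomorphic_intros mgf_holomorphic_ball \<omega> \<theta>\<omega> r) auto
    have R_0: "R \<omega> n 0 = 1" for n by (simp add: R_def mgf_0 \<omega> \<theta>\<omega>)
    have LnM: "cmod (Ln (mgf \<omega>' n z)) \<le> 1" "exp (Ln (mgf \<omega>' n z)) = mgf \<omega>' n z" if "\<omega>' \<in> \<Omega>" "cmod z < r" "n \<le> Suc n0" for \<omega>' n z
      using norm_Ln_near_one_le[OF small[OF that]] small[OF that] by auto
    have LnM_hol: "(\<lambda>z. Ln (mgf \<omega>' n z)) holomorphic_on ball 0 r" if "\<omega>' \<in> \<Omega>" "n \<le> Suc n0" for \<omega>' n
      using norm_Ln_near_one_le(2)[OF small[OF that(1) _ that(2)]] by (intro holomorphic_on_Ln' mgf_holomorphic_ball that r) auto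
    have LnR: "cmod (Ln (R \<omega> (Suc n) z)) \<le> a * \<delta> ^ n" "exp (Ln (R \<omega> (Suc n) z)) = R \<omega> (Suc n) z" if "cmod z < r" "n0 \<le> n" for n z
    proof -
      have "n0 \<le> Suc n" using that by simp
      note near = R1[OF that(1) this]
      show "exp (Ln (R \<omega> (Suc n) z)) = R \<omega> (Suc n) z" using norm_Ln_near_one_le(3)[OF near] by simp
      show "cmod (Ln (R \<omega> (Suc n) z)) \<le> a * \<delta> ^ n"
        using norm_Ln_near_one_le(1)[OF near] R[OF \<omega> that(1) \<open>n0 \<le> Suc n\<close>] by (simp add: a_def)
    qed
    have LnR_hol: "(\<lambda>z. Ln (R \<omega> (Suc n) z)) holomorphic_on ball 0 r" if "n0 \<le> n" for n
      using norm_Ln_near_one_le(2)[OF R1] that by (intro holomorphic_on_Ln' R_hol) auto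
    have main: "q n holomorphic_on ball 0 r \<and> q n 0 = 0 \<and>
        (\<forall>z\<in>ball 0 r. cmod (q n z) \<le> 2 + (\<Sum>k<n. a * \<delta> ^ k) \<and> mgf \<omega> (Suc n) z = exp (q n z) * mgf (\<theta> \<omega>) n z)" for n
    proof (induction n)
      case 0
      have "cmod (Ln (mgf \<omega> (Suc 0) z) - Ln (mgf (\<theta> \<omega>) 0 z)) \<le> 1 + 1" if "cmod z < r" for z
        by (rule order_trans[OF norm_triangle_ineq4]) (intro add_mono LnM \<omega> \<theta>\<omega> that; simp)
      then show ?case
        unfolding q_small[OF le0] using LnM(2)[OF \<omega>, of _ "Suc 0"] LnM(2)[OF \<theta>\<omega>, of _ 0] mgf_nz[OF \<theta>\<omega>, of _ 0]
        by (auto intro!: holomorphic_intros LnM_hol \<omega> \<theta>\<omega> simp: mgf_0 \<omega> \<theta>\<omega> exp_diff)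
    next
      case (Suc n)
      have sum_nonneg: "0 \<le> (\<Sum>k<Suc n. a * \<delta> ^ k)" using a pos by (intro sum_nonneg) auto
      show ?case
      proof (cases "Suc n \<le> n0")
        case True
        have "cmod (Ln (mgf \<omega> (Suc (Suc n)) z) - Ln (mgf (\<theta> \<omega>) (Suc n) z)) \<le> 1 + 1" if "cmod z < r" for z
          using True by (rule_tac order_trans[OF norm_triangle_ineq4]) (intro add_mono LnM \<omega> \<theta>\<omega> that; simp)
        then have "cmod (Ln (mgf \<omega> (Suc (Suc n)) z) - Ln (mgf (\<theta> \<omega>) (Suc n) z)) \<le> 2 + (\<Sum>k<Suc n. a * \<delta> ^ k)" if "cmod z < r" for z
          using that sum_nonneg by fastforce
        moreover have "mgf \<omega> (Suc (Suc n)) z = exp (Ln (mgf \<omega> (Suc (Suc n)) z) - Ln (mgf (\<theta> \<omega>) (Suc n) z)) * mgf (\<theta> \<omega>) (Suc n) z" if "cmod z < r" for z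
          using LnM(2)[OF \<omega> that, of "Suc (Suc n)"] LnM(2)[OF \<theta>\<omega> that, of "Suc n"] mgf_nz[OF \<theta>\<omega> that, of "Suc n"] True
          by (simp add: exp_diff)
        moreover have "(\<lambda>z. Ln (mgf \<omega> (Suc (Suc n)) z) - Ln (mgf (\<theta> \<omega>) (Suc n) z)) holomorphic_on ball 0 r"
          using True by (intro holomorphic_intros LnM_hol \<omega> \<theta>\<omega>) auto
        ultimately show ?thesis
          unfolding q_small[OF True] by (auto simp: mgf_0 \<omega> \<theta>\<omega> simp del: sum.lessThan_Suc)
      next
        case False
        then have n: "n0 \<le> n" by simp
        have "cmod (q n z + Ln (R \<omega> (Suc n) z)) \<le> 2 + (\<Sum>k<Suc n. a * \<delta> ^ k)" if "cmod z < r" for z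
        proof -
          have "cmod (q n z + Ln (R \<omega> (Suc n) z)) \<le> (2 + (\<Sum>k<n. a * \<delta> ^ k)) + a * \<delta> ^ n"
            using Suc that LnR(1)[OF that n] by (intro norm_triangle_mono) auto
          then show ?thesis by simp
        qed
        moreover have "mgf \<omega> (Suc (Suc n)) z = exp (q n z + Ln (R \<omega> (Suc n) z)) * mgf (\<theta> \<omega>) (Suc n) z" if "cmod z < r" for z
        proof -
          have "mgf \<omega> (Suc n) z = exp (q n z) * mgf (\<theta> \<omega>) n z" using Suc that by auto
          then have "exp (q n z) = mgf \<omega> (Suc n) z / mgf (\<theta> \<omega>) n z" using mgf_nz[OF \<theta>\<omega> that, of n] by simp
          then show ?thesis
            using mgf_nz[OF \<theta>\<omega> that] mgf_nz[OF \<omega> that]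
            by (simp add: exp_add LnR(2)[OF that n] R_def)
        qed
        moreover have "(\<lambda>z. q n z + Ln (R \<omega> (Suc n) z)) holomorphic_on ball 0 r"
          using Suc by (intro holomorphic_intros LnR_hol n) auto
        ultimately show ?thesis
          unfolding q_Suc[OF n] using Suc by (auto simp: R_0 simp del: sum.lessThan_Suc)
      qed
    qed
    have geo: "(\<Sum>k<n. a * \<delta> ^ k) \<le> a / (1 - \<delta>)" for n
    proof -
      have "(\<Sum>k<n. \<delta> ^ k) \<le> (\<Sum>k. \<delta> ^ k)" using pos by (intro sum_le_suminf summable_geometric) auto
      also have "\<dots> = 1 / (1 - \<delta>)" using pos by (intro suminf_geometric) auto
      finally have "a * (\<Sum>k<n. \<delta> ^ k) \<le> a * (1 / (1 - \<delta>))" using a by (rule mult_left_mono)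
      then show ?thesis by (simp add: sum_distrib_left)
    qed
    have q_le: "cmod (q n z) \<le> c" if "cmod z < r" for n z
    proof -
      have "cmod (q n z) \<le> 2 + (\<Sum>k<n. a * \<delta> ^ k)" using main[of n] that by simp
      also have "\<dots> \<le> c" using geo[of n] c_ge(1) by linarith
      finally show ?thesis .
    qed
    have incr: "cmod (q (Suc n) z - q n z) \<le> c * \<delta> ^ n" if z: "cmod z < r" for n z
    proof (cases "n0 \<le> n")
      case True
      have "cmod (q (Suc n) z - q n z) \<le> a * \<delta> ^ n" unfolding q_Suc[OF True] using LnR(1)[OF z True] by simp
      also have "\<dots> \<le> c * \<delta> ^ n" using c_ge pos by (intro mult_right_mono) auto
      finally show ?thesis .
    next
      case False
      have "cmod (q m z) \<le> 2" if "m \<le> n0" for m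
      proof -
        have "cmod (q m z) \<le> 1 + 1" unfolding q_small[OF that]
          by (rule order_trans[OF norm_triangle_ineq4]) (use that in \<open>intro add_mono LnM \<omega> \<theta>\<omega> z; simp\<close>)
        then show ?thesis by simp
      qed
      then have "cmod (q (Suc n) z - q n z) \<le> 2 + 2"
        using False by (rule_tac order_trans[OF norm_triangle_ineq4]) (intro add_mono; simp)
      also have "\<dots> \<le> 4 / \<delta> ^ n0 * \<delta> ^ n"
      proof -
        have "\<delta> ^ n0 \<le> \<delta> ^ n" using pos False by (intro power_decreasing) auto
        then show ?thesis using pos by (simp add: field_simps)
      qed
      also have "\<dots> \<le> c * \<delta> ^ n" using c_ge pos by (intro mult_right_mono) auto
      finally show ?thesis .
    qed
    show "\<exists>q. (\<forall>n. q n holomorphic_on ball 0 r \<and> q n 0 = 0 \<and>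
        (\<forall>z\<in>ball 0 r. cmod (q n z) \<le> c \<and> mgf \<omega> (Suc n) z = exp (q n z) * mgf (\<theta> \<omega>) n z \<and>
           cmod (q (Suc n) z - q n z) \<le> c * \<delta> ^ n))"
      using main q_le incr by (intro exI[of _ q]) auto
  qed
qed

definition "V \<omega> n = prob_space.variance (mu \<omega>) (S \<omega> n)"

text \<open>Induction along the orbit: a logarithm over \<open>\<omega>\<close> at
  \<open>n + 1\<close> is \<open>q n\<close> plus one over \<open>\<theta> \<omega>\<close> at
  \<open>n\<close>. The second derivative of \<open>q n\<close> at \<open>0\<close> is therefore the
  difference of variances, and Cauchy's estimate transfers the bound and the geometric increments of
  \<open>q\<close> to it.\<close>

lemma uniform_cumulant_bounds:
  obtains r c where "0 < r" "0 \<le> c"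
    "\<And>\<omega> n. \<omega> \<in> \<Omega> \<Longrightarrow> log_mgf_bound (mu \<omega>) (S \<omega> n) r (c * real n)"
    "\<And>\<omega> n. \<omega> \<in> \<Omega> \<Longrightarrow> \<bar>V \<omega> (Suc n) - V (\<theta> \<omega>) n\<bar> \<le> c"
    "\<And>\<omega> n. \<omega> \<in> \<Omega> \<Longrightarrow> \<bar>(V \<omega> (Suc (Suc n)) - V (\<theta> \<omega>) (Suc n)) - (V \<omega> (Suc n) - V (\<theta> \<omega>) n)\<bar> \<le> c * \<delta> ^ n"
proof -
  obtain r c where r: "0 < r" "r < \<rho>" and c: "0 \<le> c" and q: "\<And>\<omega>. \<omega> \<in> \<Omega> \<Longrightarrow> \<exists>q.
     (\<forall>n. q n holomorphic_on ball 0 r \<and> q n 0 = 0 \<and>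
        (\<forall>z\<in>ball 0 r. cmod (q n z) \<le> c \<and> mgf \<omega> (Suc n) z = exp (q n z) * mgf (\<theta> \<omega>) n z \<and>
           cmod (q (Suc n) z - q n z) \<le> c * \<delta> ^ n))"
    by (rule log_ratio_exists) (rule that; assumption)
  have K_ex: "\<exists>k. k holomorphic_on ball 0 r \<and> k 0 = 0 \<and> (\<forall>z\<in>ball 0 r. cmod (k z) \<le> c * real n \<and> mgf \<omega> n z = exp (k z))"
    if "\<omega> \<in> \<Omega>" for \<omega> n
    using that
  proof (induction n arbitrary: \<omega>)
    case 0
    interpret prob_space "mu \<omega>" by (rule prob_mu[OF 0])
    have "mgf \<omega> 0 z = 1" for z by (simp add: mgf_def birkhoff_sum_def prob_space)
    then show ?case by (intro exI[of _ "\<lambda>z. 0"]) auto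
  next
    case (Suc n)
    obtain k where k: "k holomorphic_on ball 0 r" "k 0 = 0"
      "\<And>z. z \<in> ball 0 r \<Longrightarrow> cmod (k z) \<le> c * real n" "\<And>z. z \<in> ball 0 r \<Longrightarrow> mgf (\<theta> \<omega>) n z = exp (k z)"
      using Suc.IH[OF \<theta>_\<Omega>[OF Suc.prems]] by blast
    obtain q where q: "q n holomorphic_on ball 0 r" "q n 0 = 0" "\<And>z. z \<in> ball 0 r \<Longrightarrow> cmod (q n z) \<le> c"
      "\<And>z. z \<in> ball 0 r \<Longrightarrow> mgf \<omega> (Suc n) z = exp (q n z) * mgf (\<theta> \<omega>) n z" using q[OF Suc.prems] by blast
    have "(\<lambda>z. q n z + k z) holomorphic_on ball 0 r" by (intro holomorphic_intros q k)
    moreover have "cmod (q n z + k z) \<le> c * real (Suc n)" if "z \<in> ball 0 r" for z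
      using norm_triangle_mono[OF q(3)[OF that] k(3)[OF that]] by (simp add: algebra_simps)
    moreover have "mgf \<omega> (Suc n) z = exp (q n z + k z)" if "z \<in> ball 0 r" for z
      using q(4)[OF that] k(4)[OF that] by (simp add: exp_add)
    ultimately show ?case using q(2) k(2) by (intro exI[of _ "\<lambda>z. q n z + k z"]) auto
  qed
  have V_deriv: "(deriv ^^ 2) k 0 = complex_of_real (V \<omega> n)"
    if "\<omega> \<in> \<Omega>" "k holomorphic_on ball 0 r" "k 0 = 0" "\<And>z. z \<in> ball 0 r \<Longrightarrow> mgf \<omega> n z = exp (k z)" for \<omega> n k
  proof -
    interpret prob_space "mu \<omega>" by (rule prob_mu[OF that(1)])
    show ?thesis unfolding V_def
      by (rule log_mgf_derivs(2)[OF S_meas[OF that(1)] that(2,3) r(1) exp_zS_integrable[OF that(1)]])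
         (use that(4) in \<open>simp add: mgf_def\<close>)
  qed
  have q_deriv: "(deriv ^^ 2) (q n) 0 = complex_of_real (V \<omega> (Suc n) - V (\<theta> \<omega>) n)"
    if \<omega>: "\<omega> \<in> \<Omega>" and q: "q n holomorphic_on ball 0 r" "q n 0 = 0"
      "\<And>z. z \<in> ball 0 r \<Longrightarrow> mgf \<omega> (Suc n) z = exp (q n z) * mgf (\<theta> \<omega>) n z" for \<omega> n q
  proof -
    obtain k where k: "k holomorphic_on ball 0 r" "k 0 = 0" "\<And>z. z \<in> ball 0 r \<Longrightarrow> mgf (\<theta> \<omega>) n z = exp (k z)"
      using K_ex[OF \<theta>_\<Omega>[OF \<omega>], of n] by blast
    have "(deriv ^^ 2) (\<lambda>z. q n z + k z) 0 = (deriv ^^ 2) (q n) 0 + (deriv ^^ 2) k 0"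
      using q k r by (intro higher_deriv_add[of _ "ball 0 r"]) auto
    moreover have "(deriv ^^ 2) (\<lambda>z. q n z + k z) 0 = complex_of_real (V \<omega> (Suc n))"
      using q k by (intro V_deriv[OF \<omega>]) (auto intro!: holomorphic_intros simp: exp_add)
    moreover have "(deriv ^^ 2) k 0 = complex_of_real (V (\<theta> \<omega>) n)"
      by (rule V_deriv[OF \<theta>_\<Omega>[OF \<omega>] k])
    ultimately show ?thesis by simp
  qed
  \<comment> \<open>The second summand is Cauchy's bound for the second derivative at
    \<open>0\<close> of a function bounded by \<open>c\<close>.\<close>
  define c' where "c' = c + 2 * c / (r / 4)\<^sup>2"
  have c': "c \<le> c'" "2 * c / (r / 4)\<^sup>2 \<le> c'" using c by (auto simp: c'_def)
  show ?thesis
  proof (rule that[of r c'])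
    show "0 < r" "0 \<le> c'" using r c c' by auto
    fix \<omega> n assume \<omega>: "\<omega> \<in> \<Omega>"
    obtain k where k: "k holomorphic_on ball 0 r" "k 0 = 0"
      "\<And>z. z \<in> ball 0 r \<Longrightarrow> cmod (k z) \<le> c * real n" "\<And>z. z \<in> ball 0 r \<Longrightarrow> mgf \<omega> n z = exp (k z)"
      using K_ex[OF \<omega>, of n] by blast
    have "c * real n \<le> c' * real n" using c'(1) by (intro mult_right_mono) auto
    then have "cmod (k z) \<le> c' * real n" if "z \<in> ball 0 r" for z using k(3)[OF that] by linarith
    then show "log_mgf_bound (mu \<omega>) (S \<omega> n) r (c' * real n)"
      unfolding log_mgf_bound_def using S_meas[OF \<omega>] exp_zS_integrable[OF \<omega>] k by (auto simp: mgf_def)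
    obtain q where q: "\<And>n. q n holomorphic_on ball 0 r" "\<And>n. q n 0 = 0" "\<And>n z. z \<in> ball 0 r \<Longrightarrow> cmod (q n z) \<le> c"
      "\<And>n z. z \<in> ball 0 r \<Longrightarrow> mgf \<omega> (Suc n) z = exp (q n z) * mgf (\<theta> \<omega>) n z"
      "\<And>n z. z \<in> ball 0 r \<Longrightarrow> cmod (q (Suc n) z - q n z) \<le> c * \<delta> ^ n" using q[OF \<omega>] by blast
    have "cmod ((deriv ^^ 2) (q n) 0) \<le> fact 2 * c / (r / 4) ^ 2"
      using q(1,3) r by (intro Cauchy_bound_half) auto
    moreover have d: "(deriv ^^ 2) (q n) 0 = complex_of_real (V \<omega> (Suc n) - V (\<theta> \<omega>) n)" for n
      by (rule q_deriv[OF \<omega> q(1) q(2) q(4)])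
    ultimately have "\<bar>V \<omega> (Suc n) - V (\<theta> \<omega>) n\<bar> \<le> fact 2 * c / (r / 4) ^ 2"
      by (simp only: d norm_of_real)
    then show "\<bar>V \<omega> (Suc n) - V (\<theta> \<omega>) n\<bar> \<le> c'" using c'(2) by simp
    have "(deriv ^^ 2) (\<lambda>z. q (Suc n) z - q n z) 0 = (deriv ^^ 2) (q (Suc n)) 0 - (deriv ^^ 2) (q n) 0"
      using q(1) r by (intro higher_deriv_diff[of _ "ball 0 r"]) auto
    then have eq: "(deriv ^^ 2) (\<lambda>z. q (Suc n) z - q n z) 0
        = complex_of_real ((V \<omega> (Suc (Suc n)) - V (\<theta> \<omega>) (Suc n)) - (V \<omega> (Suc n) - V (\<theta> \<omega>) n))"
      by (simp only: d) simp
    have "cmod ((deriv ^^ 2) (\<lambda>z. q (Suc n) z - q n z) 0) \<le> fact 2 * (c * \<delta> ^ n) / (r / 4) ^ 2"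
      using q(1,5) r by (intro Cauchy_bound_half) (auto intro!: holomorphic_intros)
    also have "\<dots> = 2 * c / (r / 4)\<^sup>2 * \<delta> ^ n" by simp
    also have "\<dots> \<le> c' * \<delta> ^ n" using c' pos by (intro mult_right_mono) auto
    finally show "\<bar>(V \<omega> (Suc (Suc n)) - V (\<theta> \<omega>) (Suc n)) - (V \<omega> (Suc n) - V (\<theta> \<omega>) n)\<bar> \<le> c' * \<delta> ^ n"
      unfolding eq norm_of_real .
  qed
qed

end

section \<open>Square integrable coboundaries\<close>

locale measure_preserving = prob_space M for M :: "'a measure" +
  fixes \<tau> :: "'a \<Rightarrow> 'a" and g :: "'a \<Rightarrow> real"
  assumes \<tau>_meas [measurable]: "\<tau> \<in> M \<rightarrow>\<^sub>M M" and \<tau>_distr: "distr M M \<tau> = M"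
    and g_meas [measurable]: "g \<in> borel_measurable M"
begin

definition bs :: "nat \<Rightarrow> 'a \<Rightarrow> real" where "bs n x = (\<Sum>j<n. g ((\<tau> ^^ j) x))"

lemma funpow_meas [measurable]: "\<tau> ^^ n \<in> M \<rightarrow>\<^sub>M M"
  by (induction n) (auto intro: measurable_comp \<tau>_meas)

lemma funpow_distr: "distr M M (\<tau> ^^ n) = M"
proof (induction n)
  case 0
  then show ?case by (simp add: distr_id2 id_def)
next
  case (Suc n)
  have "distr (distr M M (\<tau> ^^ n)) M \<tau> = distr M M (\<tau> \<circ> \<tau> ^^ n)"
    by (rule distr_distr[OF \<tau>_meas funpow_meas])
  then show ?case using Suc \<tau>_distr by (simp only: funpow.simps)
qed

lemma bs_meas [measurable]: "bs n \<in> borel_measurable M"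
proof -
  have "(\<lambda>x. g ((\<tau> ^^ j) x)) \<in> borel_measurable M" for j
    by (rule measurable_compose[OF funpow_meas g_meas])
  then show ?thesis unfolding bs_def[abs_def] by measurable
qed

lemma bs_add: "bs (m + n) x = bs m x + bs n ((\<tau> ^^ m) x)"
  unfolding bs_def by (induction n) (auto simp: funpow_add add.commute[of m])

lemma integral_funpow:
  fixes h :: "'a \<Rightarrow> real"
  assumes "h \<in> borel_measurable M"
  shows "(\<integral>x. h ((\<tau> ^^ n) x) \<partial>M) = (\<integral>x. h x \<partial>M)"
  using integral_distr[OF funpow_meas assms, of n] by (simp add: funpow_distr)

lemma nn_integral_funpow:
  assumes "h \<in> borel_measurable M"
  shows "(\<integral>\<^sup>+x. h ((\<tau> ^^ n) x) \<partial>M) = (\<integral>\<^sup>+x. h x \<partial>M)"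
  using nn_integral_distr[OF funpow_meas, of h n] assms by (simp add: funpow_distr)

lemma AE_funpow:
  assumes "AE x in M. Q x"
  shows "AE x in M. Q ((\<tau> ^^ n) x)"
  by (rule AE_distrD[of "\<tau> ^^ n" M M]) (simp_all only: funpow_distr funpow_meas assms)

text \<open>The sums telescope to \<open>r x - r ((\<tau> ^^ n) x)\<close>, and by invariance both
  terms have the same second moment.\<close>

lemma nn_integral_square_bs_le_of_coboundary:
  assumes r[measurable]: "r \<in> borel_measurable M" and cob: "AE x in M. g x = r x - r (\<tau> x)"
  shows "(\<integral>\<^sup>+x. ennreal ((bs n x)\<^sup>2) \<partial>M) \<le> 4 * (\<integral>\<^sup>+x. ennreal ((r x)\<^sup>2) \<partial>M)"
proof -
  have "AE x in M. \<forall>j. g ((\<tau> ^^ j) x) = r ((\<tau> ^^ j) x) - r (\<tau> ((\<tau> ^^ j) x))"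
    unfolding AE_all_countable using AE_funpow[OF cob] by blast
  then have "AE x in M. bs n x = r x - r ((\<tau> ^^ n) x)"
  proof (rule AE_mp, intro AE_I2 impI)
    fix x assume *: "\<forall>j. g ((\<tau> ^^ j) x) = r ((\<tau> ^^ j) x) - r (\<tau> ((\<tau> ^^ j) x))"
    have "bs n x = (\<Sum>j<n. r ((\<tau> ^^ j) x) - r ((\<tau> ^^ Suc j) x))" unfolding bs_def using * by simp
    also have "\<dots> = r x - r ((\<tau> ^^ n) x)" by (subst sum_lessThan_telescope') simp
    finally show "bs n x = r x - r ((\<tau> ^^ n) x)" .
  qed
  then have "(\<integral>\<^sup>+x. ennreal ((bs n x)\<^sup>2) \<partial>M) = (\<integral>\<^sup>+x. ennreal ((r x - r ((\<tau> ^^ n) x))\<^sup>2) \<partial>M)"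
    by (intro nn_integral_cong_AE) auto
  also have "\<dots> \<le> (\<integral>\<^sup>+x. 2 * ennreal ((r x)\<^sup>2) + 2 * ennreal ((r ((\<tau> ^^ n) x))\<^sup>2) \<partial>M)"
  proof (rule nn_integral_mono)
    fix x
    have "(r x - r ((\<tau> ^^ n) x))\<^sup>2 \<le> 2 * (r x)\<^sup>2 + 2 * (r ((\<tau> ^^ n) x))\<^sup>2"
      using zero_le_power2[of "r x + r ((\<tau> ^^ n) x)"] by (simp add: power2_diff power2_sum)
    then have "ennreal ((r x - r ((\<tau> ^^ n) x))\<^sup>2) \<le> ennreal (2 * (r x)\<^sup>2 + 2 * (r ((\<tau> ^^ n) x))\<^sup>2)"
      by (rule ennreal_leI)
    then show "ennreal ((r x - r ((\<tau> ^^ n) x))\<^sup>2) \<le> 2 * ennreal ((r x)\<^sup>2) + 2 * ennreal ((r ((\<tau> ^^ n) x))\<^sup>2)"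
      by (simp add: ennreal_mult' ennreal_plus)
  qed
  also have "\<dots> = 2 * (\<integral>\<^sup>+x. ennreal ((r x)\<^sup>2) \<partial>M) + 2 * (\<integral>\<^sup>+x. ennreal ((r ((\<tau> ^^ n) x))\<^sup>2) \<partial>M)"
    by (subst nn_integral_add) (auto simp: nn_integral_cmult)
  also have "(\<integral>\<^sup>+x. ennreal ((r ((\<tau> ^^ n) x))\<^sup>2) \<partial>M) = (\<integral>\<^sup>+x. ennreal ((r x)\<^sup>2) \<partial>M)"
    by (rule nn_integral_funpow) measurable
  also have "2 * (\<integral>\<^sup>+x. ennreal ((r x)\<^sup>2) \<partial>M) + 2 * (\<integral>\<^sup>+x. ennreal ((r x)\<^sup>2) \<partial>M) = 4 * (\<integral>\<^sup>+x. ennreal ((r x)\<^sup>2) \<partial>M)"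
    by (simp add: distrib_right[symmetric])
  finally show ?thesis .
qed

section \<open>Solving the coboundary equation when the second moments of the sums converge
  summably\<close>

context
  fixes v :: real and D :: real
  assumes g2: "integrable M (\<lambda>x. (g x)\<^sup>2)"
    and v_sum: "\<And>n. (\<Sum>k<n. \<bar>(\<integral>x. (bs k x)\<^sup>2 \<partial>M) - v\<bar>) \<le> D"
begin

definition "vn n = (\<integral>x. (bs n x)\<^sup>2 \<partial>M)"

lemma square_integrable_add:
  fixes p q :: "'a \<Rightarrow> real"
  assumes [measurable]: "p \<in> borel_measurable M" "q \<in> borel_measurable M"
    and "integrable M (\<lambda>x. (p x)\<^sup>2)" "integrable M (\<lambda>x. (q x)\<^sup>2)"
  shows "integrable M (\<lambda>x. (p x + q x)\<^sup>2)" "integrable M (\<lambda>x. p x * q x)"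
proof -
  have i: "integrable M (\<lambda>x. 2 * ((p x)\<^sup>2 + (q x)\<^sup>2))" using assms by simp
  have "(p x + q x)\<^sup>2 \<le> 2 * ((p x)\<^sup>2 + (q x)\<^sup>2)" for x
    using zero_le_power2[of "p x - q x"] by (simp add: power2_diff power2_sum)
  then show "integrable M (\<lambda>x. (p x + q x)\<^sup>2)"
    by (intro Bochner_Integration.integrable_bound[OF i]) auto
  have "\<bar>p x * q x\<bar> \<le> 2 * ((p x)\<^sup>2 + (q x)\<^sup>2)" for x
  proof -
    have "2 * \<bar>p x * q x\<bar> \<le> (p x)\<^sup>2 + (q x)\<^sup>2"
      using sum_squares_bound[of "\<bar>p x\<bar>" "\<bar>q x\<bar>"] by (simp add: abs_mult mult.assoc)
    then show ?thesis using sum_power2_ge_zero[of "p x" "q x"] abs_ge_zero[of "p x * q x"]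
      unfolding distrib_left by linarith
  qed
  then show "integrable M (\<lambda>x. p x * q x)"
    by (intro Bochner_Integration.integrable_bound[OF i]) auto
qed

lemma bs_square_integrable: "integrable M (\<lambda>x. (bs n x)\<^sup>2)"
proof (induction n)
  case (Suc n)
  have "integrable M (\<lambda>x. (g ((\<tau> ^^ n) x))\<^sup>2)"
    using integrable_distr[OF funpow_meas, of n "\<lambda>x. (g x)\<^sup>2"] g2 by (simp add: funpow_distr)
  moreover have "(\<lambda>x. g ((\<tau> ^^ n) x)) \<in> borel_measurable M" by (rule measurable_compose[OF funpow_meas g_meas])
  ultimately have "integrable M (\<lambda>x. (bs n x + g ((\<tau> ^^ n) x))\<^sup>2)" using Suc by (intro square_integrable_add) auto
  then show ?case by (simp add: bs_def)
qed (simp add: bs_def)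

lemma bs_prod_integrable: "integrable M (\<lambda>x. bs m x * bs n x)"
  by (rule square_integrable_add) (auto simp: bs_square_integrable)

text \<open>Polarisation: the difference of two sums is a shorter sum along a shifted orbit, and the
  shift does not change its second moment.\<close>

lemma inner_bs: "(\<integral>x. bs m x * bs n x \<partial>M) = (vn m + vn n - vn (nat \<bar>int m - int n\<bar>)) / 2"
proof -
  have *: "(\<integral>x. bs m x * bs (m + k) x \<partial>M) = (vn m + vn (m + k) - vn k) / 2" for m k
  proof -
    have "vn k = (\<integral>x. (bs k ((\<tau> ^^ m) x))\<^sup>2 \<partial>M)" unfolding vn_def by (rule integral_funpow[symmetric]) measurable
    also have "\<dots> = (\<integral>x. (bs (m + k) x)\<^sup>2 + (bs m x)\<^sup>2 - 2 * (bs m x * bs (m + k) x) \<partial>M)"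
      by (intro Bochner_Integration.integral_cong refl) (simp only: bs_add[of m k], simp add: power2_eq_square algebra_simps)
    also have "\<dots> = vn (m + k) + vn m - 2 * (\<integral>x. bs m x * bs (m + k) x \<partial>M)"
      using bs_square_integrable bs_prod_integrable by (simp add: vn_def)
    finally show ?thesis by simp
  qed
  show ?thesis
  proof (cases "m \<le> n")
    case True
    then obtain k where "n = m + k" using le_Suc_ex by blast
    then show ?thesis using *[of m k] by simp
  next
    case False
    then obtain k where "m = n + k" using le_Suc_ex nat_le_linear by blast
    then show ?thesis using *[of n k] by (simp add: mult.commute add.commute)
  qed
qed

text \<open>Weights of total \<open>0\<close> remove the terms of the polarisation formula that
  depend on one index only, and for the same reason \<open>v\<close> may be subtracted from the
  others.\<close>

lemma weighted_sum_square:
  fixes w :: "nat \<Rightarrow> real"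
  assumes "(\<Sum>i<N. w i) = 0"
  shows "(\<integral>x. (\<Sum>i<N. w i * bs i x)\<^sup>2 \<partial>M) = - (\<Sum>i<N. \<Sum>j<N. w i * w j * (vn (nat \<bar>int i - int j\<bar>) - v)) / 2"
proof -
  have "(\<integral>x. (\<Sum>i<N. w i * bs i x)\<^sup>2 \<partial>M) = (\<integral>x. (\<Sum>i<N. \<Sum>j<N. w i * w j * (bs i x * bs j x)) \<partial>M)"
    by (intro Bochner_Integration.integral_cong refl) (simp add: power2_eq_square sum_product mult_ac)
  also have "\<dots> = (\<Sum>i<N. \<Sum>j<N. w i * w j * (\<integral>x. bs i x * bs j x \<partial>M))"
    using bs_prod_integrable by (simp add: Bochner_Integration.integral_sum)
  also have "\<dots> = (\<Sum>i<N. \<Sum>j<N. (w i * (vn i - v) * w j + w i * (w j * vn j) - w i * w j * (vn (nat \<bar>int i - int j\<bar>) - v)) / 2)"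
    by (intro sum.cong refl) (simp add: inner_bs field_simps)
  also have "\<dots> = ((\<Sum>i<N. w i * (vn i - v)) * (\<Sum>j<N. w j) + (\<Sum>i<N. w i) * (\<Sum>j<N. w j * vn j)
      - (\<Sum>i<N. \<Sum>j<N. w i * w j * (vn (nat \<bar>int i - int j\<bar>) - v))) / 2"
    unfolding sum_product by (simp add: sum_divide_distrib[symmetric] sum.distrib sum_subtractf)
  finally show ?thesis using assms by simp
qed

text \<open>Each distance from \<open>i\<close> occurs at most twice, once on either side.\<close>

lemma sum_abs_dist_le: "(\<Sum>j<N. \<bar>vn (nat \<bar>int i - int j\<bar>) - v\<bar>) \<le> 2 * D"
proof -
  let ?\<epsilon> = "\<lambda>k. \<bar>vn k - v\<bar>"
  have "(\<Sum>j<N. ?\<epsilon> (nat \<bar>int i - int j\<bar>)) = (\<Sum>j\<in>{j. j < N \<and> j \<le> i}. ?\<epsilon> (nat \<bar>int i - int j\<bar>)) + (\<Sum>j\<in>{j. j < N \<and> i < j}. ?\<epsilon> (nat \<bar>int i - int j\<bar>))"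
    by (subst sum.union_disjoint[symmetric]) (auto intro!: sum.cong)
  also have "(\<Sum>j\<in>{j. j < N \<and> j \<le> i}. ?\<epsilon> (nat \<bar>int i - int j\<bar>)) = (\<Sum>k\<in>(\<lambda>j. i - j) ` {j. j < N \<and> j \<le> i}. ?\<epsilon> k)"
    by (subst sum.reindex) (auto simp: inj_on_def nat_diff_distrib' intro!: sum.cong arg_cong[where f = vn] arg_cong[where f = abs])
  also have "\<dots> \<le> (\<Sum>k<Suc i. ?\<epsilon> k)" by (intro sum_mono2) auto
  also have "\<dots> \<le> D" using v_sum[of "Suc i"] by (simp only: vn_def)
  also have "(\<Sum>j\<in>{j. j < N \<and> i < j}. ?\<epsilon> (nat \<bar>int i - int j\<bar>)) = (\<Sum>k\<in>(\<lambda>j. j - i) ` {j. j < N \<and> i < j}. ?\<epsilon> k)"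
    by (subst sum.reindex) (auto simp: inj_on_def nat_diff_distrib' intro!: sum.cong arg_cong[where f = vn] arg_cong[where f = abs])
  also have "\<dots> \<le> (\<Sum>k<N. ?\<epsilon> k)" by (intro sum_mono2) auto
  also have "\<dots> \<le> D" using v_sum[of N] by (simp only: vn_def)
  finally show ?thesis by simp
qed

definition "av N x = (\<Sum>i<N. bs i x) / real N"

lemma av_meas [measurable]: "av N \<in> borel_measurable M"
  unfolding av_def[abs_def] by measurable

text \<open>The difference has weights of total \<open>0\<close>, each at most \<open>2 / N\<close>
  in modulus and with absolute sum at most \<open>2\<close>. Summing one index against the summable
  error and the other against the weights gives the rate \<open>1 / N\<close>.\<close>

lemma av_diff_square:
  assumes "0 < N" "N \<le> N'"
  shows "integrable M (\<lambda>x. (av N' x - av N x)\<^sup>2)" "(\<integral>x. (av N' x - av N x)\<^sup>2 \<partial>M) \<le> 4 * D / real N"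
proof -
  define w where "w i = 1 / real N' - (if i < N then 1 / real N else 0)" for i
  have N': "0 < N'" using assms by simp
  have av: "av N' x - av N x = (\<Sum>i<N'. w i * bs i x)" for x
  proof -
    have "(\<Sum>i<N'. (if i < N then 1 / real N else 0) * bs i x) = (\<Sum>i<N. bs i x / real N)"
      using assms by (intro sum.mono_neutral_cong_right) auto
    then show ?thesis by (simp add: av_def w_def left_diff_distrib sum_subtractf sum_divide_distrib)
  qed
  have w0: "(\<Sum>i<N'. w i) = 0"
  proof -
    have "(\<Sum>i<N'. if i < N then 1 / real N else 0) = (\<Sum>i<N. 1 / real N)"
      using assms by (intro sum.mono_neutral_cong_right) auto
    then show ?thesis using assms N' by (simp add: w_def sum_subtractf)
  qed
  have w_le: "\<bar>w i\<bar> \<le> 1 / real N' + (if i < N then 1 / real N else 0)" for i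
    unfolding w_def by (rule order_trans[OF abs_triangle_ineq4]) auto
  have w_le': "\<bar>w i\<bar> \<le> 2 / real N" for i
  proof -
    have "1 / real N' \<le> 1 / real N" using assms by (intro divide_left_mono) auto
    then show ?thesis using w_le[of i] by (auto split: if_splits)
  qed
  have w_sum: "(\<Sum>i<N'. \<bar>w i\<bar>) \<le> 2"
  proof -
    have "(\<Sum>i<N'. \<bar>w i\<bar>) \<le> (\<Sum>i<N'. 1 / real N' + (if i < N then 1 / real N else 0))" by (intro sum_mono w_le)
    also have "\<dots> = 1 + (\<Sum>i<N'. if i < N then 1 / real N else 0)" using N' by (simp add: sum.distrib)
    also have "(\<Sum>i<N'. if i < N then 1 / real N else 0) = (\<Sum>i<N. 1 / real N)"
      using assms by (intro sum.mono_neutral_cong_right) auto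
    finally show ?thesis using assms by simp
  qed
  have "integrable M (\<lambda>x. (\<Sum>i<N'. w i * bs i x)\<^sup>2)"
  proof -
    have "integrable M (\<lambda>x. (\<Sum>i<N'. \<Sum>j<N'. w i * w j * (bs i x * bs j x)))"
      using bs_prod_integrable by auto
    then show ?thesis by (simp add: power2_eq_square sum_product mult_ac)
  qed
  then show "integrable M (\<lambda>x. (av N' x - av N x)\<^sup>2)" by (simp add: av)
  have "(\<integral>x. (av N' x - av N x)\<^sup>2 \<partial>M) = - (\<Sum>i<N'. \<Sum>j<N'. w i * w j * (vn (nat \<bar>int i - int j\<bar>) - v)) / 2"
    unfolding av by (rule weighted_sum_square[OF w0])
  also have "\<dots> \<le> (\<Sum>i<N'. \<Sum>j<N'. \<bar>w i * w j * (vn (nat \<bar>int i - int j\<bar>) - v)\<bar>) / 2"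
    unfolding sum_negf[symmetric] by (intro divide_right_mono sum_mono) auto
  also have "\<dots> \<le> (\<Sum>i<N'. \<bar>w i\<bar> * (2 / real N * (2 * D))) / 2"
  proof (intro divide_right_mono sum_mono)
    fix i
    have "(\<Sum>j<N'. \<bar>w i * w j * (vn (nat \<bar>int i - int j\<bar>) - v)\<bar>) = \<bar>w i\<bar> * (\<Sum>j<N'. \<bar>w j\<bar> * \<bar>vn (nat \<bar>int i - int j\<bar>) - v\<bar>)"
      by (simp add: abs_mult sum_distrib_left mult.assoc)
    also have "\<dots> \<le> \<bar>w i\<bar> * (\<Sum>j<N'. 2 / real N * \<bar>vn (nat \<bar>int i - int j\<bar>) - v\<bar>)"
      by (intro mult_left_mono sum_mono mult_right_mono w_le') auto
    also have "\<dots> \<le> \<bar>w i\<bar> * (2 / real N * (2 * D))"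
      unfolding sum_distrib_left[symmetric] by (intro mult_left_mono sum_abs_dist_le) auto
    finally show "(\<Sum>j<N'. \<bar>w i * w j * (vn (nat \<bar>int i - int j\<bar>) - v)\<bar>) \<le> \<bar>w i\<bar> * (2 / real N * (2 * D))" .
  qed simp
  also have "\<dots> \<le> 2 * (2 / real N * (2 * D)) / 2"
    unfolding sum_distrib_right[symmetric] using w_sum v_sum[of 0]
    by (intro divide_right_mono mult_right_mono) auto
  finally show "(\<integral>x. (av N' x - av N x)\<^sup>2 \<partial>M) \<le> 4 * D / real N" by simp
qed

lemma vn_le: "vn n \<le> \<bar>v\<bar> + D"
proof -
  have "\<bar>vn n - v\<bar> \<le> (\<Sum>k<Suc n. \<bar>vn k - v\<bar>)" by (intro member_le_sum) auto
  also have "\<dots> \<le> D" using v_sum[of "Suc n"] by (simp only: vn_def)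
  finally show ?thesis by simp
qed

text \<open>Monotone convergence: the sum of the series has finite integral, hence is finite almost
  everywhere.\<close>

lemma AE_tendsto_0_of_summable:
  fixes X :: "nat \<Rightarrow> 'a \<Rightarrow> real"
  assumes int: "\<And>k. integrable M (X k)" and nonneg: "\<And>k x. 0 \<le> X k x" and "summable (\<lambda>k. \<integral>x. X k x \<partial>M)"
  shows "AE x in M. summable (\<lambda>k. X k x)"
proof -
  have "(\<integral>\<^sup>+x. (\<Sum>k. ennreal (X k x)) \<partial>M) = (\<Sum>k. \<integral>\<^sup>+x. ennreal (X k x) \<partial>M)"
    using int by (intro nn_integral_suminf) auto
  also have "\<dots> = (\<Sum>k. ennreal (\<integral>x. X k x \<partial>M))"
    using int nonneg by (intro suminf_cong nn_integral_eq_integral) auto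
  also have "\<dots> \<noteq> \<infinity>" using assms(3) nonneg by (simp add: suminf_ennreal_eq[OF _ summable_sums] integral_nonneg_AE)
  finally have "AE x in M. (\<Sum>k. ennreal (X k x)) \<noteq> \<infinity>"
    using int by (intro nn_integral_PInf_AE) auto
  then show ?thesis
    by (rule AE_mp) (auto intro!: AE_I2 summable_suminf_not_top nonneg)
qed

text \<open>The inner products of the sums \<open>bs n\<close> are determined by their norms \<open>vn n\<close>. This makes the
  means \<open>av (4 ^ k)\<close> a fast Cauchy sequence; its limit \<open>r\<close> solves the equation because
  \<open>av N - av N \<circ> \<tau> = g - bs N / N\<close>.\<close>

lemma coboundary_exists:
  "\<exists>r \<in> borel_measurable M. (\<integral>\<^sup>+x. ennreal ((r x)\<^sup>2) \<partial>M) < \<infinity> \<and> (AE x in M. g x = r x - r (\<tau> x))"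
proof -
  \<comment> \<open>Along powers of \<open>4\<close> the mean square distance of consecutive means
    is of order \<open>4 ^ (- k)\<close>, so its root is summable.\<close>
  define N :: "nat \<Rightarrow> nat" where "N k = 4 ^ k" for k
  have N: "0 < N k" "N k \<le> N (Suc k)" "real (N k) = 4 ^ k" for k by (auto simp: N_def)
  define Y where "Y k x = \<bar>av (N (Suc k)) x - av (N k) x\<bar>" for k x
  have D0: "0 \<le> D" using v_sum[of 0] by simp
  have [measurable]: "Y k \<in> borel_measurable M" for k unfolding Y_def[abs_def] by measurable
  \<comment> \<open>With \<open>p = 2 ^ k\<close>, the inequality
    \<open>y \<le> 1 / p + p * y\<^sup>2\<close> takes the place of Cauchy-Schwarz; both terms have
    mean of order \<open>2 ^ (- k)\<close>.\<close>
  have Y_le: "Y k x \<le> (1 / 2) ^ k + 2 ^ k * (av (N (Suc k)) x - av (N k) x)\<^sup>2" for k x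
  proof -
    define p :: real where "p = 2 ^ k"
    have p: "0 < p" by (simp add: p_def)
    have "0 \<le> (p * Y k x - 1)\<^sup>2 + p * Y k x" using p by (intro add_nonneg_nonneg) (auto simp: Y_def)
    then have "p * Y k x \<le> 1 + p * (p * (Y k x)\<^sup>2)" by (simp add: power2_diff power_mult_distrib power2_eq_square algebra_simps)
    then have "Y k x \<le> 1 / p + p * (Y k x)\<^sup>2" using p by (simp add: field_simps)
    then show ?thesis by (simp add: p_def Y_def power_one_over)
  qed
  have dom: "integrable M (\<lambda>x. (1 / 2) ^ k + 2 ^ k * (av (N (Suc k)) x - av (N k) x)\<^sup>2)" for k
    using av_diff_square(1)[OF N(1,2)] by (intro Bochner_Integration.integrable_add integrable_mult_right) auto
  have Y_int: "integrable M (Y k)" for k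
  proof (rule Bochner_Integration.integrable_bound[OF dom[of k]])
    show "AE x in M. norm (Y k x) \<le> norm ((1 / 2) ^ k + 2 ^ k * (av (N (Suc k)) x - av (N k) x)\<^sup>2)"
      using Y_le[of k] by (auto simp: Y_def intro!: AE_I2 order_trans[OF _ abs_ge_self])
  qed measurable
  have Y_mean: "(\<integral>x. Y k x \<partial>M) \<le> (1 + 4 * D) * (1 / 2) ^ k" for k
  proof -
    have "(\<integral>x. Y k x \<partial>M) \<le> (\<integral>x. (1 / 2) ^ k + 2 ^ k * (av (N (Suc k)) x - av (N k) x)\<^sup>2 \<partial>M)"
      by (rule integral_mono[OF Y_int dom Y_le])
    also have "\<dots> = (1 / 2) ^ k + 2 ^ k * (\<integral>x. (av (N (Suc k)) x - av (N k) x)\<^sup>2 \<partial>M)"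
      using av_diff_square(1)[OF N(1,2)] by (simp add: prob_space)
    also have "\<dots> \<le> (1 / 2) ^ k + 2 ^ k * (4 * D / 4 ^ k)"
      using av_diff_square(2)[OF N(1,2), of k] unfolding N(3) by (intro add_left_mono mult_left_mono) auto
    also have "2 ^ k * (4 * D / 4 ^ k) = 4 * D * (1 / 2) ^ k"
    proof -
      have "(4::real) ^ k = 2 ^ k * 2 ^ k" by (simp add: power_mult_distrib[symmetric])
      then show ?thesis by (simp add: power_one_over)
    qed
    finally show ?thesis by (simp add: algebra_simps)
  qed
  have "summable (\<lambda>k. (1 + 4 * D) * (1 / 2) ^ k)" by (intro summable_mult summable_geometric) auto
  then have "summable (\<lambda>k. \<integral>x. Y k x \<partial>M)"
    by (rule summable_comparison_test_ev[rotated])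
       (use Y_mean in \<open>auto simp: Y_def intro!: always_eventually integral_nonneg_AE abs_of_nonneg[THEN ord_eq_le_trans]\<close>)
  then have AE_Y: "AE x in M. summable (\<lambda>k. Y k x)"
    by (intro AE_tendsto_0_of_summable Y_int) (auto simp: Y_def)
  have AE_conv: "AE x in M. convergent (\<lambda>k. av (N k) x)"
    using AE_Y
  proof (rule AE_mp, intro AE_I2 impI)
    fix x assume "summable (\<lambda>k. Y k x)"
    then have "summable (\<lambda>k. av (N (Suc k)) x - av (N k) x)"
      unfolding Y_def by (rule summable_rabs_cancel)
    then have "convergent (\<lambda>n. \<Sum>k<n. av (N (Suc k)) x - av (N k) x)" by (simp add: summable_iff_convergent)
    then have "convergent (\<lambda>n. av (N n) x - av (N 0) x)" by (simp only: sum_lessThan_telescope[of "\<lambda>k. av (N k) x"])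
    then have "convergent (\<lambda>n. (av (N n) x - av (N 0) x) + av (N 0) x)" by (intro convergent_add convergent_const)
    then show "convergent (\<lambda>k. av (N k) x)" by simp
  qed
  define r where "r x = lim (\<lambda>k. av (N k) x)" for x
  have r_meas[measurable]: "r \<in> borel_measurable M" unfolding r_def[abs_def] by measurable
  have AE_r: "AE x in M. (\<lambda>k. av (N k) x) \<longlonglongrightarrow> r x"
    using AE_conv by (rule AE_mp) (auto simp: r_def convergent_LIMSEQ_iff)
  have AE_r\<tau>: "AE x in M. (\<lambda>k. av (N k) (\<tau> x)) \<longlonglongrightarrow> r (\<tau> x)"
    using AE_funpow[OF AE_r, of 1] by simp
  \<comment> \<open>The second moments of the sums are bounded, so those of the quotients are of
    order \<open>16 ^ (- k)\<close>.\<close>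
  have "AE x in M. summable (\<lambda>k. (bs (N k) x / real (N k))\<^sup>2)"
  proof (rule AE_tendsto_0_of_summable)
    show i: "integrable M (\<lambda>x. (bs (N k) x / real (N k))\<^sup>2)" for k
      using bs_square_integrable by (simp add: power_divide)
    show "summable (\<lambda>k. \<integral>x. (bs (N k) x / real (N k))\<^sup>2 \<partial>M)"
    proof (rule summable_comparison_test'[of "\<lambda>k. (\<bar>v\<bar> + D) * (1 / 16) ^ k" 0])
      show "summable (\<lambda>k. (\<bar>v\<bar> + D) * (1 / 16 :: real) ^ k)" by (intro summable_mult summable_geometric) auto
      fix k :: nat
      have "norm (\<integral>x. (bs (N k) x / real (N k))\<^sup>2 \<partial>M) = (\<integral>x. (bs (N k) x / real (N k))\<^sup>2 \<partial>M)"
        unfolding real_norm_def by (intro abs_of_nonneg integral_nonneg_AE) auto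
      also have "\<dots> = vn (N k) / (real (N k))\<^sup>2" by (simp add: vn_def power_divide)
      also have "\<dots> \<le> (\<bar>v\<bar> + D) / (real (N k))\<^sup>2" by (intro divide_right_mono vn_le) auto
      also have "(real (N k))\<^sup>2 = 16 ^ k"
      proof -
        have "(real (4 ^ k))\<^sup>2 = (4\<^sup>2) ^ k"
          by (simp only: of_nat_power of_nat_numeral power_mult[symmetric] mult.commute)
        then show ?thesis by (simp add: N(3))
      qed
      finally show "norm (\<integral>x. (bs (N k) x / real (N k))\<^sup>2 \<partial>M) \<le> (\<bar>v\<bar> + D) * (1 / 16) ^ k"
        by (simp add: power_one_over)
    qed
  qed auto
  then have AE_0: "AE x in M. (\<lambda>k. bs (N k) x / real (N k)) \<longlonglongrightarrow> 0"
  proof (rule AE_mp, intro AE_I2 impI)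
    fix x assume "summable (\<lambda>k. (bs (N k) x / real (N k))\<^sup>2)"
    then have "(\<lambda>k. (bs (N k) x / real (N k))\<^sup>2) \<longlonglongrightarrow> 0" by (rule summable_LIMSEQ_zero)
    from tendsto_real_sqrt[OF this] show "(\<lambda>k. bs (N k) x / real (N k)) \<longlonglongrightarrow> 0"
      by (simp only: real_sqrt_abs real_sqrt_zero tendsto_rabs_zero_iff)
  qed
  have step: "av (N k) x - av (N k) (\<tau> x) = g x - bs (N k) x / real (N k)" for k x
  proof -
    have "bs i x - bs i (\<tau> x) = g x - g ((\<tau> ^^ i) x)" for i
      using bs_add[of 1 i x] bs_add[of i 1 x] by (simp add: bs_def)
    then have "(\<Sum>i<N k. bs i x) - (\<Sum>i<N k. bs i (\<tau> x)) = real (N k) * g x - bs (N k) x"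
      by (subst sum_subtractf[symmetric]) (simp only: sum_subtractf sum_constant card_lessThan bs_def)
    then show ?thesis using N(1)[of k] by (simp add: av_def diff_divide_distrib[symmetric] field_simps)
  qed
  have "AE x in M. g x = r x - r (\<tau> x)"
    using AE_r AE_r\<tau> AE_0
  proof eventually_elim
    case (elim x)
    have "(\<lambda>k. av (N k) x - av (N k) (\<tau> x)) \<longlonglongrightarrow> r x - r (\<tau> x)" by (intro tendsto_diff elim)
    moreover have "(\<lambda>k. av (N k) x - av (N k) (\<tau> x)) \<longlonglongrightarrow> g x - 0"
      unfolding step by (intro tendsto_diff tendsto_const elim)
    ultimately show ?case using LIMSEQ_unique by fastforce
  qed
  \<comment> \<open>Fatou's lemma; the second moments of the means are bounded by averages of those
    of the sums.\<close>
  moreover have "(\<integral>\<^sup>+x. ennreal ((r x)\<^sup>2) \<partial>M) < \<infinity>"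
  proof -
    have av_le: "(\<integral>\<^sup>+x. ennreal ((av (N k) x)\<^sup>2) \<partial>M) \<le> ennreal (\<bar>v\<bar> + D)" for k
    proof -
      have le: "(av (N k) x)\<^sup>2 \<le> (\<Sum>i<N k. (bs i x)\<^sup>2) / real (N k)" for x
      proof -
        have "(\<Sum>i<N k. bs i x)\<^sup>2 \<le> real (N k) * (\<Sum>i<N k. (bs i x)\<^sup>2)"
          using sum_squared_le_sum_of_squares[of "\<lambda>i. bs i x" "{..<N k}"] by (simp add: mult.commute)
        then show ?thesis using N(1)[of k] by (simp add: av_def power_divide power2_eq_square[of "real (N k)"] field_simps)
      qed
      have i: "integrable M (\<lambda>x. (\<Sum>i<N k. (bs i x)\<^sup>2) / real (N k))"
        using bs_square_integrable by auto
      have "(\<integral>\<^sup>+x. ennreal ((av (N k) x)\<^sup>2) \<partial>M) \<le> (\<integral>\<^sup>+x. ennreal ((\<Sum>i<N k. (bs i x)\<^sup>2) / real (N k)) \<partial>M)"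
        by (intro nn_integral_mono ennreal_leI le)
      also have "\<dots> = ennreal (\<integral>x. (\<Sum>i<N k. (bs i x)\<^sup>2) / real (N k) \<partial>M)"
        by (intro nn_integral_eq_integral i) (auto intro!: AE_I2 divide_nonneg_nonneg sum_nonneg)
      also have "(\<integral>x. (\<Sum>i<N k. (bs i x)\<^sup>2) / real (N k) \<partial>M) = (\<Sum>i<N k. vn i) / real (N k)"
        using bs_square_integrable by (simp add: Bochner_Integration.integral_sum vn_def)
      also have "ennreal \<dots> \<le> ennreal (\<bar>v\<bar> + D)"
      proof (rule ennreal_leI)
        have "(\<Sum>i<N k. vn i) \<le> (\<Sum>i<N k. \<bar>v\<bar> + D)" by (intro sum_mono vn_le)
        then show "(\<Sum>i<N k. vn i) / real (N k) \<le> \<bar>v\<bar> + D" using N(1)[of k] by (simp add: divide_le_eq mult.commute)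
      qed
      finally show ?thesis .
    qed
    have "(\<integral>\<^sup>+x. ennreal ((r x)\<^sup>2) \<partial>M) = (\<integral>\<^sup>+x. liminf (\<lambda>k. ennreal ((av (N k) x)\<^sup>2)) \<partial>M)"
    proof (rule nn_integral_cong_AE)
      show "AE x in M. ennreal ((r x)\<^sup>2) = liminf (\<lambda>k. ennreal ((av (N k) x)\<^sup>2))"
        using AE_r
      proof eventually_elim
        case (elim x)
        have "(\<lambda>k. ennreal ((av (N k) x)\<^sup>2)) \<longlonglongrightarrow> ennreal ((r x)\<^sup>2)"
          by (intro tendsto_ennrealI tendsto_power elim)
        then show ?case by (intro lim_imp_Liminf[symmetric] trivial_limit_sequentially)
      qed
    qed
    also have "\<dots> \<le> liminf (\<lambda>k. \<integral>\<^sup>+x. ennreal ((av (N k) x)\<^sup>2) \<partial>M)"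
      by (rule nn_integral_liminf) measurable
    also have "\<dots> \<le> ennreal (\<bar>v\<bar> + D)"
      by (rule order_trans[OF Liminf_mono[of _ "\<lambda>k. ennreal (\<bar>v\<bar> + D)"]])
         (auto intro!: always_eventually av_le simp: Liminf_const)
    also have "\<dots> < \<infinity>" by simp
    finally show ?thesis .
  qed
  ultimately show ?thesis using r_meas by blast
qed

end
end

section \<open>Asymptotic variance and disintegration\<close>

lemma geometric_increments:
  fixes d :: "nat \<Rightarrow> real"
  assumes "0 < \<delta>" "\<delta> < 1" "0 \<le> c" and d: "\<And>n. \<bar>d (Suc n) - d n\<bar> \<le> c * \<delta> ^ n"
  shows "\<exists>L. d \<longlonglongrightarrow> L \<and> (\<forall>n. \<bar>d n - L\<bar> \<le> c / (1 - \<delta>) * \<delta> ^ n)"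
proof -
  have "summable (\<lambda>n. d (Suc n) - d n)"
  proof (rule summable_comparison_test'[of "\<lambda>n. c * \<delta> ^ n" 0])
    show "summable (\<lambda>n. c * \<delta> ^ n)" using assms by (intro summable_mult summable_geometric) auto
  qed (simp add: d)
  then have "convergent (\<lambda>n. \<Sum>k<n. d (Suc k) - d k)" by (simp only: summable_iff_convergent)
  then have "convergent (\<lambda>n. d n - d 0)" by (simp only: sum_lessThan_telescope)
  then have "convergent (\<lambda>n. (d n - d 0) + d 0)" by (intro convergent_add convergent_const)
  then obtain L where L: "d \<longlonglongrightarrow> L" by (auto simp: convergent_def)
  \<comment> \<open>The factor \<open>1 - \<delta> ^ k\<close> is the partial geometric sum in
    closed form, which is what the induction needs.\<close>
  have le: "\<bar>d (n + k) - d n\<bar> \<le> c / (1 - \<delta>) * \<delta> ^ n * (1 - \<delta> ^ k)" for n k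
  proof (induction k)
    case (Suc k)
    have "\<bar>d (n + Suc k) - d n\<bar> \<le> \<bar>d (Suc (n + k)) - d (n + k)\<bar> + \<bar>d (n + k) - d n\<bar>" by simp
    also have "\<dots> \<le> c * \<delta> ^ (n + k) + c / (1 - \<delta>) * \<delta> ^ n * (1 - \<delta> ^ k)" by (intro add_mono d Suc)
    also have "\<dots> = c / (1 - \<delta>) * \<delta> ^ n * (1 - \<delta> ^ Suc k)" using assms by (simp add: field_simps power_add)
    finally show ?case .
  qed simp
  have "\<bar>d n - L\<bar> \<le> c / (1 - \<delta>) * \<delta> ^ n" for n
  proof -
    have "(\<lambda>k. \<bar>d n - d (n + k)\<bar>) \<longlonglongrightarrow> \<bar>d n - L\<bar>"
      using LIMSEQ_ignore_initial_segment[OF L, of n] by (intro tendsto_intros) (simp add: add.commute)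
    moreover have "\<bar>d n - d (n + k)\<bar> \<le> c / (1 - \<delta>) * \<delta> ^ n" for k
    proof -
      have "c / (1 - \<delta>) * \<delta> ^ n * (1 - \<delta> ^ k) \<le> c / (1 - \<delta>) * \<delta> ^ n * 1"
        using assms by (intro mult_left_mono) auto
      then show ?thesis using le[of n k] by (simp add: abs_minus_commute)
    qed
    ultimately show ?thesis by (intro LIMSEQ_le_const2) auto
  qed
  then show ?thesis using L by blast
qed

lemma sum_geometric_le:
  fixes \<delta> :: real
  assumes "0 < \<delta>" "\<delta> < 1"
  shows "(\<Sum>k<n. \<delta> ^ k) \<le> 1 / (1 - \<delta>)"
  using assms by (auto simp: sum_gp_strict divide_right_mono)

text \<open>The differences \<open>W (n + 1) \<omega> - W n (\<theta> \<omega>)\<close> converge exponentially fast to a function whose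
  Birkhoff sums stay within a bounded distance of \<open>W n\<close>.\<close>

lemma (in ergodic_invertible) almost_additive_limit:
  fixes W :: "nat \<Rightarrow> 'w \<Rightarrow> real"
  assumes W[measurable]: "\<And>n. W n \<in> borel_measurable P" and "0 < \<delta>" "\<delta> < 1" "0 \<le> c"
    and W0: "AE \<omega> in P. W 0 \<omega> = 0"
    and d_le: "AE \<omega> in P. \<forall>n. \<bar>W (Suc n) \<omega> - W n (\<theta> \<omega>)\<bar> \<le> c"
    and dd_le: "AE \<omega> in P. \<forall>n. \<bar>(W (Suc (Suc n)) \<omega> - W (Suc n) (\<theta> \<omega>)) - (W (Suc n) \<omega> - W n (\<theta> \<omega>))\<bar> \<le> c * \<delta> ^ n"
  shows "\<exists>v. (AE \<omega> in P. (\<lambda>n. W n \<omega> / real n) \<longlonglongrightarrow> v) \<and>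
     (\<forall>n. integrable P (W n)) \<and>
     (\<forall>n. \<bar>expectation (W (Suc n)) - expectation (W n) - v\<bar> \<le> c / (1 - \<delta>) * \<delta> ^ n)"
proof -
  note [measurable] = measurable_base
  define d where "d n \<omega> = W (Suc n) \<omega> - W n (\<theta> \<omega>)" for n \<omega>
  have d_meas[measurable]: "d n \<in> borel_measurable P" for n unfolding d_def[abs_def] by measurable
  \<comment> \<open>Truncation at \<open>c\<close> changes nothing almost everywhere, but makes the
    function bounded everywhere, as the ergodic theorem above asks.\<close>
  define \<Psi> where "\<Psi> \<omega> = max (- c) (min c (lim (\<lambda>n. d n \<omega>)))" for \<omega>
  have \<Psi>_meas[measurable]: "\<Psi> \<in> borel_measurable P" unfolding \<Psi>_def[abs_def] by measurable
  have \<Psi>_le: "\<bar>\<Psi> \<omega>\<bar> \<le> c" for \<omega> using assms(4) by (auto simp: \<Psi>_def)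
  define e where "e = c / (1 - \<delta>)"
  have e: "0 \<le> e" using assms by (simp add: e_def)
  have AE_d: "AE \<omega> in P. W 0 \<omega> = 0 \<and> (\<forall>n. \<bar>d n \<omega>\<bar> \<le> c) \<and> (\<forall>n. \<bar>d n \<omega> - \<Psi> \<omega>\<bar> \<le> e * \<delta> ^ n)"
    using W0 d_le dd_le
  proof eventually_elim
    case (elim \<omega>)
    have "\<exists>L. (\<lambda>n. d n \<omega>) \<longlonglongrightarrow> L \<and> (\<forall>n. \<bar>d n \<omega> - L\<bar> \<le> c / (1 - \<delta>) * \<delta> ^ n)"
      using elim by (intro geometric_increments assms) (auto simp: d_def)
    then obtain L where L: "(\<lambda>n. d n \<omega>) \<longlonglongrightarrow> L" "\<And>n. \<bar>d n \<omega> - L\<bar> \<le> e * \<delta> ^ n" by (auto simp: e_def)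
    have "\<bar>d n \<omega>\<bar> \<le> c" for n using elim by (simp add: d_def)
    moreover from this have "\<bar>L\<bar> \<le> c"
      by (intro LIMSEQ_le_const2[OF tendsto_rabs[OF L(1)]]) auto
    then have "\<Psi> \<omega> = L" using limI[OF L(1)] by (auto simp: \<Psi>_def)
    ultimately show ?case using elim L(2) by simp
  qed
  have AE_orbit: "AE \<omega> in P. \<forall>j. W 0 ((\<theta> ^^ j) \<omega>) = 0 \<and> (\<forall>n. \<bar>d n ((\<theta> ^^ j) \<omega>)\<bar> \<le> c) \<and>
      (\<forall>n. \<bar>d n ((\<theta> ^^ j) \<omega>) - \<Psi> ((\<theta> ^^ j) \<omega>)\<bar> \<le> e * \<delta> ^ n)"
    by (rule AE_funpow_base[OF AE_d])
  \<comment> \<open>Both bounds come from unfolding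
    \<open>W (Suc n) \<omega> = d n \<omega> + W n (\<theta> \<omega>)\<close> along the
    orbit.\<close>
  have W_le: "\<bar>W n \<omega>\<bar> \<le> real n * c \<and> \<bar>W n \<omega> - (\<Sum>j<n. \<Psi> ((\<theta> ^^ j) \<omega>))\<bar> \<le> e * (\<Sum>k<n. \<delta> ^ k)"
    if "\<forall>j. W 0 ((\<theta> ^^ j) \<omega>) = 0 \<and> (\<forall>n. \<bar>d n ((\<theta> ^^ j) \<omega>)\<bar> \<le> c) \<and>
      (\<forall>n. \<bar>d n ((\<theta> ^^ j) \<omega>) - \<Psi> ((\<theta> ^^ j) \<omega>)\<bar> \<le> e * \<delta> ^ n)" for n \<omega>
    using that
  proof (induction n arbitrary: \<omega>)
    case 0
    then show ?case using spec[OF 0, of 0] by simp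
  next
    case (Suc n)
    have shift: "(\<theta> ^^ j) (\<theta> \<omega>) = (\<theta> ^^ Suc j) \<omega>" for j by (simp add: funpow_swap1)
    have IH: "\<bar>W n (\<theta> \<omega>)\<bar> \<le> real n * c" "\<bar>W n (\<theta> \<omega>) - (\<Sum>j<n. \<Psi> ((\<theta> ^^ Suc j) \<omega>))\<bar> \<le> e * (\<Sum>k<n. \<delta> ^ k)"
      using Suc.IH[of "\<theta> \<omega>"] Suc.prems unfolding shift by blast+
    have d: "\<bar>d n \<omega>\<bar> \<le> c" "\<bar>d n \<omega> - \<Psi> \<omega>\<bar> \<le> e * \<delta> ^ n" using spec[OF Suc.prems, of 0] by auto
    have eq: "W (Suc n) \<omega> = d n \<omega> + W n (\<theta> \<omega>)" by (simp add: d_def)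
    have "(\<Sum>j<Suc n. \<Psi> ((\<theta> ^^ j) \<omega>)) = \<Psi> \<omega> + (\<Sum>j<n. \<Psi> ((\<theta> ^^ Suc j) \<omega>))"
      by (subst sum.lessThan_Suc_shift) simp
    moreover have "real (Suc n) * c = c + real n * c" by (simp add: algebra_simps)
    moreover have "e * (\<Sum>k<Suc n. \<delta> ^ k) = e * (\<Sum>k<n. \<delta> ^ k) + e * \<delta> ^ n" by (simp add: algebra_simps)
    ultimately show ?case using IH d unfolding eq by linarith
  qed
  have lim: "AE \<omega> in P. (\<lambda>n. W n \<omega> / real n) \<longlonglongrightarrow> expectation \<Psi>"
    using AE_orbit birkhoff_averages_tendsto[OF \<Psi>_meas \<Psi>_le]
  proof eventually_elim
    case (elim \<omega>)
    have "(\<lambda>n. W n \<omega> / real n - (\<Sum>j<n. \<Psi> ((\<theta> ^^ j) \<omega>)) / real n) \<longlonglongrightarrow> 0"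
    proof (rule Lim_null_comparison)
      show "\<forall>\<^sub>F n in sequentially. norm (W n \<omega> / real n - (\<Sum>j<n. \<Psi> ((\<theta> ^^ j) \<omega>)) / real n) \<le> (e * (1 / (1 - \<delta>))) / real n"
      proof (intro always_eventually allI)
        fix n
        have "\<bar>W n \<omega> - (\<Sum>j<n. \<Psi> ((\<theta> ^^ j) \<omega>))\<bar> \<le> e * (1 / (1 - \<delta>))"
          using W_le[OF elim(1), of n] mult_left_mono[OF sum_geometric_le[OF assms(2,3), of n] e] by linarith
        then show "norm (W n \<omega> / real n - (\<Sum>j<n. \<Psi> ((\<theta> ^^ j) \<omega>)) / real n) \<le> (e * (1 / (1 - \<delta>))) / real n"
          unfolding diff_divide_distrib[symmetric] real_norm_def abs_divide abs_of_nat by (intro divide_right_mono) auto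
      qed
      show "(\<lambda>n. (e * (1 / (1 - \<delta>))) / real n) \<longlonglongrightarrow> 0" by (rule lim_const_over_n)
    qed
    from tendsto_add[OF this elim(2)] show ?case by simp
  qed
  have W_int: "integrable P (W n)" for n
  proof (rule integrable_const_bound[where B = "real n * c"])
    show "AE \<omega> in P. norm (W n \<omega>) \<le> real n * c" using AE_orbit by eventually_elim (use W_le in simp)
  qed measurable
  have "\<bar>expectation (W (Suc n)) - expectation (W n) - expectation \<Psi>\<bar> \<le> e * \<delta> ^ n" for n
  proof -
    have "expectation (\<lambda>\<omega>. W n (\<theta> \<omega>)) = expectation (W n)"
      using integral_distr[OF measurable_base W, of n] by (simp add: preserving_base)
    moreover have "integrable P (\<lambda>\<omega>. W n (\<theta> \<omega>))"
      using integrable_distr[OF measurable_base, of "W n"] W_int[of n] by (simp add: preserving_base)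
    moreover have \<Psi>_int: "integrable P \<Psi>" by (rule integrable_const_bound[of _ c]) (auto simp: \<Psi>_le)
    ultimately have eq: "expectation (W (Suc n)) - expectation (W n) - expectation \<Psi> = expectation (\<lambda>\<omega>. d n \<omega> - \<Psi> \<omega>)"
      and int: "integrable P (\<lambda>\<omega>. d n \<omega> - \<Psi> \<omega>)"
      using W_int[of "Suc n"] by (simp_all add: d_def)
    have "norm (expectation (\<lambda>\<omega>. d n \<omega> - \<Psi> \<omega>)) \<le> expectation (\<lambda>\<omega>. norm (d n \<omega> - \<Psi> \<omega>))"
      by (rule integral_norm_bound)
    also have "\<dots> \<le> expectation (\<lambda>\<omega>. e * \<delta> ^ n)"
    proof (rule integral_mono_AE)
      show "AE \<omega> in P. norm (d n \<omega> - \<Psi> \<omega>) \<le> e * \<delta> ^ n" using AE_d by eventually_elim simp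
    qed (use int in auto)
    finally show ?thesis by (simp add: eq prob_space)
  qed
  then show ?thesis using lim W_int unfolding e_def by blast
qed

section \<open>Integration along the fibres\<close>

context random_dynamical_system
begin

lemma space_total: "space (total_space P E) = Sigma (space P) E"
  using sets.sets_into_space[OF measurable_family] by (auto simp: total_space_def space_restrict_space)

lemma space_fibre:
  assumes "sets (mu \<omega>) = sets (restrict_space borel (E \<omega>))"
  shows "space (mu \<omega>) = E \<omega>"
  using sets_eq_imp_space_eq[OF assms] by (simp add: space_restrict_space)

lemma Pair_measurable:
  assumes "\<omega> \<in> space P" and sets: "sets (mu \<omega>) = sets (restrict_space borel (E \<omega>))"
  shows "Pair \<omega> \<in> mu \<omega> \<rightarrow>\<^sub>M total_space P E"
  unfolding total_space_def
proof (rule measurable_restrict_space2)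
  show "Pair \<omega> \<in> space (mu \<omega>) \<rightarrow> Sigma (space P) E" using assms space_fibre[OF sets] by auto
  have "(\<lambda>x. x) \<in> mu \<omega> \<rightarrow>\<^sub>M borel"
    unfolding measurable_cong_sets[OF sets refl] by (rule measurable_restrict_space1) simp
  then show "Pair \<omega> \<in> mu \<omega> \<rightarrow>\<^sub>M P \<Otimes>\<^sub>M borel" using assms(1) by (intro measurable_Pair measurable_const)
qed

text \<open>The fibre measures live on different spaces and form a kernel only after being pushed
  into the total space. On a null set containing all exceptional points \<open>M\<close> is
  substituted, which keeps every value a probability measure and does not affect the
  mixture.\<close>

lemma fibre_kernel:
  obtains \<kappa> where "\<kappa> \<in> P \<rightarrow>\<^sub>M subprob_algebra (total_space P E)"
    "AE \<omega> in P. \<omega> \<in> space P \<and> sets (mu \<omega>) = sets (restrict_space borel (E \<omega>)) \<and> \<kappa> \<omega> = distr (mu \<omega>) (total_space P E) (Pair \<omega>)"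
    "P \<bind> \<kappa> = M"
proof -
  let ?TS = "total_space P E"
  obtain Z where Z: "Z \<in> sets P" "emeasure P Z = 0" and Z_sub: "{\<omega> \<in> space P. \<not> (sets (mu \<omega>) = sets (restrict_space borel (E \<omega>)) \<and>
          prob_space (mu \<omega>) \<and> distr (mu \<omega>) (mu (\<theta> \<omega>)) (T \<omega>) = mu (\<theta> \<omega>))} \<subseteq> Z"
    by (rule AE_E[OF fibre_measures]) auto
  define \<kappa> where "\<kappa> \<omega> = (if \<omega> \<in> Z then M else distr (mu \<omega>) ?TS (Pair \<omega>))" for \<omega>
  have good: "sets (mu \<omega>) = sets (restrict_space borel (E \<omega>))" "prob_space (mu \<omega>)" if "\<omega> \<in> space P - Z" for \<omega>
    using that Z_sub by auto
  have em: "emeasure (\<kappa> \<omega>) A = (if \<omega> \<in> Z then emeasure M A else emeasure (mu \<omega>) (Pair \<omega> -` A))"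
    if A: "A \<in> sets ?TS" and \<omega>: "\<omega> \<in> space P" for A \<omega>
  proof (cases "\<omega> \<in> Z")
    case False
    have "Pair \<omega> -` A \<inter> space (mu \<omega>) = Pair \<omega> -` A"
      using sets.sets_into_space[OF A] space_fibre[OF good(1)] \<omega> False by (auto simp: space_total)
    then show ?thesis using False \<omega> Pair_measurable[OF \<omega> good(1)] A by (simp add: \<kappa>_def emeasure_distr)
  qed (simp add: \<kappa>_def)
  have \<kappa>_meas: "\<kappa> \<in> P \<rightarrow>\<^sub>M subprob_algebra ?TS"
  proof (rule measurable_subprob_algebra)
    fix \<omega> assume \<omega>: "\<omega> \<in> space P"
    show "sets (\<kappa> \<omega>) = sets ?TS" using sets_total by (simp add: \<kappa>_def)
    have "prob_space (\<kappa> \<omega>)"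
      using prob_total prob_space.prob_space_distr[OF good(2) Pair_measurable[OF \<omega> good(1)]] \<omega> by (auto simp: \<kappa>_def)
    then show "subprob_space (\<kappa> \<omega>)" by (rule prob_space_imp_subprob_space)
  next
    fix A assume A: "A \<in> sets ?TS"
    have "(\<lambda>\<omega>. if \<omega> \<in> Z then emeasure M A else emeasure (mu \<omega>) (Pair \<omega> -` A)) \<in> borel_measurable P"
      using measurable_fibre_measures[OF A] Z by measurable
    then show "(\<lambda>\<omega>. emeasure (\<kappa> \<omega>) A) \<in> borel_measurable P" by (simp add: em[OF A] cong: measurable_cong)
  qed
  have "Z \<in> null_sets P" using Z by auto
  from AE_not_in[OF this] AE_space have AE_Z: "AE \<omega> in P. \<omega> \<in> space P - Z" by eventually_elim simp
  have "P \<bind> \<kappa> = M"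
  proof (rule measure_eqI)
    show s: "sets (P \<bind> \<kappa>) = sets M" using sets_bind_measurable[OF \<kappa>_meas not_empty] sets_total by simp
    fix A assume "A \<in> sets (P \<bind> \<kappa>)"
    then have A: "A \<in> sets ?TS" using s sets_total by simp
    have "emeasure (P \<bind> \<kappa>) A = (\<integral>\<^sup>+\<omega>. emeasure (\<kappa> \<omega>) A \<partial>P)" by (rule emeasure_bind[OF not_empty \<kappa>_meas A])
    also have "\<dots> = (\<integral>\<^sup>+\<omega>. emeasure (mu \<omega>) (Pair \<omega> -` A) \<partial>P)"
      by (rule nn_integral_cong_AE, use AE_Z in eventually_elim) (simp add: em[OF A])
    finally show "emeasure (P \<bind> \<kappa>) A = emeasure M A" by (simp only: disintegration[OF A])
  qed
  moreover have "AE \<omega> in P. \<omega> \<in> space P \<and> sets (mu \<omega>) = sets (restrict_space borel (E \<omega>)) \<and> \<kappa> \<omega> = distr (mu \<omega>) ?TS (Pair \<omega>)"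
    using AE_Z by (rule AE_mp) (auto simp: \<kappa>_def intro!: AE_I2 good(1))
  ultimately show ?thesis using \<kappa>_meas by (intro that)
qed

lemma nn_integral_total:
  assumes g: "g \<in> borel_measurable (total_space P E)"
  shows "(\<integral>\<^sup>+p. g p \<partial>M) = (\<integral>\<^sup>+\<omega>. \<integral>\<^sup>+x. g (\<omega>, x) \<partial>mu \<omega> \<partial>P)"
proof -
  obtain \<kappa> where \<kappa>: "\<kappa> \<in> P \<rightarrow>\<^sub>M subprob_algebra (total_space P E)"
    "AE \<omega> in P. \<omega> \<in> space P \<and> sets (mu \<omega>) = sets (restrict_space borel (E \<omega>)) \<and> \<kappa> \<omega> = distr (mu \<omega>) (total_space P E) (Pair \<omega>)"
    "P \<bind> \<kappa> = M" by (rule fibre_kernel)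
  have "(\<integral>\<^sup>+p. g p \<partial>M) = (\<integral>\<^sup>+\<omega>. \<integral>\<^sup>+p. g p \<partial>\<kappa> \<omega> \<partial>P)"
    unfolding \<kappa>(3)[symmetric] by (rule nn_integral_bind[OF g \<kappa>(1)])
  also have "\<dots> = (\<integral>\<^sup>+\<omega>. \<integral>\<^sup>+x. g (\<omega>, x) \<partial>mu \<omega> \<partial>P)"
  proof (rule nn_integral_cong_AE)
    show "AE \<omega> in P. (\<integral>\<^sup>+p. g p \<partial>\<kappa> \<omega>) = (\<integral>\<^sup>+x. g (\<omega>, x) \<partial>mu \<omega>)"
      using \<kappa>(2) by eventually_elim (auto intro!: nn_integral_distr Pair_measurable g)
  qed
  finally show ?thesis .
qed

lemma AE_total_iff:
  assumes Q: "Measurable.pred (total_space P E) Q"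
  shows "(AE p in M. Q p) \<longleftrightarrow> (AE \<omega> in P. AE x in mu \<omega>. Q (\<omega>, x))"
proof -
  obtain \<kappa> where \<kappa>: "\<kappa> \<in> P \<rightarrow>\<^sub>M subprob_algebra (total_space P E)"
    "AE \<omega> in P. \<omega> \<in> space P \<and> sets (mu \<omega>) = sets (restrict_space borel (E \<omega>)) \<and> \<kappa> \<omega> = distr (mu \<omega>) (total_space P E) (Pair \<omega>)"
    "P \<bind> \<kappa> = M" by (rule fibre_kernel)
  have "(AE p in M. Q p) \<longleftrightarrow> (AE \<omega> in P. AE p in \<kappa> \<omega>. Q p)"
    unfolding \<kappa>(3)[symmetric] by (rule AE_bind[OF \<kappa>(1) Q])
  also have "\<dots> \<longleftrightarrow> (AE \<omega> in P. AE x in mu \<omega>. Q (\<omega>, x))"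
  proof (rule eventually_subst)
    show "AE \<omega> in P. (AE p in \<kappa> \<omega>. Q p) \<longleftrightarrow> (AE x in mu \<omega>. Q (\<omega>, x))"
      using \<kappa>(2)
    proof eventually_elim
      case (elim \<omega>)
      have "Pair \<omega> \<in> mu \<omega> \<rightarrow>\<^sub>M total_space P E" by (rule Pair_measurable) (use elim in auto)
      from AE_distr_iff[OF this, of Q] Q have "(AE p in distr (mu \<omega>) (total_space P E) (Pair \<omega>). Q p) \<longleftrightarrow> (AE x in mu \<omega>. Q (\<omega>, x))"
        by (simp add: pred_def)
      moreover have "\<kappa> \<omega> = distr (mu \<omega>) (total_space P E) (Pair \<omega>)" using elim by blast
      ultimately show ?case by (simp only:)
    qed
  qed
  finally show ?thesis .
qed

text \<open>Integration against the kernel is measurable in \<open>\<omega>\<close> and agrees with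
  the fibre integral only almost everywhere, hence the separate function \<open>G\<close>.\<close>

lemma integral_fibre_measurable:
  fixes g :: "'w \<times> 'x \<Rightarrow> real"
  assumes g: "g \<in> borel_measurable (total_space P E)"
  obtains G where "G \<in> borel_measurable P" "AE \<omega> in P. G \<omega> = (\<integral>x. g (\<omega>, x) \<partial>mu \<omega>)"
proof -
  obtain \<kappa> where \<kappa>: "\<kappa> \<in> P \<rightarrow>\<^sub>M subprob_algebra (total_space P E)"
    "AE \<omega> in P. \<omega> \<in> space P \<and> sets (mu \<omega>) = sets (restrict_space borel (E \<omega>)) \<and> \<kappa> \<omega> = distr (mu \<omega>) (total_space P E) (Pair \<omega>)"
    by (rule fibre_kernel)
  show ?thesis
  proof
    show "(\<lambda>\<omega>. \<integral>p. g p \<partial>\<kappa> \<omega>) \<in> borel_measurable P"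
      by (rule measurable_compose[OF \<kappa>(1) integral_measurable_subprob_algebra[OF g]])
    show "AE \<omega> in P. (\<integral>p. g p \<partial>\<kappa> \<omega>) = (\<integral>x. g (\<omega>, x) \<partial>mu \<omega>)"
      using \<kappa>(2) by eventually_elim (auto intro!: integral_distr Pair_measurable g)
  qed
qed

end

text \<open>Only points whose whole forward orbit avoids the exceptional null sets are kept;
  invariance of \<open>P\<close> leaves this set of full measure. The radius is the smallest of
  those provided, the constant the largest and at least \<open>1\<close>.\<close>

lemma (in random_transfer_operators) uniform_transfer_exists:
  assumes "random_spectral_assumption P \<theta> E mu L B N f"
  obtains \<Omega> lam h \<nu> \<rho> K C \<delta> where "uniform_transfer \<Omega> \<theta> E T mu L B N f lam h \<nu> \<rho> K C \<delta>"
    "AE \<omega> in P. \<omega> \<in> \<Omega>" "\<Omega> \<subseteq> space P"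
proof -
  obtain r0 \<rho>2 K2 C \<delta> and lam h :: "'w \<Rightarrow> complex \<Rightarrow> _" and \<nu> :: "'w \<Rightarrow> complex \<Rightarrow> ('x \<Rightarrow> complex) \<Rightarrow> complex"
    where s1: "AE \<omega> in P. \<forall>z\<in>ball 0 r0. lam \<omega> z \<noteq> 0 \<and> h \<omega> z \<in> B \<omega> \<and> \<nu> \<omega> z \<in> dual_space (B \<omega>) (N \<omega>)"
    and s2: "AE \<omega> in P. \<forall>z\<in>ball 0 r0. \<forall>g\<in>B \<omega>. (\<lambda>x. g x * exp (z * complex_of_real (f \<omega> x))) \<in> B \<omega>"
    and s3: "AE \<omega> in P. lam \<omega> analytic_on ball 0 r0 \<and> analytic_into (B \<omega>) (N \<omega>) (ball 0 r0) (h \<omega>) \<and>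
        analytic_into (dual_space (B \<omega>) (N \<omega>)) (dual_norm (B \<omega>) (N \<omega>)) (ball 0 r0) (\<nu> \<omega>)"
    and s4': "AE \<omega> in P. \<forall>z\<in>ball 0 \<rho>2. N \<omega> (h \<omega> z) \<le> K2 \<and> dual_norm (B \<omega>) (N \<omega>) (\<nu> \<omega> z) \<le> K2"
    and s5: "AE \<omega> in P. lam \<omega> 0 = 1 \<and> (\<forall>x\<in>E \<omega>. h \<omega> 0 x = 1) \<and>
        (\<forall>g\<in>B \<omega>. integrable (mu \<omega>) g \<and> \<nu> \<omega> 0 g = (\<integral>x. g x \<partial>mu \<omega>)) \<and> (\<forall>z\<in>ball 0 r0. \<nu> \<omega> z (h \<omega> z) = 1)"
    and s6': "AE \<omega> in P. \<forall>z\<in>ball 0 r0. \<forall>n\<ge>1. \<forall>g\<in>B \<omega>.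
           N ((\<theta> ^^ n) \<omega>) (\<lambda>y. inverse (\<Prod>j<n. lam ((\<theta> ^^ j) \<omega>) z) *
                     fibre_iterate \<theta> (twisted_transfer L f z) \<omega> n g y - \<nu> \<omega> z g * h ((\<theta> ^^ n) \<omega>) z y)
           \<le> C * \<delta> ^ n * N \<omega> g"
    and r0: "0 < r0" and \<rho>2: "0 < \<rho>2" and C: "0 < C" "0 < \<delta>" "\<delta> < 1"
    using assms unfolding random_spectral_assumption_def by (elim exE conjE) (rule that; assumption)
  have e1: "AE \<omega> in P. analytic_into (B \<omega>) (N \<omega>) UNIV (\<lambda>z x. exp (z * complex_of_real (f \<omega> x)))"
    and e2: "\<exists>\<rho>>0. \<exists>K. AE \<omega> in P. \<forall>z\<in>ball 0 \<rho>. N \<omega> (\<lambda>x. exp (z * complex_of_real (f \<omega> x))) \<le> K"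
    using analytic_observable unfolding analytic_into_uniformly_def by auto
  obtain \<rho>1 K1 where \<rho>1: "0 < \<rho>1"
    and e2': "AE \<omega> in P. \<forall>z\<in>ball 0 \<rho>1. N \<omega> (\<lambda>x. exp (z * complex_of_real (f \<omega> x))) \<le> K1"
    using e2 by (elim exE conjE) (rule that; assumption)
  define \<rho> where "\<rho> = min r0 (min \<rho>1 \<rho>2)"
  define K where "K = max 1 (max K1 K2)"
  have \<rho>: "0 < \<rho>" "ball (0::complex) \<rho> \<subseteq> ball 0 r0" "ball (0::complex) \<rho> \<subseteq> ball 0 \<rho>1" "ball (0::complex) \<rho> \<subseteq> ball 0 \<rho>2"
    using r0 \<rho>1 \<rho>2 by (auto simp: \<rho>_def)
  have K: "1 \<le> K" "K1 \<le> K" "K2 \<le> K" by (auto simp: K_def)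
  define Q where "Q \<omega> \<longleftrightarrow> (sets (mu \<omega>) = sets (restrict_space borel (E \<omega>)) \<and> prob_space (mu \<omega>) \<and> distr (mu \<omega>) (mu (\<theta> \<omega>)) (T \<omega>) = mu (\<theta> \<omega>)) \<and>
      (\<forall>g. integrable (mu \<omega>) g \<and> (bounded (g ` E \<omega>) \<or> g \<in> B \<omega>) \<longrightarrow>
          integrable (mu (\<theta> \<omega>)) (L \<omega> g) \<and>
          (\<forall>u. u \<in> borel_measurable (mu (\<theta> \<omega>)) \<and> bounded (u ` E (\<theta> \<omega>)) \<longrightarrow>
             (\<integral>x. g x * u (T \<omega> x) \<partial>mu \<omega>) = (\<integral>y. u y * L \<omega> g y \<partial>mu (\<theta> \<omega>)))) \<and>
      continuous_operator (E (\<theta> \<omega>)) (B \<omega>) (N \<omega>) (B (\<theta> \<omega>)) (N (\<theta> \<omega>)) (L \<omega>) \<and>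
      analytic_into (B \<omega>) (N \<omega>) UNIV (\<lambda>z x. exp (z * complex_of_real (f \<omega> x))) \<and>
      (\<forall>z\<in>ball 0 \<rho>1. N \<omega> (\<lambda>x. exp (z * complex_of_real (f \<omega> x))) \<le> K1) \<and>
      (\<forall>z\<in>ball 0 r0. lam \<omega> z \<noteq> 0 \<and> h \<omega> z \<in> B \<omega> \<and> \<nu> \<omega> z \<in> dual_space (B \<omega>) (N \<omega>)) \<and>
      (\<forall>z\<in>ball 0 r0. \<forall>g\<in>B \<omega>. (\<lambda>x. g x * exp (z * complex_of_real (f \<omega> x))) \<in> B \<omega>) \<and>
      (lam \<omega> analytic_on ball 0 r0 \<and> analytic_into (B \<omega>) (N \<omega>) (ball 0 r0) (h \<omega>) \<and>
        analytic_into (dual_space (B \<omega>) (N \<omega>)) (dual_norm (B \<omega>) (N \<omega>)) (ball 0 r0) (\<nu> \<omega>)) \<and>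
      (\<forall>z\<in>ball 0 \<rho>2. N \<omega> (h \<omega> z) \<le> K2 \<and> dual_norm (B \<omega>) (N \<omega>) (\<nu> \<omega> z) \<le> K2) \<and>
      (lam \<omega> 0 = 1 \<and> (\<forall>x\<in>E \<omega>. h \<omega> 0 x = 1) \<and>
        (\<forall>g\<in>B \<omega>. integrable (mu \<omega>) g \<and> \<nu> \<omega> 0 g = (\<integral>x. g x \<partial>mu \<omega>)) \<and> (\<forall>z\<in>ball 0 r0. \<nu> \<omega> z (h \<omega> z) = 1)) \<and>
      (\<forall>z\<in>ball 0 r0. \<forall>n\<ge>1. \<forall>g\<in>B \<omega>.
           N ((\<theta> ^^ n) \<omega>) (\<lambda>y. inverse (\<Prod>j<n. lam ((\<theta> ^^ j) \<omega>) z) *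
                     fibre_iterate \<theta> (twisted_transfer L f z) \<omega> n g y - \<nu> \<omega> z g * h ((\<theta> ^^ n) \<omega>) z y)
           \<le> C * \<delta> ^ n * N \<omega> g)" for \<omega>
  have AE_Q: "AE \<omega> in P. Q \<omega>"
    unfolding Q_def by (intro AE_conjI fibre_measures duality continuous_transfer e1 e2' s1 s2 s3 s4' s5 s6')
  define \<Omega> where "\<Omega> = {\<omega> \<in> space P. \<forall>n. Q ((\<theta> ^^ n) \<omega>)}"
  have AE_\<Omega>: "AE \<omega> in P. \<omega> \<in> \<Omega>" using AE_funpow_base[OF AE_Q] AE_space by eventually_elim (simp add: \<Omega>_def)
  have sp: "\<omega> \<in> space P" if "\<omega> \<in> \<Omega>" for \<omega> using that by (simp add: \<Omega>_def)
  have \<theta>_\<Omega>: "\<theta> \<omega> \<in> \<Omega>" if "\<omega> \<in> \<Omega>" for \<omega>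
  proof -
    have "Q ((\<theta> ^^ n) (\<theta> \<omega>))" for n
    proof -
      have "Q ((\<theta> ^^ Suc n) \<omega>)" using that by (simp only: \<Omega>_def mem_Collect_eq)
      then show ?thesis by (simp add: funpow_swap1)
    qed
    moreover have "\<theta> \<omega> \<in> space P" using funpow_base_space[of \<omega> 1] sp[OF that] by simp
    ultimately show ?thesis by (simp add: \<Omega>_def)
  qed
  have Q: "Q \<omega>" if "\<omega> \<in> \<Omega>" for \<omega>
  proof -
    have "Q ((\<theta> ^^ 0) \<omega>)" using that unfolding \<Omega>_def by blast
    then show ?thesis by simp
  qed
  note c1 = Q[unfolded Q_def, THEN conjunct1] and r1 = Q[unfolded Q_def, THEN conjunct2]
  note c2 = r1[THEN conjunct1] and r2 = r1[THEN conjunct2]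
  note c3 = r2[THEN conjunct1] and r3 = r2[THEN conjunct2]
  note c4 = r3[THEN conjunct1] and r4 = r3[THEN conjunct2]
  note c5 = r4[THEN conjunct1] and r5 = r4[THEN conjunct2]
  note c6 = r5[THEN conjunct1] and r6 = r5[THEN conjunct2]
  note c7 = r6[THEN conjunct1] and r7 = r6[THEN conjunct2]
  note c8 = r7[THEN conjunct1] and r8 = r7[THEN conjunct2]
  note c9 = r8[THEN conjunct1] and r9 = r8[THEN conjunct2]
  note c10 = r9[THEN conjunct1] and r10 = r9[THEN conjunct2]
  have sets: "sets (mu \<omega>) = sets (restrict_space borel (E \<omega>))" if "\<omega> \<in> \<Omega>" for \<omega>
    by (rule conjunct1[OF c1[OF that]])
  have Pair: "Pair \<omega> \<in> mu \<omega> \<rightarrow>\<^sub>M total_space P E" if "\<omega> \<in> \<Omega>" for \<omega> by (rule Pair_measurable[OF sp sets]) fact+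
  \<comment> \<open>Measurability on a single fibre is obtained from that of the skew product with
    the first coordinate frozen.\<close>
  have T_meas: "T \<omega> \<in> mu \<omega> \<rightarrow>\<^sub>M mu (\<theta> \<omega>)" if \<omega>: "\<omega> \<in> \<Omega>" for \<omega>
    unfolding measurable_cong_sets[OF refl sets[OF \<theta>_\<Omega>[OF \<omega>]]]
  proof (rule measurable_restrict_space2)
    have skew: "(\<lambda>x. (\<theta> \<omega>, T \<omega> x)) \<in> mu \<omega> \<rightarrow>\<^sub>M total_space P E"
      using measurable_compose[OF Pair[OF \<omega>] measurable_skew] by (simp add: skew_product_def)
    then show "T \<omega> \<in> space (mu \<omega>) \<rightarrow> E (\<theta> \<omega>)"
      using measurable_space[OF skew] by (auto simp: space_total)
    have "snd \<in> total_space P E \<rightarrow>\<^sub>M borel" unfolding total_space_def by (intro measurable_restrict_space1 measurable_snd)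
    from measurable_compose[OF skew this] show "T \<omega> \<in> mu \<omega> \<rightarrow>\<^sub>M borel" by simp
  qed
  have f_meas: "f \<omega> \<in> borel_measurable (mu \<omega>)" if "\<omega> \<in> \<Omega>" for \<omega>
    using measurable_compose[OF Pair[OF that] measurable_observable] by simp
  have anti: "analytic_into V N' (ball 0 \<rho>) F" if "analytic_into V N' (ball 0 r0) F" for V N' F
    using that \<rho>(2) unfolding analytic_into_def by blast
  have in_ball: "z \<in> ball 0 r0" "z \<in> ball 0 \<rho>1" "z \<in> ball 0 \<rho>2" if "cmod z < \<rho>" for z
    using that \<rho> by (auto simp: \<rho>_def)
  have "uniform_transfer \<Omega> \<theta> E T mu L B N f lam h \<nu> \<rho> K C \<delta>"
  proof (rule uniform_transfer.intro)
    show "\<omega> \<in> \<Omega> \<Longrightarrow> \<theta> \<omega> \<in> \<Omega>" for \<omega> by (rule \<theta>_\<Omega>)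
    show "\<omega> \<in> \<Omega> \<Longrightarrow> prob_space (mu \<omega>)" for \<omega> using c1 by blast
    show "\<omega> \<in> \<Omega> \<Longrightarrow> space (mu \<omega>) = E \<omega>" for \<omega> by (rule space_fibre[OF sets])
    show "\<omega> \<in> \<Omega> \<Longrightarrow> T \<omega> \<in> mu \<omega> \<rightarrow>\<^sub>M mu (\<theta> \<omega>)" for \<omega> by (rule T_meas)
    show "\<omega> \<in> \<Omega> \<Longrightarrow> distr (mu \<omega>) (mu (\<theta> \<omega>)) (T \<omega>) = mu (\<theta> \<omega>)" for \<omega> using c1 by blast
    show "\<omega> \<in> \<Omega> \<Longrightarrow> f \<omega> \<in> borel_measurable (mu \<omega>)" for \<omega> by (rule f_meas)
    show "\<omega> \<in> \<Omega> \<Longrightarrow> function_normed_space (E \<omega>) (B \<omega>) (N \<omega>)" for \<omega> by (rule normed_spaces[OF sp])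
    show I: "\<omega> \<in> \<Omega> \<Longrightarrow> g \<in> B \<omega> \<Longrightarrow> integrable (mu \<omega>) g" for \<omega> g using c10 by blast
    show "\<omega> \<in> \<Omega> \<Longrightarrow> g \<in> B \<omega> \<Longrightarrow> L \<omega> g \<in> B (\<theta> \<omega>)" for \<omega> g using c3 unfolding continuous_operator_def by blast
    show "\<omega> \<in> \<Omega> \<Longrightarrow> g \<in> B \<omega> \<Longrightarrow> u \<in> borel_measurable (mu (\<theta> \<omega>)) \<Longrightarrow> bounded (u ` E (\<theta> \<omega>)) \<Longrightarrow>
       (\<integral>x. g x * u (T \<omega> x) \<partial>mu \<omega>) = (\<integral>y. u y * L \<omega> g y \<partial>mu (\<theta> \<omega>))" for \<omega> g u
      using c2[of \<omega>] I[of \<omega> g] by blast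
    show "\<omega> \<in> \<Omega> \<Longrightarrow> (\<lambda>x. exp (z * complex_of_real (f \<omega> x))) \<in> B \<omega>" for \<omega> z
    proof -
      assume \<omega>: "\<omega> \<in> \<Omega>"
      have "analytic_into (B \<omega>) (N \<omega>) UNIV (\<lambda>z x. exp (z * complex_of_real (f \<omega> x)))"
        by (rule c4[OF \<omega>])
      from analytic_intoE[OF this UNIV_I[of z]] show "(\<lambda>x. exp (z * complex_of_real (f \<omega> x))) \<in> B \<omega>" by (metis centre_in_ball)
    qed
    show "\<omega> \<in> \<Omega> \<Longrightarrow> cmod z < \<rho> \<Longrightarrow> N \<omega> (\<lambda>x. exp (z * complex_of_real (f \<omega> x))) \<le> K" for \<omega> z
      by (rule order_trans[OF bspec[OF c5 in_ball(2)] K(2)])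
    show "\<omega> \<in> \<Omega> \<Longrightarrow> cmod z < \<rho> \<Longrightarrow> g \<in> B \<omega> \<Longrightarrow> (\<lambda>x. g x * exp (z * complex_of_real (f \<omega> x))) \<in> B \<omega>" for \<omega> z g
      by (rule bspec[OF bspec[OF c7 in_ball(1)]])
    show "\<omega> \<in> \<Omega> \<Longrightarrow> cmod z < \<rho> \<Longrightarrow> lam \<omega> z \<noteq> 0" for \<omega> z using c6 in_ball(1) by blast
    show "\<omega> \<in> \<Omega> \<Longrightarrow> cmod z < \<rho> \<Longrightarrow> h \<omega> z \<in> B \<omega>" for \<omega> z using c6 in_ball(1) by blast
    show "\<omega> \<in> \<Omega> \<Longrightarrow> cmod z < \<rho> \<Longrightarrow> \<nu> \<omega> z \<in> dual_space (B \<omega>) (N \<omega>)" for \<omega> z using c6 in_ball(1) by blast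
    show "\<omega> \<in> \<Omega> \<Longrightarrow> analytic_into (B \<omega>) (N \<omega>) (ball 0 \<rho>) (h \<omega>)" for \<omega> using c8 by (intro anti) blast
    show "\<omega> \<in> \<Omega> \<Longrightarrow> analytic_into (dual_space (B \<omega>) (N \<omega>)) (dual_norm (B \<omega>) (N \<omega>)) (ball 0 \<rho>) (\<nu> \<omega>)" for \<omega>
      using c8 by (intro anti) blast
    show "\<omega> \<in> \<Omega> \<Longrightarrow> cmod z < \<rho> \<Longrightarrow> N \<omega> (h \<omega> z) \<le> K" for \<omega> z
      by (rule order_trans[OF conjunct1[OF bspec[OF c9 in_ball(3)]] K(3)])
    show "\<omega> \<in> \<Omega> \<Longrightarrow> cmod z < \<rho> \<Longrightarrow> dual_norm (B \<omega>) (N \<omega>) (\<nu> \<omega> z) \<le> K" for \<omega> z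
      by (rule order_trans[OF conjunct2[OF bspec[OF c9 in_ball(3)]] K(3)])
    show "\<omega> \<in> \<Omega> \<Longrightarrow> x \<in> E \<omega> \<Longrightarrow> h \<omega> 0 x = 1" for \<omega> x using c10 by blast
    show "\<omega> \<in> \<Omega> \<Longrightarrow> g \<in> B \<omega> \<Longrightarrow> \<nu> \<omega> 0 g = (\<integral>x. g x \<partial>mu \<omega>)" for \<omega> g using c10 by blast
    show "\<omega> \<in> \<Omega> \<Longrightarrow> cmod z < \<rho> \<Longrightarrow> 1 \<le> n \<Longrightarrow> g \<in> B \<omega> \<Longrightarrow>
           N ((\<theta> ^^ n) \<omega>) (\<lambda>y. inverse (\<Prod>j<n. lam ((\<theta> ^^ j) \<omega>) z) *
                fibre_iterate \<theta> (twisted_transfer L f z) \<omega> n g y - \<nu> \<omega> z g * h ((\<theta> ^^ n) \<omega>) z y)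
           \<le> C * \<delta> ^ n * N \<omega> g" for \<omega> z n g
      using bspec[OF r10 in_ball(1)] by blast
  qed (use \<rho> K C in auto)
  then show ?thesis by (rule that[OF _ AE_\<Omega>]) (auto intro: sp)
qed

section \<open>The limit theorems\<close>

context uniform_transfer
begin

lemma S_moments:
  assumes \<omega>: "\<omega> \<in> \<Omega>"
  shows "integrable (mu \<omega>) (\<lambda>x. \<bar>S \<omega> n x\<bar> ^ k)"
proof -
  obtain r c where r: "0 < r" "\<And>\<omega> n. \<omega> \<in> \<Omega> \<Longrightarrow> log_mgf_bound (mu \<omega>) (S \<omega> n) r (c * real n)"
    by (rule uniform_cumulant_bounds) (rule that; assumption)
  interpret prob_space "mu \<omega>" by (rule prob_mu[OF \<omega>])
  show ?thesis by (rule log_mgf_boundE[OF r(2)[OF \<omega>] r(1)])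
qed

lemma S_integrable: "\<omega> \<in> \<Omega> \<Longrightarrow> integrable (mu \<omega>) (S \<omega> n)"
  using S_moments[of \<omega> n 1] S_meas[of \<omega> n] by (simp add: integrable_abs_iff)

lemma S_square_integrable: "\<omega> \<in> \<Omega> \<Longrightarrow> integrable (mu \<omega>) (\<lambda>x. (S \<omega> n x)\<^sup>2)"
  using S_moments[of \<omega> n 2] by simp

text \<open>Each term is carried by invariance to the fibre on which it is evaluated.\<close>

lemma expectation_S:
  assumes \<omega>: "\<omega> \<in> \<Omega>"
  shows "(\<integral>x. S \<omega> n x \<partial>mu \<omega>) = (\<Sum>j<n. \<integral>x. f ((\<theta> ^^ j) \<omega>) x \<partial>mu ((\<theta> ^^ j) \<omega>))"
proof -
  have f_int: "integrable (mu \<omega>) (f \<omega>)" if "\<omega> \<in> \<Omega>" for \<omega>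
    using S_integrable[OF that, of "Suc 0"] by (simp add: birkhoff_sum_def[abs_def])
  have "integrable (distr (mu \<omega>) (mu ((\<theta> ^^ j) \<omega>)) (Tn \<omega> j)) (f ((\<theta> ^^ j) \<omega>))" for j
    unfolding distr_Tn[OF \<omega>] by (rule f_int[OF funpow_\<Omega>[OF \<omega>]])
  then have "integrable (mu \<omega>) (\<lambda>x. f ((\<theta> ^^ j) \<omega>) (Tn \<omega> j x))" for j
    using integrable_distr[OF Tn_meas[OF \<omega>]] by blast
  moreover have "(\<integral>x. f ((\<theta> ^^ j) \<omega>) (Tn \<omega> j x) \<partial>mu \<omega>) = (\<integral>x. f ((\<theta> ^^ j) \<omega>) x \<partial>mu ((\<theta> ^^ j) \<omega>))" for j
    using integral_distr[OF Tn_meas[OF \<omega>] f_meas[OF funpow_\<Omega>[OF \<omega>]], of j] by (simp only: distr_Tn[OF \<omega>])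
  ultimately show ?thesis unfolding birkhoff_sum_def by (simp add: Bochner_Integration.integral_sum)
qed

lemma V_nonneg: "0 \<le> V \<omega> n"
  unfolding V_def by (intro integral_nonneg_AE) auto

lemma V_0: "\<omega> \<in> \<Omega> \<Longrightarrow> V \<omega> 0 = 0"
  unfolding V_def by (simp add: birkhoff_sum_def[abs_def])

end

lemma funpow_skew_product: "(skew_product \<theta> T ^^ n) (\<omega>, x) = ((\<theta> ^^ n) \<omega>, fibre_iterate \<theta> T \<omega> n x)"
  by (induction n) (auto simp: skew_product_def)

text \<open>The centred observable becomes one function \<open>g\<close> on the total space. Its
  Birkhoff sums under the skew product are the centred fibre sums, so their second moments under
  \<open>M\<close> are the means \<open>u n\<close> of the fibre variances. If \<open>v = 0\<close>,
  the increments of \<open>u\<close> are geometrically small, which supplies the summability for the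
  coboundary equation. Conversely, a coboundary keeps \<open>u\<close> bounded, while
  \<open>u n\<close> is at least \<open>n * v\<close> up to a constant.\<close>

lemma (in random_transfer_operators) variance_coboundary:
  assumes "uniform_transfer \<Omega> \<theta> E T mu L B N f lam h \<nu> \<rho> K C \<delta>"
    and AE_\<Omega>: "AE \<omega> in P. \<omega> \<in> \<Omega>"
  shows "\<exists>v\<ge>0. (AE \<omega> in P. (\<lambda>n. prob_space.variance (mu \<omega>) (birkhoff_sum \<theta> T f \<omega> n) / real n) \<longlonglongrightarrow> v) \<and>
    (v = 0 \<longleftrightarrow>
       (\<exists>r :: 'w \<Rightarrow> 'x \<Rightarrow> real. (\<lambda>(\<omega>, x). r \<omega> x) \<in> borel_measurable (total_space P E) \<and>
          (\<integral>\<^sup>+\<omega>. (\<integral>\<^sup>+y. ennreal (\<bar>r \<omega> y\<bar>\<^sup>2) \<partial>mu \<omega>) \<partial>P) < \<infinity> \<and>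
          (AE \<omega> in P. AE x in mu \<omega>.
             f \<omega> x - (\<integral>y. f \<omega> y \<partial>mu \<omega>) = r \<omega> x - r (\<theta> \<omega>) (T \<omega> x))))"
    (is "\<exists>v\<ge>0. _ \<and> (_ \<longleftrightarrow> ?cob)")
proof -
  interpret U: uniform_transfer \<Omega> \<theta> E T mu L B N f lam h \<nu> \<rho> K C \<delta> by fact
  interpret total: prob_space M by (rule prob_total)
  let ?TS = "total_space P E"
  note M_TS = measurable_cong_sets[OF sets_total refl] and [measurable_cong] = sets_total
  obtain c where c: "0 \<le> c"
    and d_le: "\<And>\<omega> n. \<omega> \<in> \<Omega> \<Longrightarrow> \<bar>U.V \<omega> (Suc n) - U.V (\<theta> \<omega>) n\<bar> \<le> c"
    and dd_le: "\<And>\<omega> n. \<omega> \<in> \<Omega> \<Longrightarrow>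
      \<bar>(U.V \<omega> (Suc (Suc n)) - U.V (\<theta> \<omega>) (Suc n)) - (U.V \<omega> (Suc n) - U.V (\<theta> \<omega>) n)\<bar> \<le> c * \<delta> ^ n"
    by (rule U.uniform_cumulant_bounds) (rule that; assumption)
  have \<delta>: "0 < \<delta>" "\<delta> < 1" using U.pos by auto
  obtain F where F[measurable]: "F \<in> borel_measurable P"
    and AE_F: "AE \<omega> in P. F \<omega> = (\<integral>x. (\<lambda>(\<omega>, x). f \<omega> x) (\<omega>, x) \<partial>mu \<omega>)"
    by (rule integral_fibre_measurable[OF measurable_observable])
  have fst_meas[measurable]: "fst \<in> ?TS \<rightarrow>\<^sub>M P"
    unfolding total_space_def by (intro measurable_restrict_space1 measurable_fst)
  define \<tau> where "\<tau> = skew_product \<theta> T"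
  define g where "g p = (\<lambda>(\<omega>, x). f \<omega> x) p - F (fst p)" for p
  have \<tau>_TS[measurable]: "\<tau> \<in> ?TS \<rightarrow>\<^sub>M ?TS" unfolding \<tau>_def by (rule measurable_skew)
  have g_TS[measurable]: "g \<in> borel_measurable ?TS"
    unfolding g_def[abs_def] using measurable_observable by measurable
  interpret mp: measure_preserving M \<tau> g
  proof
    show "\<tau> \<in> M \<rightarrow>\<^sub>M M" unfolding measurable_cong_sets[OF sets_total sets_total] by (rule \<tau>_TS)
    show "distr M M \<tau> = M" unfolding \<tau>_def by (rule invariant_total)
    show "g \<in> borel_measurable M" unfolding M_TS by (rule g_TS)
  qed
  have bs_TS[measurable]: "mp.bs n \<in> borel_measurable ?TS" for n using mp.bs_meas[of n] unfolding M_TS .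
  \<comment> \<open>The version \<open>F\<close> of the fibre mean has to be correct along the whole
    orbit, because the sums of \<open>g\<close> use it there.\<close>
  define good where "good \<omega> \<longleftrightarrow> \<omega> \<in> \<Omega> \<and> (\<forall>j. F ((\<theta> ^^ j) \<omega>) = (\<integral>x. f ((\<theta> ^^ j) \<omega>) x \<partial>mu ((\<theta> ^^ j) \<omega>)))" for \<omega>
  have AE_good: "AE \<omega> in P. good \<omega>"
    using AE_\<Omega> AE_funpow_base[OF AE_F] by eventually_elim (simp add: good_def)
  have bs_eq: "mp.bs n (\<omega>, x) = birkhoff_sum \<theta> T f \<omega> n x - (\<integral>y. birkhoff_sum \<theta> T f \<omega> n y \<partial>mu \<omega>)"
    if "good \<omega>" for \<omega> n x
  proof -
    have \<omega>: "\<omega> \<in> \<Omega>" and F: "F ((\<theta> ^^ j) \<omega>) = (\<integral>x. f ((\<theta> ^^ j) \<omega>) x \<partial>mu ((\<theta> ^^ j) \<omega>))" for j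
      using that by (auto simp: good_def)
    show ?thesis unfolding U.expectation_S[OF \<omega>] F[symmetric]
      unfolding mp.bs_def unfolding \<tau>_def funpow_skew_product g_def birkhoff_sum_def by (simp add: sum_subtractf)
  qed
  have bs_sq: "integrable (mu \<omega>) (\<lambda>x. (mp.bs n (\<omega>, x))\<^sup>2)" "(\<integral>x. (mp.bs n (\<omega>, x))\<^sup>2 \<partial>mu \<omega>) = U.V \<omega> n"
    if "good \<omega>" for \<omega> n
  proof -
    have \<omega>: "\<omega> \<in> \<Omega>" using that by (simp add: good_def)
    interpret fibre: prob_space "mu \<omega>" by (rule U.prob_mu[OF \<omega>])
    have "integrable (mu \<omega>) (\<lambda>x. (birkhoff_sum \<theta> T f \<omega> n x)\<^sup>2 + k\<^sup>2 - 2 * birkhoff_sum \<theta> T f \<omega> n x * k)" for k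
      by (intro Bochner_Integration.integrable_diff Bochner_Integration.integrable_add integrable_mult_left
          integrable_mult_right fibre.integrable_const U.S_integrable U.S_square_integrable \<omega>)
    then show "integrable (mu \<omega>) (\<lambda>x. (mp.bs n (\<omega>, x))\<^sup>2)"
      unfolding bs_eq[OF that] power2_diff .
    show "(\<integral>x. (mp.bs n (\<omega>, x))\<^sup>2 \<partial>mu \<omega>) = U.V \<omega> n"
      unfolding bs_eq[OF that] U.V_def ..
  qed
  \<comment> \<open>Measurable versions of the fibre variances, to be chosen for all
    \<open>n\<close> at once.\<close>
  have "\<exists>G. G \<in> borel_measurable P \<and> (AE \<omega> in P. G \<omega> = (\<integral>x. (mp.bs n (\<omega>, x))\<^sup>2 \<partial>mu \<omega>))" for n
  proof -
    have sq: "(\<lambda>p. (mp.bs n p)\<^sup>2) \<in> borel_measurable ?TS" by measurable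
    obtain G where "G \<in> borel_measurable P" "AE \<omega> in P. G \<omega> = (\<integral>x. (mp.bs n (\<omega>, x))\<^sup>2 \<partial>mu \<omega>)"
      by (rule integral_fibre_measurable[OF sq])
    then show ?thesis by (intro exI conjI)
  qed
  from choice[OF allI[OF this]] obtain W where
    W': "\<forall>n. W n \<in> borel_measurable P \<and> (AE \<omega> in P. W n \<omega> = (\<integral>x. (mp.bs n (\<omega>, x))\<^sup>2 \<partial>mu \<omega>))" by (rule exE)
  have W[measurable]: "W n \<in> borel_measurable P"
    and AE_W': "AE \<omega> in P. W n \<omega> = (\<integral>x. (mp.bs n (\<omega>, x))\<^sup>2 \<partial>mu \<omega>)" for n using spec[OF W', of n] by auto
  have "AE \<omega> in P. \<forall>n. W n \<omega> = (\<integral>x. (mp.bs n (\<omega>, x))\<^sup>2 \<partial>mu \<omega>)"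
    unfolding AE_all_countable using AE_W' by blast
  then have AE_W: "AE \<omega> in P. good \<omega> \<and> (\<forall>n. W n \<omega> = U.V \<omega> n)"
    using AE_good by eventually_elim (simp add: bs_sq(2))
  have AE_W\<theta>: "AE \<omega> in P. good \<omega> \<and> (\<forall>n. W n \<omega> = U.V \<omega> n \<and> W n (\<theta> \<omega>) = U.V (\<theta> \<omega>) n)"
    using AE_W AE_funpow_base[OF AE_W]
  proof eventually_elim
    case (elim \<omega>)
    then show ?case using spec[OF elim(2), of 1] by simp
  qed
  have "\<exists>v. (AE \<omega> in P. (\<lambda>n. W n \<omega> / real n) \<longlonglongrightarrow> v) \<and> (\<forall>n. integrable P (W n)) \<and>
     (\<forall>n. \<bar>expectation (W (Suc n)) - expectation (W n) - v\<bar> \<le> c / (1 - \<delta>) * \<delta> ^ n)"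
  proof (rule almost_additive_limit[OF W \<delta> c])
    show "AE \<omega> in P. W 0 \<omega> = 0"
      using AE_W by eventually_elim (simp add: good_def U.V_0)
    show "AE \<omega> in P. \<forall>n. \<bar>W (Suc n) \<omega> - W n (\<theta> \<omega>)\<bar> \<le> c"
      using AE_W\<theta> by eventually_elim (use d_le in \<open>simp add: good_def\<close>)
    show "AE \<omega> in P. \<forall>n. \<bar>(W (Suc (Suc n)) \<omega> - W (Suc n) (\<theta> \<omega>)) - (W (Suc n) \<omega> - W n (\<theta> \<omega>))\<bar> \<le> c * \<delta> ^ n"
      using AE_W\<theta> by eventually_elim (use dd_le in \<open>simp add: good_def\<close>)
  qed
  then obtain v where lim_W: "AE \<omega> in P. (\<lambda>n. W n \<omega> / real n) \<longlonglongrightarrow> v" and W_int: "\<And>n. integrable P (W n)"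
    and incr: "\<And>n. \<bar>expectation (W (Suc n)) - expectation (W n) - v\<bar> \<le> c / (1 - \<delta>) * \<delta> ^ n" by blast
  define u where "u n = expectation (W n)" for n
  define e where "e = c / (1 - \<delta>)"
  have e: "0 \<le> e" using c \<delta> by (simp add: e_def)
  have lim_V: "AE \<omega> in P. (\<lambda>n. U.V \<omega> n / real n) \<longlonglongrightarrow> v" using lim_W AE_W by eventually_elim simp
  then have "AE \<omega> in P. 0 \<le> v"
    by eventually_elim (rule LIMSEQ_le_const, assumption, auto intro!: exI[of _ 0] divide_nonneg_nonneg U.V_nonneg)
  then have v: "0 \<le> v" by simp
  have W_nonneg: "AE \<omega> in P. 0 \<le> W n \<omega>" for n using AE_W by eventually_elim (simp add: U.V_nonneg)
  have u_nonneg: "0 \<le> u n" for n unfolding u_def by (rule integral_nonneg_AE[OF W_nonneg])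
  have nn_bs: "(\<integral>\<^sup>+p. ennreal ((mp.bs n p)\<^sup>2) \<partial>M) = ennreal (u n)" for n
  proof -
    have "(\<integral>\<^sup>+p. ennreal ((mp.bs n p)\<^sup>2) \<partial>M) = (\<integral>\<^sup>+\<omega>. \<integral>\<^sup>+x. ennreal ((mp.bs n (\<omega>, x))\<^sup>2) \<partial>mu \<omega> \<partial>P)"
      by (rule nn_integral_total) measurable
    also have "\<dots> = (\<integral>\<^sup>+\<omega>. ennreal (W n \<omega>) \<partial>P)"
    proof (rule nn_integral_cong_AE)
      show "AE \<omega> in P. (\<integral>\<^sup>+x. ennreal ((mp.bs n (\<omega>, x))\<^sup>2) \<partial>mu \<omega>) = ennreal (W n \<omega>)"
        using AE_W
      proof eventually_elim
        case (elim \<omega>)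
        have "(\<integral>\<^sup>+x. ennreal ((mp.bs n (\<omega>, x))\<^sup>2) \<partial>mu \<omega>) = ennreal (\<integral>x. (mp.bs n (\<omega>, x))\<^sup>2 \<partial>mu \<omega>)"
          by (rule nn_integral_eq_integral[OF bs_sq(1)]) (use elim in auto)
        then show ?case using elim bs_sq(2)[of \<omega> n] by simp
      qed
    qed
    also have "\<dots> = ennreal (u n)" unfolding u_def by (rule nn_integral_eq_integral[OF W_int W_nonneg])
    finally show ?thesis .
  qed
  have bs_mean: "integrable M (\<lambda>p. (mp.bs n p)\<^sup>2)" "(\<integral>p. (mp.bs n p)\<^sup>2 \<partial>M) = u n" for n
  proof -
    have "integrable M (\<lambda>p. (mp.bs n p)\<^sup>2) \<and> (\<integral>p. (mp.bs n p)\<^sup>2 \<partial>M) = u n"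
      by (rule nn_integral_eq_integrable[THEN iffD1, OF _ _ u_nonneg nn_bs]) auto
    then show "integrable M (\<lambda>p. (mp.bs n p)\<^sup>2)" "(\<integral>p. (mp.bs n p)\<^sup>2 \<partial>M) = u n" by auto
  qed
  have g2: "integrable M (\<lambda>p. (g p)\<^sup>2)" using bs_mean(1)[of "Suc 0"] by (simp add: mp.bs_def)
  have "v = 0 \<longleftrightarrow> ?cob"
  proof
    assume v0: "v = 0"
    have "\<exists>l. u \<longlonglongrightarrow> l \<and> (\<forall>n. \<bar>u n - l\<bar> \<le> e / (1 - \<delta>) * \<delta> ^ n)"
      by (rule geometric_increments[OF \<delta> e]) (use incr in \<open>simp add: u_def e_def v0\<close>)
    then obtain l where l: "\<And>n. \<bar>u n - l\<bar> \<le> e / (1 - \<delta>) * \<delta> ^ n" by blast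
    have "(\<Sum>k<n. \<bar>(\<integral>p. (mp.bs k p)\<^sup>2 \<partial>M) - l\<bar>) \<le> e / (1 - \<delta>) * (1 / (1 - \<delta>))" for n
    proof -
      have "(\<Sum>k<n. \<bar>(\<integral>p. (mp.bs k p)\<^sup>2 \<partial>M) - l\<bar>) \<le> (\<Sum>k<n. e / (1 - \<delta>) * \<delta> ^ k)"
        unfolding bs_mean(2) by (intro sum_mono l)
      also have "\<dots> = e / (1 - \<delta>) * (\<Sum>k<n. \<delta> ^ k)" by (simp only: sum_distrib_left)
      also have "\<dots> \<le> e / (1 - \<delta>) * (1 / (1 - \<delta>))"
        using e \<delta> by (intro mult_left_mono sum_geometric_le) auto
      finally show ?thesis .
    qed
    from mp.coboundary_exists[OF g2 this]
    obtain r where r: "r \<in> borel_measurable M" and r2: "(\<integral>\<^sup>+p. ennreal ((r p)\<^sup>2) \<partial>M) < \<infinity>"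
      and cob: "AE p in M. g p = r p - r (\<tau> p)" by blast
    have r_TS[measurable]: "r \<in> borel_measurable ?TS" using r unfolding M_TS .
    show ?cob
    proof (intro exI[of _ "\<lambda>\<omega> x. r (\<omega>, x)"] conjI)
      show "(\<lambda>(\<omega>, x). r (\<omega>, x)) \<in> borel_measurable ?TS" by simp
      have "(\<integral>\<^sup>+p. ennreal ((r p)\<^sup>2) \<partial>M) = (\<integral>\<^sup>+\<omega>. (\<integral>\<^sup>+y. ennreal ((r (\<omega>, y))\<^sup>2) \<partial>mu \<omega>) \<partial>P)"
        by (rule nn_integral_total) measurable
      then show "(\<integral>\<^sup>+\<omega>. (\<integral>\<^sup>+y. ennreal (\<bar>r (\<omega>, y)\<bar>\<^sup>2) \<partial>mu \<omega>) \<partial>P) < \<infinity>" using r2 by simp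
      have "AE \<omega> in P. AE x in mu \<omega>. g (\<omega>, x) = r (\<omega>, x) - r (\<tau> (\<omega>, x))"
        by (rule AE_total_iff[THEN iffD1, OF _ cob]) measurable
      then show "AE \<omega> in P. AE x in mu \<omega>. f \<omega> x - (\<integral>y. f \<omega> y \<partial>mu \<omega>) = r (\<omega>, x) - r (\<theta> \<omega>, T \<omega> x)"
        using AE_F by eventually_elim (simp add: g_def \<tau>_def skew_product_def)
    qed
  next
    assume ?cob
    then obtain r' where r'_TS: "(\<lambda>(\<omega>, x). r' \<omega> x) \<in> borel_measurable ?TS"
      and r'2: "(\<integral>\<^sup>+\<omega>. (\<integral>\<^sup>+y. ennreal (\<bar>r' \<omega> y\<bar>\<^sup>2) \<partial>mu \<omega>) \<partial>P) < \<infinity>"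
      and cob: "AE \<omega> in P. AE x in mu \<omega>. f \<omega> x - (\<integral>y. f \<omega> y \<partial>mu \<omega>) = r' \<omega> x - r' (\<theta> \<omega>) (T \<omega> x)"
      by blast
    define r where "r = (\<lambda>(\<omega>, x). r' \<omega> x)"
    have r_TS[measurable]: "r \<in> borel_measurable ?TS" using r'_TS by (simp add: r_def)
    have "AE \<omega> in P. AE x in mu \<omega>. g (\<omega>, x) = r (\<omega>, x) - r (\<tau> (\<omega>, x))"
      using cob AE_F by eventually_elim (simp add: g_def \<tau>_def skew_product_def r_def)
    then have "AE p in M. g p = r p - r (\<tau> p)"
      by (rule AE_total_iff[THEN iffD2, rotated]) measurable
    moreover have "r \<in> borel_measurable M" unfolding M_TS by (rule r_TS)
    ultimately have bs_le: "(\<integral>\<^sup>+p. ennreal ((mp.bs n p)\<^sup>2) \<partial>M) \<le> 4 * (\<integral>\<^sup>+p. ennreal ((r p)\<^sup>2) \<partial>M)" for n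
      by (intro mp.nn_integral_square_bs_le_of_coboundary)
    have "(\<integral>\<^sup>+p. ennreal ((r p)\<^sup>2) \<partial>M) = (\<integral>\<^sup>+\<omega>. (\<integral>\<^sup>+y. ennreal ((r (\<omega>, y))\<^sup>2) \<partial>mu \<omega>) \<partial>P)"
      by (rule nn_integral_total) measurable
    then have "4 * (\<integral>\<^sup>+p. ennreal ((r p)\<^sup>2) \<partial>M) < \<infinity>" using r'2 by (simp add: r_def ennreal_mult_less_top)
    then obtain D where D: "4 * (\<integral>\<^sup>+p. ennreal ((r p)\<^sup>2) \<partial>M) = ennreal D" "0 \<le> D"
      by (cases "4 * (\<integral>\<^sup>+p. ennreal ((r p)\<^sup>2) \<partial>M)") auto
    have u_le: "u n \<le> D" for n using bs_le[of n] D by (simp add: nn_bs)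
    \<comment> \<open>Summed over the increments, the geometric errors stay below a constant, so a
      bounded \<open>u\<close> forces \<open>v = 0\<close>.\<close>
    have "real n * v - e * (\<Sum>k<n. \<delta> ^ k) \<le> u n" for n
    proof (induction n)
      case (Suc n)
      have "\<bar>u (Suc n) - u n - v\<bar> \<le> e * \<delta> ^ n" using incr[of n] by (simp add: u_def e_def)
      then show ?case using Suc by (simp add: algebra_simps)
    qed (simp add: u_nonneg)
    then have "real n * v \<le> D + e * (1 / (1 - \<delta>))" for n
      using u_le[of n] mult_left_mono[OF sum_geometric_le[OF \<delta>, of n] e] by (smt (verit))
    then show "v = 0" using ex_less_of_nat_mult[of v "D + e * (1 / (1 - \<delta>))"] v by (meson less_le not_less)
  qed
  then show ?thesis using v lim_V unfolding U.V_def by blast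
qed

theorem proposition36:
  fixes P :: "'w measure" and \<theta> :: "'w \<Rightarrow> 'w"
    and E :: "'w \<Rightarrow> 'x::metric_space set" and T :: "'w \<Rightarrow> 'x \<Rightarrow> 'x"
    and mu :: "'w \<Rightarrow> 'x measure" and M :: "('w \<times> 'x) measure"
    and L :: "'w \<Rightarrow> ('x \<Rightarrow> complex) \<Rightarrow> 'x \<Rightarrow> complex"
    and B :: "'w \<Rightarrow> ('x \<Rightarrow> complex) set" and N :: "'w \<Rightarrow> ('x \<Rightarrow> complex) \<Rightarrow> real"
    and f :: "'w \<Rightarrow> 'x \<Rightarrow> real"
    and S S0 :: "'w \<Rightarrow> nat \<Rightarrow> 'x \<Rightarrow> real"
  assumes "random_transfer_operators P \<theta> E T mu M L B N f"
    and "random_spectral_assumption P \<theta> E mu L B N f"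
    and "S = birkhoff_sum \<theta> T f"
    and "S0 = (\<lambda>\<omega> n x. S \<omega> n x - (\<integral>y. S \<omega> n y \<partial>mu \<omega>))"
  shows "\<exists>\<sigma>\<ge>0.
    (AE \<omega> in P. (\<forall>n. integrable (mu \<omega>) (\<lambda>x. (S \<omega> n x)\<^sup>2)) \<and>
       (\<lambda>n. prob_space.variance (mu \<omega>) (S \<omega> n) / real n) \<longlonglongrightarrow> \<sigma>\<^sup>2) \<and>
    (\<sigma>\<^sup>2 = 0 \<longleftrightarrow>
       (\<exists>r :: 'w \<Rightarrow> 'x \<Rightarrow> real. (\<lambda>(\<omega>, x). r \<omega> x) \<in> borel_measurable (total_space P E) \<and>
          (\<integral>\<^sup>+\<omega>. (\<integral>\<^sup>+y. ennreal (\<bar>r \<omega> y\<bar>\<^sup>2) \<partial>mu \<omega>) \<partial>P) < \<infinity> \<and>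
          (AE \<omega> in P. AE x in mu \<omega>.
             f \<omega> x - (\<integral>y. f \<omega> y \<partial>mu \<omega>) = r \<omega> x - r (\<theta> \<omega>) (T \<omega> x)))) \<and>
    (\<sigma>\<^sup>2 > 0 \<longrightarrow> (AE \<omega> in P.
       (\<forall>m\<ge>2. growth_condition (mu \<omega>) (S0 \<omega>) m) \<and>
       (\<forall>a b. bounded (range a) \<and> (\<lambda>n. b n - l2_norm (mu \<omega>) (S0 \<omega> n)) \<in> O(\<lambda>n. 1) \<longrightarrow>
          (\<forall>m::nat\<ge>2.
             (\<exists>C. \<forall>n x. admissible_index (mu \<omega>) (S0 \<omega>) b n \<longrightarrow>
                cdf_error (mu \<omega>) (normalized_sum (S0 \<omega>) a b n) x
                  \<le> C * inverse (l2_norm (mu \<omega>) (S0 \<omega> n)) * inverse ((1 + \<bar>x\<bar>) ^ m)) \<and>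
             (\<forall>p::real>1 / real m.
                (\<forall>n. admissible_index (mu \<omega>) (S0 \<omega>) b n \<longrightarrow>
                   integrable lborel
                     (\<lambda>x. cdf_error (mu \<omega>) (normalized_sum (S0 \<omega>) a b n) x powr p)) \<and>
                (\<lambda>n. (\<integral>x. cdf_error (mu \<omega>) (normalized_sum (S0 \<omega>) a b n) x powr p \<partial>lborel)
                       powr (1 / p))
                  \<in> O(\<lambda>n. inverse (l2_norm (mu \<omega>) (S0 \<omega> n)))) \<and>
             (\<exists>R>0.
                (\<forall>h. ae_differentiable h \<and> finite_weighted_variation m h \<longrightarrow>
                   expectation_bound (mu \<omega>) (S0 \<omega>) a b m R h) \<and>
                (\<forall>q::nat<m. expectation_bound (mu \<omega>) (S0 \<omega>) a b m R (\<lambda>x. x ^ q)) \<and>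
                (\<forall>q::real. 0 < q \<and> q < real m \<longrightarrow>
                   expectation_bound (mu \<omega>) (S0 \<omega>) a b m R (\<lambda>x. \<bar>x\<bar> powr q)))))))"
proof -
  interpret random_transfer_operators P \<theta> E T mu M L B N f by fact
  obtain \<Omega> lam h \<nu> \<rho> K C \<delta> where U: "uniform_transfer \<Omega> \<theta> E T mu L B N f lam h \<nu> \<rho> K C \<delta>"
    and AE_\<Omega>: "AE \<omega> in P. \<omega> \<in> \<Omega>"
    by (rule uniform_transfer_exists[OF assms(2)]) (rule that; assumption)
  interpret U: uniform_transfer \<Omega> \<theta> E T mu L B N f lam h \<nu> \<rho> K C \<delta> by (rule U)
  obtain v where v: "0 \<le> v"
    and lim: "AE \<omega> in P. (\<lambda>n. prob_space.variance (mu \<omega>) (S \<omega> n) / real n) \<longlonglongrightarrow> v"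
    and cob: "v = 0 \<longleftrightarrow>
       (\<exists>r :: 'w \<Rightarrow> 'x \<Rightarrow> real. (\<lambda>(\<omega>, x). r \<omega> x) \<in> borel_measurable (total_space P E) \<and>
          (\<integral>\<^sup>+\<omega>. (\<integral>\<^sup>+y. ennreal (\<bar>r \<omega> y\<bar>\<^sup>2) \<partial>mu \<omega>) \<partial>P) < \<infinity> \<and>
          (AE \<omega> in P. AE x in mu \<omega>.
             f \<omega> x - (\<integral>y. f \<omega> y \<partial>mu \<omega>) = r \<omega> x - r (\<theta> \<omega>) (T \<omega> x)))"
    using variance_coboundary[OF U AE_\<Omega>, folded assms(3)] by (elim exE conjE) (rule that; assumption)
  obtain r c where r: "0 < r" "0 \<le> c" "\<And>\<omega> n. \<omega> \<in> \<Omega> \<Longrightarrow> log_mgf_bound (mu \<omega>) (S \<omega> n) r (c * real n)"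
    by (rule U.uniform_cumulant_bounds[folded assms(3)]) (rule that; assumption)
  have \<sigma>: "(sqrt v)\<^sup>2 = v" using v by simp
  have laws: "growth_condition (mu \<omega>) (S0 \<omega>) m" "\<exists>D n0. near_gaussian_sequence (mu \<omega>) (S0 \<omega>) D n0"
    if "\<omega> \<in> \<Omega>" "(\<lambda>n. prob_space.variance (mu \<omega>) (S \<omega> n) / real n) \<longlonglongrightarrow> v" "0 < v" for \<omega> m
    unfolding assms(4)
    by (rule prob_space.limit_laws_of_log_mgf_bound[OF U.prob_mu[OF that(1)] r(1,2) r(3)[OF that(1)] that(2,3)])+
  show ?thesis
  proof (rule exI[of _ "sqrt v"], unfold \<sigma>, intro conjI impI)
    show "0 \<le> sqrt v" using v by simp
    show "AE \<omega> in P. (\<forall>n. integrable (mu \<omega>) (\<lambda>x. (S \<omega> n x)\<^sup>2)) \<and>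
       (\<lambda>n. prob_space.variance (mu \<omega>) (S \<omega> n) / real n) \<longlonglongrightarrow> v"
      using AE_\<Omega> lim by eventually_elim (auto simp: assms(3) intro: U.S_square_integrable)
  next
    assume v_pos: "0 < v"
    show "AE \<omega> in P. (\<forall>m\<ge>2. growth_condition (mu \<omega>) (S0 \<omega>) m) \<and>
       (\<forall>a b. bounded (range a) \<and> (\<lambda>n. b n - l2_norm (mu \<omega>) (S0 \<omega> n)) \<in> O(\<lambda>n. 1) \<longrightarrow>
          (\<forall>m::nat\<ge>2.
             (\<exists>C. \<forall>n x. admissible_index (mu \<omega>) (S0 \<omega>) b n \<longrightarrow>
                cdf_error (mu \<omega>) (normalized_sum (S0 \<omega>) a b n) x
                  \<le> C * inverse (l2_norm (mu \<omega>) (S0 \<omega> n)) * inverse ((1 + \<bar>x\<bar>) ^ m)) \<and>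
             (\<forall>p::real>1 / real m.
                (\<forall>n. admissible_index (mu \<omega>) (S0 \<omega>) b n \<longrightarrow>
                   integrable lborel
                     (\<lambda>x. cdf_error (mu \<omega>) (normalized_sum (S0 \<omega>) a b n) x powr p)) \<and>
                (\<lambda>n. (\<integral>x. cdf_error (mu \<omega>) (normalized_sum (S0 \<omega>) a b n) x powr p \<partial>lborel)
                       powr (1 / p))
                  \<in> O(\<lambda>n. inverse (l2_norm (mu \<omega>) (S0 \<omega> n)))) \<and>
             (\<exists>R>0.
                (\<forall>h. ae_differentiable h \<and> finite_weighted_variation m h \<longrightarrow>
                   expectation_bound (mu \<omega>) (S0 \<omega>) a b m R h) \<and>
                (\<forall>q::nat<m. expectation_bound (mu \<omega>) (S0 \<omega>) a b m R (\<lambda>x. x ^ q)) \<and>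
                (\<forall>q::real. 0 < q \<and> q < real m \<longrightarrow>
                   expectation_bound (mu \<omega>) (S0 \<omega>) a b m R (\<lambda>x. \<bar>x\<bar> powr q)))))"
      using AE_\<Omega> lim
    proof eventually_elim
      case (elim \<omega>)
      \<comment> \<open>Depends on \<open>\<omega>\<close> alone: \<open>a\<close>,
        \<open>b\<close>, \<open>m\<close> and the test functions come in afterwards, so one null
        set serves all of them.\<close>
      obtain D n0 where "near_gaussian_sequence (mu \<omega>) (S0 \<omega>) D n0" using laws(2)[OF elim v_pos] by blast
      note approx = near_gaussian_sequence.normal_approximation[OF this]
      show ?case
      proof (rule conjI)
        show "\<forall>m\<ge>2. growth_condition (mu \<omega>) (S0 \<omega>) m" by (intro allI impI laws(1)[OF elim v_pos])
      qed (intro allI impI, elim conjE, rule approx; assumption)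
    qed
  qed (rule cob)
qed

end
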